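(* Let $T>0$, $g\in L^2(I)$, $\mu,\zeta,\epsilon,\ell,\beta,S>0$, $P,\kappa\ge 0$, $\Upsilon\in[-\ell,\ell]$ and $\eta\in\mathbb{R}$. For any initial data $(w_0,w_1;\theta_0,\theta_1)\in Y$ there exists a unique weak solution $(w,\theta)$ (on $[0,T]$) of the fish-bone system (FB). Moreover, if $w_0,\theta_0\in\mathcal{D}$ and $w_1,\theta_1\in (H^2\cap H^1_0)(I)$, then $$w,\theta\in C^0([0,T];\mathcal{D})\cap C^1([0,T];(H^2\cap H^1_0)(I))\cap C^2([0,T];L^2(I))$$ and $(w,\theta)$ is a strong solution of (FB), i.e. it satisfies the equations and boundary conditions pointwise for a.e. $x$ and $t$. Any weak solution satisfies, for $0\le s<t\le T$, the energy identity $$\mathcal{E}(t)+\mu\int_s^t\|w_t(\tau)\|_0^2\,d\tau+\zeta\int_s^t\|\theta_t(\tau)\|_0^2\,d\tau=\mathcal{E}(s)-\beta\Upsilon\int_s^t(\theta_t(\tau),w_t(\tau))_0\,d\tau-\eta\int_s^t(\theta(\tau),w_t(\tau))_0\,d\tau .$$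
   Context: Let $I=(0,\pi)$. Norms and inner products: $(u,v)_0=\int_I uv$, $(u,v)_1=\int_I u_xv_x$, $(u,v)_2=\int_I u_{xx}v_{xx}$, with norms $\|\cdot\|_0,\|\cdot\|_1,\|\cdot\|_2$ (the latter two used on $H^1_0(I)$ and $(H^2\cap H^1_0)(I)$). $\mathcal{H}$ is the dual of $(H^2\cap H^1_0)(I)$, with duality pairing ${}_{-2}\langle\cdot,\cdot\rangle_2$. $\mathcal{D}=\{u\in(H^4\cap H^1_0)(I): u_{xx}=0\text{ on }\{0,\pi\}\}$. $Y=\big((H^2\cap H^1_0)(I)\times L^2(I)\big)^2$ with $\|(w,v;\theta,\varphi)\|_Y^2=\|v\|_0^2+\|w\|_2^2+\|\varphi\|_0^2+\|\theta\|_2^2$. Cable nonlinearity. Fix constants $a,s_0>0$ and $b,c\ge 0$; $s(x)=-\frac a2x^2+\frac a2\pi x+s_0$; $\Xi(u)=\sqrt{1+(u_x+s_x)^2}$, $\xi_0=\Xi(0)$, $\mathcal{L}(u)=\int_0^\pi\Xi(u)\,dx$, $\mathcal{L}_0=\mathcal{L}(0)$, $$h(u)=\big[b(\mathcal{L}_0-\mathcal{L}(u))-c\,\xi_0\big]\frac{u_x+s_x}{\sqrt{1+(u_x+s_x)^2}},$$ $f(w,\theta)=h(w+\ell\theta)+h(w-\ell\theta)$, $\overline f(w,\theta)=\ell[h(w+\ell\theta)-h(w-\ell\theta)]$, and $\Pi(u)=\frac b2(\mathcal{L}(u)-\mathcal{L}_0)^2+c\int_0^\pi\xi_0(\Xi(u)-\xi_0)\,dx$.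 System (FB), for $(x,t)\in I\times(0,T)$: $$w_{tt}+\mu w_t+w_{xxxx}+\Big(P-S\int_Iw_x^2\Big)w_{xx}+(f(w,\theta))_x=g-\beta\Upsilon\theta_t-\eta\theta,$$ $$\tfrac{\ell^2}{3}\theta_{tt}+\zeta\theta_t+\epsilon\theta_{xxxx}-\kappa\theta_{xx}+(\overline f(w,\theta))_x=0,$$ with $w=w_{xx}=\theta=\theta_{xx}=0$ on $\{0,\pi\}\times(0,T)$ and $w(0)=w_0$, $w_t(0)=w_1$, $\theta(0)=\theta_0$, $\theta_t(0)=\theta_1$. Here $g=g(x)$ is time independent. A weak solution of (FB) is a pair $(w,\theta)$ with $w,\theta\in C^0([0,T];(H^2\cap H^1_0)(I))\cap C^1([0,T];L^2(I))\cap C^2([0,T];\mathcal{H})$, attaining the initial data, such that for all $t\in(0,T]$ and all $v,\varphi\in(H^2\cap H^1_0)(I)$: $${}_{-2}\langle w_{tt},v\rangle_2+\mu(w_t,v)_0+(w,v)_2+[S\|w\|_1^2-P](w,v)_1-(f(w,\theta),v_x)_0=(g-\beta\Upsilon\theta_t-\eta\theta,v)_0,$$ $$\tfrac{\ell^2}{3}{}_{-2}\langle\theta_{tt},\varphi\rangle_2+\zeta(\theta_t,\varphi)_0+\epsilon(\theta,\varphi)_2+\kappa(\theta,\varphi)_1-(\overline f(w,\theta),\varphi_x)_0=0.$$ Energy: $E=\frac12\|w_t\|_0^2+\frac12\|w\|_2^2+\frac{\ell^2}{6}\|\theta_t\|_0^2+\frac\epsilon2\|\theta\|_2^2+\frac\kappa2\|\theta\|_1^2$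 and $\mathcal{E}=E+\Pi(w+\ell\theta)+\Pi(w-\ell\theta)+\frac S4\|w\|_1^4-\frac P2\|w\|_1^2-(g,w)_0$; $\mathcal{E}(t)$ denotes its value at time $t$ along the solution. *)

theory Defs
  imports "HOL-Analysis.Analysis"
begin

section \<open>Sobolev spaces on the interval\<close>

text \<open>
  Elements of a function space over I are represented by functions on the real line, two of which
  stand for the same element iff they agree a.e. on I; values outside I are irrelevant.
\<close>

definition I_set :: "real set" where
  "I_set = {0<..<pi}"

abbreviation I_leb :: "real measure" where
  "I_leb \<equiv> lebesgue_on I_set"

definition test_fun :: "(real \<Rightarrow> real) set" where
  "test_fun = {\<phi>. (\<forall>n. (deriv ^^ n) \<phi> differentiable_on UNIV) \<and>
                  (\<exists>K. compact K \<and> K \<subseteq> I_set \<and> (\<forall>x. x \<notin> K \<longrightarrow> \<phi> x = 0))}"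

definition loc_integrable :: "(real \<Rightarrow> real) \<Rightarrow> bool" where
  "loc_integrable u \<longleftrightarrow> (\<forall>K. compact K \<and> K \<subseteq> I_set \<longrightarrow> integrable (lebesgue_on K) u)"

definition has_weak_deriv :: "nat \<Rightarrow> (real \<Rightarrow> real) \<Rightarrow> (real \<Rightarrow> real) \<Rightarrow> bool" where
  "has_weak_deriv k u v \<longleftrightarrow> loc_integrable u \<and> loc_integrable v \<and>
     (\<forall>\<phi>\<in>test_fun. (LINT x|I_leb. u x * (deriv ^^ k) \<phi> x) = (-1) ^ k * (LINT x|I_leb. v x * \<phi> x))"

text \<open>The weak derivative of order k, determined up to a.e. equality on I when it exists.\<close>

definition wderiv :: "nat \<Rightarrow> (real \<Rightarrow> real) \<Rightarrow> real \<Rightarrow> real" where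
  "wderiv k u = (SOME v. has_weak_deriv k u v)"

definition L2 :: "(real \<Rightarrow> real) set" where
  "L2 = {u. u \<in> borel_measurable I_leb \<and> integrable I_leb (\<lambda>x. (u x)\<^sup>2)}"

definition Hk :: "nat \<Rightarrow> (real \<Rightarrow> real) set" where
  "Hk k = {u \<in> L2. \<forall>j\<le>k. \<exists>v\<in>L2. has_weak_deriv j u v}"

definition inner0 :: "(real \<Rightarrow> real) \<Rightarrow> (real \<Rightarrow> real) \<Rightarrow> real" where
  "inner0 u v = (LINT x|I_leb. u x * v x)"

definition inner1 :: "(real \<Rightarrow> real) \<Rightarrow> (real \<Rightarrow> real) \<Rightarrow> real" where
  "inner1 u v = inner0 (wderiv 1 u) (wderiv 1 v)"

definition inner2 :: "(real \<Rightarrow> real) \<Rightarrow> (real \<Rightarrow> real) \<Rightarrow> real" where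
  "inner2 u v = inner0 (wderiv 2 u) (wderiv 2 v)"

definition norm0 :: "(real \<Rightarrow> real) \<Rightarrow> real" where
  "norm0 u = sqrt (inner0 u u)"

definition norm1 :: "(real \<Rightarrow> real) \<Rightarrow> real" where
  "norm1 u = sqrt (inner1 u u)"

definition norm2 :: "(real \<Rightarrow> real) \<Rightarrow> real" where
  "norm2 u = sqrt (inner2 u u)"

definition norm_Hk :: "nat \<Rightarrow> (real \<Rightarrow> real) \<Rightarrow> real" where
  "norm_Hk k u = sqrt (\<Sum>j\<le>k. (norm0 (wderiv j u))\<^sup>2)"

definition H10 :: "(real \<Rightarrow> real) set" where
  "H10 = {u \<in> Hk 1. \<forall>e>0. \<exists>\<phi>\<in>test_fun. norm_Hk 1 (\<lambda>x. u x - \<phi> x) < e}"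

definition V :: "(real \<Rightarrow> real) set" where
  "V = Hk 2 \<inter> H10"

text \<open>Vanishing on the boundary, for the continuous representative on the closed interval.\<close>

definition zero_on_bd :: "(real \<Rightarrow> real) \<Rightarrow> bool" where
  "zero_on_bd u \<longleftrightarrow>
     (\<exists>U. continuous_on {0..pi} U \<and> (AE x in I_leb. u x = U x) \<and> U 0 = 0 \<and> U pi = 0)"

definition Dom :: "(real \<Rightarrow> real) set" where
  "Dom = {u \<in> Hk 4 \<inter> H10. zero_on_bd (wderiv 2 u)}"

text \<open>
  The dual of V. Functionals act on representatives; boundedness forces them to
  respect a.e. equality, and their values off V are irrelevant. The duality pairing of F and v
  is F v.
\<close>

definition V_dual :: "((real \<Rightarrow> real) \<Rightarrow> real) set" where
  "V_dual = {F. (\<forall>u\<in>V. \<forall>v\<in>V. \<forall>\<alpha> \<gamma>. F (\<lambda>x. \<alpha> * u x + \<gamma> * v x) = \<alpha> * F u + \<gamma> * F v) \<and>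
                (\<exists>C. \<forall>v\<in>V. \<bar>F v\<bar> \<le> C * norm2 v)}"

definition dual_norm :: "((real \<Rightarrow> real) \<Rightarrow> real) \<Rightarrow> real" where
  "dual_norm F = (SUP v\<in>{v \<in> V. norm2 v \<le> 1}. \<bar>F v\<bar>)"

text \<open>The canonical embedding of L2 into the dual of V.\<close>

definition emb :: "(real \<Rightarrow> real) \<Rightarrow> (real \<Rightarrow> real) \<Rightarrow> real" where
  "emb u = (\<lambda>v. inner0 u v)"


section \<open>Regularity in time\<close>

text \<open>
  X is a space of functions or of functionals and N its norm; at the endpoints of the time
  interval, limits and derivatives are one-sided.
\<close>

definition has_time_deriv ::
  "('a \<Rightarrow> real) set \<Rightarrow> (('a \<Rightarrow> real) \<Rightarrow> real) \<Rightarrow> real \<Rightarrow> (real \<Rightarrow> 'a \<Rightarrow> real) \<Rightarrow> (real \<Rightarrow> 'a \<Rightarrow> real) \<Rightarrow> bool"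
where
  "has_time_deriv X N T u v \<longleftrightarrow> (\<forall>t\<in>{0..T}. u t \<in> X \<and> v t \<in> X \<and>
     ((\<lambda>r. N (\<lambda>x. (u r x - u t x) / (r - t) - v t x)) \<longlongrightarrow> 0) (at t within {0..T}))"

definition time_deriv ::
  "('a \<Rightarrow> real) set \<Rightarrow> (('a \<Rightarrow> real) \<Rightarrow> real) \<Rightarrow> real \<Rightarrow> (real \<Rightarrow> 'a \<Rightarrow> real) \<Rightarrow> real \<Rightarrow> 'a \<Rightarrow> real"
where
  "time_deriv X N T u = (SOME v. has_time_deriv X N T u v)"

primrec Ck ::
  "nat \<Rightarrow> ('a \<Rightarrow> real) set \<Rightarrow> (('a \<Rightarrow> real) \<Rightarrow> real) \<Rightarrow> real \<Rightarrow> (real \<Rightarrow> 'a \<Rightarrow> real) set"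
where
  "Ck 0 X N T = {u. \<forall>t\<in>{0..T}. u t \<in> X \<and>
     ((\<lambda>r. N (\<lambda>x. u r x - u t x)) \<longlongrightarrow> 0) (at t within {0..T})}"
| "Ck (Suc k) X N T = {u. \<exists>v\<in>Ck k X N T. has_time_deriv X N T u v}"

abbreviation dt :: "real \<Rightarrow> (real \<Rightarrow> real \<Rightarrow> real) \<Rightarrow> real \<Rightarrow> real \<Rightarrow> real" where
  "dt \<equiv> time_deriv L2 norm0"

text \<open>Second time derivative with values in the dual of V.\<close>

definition dtt_dual ::
  "real \<Rightarrow> (real \<Rightarrow> real \<Rightarrow> real) \<Rightarrow> real \<Rightarrow> (real \<Rightarrow> real) \<Rightarrow> real" where
  "dtt_dual T w =
     time_deriv V_dual dual_norm T (time_deriv V_dual dual_norm T (\<lambda>t. emb (w t)))"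


section \<open>The fish-bone system\<close>

record fb_params =
  cab_a :: real
  cab_s0 :: real
  cab_b :: real
  cab_c :: real
  mu :: real
  zeta :: real
  eps :: real
  ell :: real
  bet :: real
  S_par :: real
  P_par :: real
  kap :: real
  Ups :: real
  eta :: real

definition shape :: "fb_params \<Rightarrow> real \<Rightarrow> real" where
  "shape p x = - (cab_a p / 2) * x\<^sup>2 + cab_a p / 2 * pi * x + cab_s0 p"

definition Xi :: "fb_params \<Rightarrow> (real \<Rightarrow> real) \<Rightarrow> real \<Rightarrow> real" where
  "Xi p u x = sqrt (1 + (wderiv 1 u x + deriv (shape p) x)\<^sup>2)"

definition xi0 :: "fb_params \<Rightarrow> real \<Rightarrow> real" where
  "xi0 p = Xi p (\<lambda>_. 0)"

definition cable_len :: "fb_params \<Rightarrow> (real \<Rightarrow> real) \<Rightarrow> real" where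
  "cable_len p u = (LINT x|I_leb. Xi p u x)"

definition cable_len0 :: "fb_params \<Rightarrow> real" where
  "cable_len0 p = cable_len p (\<lambda>_. 0)"

definition h_cab :: "fb_params \<Rightarrow> (real \<Rightarrow> real) \<Rightarrow> real \<Rightarrow> real" where
  "h_cab p u x = (cab_b p * (cable_len0 p - cable_len p u) - cab_c p * xi0 p x) *
     ((wderiv 1 u x + deriv (shape p) x) / sqrt (1 + (wderiv 1 u x + deriv (shape p) x)\<^sup>2))"

definition f_cab :: "fb_params \<Rightarrow> (real \<Rightarrow> real) \<Rightarrow> (real \<Rightarrow> real) \<Rightarrow> real \<Rightarrow> real" where
  "f_cab p w \<theta> x =
     h_cab p (\<lambda>y. w y + ell p * \<theta> y) x + h_cab p (\<lambda>y. w y - ell p * \<theta> y) x"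

definition fbar_cab :: "fb_params \<Rightarrow> (real \<Rightarrow> real) \<Rightarrow> (real \<Rightarrow> real) \<Rightarrow> real \<Rightarrow> real" where
  "fbar_cab p w \<theta> x =
     ell p * (h_cab p (\<lambda>y. w y + ell p * \<theta> y) x - h_cab p (\<lambda>y. w y - ell p * \<theta> y) x)"

definition Pi_cab :: "fb_params \<Rightarrow> (real \<Rightarrow> real) \<Rightarrow> real" where
  "Pi_cab p u = cab_b p / 2 * (cable_len p u - cable_len0 p)\<^sup>2 +
     cab_c p * (LINT x|I_leb. xi0 p x * (Xi p u x - xi0 p x))"

definition weak_solution ::
  "fb_params \<Rightarrow> (real \<Rightarrow> real) \<Rightarrow> real \<Rightarrow> (real \<Rightarrow> real) \<Rightarrow> (real \<Rightarrow> real) \<Rightarrow> (real \<Rightarrow> real) \<Rightarrow> (real \<Rightarrow> real) \<Rightarrow>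
   (real \<Rightarrow> real \<Rightarrow> real) \<Rightarrow> (real \<Rightarrow> real \<Rightarrow> real) \<Rightarrow> bool"
where
  "weak_solution p g T w0 w1 \<theta>0 \<theta>1 w \<theta> \<longleftrightarrow>
     (\<forall>u\<in>{w, \<theta>}. u \<in> Ck 0 V norm2 T \<and> u \<in> Ck 1 L2 norm0 T \<and>
                (\<lambda>t. emb (u t)) \<in> Ck 2 V_dual dual_norm T) \<and>
     (AE x in I_leb. w 0 x = w0 x) \<and> (AE x in I_leb. dt T w 0 x = w1 x) \<and>
     (AE x in I_leb. \<theta> 0 x = \<theta>0 x) \<and> (AE x in I_leb. dt T \<theta> 0 x = \<theta>1 x) \<and>
     (\<forall>t\<in>{0<..T}. \<forall>v\<in>V. \<forall>\<phi>\<in>V.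
        dtt_dual T w t v + mu p * inner0 (dt T w t) v + inner2 (w t) v
          + (S_par p * (norm1 (w t))\<^sup>2 - P_par p) * inner1 (w t) v
          - inner0 (f_cab p (w t) (\<theta> t)) (wderiv 1 v)
        = inner0 (\<lambda>x. g x - bet p * Ups p * dt T \<theta> t x - eta p * \<theta> t x) v \<and>
        (ell p)\<^sup>2 / 3 * dtt_dual T \<theta> t \<phi> + zeta p * inner0 (dt T \<theta> t) \<phi>
          + eps p * inner2 (\<theta> t) \<phi> + kap p * inner1 (\<theta> t) \<phi>
          - inner0 (fbar_cab p (w t) (\<theta> t)) (wderiv 1 \<phi>) = 0)"

definition strong_regular :: "real \<Rightarrow> (real \<Rightarrow> real \<Rightarrow> real) \<Rightarrow> bool" where
  "strong_regular T u \<longleftrightarrow>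
     u \<in> Ck 0 Dom (norm_Hk 4) T \<and> u \<in> Ck 1 V norm2 T \<and> u \<in> Ck 2 L2 norm0 T"

text \<open>
  The equations and boundary conditions pointwise. ``For a.e. x and t'' is rendered by iterated
  quantifiers, as representatives are chosen separately for each t and hence need not be jointly
  measurable.
\<close>

definition solves_pointwise ::
  "fb_params \<Rightarrow> (real \<Rightarrow> real) \<Rightarrow> real \<Rightarrow> (real \<Rightarrow> real \<Rightarrow> real) \<Rightarrow> (real \<Rightarrow> real \<Rightarrow> real) \<Rightarrow> bool"
where
  "solves_pointwise p g T w \<theta> \<longleftrightarrow>
     (AE t in lebesgue_on {0<..<T}. AE x in I_leb.
        dt T (dt T w) t x + mu p * dt T w t x + wderiv 4 (w t) x
          + (P_par p - S_par p * (LINT y|I_leb. (wderiv 1 (w t) y)\<^sup>2)) * wderiv 2 (w t) x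
          + wderiv 1 (f_cab p (w t) (\<theta> t)) x
        = g x - bet p * Ups p * dt T \<theta> t x - eta p * \<theta> t x \<and>
        (ell p)\<^sup>2 / 3 * dt T (dt T \<theta>) t x + zeta p * dt T \<theta> t x
          + eps p * wderiv 4 (\<theta> t) x - kap p * wderiv 2 (\<theta> t) x
          + wderiv 1 (fbar_cab p (w t) (\<theta> t)) x = 0) \<and>
     (\<forall>t\<in>{0<..<T}. zero_on_bd (w t) \<and> zero_on_bd (wderiv 2 (w t)) \<and>
        zero_on_bd (\<theta> t) \<and> zero_on_bd (wderiv 2 (\<theta> t)))"

text \<open>The energies at a state with displacements w, \<open>\<theta>\<close> and velocities v, \<open>\<phi>\<close>.\<close>

definition E_lin ::
  "fb_params \<Rightarrow> (real \<Rightarrow> real) \<Rightarrow> (real \<Rightarrow> real) \<Rightarrow> (real \<Rightarrow> real) \<Rightarrow> (real \<Rightarrow> real) \<Rightarrow> real"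
where
  "E_lin p w v \<theta> \<phi> = (norm0 v)\<^sup>2 / 2 + (norm2 w)\<^sup>2 / 2 + (ell p)\<^sup>2 / 6 * (norm0 \<phi>)\<^sup>2
     + eps p / 2 * (norm2 \<theta>)\<^sup>2 + kap p / 2 * (norm1 \<theta>)\<^sup>2"

definition E_tot ::
  "fb_params \<Rightarrow> (real \<Rightarrow> real) \<Rightarrow> (real \<Rightarrow> real) \<Rightarrow> (real \<Rightarrow> real) \<Rightarrow> (real \<Rightarrow> real) \<Rightarrow> (real \<Rightarrow> real) \<Rightarrow> real"
where
  "E_tot p g w v \<theta> \<phi> = E_lin p w v \<theta> \<phi>
     + Pi_cab p (\<lambda>x. w x + ell p * \<theta> x) + Pi_cab p (\<lambda>x. w x - ell p * \<theta> x)
     + S_par p / 4 * (norm1 w) ^ 4 - P_par p / 2 * (norm1 w)\<^sup>2 - inner0 g w"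

definition energy_at ::
  "fb_params \<Rightarrow> (real \<Rightarrow> real) \<Rightarrow> real \<Rightarrow> (real \<Rightarrow> real \<Rightarrow> real) \<Rightarrow> (real \<Rightarrow> real \<Rightarrow> real) \<Rightarrow> real \<Rightarrow> real"
where
  "energy_at p g T w \<theta> t = E_tot p g (w t) (dt T w t) (\<theta> t) (dt T \<theta> t)"

end

theory Submission
  imports Defs
begin

text \<open>
  Functions in V are sine series with square summable coefficients, weighted by the inverse squares of
  the wave numbers; the weight-free coefficients represent \<open>- u_xx\<close>, and norms and pairings
  become sequence space expressions. The linear part of the system turns into two groups of
  coordinatewise rotations whose frequencies grow quadratically, and the system into a semilinear evolution equation for
  displacements and velocities. The cable force is the x-derivative of an H1-valued function
  of the displacement, so the nonlinearity is Lipschitz on balls of the energy space. Weak solutions are the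
  mild ones, which gives uniqueness and local existence. The energy identity
  holds for mild solutions because rotations are isometries and the potential terms are differentiable along
  the flow. The potential is bounded below and the quartic term dominates the compressive one, so
  Gronwall's inequality bounds the solution and makes it global. From data in the domain, the mild solution
  is Lipschitz in time, hence in the domain of the generator at all times, that is, strong.
\<close>

section \<open>Square summable sequences\<close>

text \<open>The coordinates are chosen so that displacement and velocity are measured in the same
  norm: \<open>norm2 u\<close> is the norm of \<open>lap u\<close>, and \<open>norm0 v\<close> that
  of \<open>cf v\<close>. In them the beam operator couples the two by multiplication with plus and
  minus a multiple of the squared wave number. This is skew, whence the rotations. The price is an
  unbounded generator: a mild solution is in general differentiable in time only after smoothing by
  \<open>J\<close>, the inverse of minus the second derivative. Two devices deal with this. Norms
  are differentiated in the rotating frame, where the unbounded part has disappeared; potentials are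
  differentiated through remainders bounded by the product of a strong and a weak norm. The cable
  term is delicate because the density \<open>hz\<close> need not vanish at the ends of the
  interval, so only its x-derivative is expanded in sines, with coefficients read off from the
  cosine coefficients of \<open>hz\<close>. Since functions are mere representatives and derivatives
  are chosen by \<open>SOME\<close>, time regularity, equations and energies are first carried over
  to sequences, where uniqueness of limits is available.\<close>

typedef ell2 = "{f :: nat \<Rightarrow> real. summable (\<lambda>k. (f k)\<^sup>2)}"
  morphisms coord Ell
  by (rule exI[of _ "\<lambda>_. 0"]) simp

setup_lifting type_definition_ell2

lemma summable_coord: "summable (\<lambda>k. (coord x k)\<^sup>2)"
  using coord[of x] by simp

lemma coord_Ell: "summable (\<lambda>k. (f k)\<^sup>2) \<Longrightarrow> coord (Ell f) = f"
  by (simp add: Ell_inverse)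

lemma ell2_eqI: "(\<And>k. coord x k = coord y k) \<Longrightarrow> x = y"
  by (metis coord_inverse ext)

lemma summable_mult_of_squares:
  fixes f g :: "nat \<Rightarrow> real"
  assumes "summable (\<lambda>k. (f k)\<^sup>2)" "summable (\<lambda>k. (g k)\<^sup>2)"
  shows "summable (\<lambda>k. f k * g k)"
proof (rule summable_comparison_test)
  show "\<exists>N. \<forall>n\<ge>N. norm (f n * g n) \<le> (f n)\<^sup>2 + (g n)\<^sup>2"
  proof (intro exI allI impI)
    fix n
    have "0 \<le> (\<bar>f n\<bar> - \<bar>g n\<bar>)\<^sup>2" by simp
    then have "2 * (\<bar>f n\<bar> * \<bar>g n\<bar>) \<le> (f n)\<^sup>2 + (g n)\<^sup>2"
      by (simp add: power2_diff)
    moreover have "0 \<le> \<bar>f n\<bar> * \<bar>g n\<bar>" by simp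
    ultimately show "norm (f n * g n) \<le> (f n)\<^sup>2 + (g n)\<^sup>2"
      by (simp only: real_norm_def abs_mult)
  qed
  show "summable (\<lambda>n. (f n)\<^sup>2 + (g n)\<^sup>2)"
    using assms by (rule summable_add)
qed

lemma summable_square_add:
  fixes f g :: "nat \<Rightarrow> real"
  assumes "summable (\<lambda>k. (f k)\<^sup>2)" "summable (\<lambda>k. (g k)\<^sup>2)"
  shows "summable (\<lambda>k. (f k + g k)\<^sup>2)"
proof -
  have "summable (\<lambda>k. (f k)\<^sup>2 + (g k)\<^sup>2 + 2 * (f k * g k))"
    by (intro summable_add summable_mult summable_mult_of_squares assms)
  then show ?thesis by (simp add: power2_sum mult.assoc)
qed

lemma summable_square_scale:
  fixes f :: "nat \<Rightarrow> real"
  assumes "summable (\<lambda>k. (f k)\<^sup>2)"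
  shows "summable (\<lambda>k. (c * f k)\<^sup>2)"
  unfolding power_mult_distrib by (intro summable_mult assms)

instantiation ell2 :: real_vector
begin
lift_definition zero_ell2 :: ell2 is "\<lambda>_. 0" by simp
lift_definition uminus_ell2 :: "ell2 \<Rightarrow> ell2" is "\<lambda>f k. - f k" by simp
lift_definition plus_ell2 :: "ell2 \<Rightarrow> ell2 \<Rightarrow> ell2" is "\<lambda>f g k. f k + g k"
  by (rule summable_square_add)
lift_definition scaleR_ell2 :: "real \<Rightarrow> ell2 \<Rightarrow> ell2" is "\<lambda>c f k. c * f k"
  by (rule summable_square_scale)
definition minus_ell2 :: "ell2 \<Rightarrow> ell2 \<Rightarrow> ell2" where "x - y = x + (- y)" for x y :: ell2
instance
proof
  fix x y z :: ell2 and r s :: real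
  show "x + y + z = x + (y + z)" by transfer (simp add: algebra_simps)
  show "x + y = y + x" by transfer (simp add: algebra_simps)
  show "0 + x = x" "- x + x = 0" "1 *\<^sub>R x = x" by (transfer, simp)+
  show "x - y = x + - y" by (simp only: minus_ell2_def)
  show "r *\<^sub>R (x + y) = r *\<^sub>R x + r *\<^sub>R y" "(r + s) *\<^sub>R x = r *\<^sub>R x + s *\<^sub>R x"
    "r *\<^sub>R s *\<^sub>R x = (r * s) *\<^sub>R x"
    by (transfer, simp add: algebra_simps)+
qed
end

lemma coord_zero [simp]: "coord 0 k = 0"
  and coord_add [simp]: "coord (x + y) k = coord x k + coord y k"
  and coord_uminus [simp]: "coord (- x) k = - coord x k"
  and coord_scaleR [simp]: "coord (c *\<^sub>R x) k = c * coord x k"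
  by (transfer; simp)+

lemma coord_diff [simp]: "coord (x - y) k = coord x k - coord y k"
  by (simp only: minus_ell2_def coord_add coord_uminus)

instantiation ell2 :: real_inner
begin
definition inner_ell2 :: "ell2 \<Rightarrow> ell2 \<Rightarrow> real" where
  "inner x y = (\<Sum>k. coord x k * coord y k)" for x y :: ell2
definition norm_ell2 :: "ell2 \<Rightarrow> real" where "norm x = sqrt (inner x x)" for x :: ell2
definition dist_ell2 :: "ell2 \<Rightarrow> ell2 \<Rightarrow> real" where "dist x y = norm (x - y)" for x y :: ell2
definition sgn_ell2 :: "ell2 \<Rightarrow> ell2" where "sgn x = x /\<^sub>R norm x" for x :: ell2
definition uniformity_ell2 :: "(ell2 \<times> ell2) filter" where
  "uniformity_ell2 = (INF e\<in>{0<..}. principal {(x, y). dist x y < e})"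
definition open_ell2 :: "ell2 set \<Rightarrow> bool" where
  "open_ell2 U \<longleftrightarrow> (\<forall>x\<in>U. eventually (\<lambda>(x', y). x' = x \<longrightarrow> y \<in> U) uniformity)"
instance
proof
  fix x y z :: ell2 and r :: real
  have s: "summable (\<lambda>k. coord a k * coord b k)" for a b
    by (intro summable_mult_of_squares summable_coord)
  show "inner x y = inner y x" by (simp add: inner_ell2_def mult.commute)
  show "inner (x + y) z = inner x z + inner y z"
    by (simp add: inner_ell2_def algebra_simps suminf_add s)
  show "inner (r *\<^sub>R x) y = r * inner x y"
    by (simp add: inner_ell2_def mult.assoc suminf_mult s)
  show "0 \<le> inner x x" unfolding inner_ell2_def by (intro suminf_nonneg s) simp
  show "(inner x x = 0) = (x = 0)"
    using suminf_eq_zero_iff[OF s[of x x]] by (auto simp: inner_ell2_def intro!: ell2_eqI)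
qed (auto simp: norm_ell2_def dist_ell2_def sgn_ell2_def uniformity_ell2_def open_ell2_def)
end

lemma norm_ell2_square: "(norm x)\<^sup>2 = (\<Sum>k. (coord x k)\<^sup>2)" for x :: ell2
  unfolding power2_norm_eq_inner inner_ell2_def by (simp add: power2_eq_square)

lemma sums_inner_ell2: "(\<lambda>k. coord x k * coord y k) sums inner x y"
  unfolding inner_ell2_def
  by (intro summable_sums summable_mult_of_squares summable_coord)

lemma sums_norm_ell2: "(\<lambda>k. (coord x k)\<^sup>2) sums (norm x)\<^sup>2"
  unfolding norm_ell2_square by (intro summable_sums summable_coord)

lemma abs_coord_le_norm: "\<bar>coord x k\<bar> \<le> norm x"
proof -
  have "(coord x k)\<^sup>2 \<le> (norm x)\<^sup>2"
    unfolding norm_ell2_square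
    using sum_le_suminf[OF summable_coord[of x], of "{k}"] by simp
  then show ?thesis by (simp add: abs_le_square_iff[symmetric])
qed

lemma bounded_linear_coord: "bounded_linear (\<lambda>x. coord x k)"
  by (rule bounded_linear_intro[where K=1]) (auto simp: abs_coord_le_norm)

lemmas continuous_on_coord [continuous_intros] = bounded_linear.continuous_on[OF bounded_linear_coord]

lemma ell2_boundI:
  fixes f :: "nat \<Rightarrow> real"
  assumes "\<And>K. (\<Sum>k<K. (f k)\<^sup>2) \<le> C\<^sup>2" "0 \<le> C"
  shows "summable (\<lambda>k. (f k)\<^sup>2)" "norm (Ell f) \<le> C"
proof -
  show s: "summable (\<lambda>k. (f k)\<^sup>2)"
    by (rule summableI_nonneg_bounded[where x="C\<^sup>2"]) (use assms in auto)
  have "(norm (Ell f))\<^sup>2 \<le> C\<^sup>2"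
    unfolding norm_ell2_square coord_Ell[OF s] by (rule suminf_le_const[OF s assms(1)])
  then show "norm (Ell f) \<le> C" using assms(2) power2_le_imp_le by blast
qed

lemma sum_coord_le_norm: "(\<Sum>k<K. (coord x k)\<^sup>2) \<le> (norm x)\<^sup>2"
  unfolding norm_ell2_square by (intro sum_le_suminf summable_coord) auto

lemma norm_ell2_leI:
  assumes "\<And>K. (\<Sum>k<K. (coord x k)\<^sup>2) \<le> C\<^sup>2" "0 \<le> C"
  shows "norm x \<le> C"
  using ell2_boundI(2)[OF assms] by (simp add: coord_inverse)

text \<open>Fatou's lemma for sequences: a bound on each finite partial sum survives a
  coordinatewise limit. It applies to the difference quotients of a solution as well as to Cauchy
  sequences.\<close>

lemma ell2_limit_bound:
  fixes f :: "nat \<Rightarrow> real" and x :: "'a \<Rightarrow> ell2"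
  assumes ne: "F \<noteq> bot" and lim: "\<And>k. ((\<lambda>n. coord (x n) k) \<longlongrightarrow> f k) F"
    and bd: "\<forall>\<^sub>F n in F. norm (x n) \<le> C" and C: "0 \<le> C"
  shows "summable (\<lambda>k. (f k)\<^sup>2)" "norm (Ell f) \<le> C"
proof -
  have "(\<Sum>k<K. (f k)\<^sup>2) \<le> C\<^sup>2" for K
  proof (rule tendsto_upperbound[OF _ _ ne])
    show "((\<lambda>n. \<Sum>k<K. (coord (x n) k)\<^sup>2) \<longlongrightarrow> (\<Sum>k<K. (f k)\<^sup>2)) F"
      by (intro tendsto_intros lim)
    show "\<forall>\<^sub>F n in F. (\<Sum>k<K. (coord (x n) k)\<^sup>2) \<le> C\<^sup>2"
      using bd
    proof eventually_elim
      case (elim n)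
      then show ?case
        using sum_coord_le_norm[of "x n" K] power_mono[OF elim, of 2] by simp
    qed
  qed
  from ell2_boundI[OF this C]
  show "summable (\<lambda>k. (f k)\<^sup>2)" "norm (Ell f) \<le> C" .
qed

text \<open>The coordinatewise limit is the candidate. Letting n grow in \<open>X m - X n\<close>
  with \<open>m\<close> fixed, \<open>ell2_limit_bound\<close> gives at once the square summability
  of the difference to the limit and its smallness.\<close>

instance ell2 :: complete_space
proof
  fix X :: "nat \<Rightarrow> ell2" assume X: "Cauchy X"
  have "convergent (\<lambda>n. coord (X n) k)" for k
  proof -
    have "Cauchy (\<lambda>n. coord (X n) k)"
      using bounded_linear.Cauchy[OF bounded_linear_coord X] .
    then show ?thesis by (simp add: Cauchy_convergent)
  qed
  then obtain a where a: "\<And>k. (\<lambda>n. coord (X n) k) \<longlonglongrightarrow> a k"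
    unfolding convergent_def by metis
  have key: "summable (\<lambda>k. (coord (X m) k - a k)\<^sup>2) \<and> norm (Ell (\<lambda>k. coord (X m) k - a k)) \<le> e"
    if "e > 0" "\<And>m n. m \<ge> N \<Longrightarrow> n \<ge> N \<Longrightarrow> norm (X m - X n) < e" "m \<ge> N" for e N m
  proof -
    have l: "((\<lambda>n. coord (X m - X n) k) \<longlongrightarrow> coord (X m) k - a k) sequentially" for k
      by (simp, intro tendsto_intros a)
    have ev: "\<forall>\<^sub>F n in sequentially. norm (X m - X n) \<le> e"
      using that by (intro eventually_sequentiallyI[of N]) (simp add: less_imp_le)
    show ?thesis
      using ell2_limit_bound[OF _ l ev] that(1) by simp
  qed
  have summ_a: "summable (\<lambda>k. (a k)\<^sup>2)"
  proof -
    obtain N where N: "\<And>m n. m \<ge> N \<Longrightarrow> n \<ge> N \<Longrightarrow> norm (X m - X n) < 1"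
      using CauchyD[OF X, of 1] by auto
    have "summable (\<lambda>k. (coord (X N) k - a k)\<^sup>2)" using key[OF _ N] by simp
    from summable_square_add[OF summable_coord[of "X N"] summable_square_scale[OF this, of "-1"]]
    show ?thesis by simp
  qed
  have "X \<longlonglongrightarrow> Ell a"
  proof (rule LIMSEQ_I)
    fix r :: real assume r: "0 < r"
    obtain N where N: "\<And>m n. m \<ge> N \<Longrightarrow> n \<ge> N \<Longrightarrow> norm (X m - X n) < r/2"
      using CauchyD[OF X, of "r/2"] r by auto
    have "norm (X m - Ell a) < r" if "m \<ge> N" for m
    proof -
      have k: "summable (\<lambda>k. (coord (X m) k - a k)\<^sup>2)" "norm (Ell (\<lambda>k. coord (X m) k - a k)) \<le> r/2"
        using key[OF _ N that] r by auto
      have "X m - Ell a = Ell (\<lambda>k. coord (X m) k - a k)"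
        by (rule ell2_eqI) (simp add: coord_Ell summ_a k(1))
      then show ?thesis using k(2) r by simp
    qed
    then show "\<exists>no. \<forall>n\<ge>no. norm (X n - Ell a) < r" by blast
  qed
  then show "convergent X" by (rule convergentI)
qed

instance ell2 :: banach ..

subsection \<open>Multiplication operators\<close>

text \<open>For an unbounded multiplier the product sequence may fail to be square summable, and the
  value is then arbitrary; the lemmas about it therefore carry a uniform bound.\<close>

definition mulop :: "(nat \<Rightarrow> real) \<Rightarrow> ell2 \<Rightarrow> ell2" where
  "mulop m x = Ell (\<lambda>k. m k * coord x k)"

lemma
  assumes m: "\<And>k. \<bar>m k\<bar> \<le> B"
  shows coord_mulop_bdd: "coord (mulop m x) = (\<lambda>k. m k * coord x k)"
    and norm_mulop_le: "norm (mulop m x) \<le> B * norm x"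
proof -
  have B: "0 \<le> B" using m[of 0] by linarith
  have "(\<Sum>k<K. (m k * coord x k)\<^sup>2) \<le> (B * norm x)\<^sup>2" for K
  proof -
    have "(\<Sum>k<K. (m k * coord x k)\<^sup>2) \<le> (\<Sum>k<K. B\<^sup>2 * (coord x k)\<^sup>2)"
    proof (rule sum_mono)
      fix k
      have "(m k)\<^sup>2 \<le> B\<^sup>2" using m[of k] B by (simp add: abs_le_square_iff[symmetric])
      then show "(m k * coord x k)\<^sup>2 \<le> B\<^sup>2 * (coord x k)\<^sup>2"
        by (simp add: power_mult_distrib mult_right_mono)
    qed
    also have "\<dots> \<le> B\<^sup>2 * (norm x)\<^sup>2"
      unfolding sum_distrib_left[symmetric] by (intro mult_left_mono sum_coord_le_norm) simp
    finally show ?thesis by (simp add: power_mult_distrib)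
  qed
  from ell2_boundI[OF this] B
  show "norm (mulop m x) \<le> B * norm x" "coord (mulop m x) = (\<lambda>k. m k * coord x k)"
    by (auto simp: mulop_def coord_Ell)
qed

lemma bounded_linear_mulop:
  assumes m: "\<And>k. \<bar>m k\<bar> \<le> B"
  shows "bounded_linear (mulop m)"
  by (rule bounded_linear_intro[where K=B])
    (auto intro!: ell2_eqI simp: coord_mulop_bdd[OF m] algebra_simps norm_mulop_le[OF m] mult.commute[of _ B])

text \<open>The convergence is strong, not in operator norm: beyond some index the tail of
  \<open>x\<close> is small whatever the bounded multipliers do, and below it only finitely many
  coordinates have to converge.\<close>

lemma mulop_tendsto:
  assumes ne: "F \<noteq> bot" and bd: "\<And>n k. \<bar>m n k\<bar> \<le> B" and lim: "\<And>k. ((\<lambda>n. m n k) \<longlongrightarrow> m0 k) F"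
  shows "((\<lambda>n. mulop (m n) x) \<longlongrightarrow> mulop m0 x) F"
proof -
  have B: "0 \<le> B" using bd[of undefined 0] by linarith
  have bd0: "\<bar>m0 k\<bar> \<le> B" for k
    by (rule tendsto_upperbound[OF tendsto_rabs[OF lim] _ ne]) (simp add: bd)
  have "((\<lambda>n. (norm (mulop (m n) x - mulop m0 x))\<^sup>2) \<longlongrightarrow> 0) F"
  proof (rule tendstoI)
    fix e :: real assume e: "0 < e"
    \<comment> \<open>The multipliers differ by at most 2B, so the tail contributes at most
      \<open>4 * B\<^sup>2 * d\<close>, which stays below e/2; the summand 1 covers
      \<open>B = 0\<close>.\<close>
    define d where "d = e / (2 * (4 * B\<^sup>2 + 1))"
    have d: "0 < d" using e by (auto simp: d_def intro!: divide_pos_pos add_nonneg_pos)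
    obtain K where K: "\<bar>\<Sum>k. (coord x (k + K))\<^sup>2\<bar> < d"
      using suminf_exist_split[OF d summable_coord[of x]] by auto
    have t: "((\<lambda>n. \<Sum>k<K. ((m n k - m0 k) * coord x k)\<^sup>2) \<longlongrightarrow> (\<Sum>k<K. ((m0 k - m0 k) * coord x k)\<^sup>2)) F"
      by (intro tendsto_intros lim)
    have "\<forall>\<^sub>F n in F. (\<Sum>k<K. ((m n k - m0 k) * coord x k)\<^sup>2) < e/2"
      using order_tendstoD(2)[OF t, of "e/2"] e by simp
    then show "\<forall>\<^sub>F n in F. dist ((norm (mulop (m n) x - mulop m0 x))\<^sup>2) 0 < e"
    proof eventually_elim
      case (elim n)
      let ?y = "mulop (m n) x - mulop m0 x"
      have c: "coord ?y k = (m n k - m0 k) * coord x k" for k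
        by (simp add: coord_mulop_bdd[OF bd] coord_mulop_bdd[OF bd0] algebra_simps)
      have sh: "summable (\<lambda>k. (coord x (k + K))\<^sup>2)" "summable (\<lambda>k. (coord ?y (k + K))\<^sup>2)"
        using summable_ignore_initial_segment[OF summable_coord[of x]]
          summable_ignore_initial_segment[OF summable_coord[of ?y]] by auto
      have "(norm ?y)\<^sup>2 = (\<Sum>k. (coord ?y (k + K))\<^sup>2) + (\<Sum>k<K. (coord ?y k)\<^sup>2)"
        unfolding norm_ell2_square by (rule suminf_split_initial_segment[OF summable_coord])
      moreover have "(\<Sum>k. (coord ?y (k + K))\<^sup>2) \<le> (\<Sum>k. 4 * B\<^sup>2 * (coord x (k + K))\<^sup>2)"
      proof (intro suminf_le sh summable_mult)
        fix k
        have "\<bar>m n (k+K) - m0 (k+K)\<bar> \<le> 2 * B" using bd[of n "k+K"] bd0[of "k+K"] by linarith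
        then have "(m n (k+K) - m0 (k+K))\<^sup>2 \<le> (2 * B)\<^sup>2"
          using B by (subst abs_le_square_iff[symmetric]) simp
        then show "(coord ?y (k + K))\<^sup>2 \<le> 4 * B\<^sup>2 * (coord x (k + K))\<^sup>2"
          unfolding c power_mult_distrib by (intro mult_right_mono) (auto simp: power_mult_distrib)
      qed
      moreover have "(\<Sum>k. 4 * B\<^sup>2 * (coord x (k + K))\<^sup>2) = 4 * B\<^sup>2 * (\<Sum>k. (coord x (k + K))\<^sup>2)"
        by (rule suminf_mult[OF sh(1)])
      moreover have "4 * B\<^sup>2 * (\<Sum>k. (coord x (k + K))\<^sup>2) \<le> 4 * B\<^sup>2 * d"
        using K by (intro mult_left_mono) auto
      moreover have "4 * B\<^sup>2 * d < e / 2"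
      proof -
        have "4 * B\<^sup>2 * d < (4 * B\<^sup>2 + 1) * d" using d by (simp add: algebra_simps)
        also have "\<dots> = e / 2" by (simp add: d_def field_simps add_nonneg_eq_0_iff)
        finally show ?thesis .
      qed
      moreover have "(\<Sum>k<K. (coord ?y k)\<^sup>2) < e / 2"
        unfolding c by (rule elim)
      ultimately have "(norm ?y)\<^sup>2 < e" by linarith
      then show ?case by simp
    qed
  qed
  then have "((\<lambda>n. sqrt ((norm (mulop (m n) x - mulop m0 x))\<^sup>2)) \<longlongrightarrow> sqrt 0) F"
    by (rule tendsto_real_sqrt)
  then show ?thesis by (simp add: tendsto_norm_zero_iff Lim_null[symmetric])
qed

subsection \<open>Rotation groups\<close>

text \<open>The flow of the uncoupled oscillators x' = \<omega> q, q' = - \<omega> x, with x in the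
  first component and q in the second.\<close>

definition rot :: "(nat \<Rightarrow> real) \<Rightarrow> real \<Rightarrow> ell2 \<times> ell2 \<Rightarrow> ell2 \<times> ell2" where
  "rot \<omega> t z = (mulop (\<lambda>k. cos (\<omega> k * t)) (fst z) + mulop (\<lambda>k. sin (\<omega> k * t)) (snd z),
                mulop (\<lambda>k. cos (\<omega> k * t)) (snd z) - mulop (\<lambda>k. sin (\<omega> k * t)) (fst z))"

lemma coord_cos_sin [simp]:
  "coord (mulop (\<lambda>k. cos (\<omega> k * t)) x) = (\<lambda>k. cos (\<omega> k * t) * coord x k)"
  "coord (mulop (\<lambda>k. sin (\<omega> k * t)) x) = (\<lambda>k. sin (\<omega> k * t) * coord x k)"
  by (rule coord_mulop_bdd[where B=1]; simp)+

lemma coord_rot: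
  "coord (fst (rot \<omega> t z)) k = cos (\<omega> k * t) * coord (fst z) k + sin (\<omega> k * t) * coord (snd z) k"
  "coord (snd (rot \<omega> t z)) k = cos (\<omega> k * t) * coord (snd z) k - sin (\<omega> k * t) * coord (fst z) k"
  by (simp_all add: rot_def)

lemma linear_rot: "linear (rot \<omega> t)"
  by (rule linearI) (auto intro!: prod_eqI ell2_eqI simp: coord_rot algebra_simps)

lemma rot_0 [simp]: "rot \<omega> 0 z = z"
  by (auto intro!: prod_eqI ell2_eqI simp: coord_rot)

lemma rot_add: "rot \<omega> (s + t) z = rot \<omega> s (rot \<omega> t z)"
  by (auto intro!: prod_eqI ell2_eqI simp: coord_rot distrib_left cos_add sin_add algebra_simps)

lemma inner_rot: "inner (rot \<omega> t z) (rot \<omega> t z') = inner z z'"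
proof -
  have "(\<lambda>k. coord (fst (rot \<omega> t z)) k * coord (fst (rot \<omega> t z')) k
             + coord (snd (rot \<omega> t z)) k * coord (snd (rot \<omega> t z')) k) sums
        inner (rot \<omega> t z) (rot \<omega> t z')" (is "?f sums _")
    unfolding inner_prod_def by (intro sums_add sums_inner_ell2)
  moreover have "?f = (\<lambda>k. coord (fst z) k * coord (fst z') k + coord (snd z) k * coord (snd z') k)"
  proof
    fix k
    have "(c * x + s * y) * (c * x' + s * y') + (c * y - s * x) * (c * y' - s * x')
        = (s\<^sup>2 + c\<^sup>2) * (x * x' + y * y')" for c s x y x' y' :: real
      by (simp add: algebra_simps power2_eq_square)
    then show "?f k = coord (fst z) k * coord (fst z') k + coord (snd z) k * coord (snd z') k"
      unfolding coord_rot by simp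
  qed
  moreover have "(\<lambda>k. coord (fst z) k * coord (fst z') k + coord (snd z) k * coord (snd z') k) sums
      inner z z'"
    unfolding inner_prod_def by (intro sums_add sums_inner_ell2)
  ultimately show ?thesis by (simp only: sums_unique2)
qed

lemma norm_rot [simp]: "norm (rot \<omega> t z) = norm z"
  by (simp add: norm_eq_sqrt_inner inner_rot)

lemma continuous_on_rot: "continuous_on UNIV (\<lambda>t. rot \<omega> t z)"
proof -
  have "continuous_on UNIV (\<lambda>t. mulop (\<lambda>k. cos (\<omega> k * t)) x)"
    "continuous_on UNIV (\<lambda>t. mulop (\<lambda>k. sin (\<omega> k * t)) x)" for x
    unfolding continuous_on_def
    by (intro ballI mulop_tendsto[where B=1]; auto intro!: tendsto_intros)+
  then show ?thesis
    unfolding rot_def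
    by (intro continuous_on_Pair continuous_on_add continuous_on_diff)
qed

section \<open>Semilinear evolution equations driven by an isometric group\<close>

text \<open>The right-hand side of the hypothesis, multiplied by exp(- L t), has a non-positive
  derivative.\<close>

lemma gronwall:
  fixes u :: "real \<Rightarrow> real"
  assumes cont: "continuous_on {0..T} u" and L: "0 \<le> L"
    and le: "\<And>t. t \<in> {0..T} \<Longrightarrow> u t \<le> a + L * integral {0..t} u"
    and t: "t \<in> {0..T}"
  shows "u t \<le> a * exp (L * t)"
proof -
  define y where "y r = (a + L * integral {0..r} u) * exp (- L * r)" for r
  have "y t \<le> y 0"
  proof (rule DERIV_nonpos_imp_decreasing_open[where f=y])
    show "0 \<le> t" using t by simp
    have "continuous_on {0..t} (\<lambda>r. integral {0..r} u)"
      using t by (intro indefinite_integral_continuous_1 integrable_continuous_real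
          continuous_on_subset[OF cont]) auto
    then show "continuous_on {0..t} y" unfolding y_def by (intro continuous_intros)
    fix r assume r: "0 < r" "r < t"
    have rT: "r \<in> {0..T}" using r t by simp
    have "((\<lambda>r. integral {0..r} u) has_real_derivative u r) (at r within {0..T})"
      by (rule integral_has_real_derivative[OF cont rT])
    then have d: "((\<lambda>r. integral {0..r} u) has_real_derivative u r) (at r)"
      using r t by (simp add: at_within_Icc_at)
    have "(y has_real_derivative L * (u r - (a + L * integral {0..r} u)) * exp (- L * r)) (at r)"
      unfolding y_def by (rule derivative_eq_intros d refl)+ (simp add: algebra_simps)
    moreover have "L * (u r - (a + L * integral {0..r} u)) * exp (- L * r) \<le> 0"
      using L le[OF rT] by (intro mult_nonpos_nonneg mult_nonneg_nonpos) auto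
    ultimately show "\<exists>d. (y has_real_derivative d) (at r) \<and> d \<le> 0" by blast
  qed
  then have "(a + L * integral {0..t} u) * exp (- (L * t)) * exp (L * t) \<le> a * exp (L * t)"
    by (intro mult_right_mono) (simp_all add: y_def)
  then show ?thesis using le[OF t] by (simp add: mult.assoc exp_minus)
qed

text \<open>Picard's operator in an exponentially weighted sup norm: writing \<open>W t\<close> as
  exp(l t) times the unknown turns it into a contraction with factor \<open>L / l\<close>, at most
  1/2. One fixed point then covers all of [0,T] and no short intervals have to be glued.\<close>

lemma lipschitz_ode_exists:
  fixes G :: "real \<Rightarrow> 'a::banach \<Rightarrow> 'a"
  assumes T: "0 \<le> T" and L: "0 \<le> L"
    and cont: "\<And>\<phi>. continuous_on {0..T} \<phi> \<Longrightarrow> continuous_on {0..T} (\<lambda>s. G s (\<phi> s))"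
    and lip: "\<And>s x y. s \<in> {0..T} \<Longrightarrow> norm (G s x - G s y) \<le> L * norm (x - y)"
  shows "\<exists>W. continuous_on {0..T} W \<and> (\<forall>t\<in>{0..T}. W t = x0 + integral {0..t} (\<lambda>s. G s (W s)))"
proof -
  \<comment> \<open>Clamping time to [0,T] extends functions to the whole line, so that the complete
    space of bounded continuous functions is available for the fixed point.\<close>
  define cl where "cl t = max 0 (min T t)" for t
  define l where "l = 2 * L + 1"
  have l: "0 < l" "L / l \<le> 1 / 2" using L by (auto simp: l_def field_simps)
  define g where "g \<phi> s = G s (exp (l * s) *\<^sub>R \<phi> s)" for \<phi> s
  define F where "F \<phi> t = exp (- (l * t)) *\<^sub>R (x0 + integral {0..t} (g \<phi>))" for \<phi> t
  have gc: "continuous_on {0..T} (g \<phi>)" if "continuous_on {0..T} \<phi>" for \<phi>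
    unfolding g_def by (intro cont continuous_intros that)
  have Fc: "continuous_on {0..T} (F \<phi>)" if "continuous_on {0..T} \<phi>" for \<phi>
    unfolding F_def
    by (intro continuous_intros indefinite_integral_continuous_1 integrable_continuous_real gc that)
  have clT: "cl t \<in> {0..T}" for t using T by (auto simp: cl_def)
  have clc: "continuous_on UNIV cl" unfolding cl_def by (intro continuous_intros)
  have inb: "(\<lambda>t. F \<phi> (cl t)) \<in> bcontfun" if "continuous_on {0..T} \<phi>" for \<phi>
  proof -
    have "bounded (F \<phi> ` {0..T})"
      by (intro compact_imp_bounded compact_continuous_image Fc that) simp
    then have "bounded (range (\<lambda>t. F \<phi> (cl t)))"
      by (rule bounded_subset) (use clT in auto)
    moreover have "continuous_on UNIV (\<lambda>t. F \<phi> (cl t))"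
      by (rule continuous_on_compose2[OF Fc[OF that] clc]) (use clT in auto)
    ultimately show ?thesis by (simp add: bcontfun_def)
  qed
  define \<Psi> where "\<Psi> \<phi> = Bcontfun (\<lambda>t. F (apply_bcontfun \<phi>) (cl t))" for \<phi> :: "real \<Rightarrow>\<^sub>C 'a"
  have ap: "apply_bcontfun (\<Psi> \<phi>) t = F (apply_bcontfun \<phi>) (cl t)" for \<phi> t
    unfolding \<Psi>_def by (subst Bcontfun_inverse[OF inb]) auto
  have "dist (\<Psi> \<phi>) (\<Psi> \<psi>) \<le> 1/2 * dist \<phi> \<psi>" for \<phi> \<psi>
  proof (rule dist_bound)
    fix t
    let ?d = "dist \<phi> \<psi>"
    define r where "r = cl t"
    have r: "0 \<le> r" "r \<le> T" using clT[of t] by (auto simp: r_def)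
    have int: "g (apply_bcontfun \<xi>) integrable_on {0..r}" for \<xi>
      by (intro integrable_continuous_real continuous_on_subset[OF gc]) (use r in auto)
    have hi: "((\<lambda>s. L * ?d * exp (l * s)) has_integral (L * ?d / l * exp (l * r) - L * ?d / l * exp (l * 0))) {0..r}"
      by (rule fundamental_theorem_of_calculus[OF r(1)])
        (use l in \<open>auto intro!: derivative_eq_intros simp: has_real_derivative_iff_has_vector_derivative[symmetric]\<close>)
    have "norm (integral {0..r} (\<lambda>s. g \<phi> s - g \<psi> s)) \<le> integral {0..r} (\<lambda>s. L * ?d * exp (l * s))"
    proof (rule integral_norm_bound_integral)
      show "(\<lambda>s. g \<phi> s - g \<psi> s) integrable_on {0..r}" by (intro integrable_diff int)
      show "(\<lambda>s. L * ?d * exp (l * s)) integrable_on {0..r}" using hi by blast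
      fix s assume s: "s \<in> {0..r}"
      have "norm (g \<phi> s - g \<psi> s) \<le> L * norm (exp (l * s) *\<^sub>R (\<phi> s - \<psi> s))"
        unfolding g_def scaleR_diff_right using s r by (intro lip) auto
      also have "\<dots> = L * (exp (l * s) * dist (\<phi> s) (\<psi> s))" by (simp add: dist_norm)
      also have "\<dots> \<le> L * (exp (l * s) * ?d)"
        using L by (intro mult_left_mono dist_bounded) auto
      finally show "norm (g \<phi> s - g \<psi> s) \<le> L * ?d * exp (l * s)" by (simp add: mult_ac)
    qed
    also have "\<dots> = L / l * ?d * (exp (l * r) - 1)"
      unfolding integral_unique[OF hi] by (simp add: diff_divide_distrib algebra_simps)
    also have "\<dots> \<le> L / l * ?d * exp (l * r)"
      using L l by (intro mult_left_mono) auto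
    finally have *: "norm (integral {0..r} (\<lambda>s. g \<phi> s - g \<psi> s)) \<le> L / l * ?d * exp (l * r)" .
    have "dist (\<Psi> \<phi> t) (\<Psi> \<psi> t) = exp (- (l * r)) * norm (integral {0..r} (\<lambda>s. g \<phi> s - g \<psi> s))"
      unfolding ap r_def[symmetric] F_def dist_norm scaleR_diff_right[symmetric]
      by (simp add: integral_diff int)
    also have "\<dots> \<le> exp (- (l * r)) * (L / l * ?d * exp (l * r))"
      by (intro mult_left_mono *) simp
    also have "\<dots> = L / l * ?d" by (simp add: exp_minus)
    also have "\<dots> \<le> 1/2 * ?d" by (intro mult_right_mono l) simp
    finally show "dist (\<Psi> \<phi> t) (\<Psi> \<psi> t) \<le> 1/2 * ?d" .
  qed
  then obtain \<phi> where \<phi>: "\<Psi> \<phi> = \<phi>"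
    using banach_fix_type[of "1/2" \<Psi>] by auto
  define W where "W t = exp (l * t) *\<^sub>R \<phi> t" for t
  have "continuous_on {0..T} W" unfolding W_def by (intro continuous_intros) auto
  moreover have "W t = x0 + integral {0..t} (\<lambda>s. G s (W s))" if t: "t \<in> {0..T}" for t
  proof -
    have "cl t = t" using t by (simp add: cl_def)
    then have "\<phi> t = F \<phi> t" using ap[of \<phi> t] \<phi> by simp
    then have "W t = x0 + integral {0..t} (g \<phi>)"
      by (simp add: W_def F_def exp_minus)
    also have "g \<phi> = (\<lambda>s. G s (W s))" by (simp add: g_def W_def fun_eq_iff)
    finally show ?thesis .
  qed
  ultimately show ?thesis by blast
qed

section \<open>Locally Lipschitz maps and radial truncation\<close>

definition lipschitz_on_balls :: "('a::real_normed_vector \<Rightarrow> 'b::real_normed_vector) \<Rightarrow> bool" where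
  "lipschitz_on_balls N \<longleftrightarrow>
     (\<forall>r. \<exists>L\<ge>0. \<forall>x y. norm x \<le> r \<longrightarrow> norm y \<le> r \<longrightarrow> norm (N x - N y) \<le> L * norm (x - y))"

lemma lipschitz_on_ballsD:
  assumes "lipschitz_on_balls N"
  obtains L where "0 \<le> L" "\<And>x y. norm x \<le> r \<Longrightarrow> norm y \<le> r \<Longrightarrow> norm (N x - N y) \<le> L * norm (x - y)"
  using assms unfolding lipschitz_on_balls_def by metis

lemma lipschitz_on_ballsI:
  assumes "\<And>r. 0 \<le> r \<Longrightarrow> \<exists>L. \<forall>x y. norm x \<le> r \<longrightarrow> norm y \<le> r \<longrightarrow> norm (N x - N y) \<le> L * norm (x - y)"
  shows "lipschitz_on_balls N"
  unfolding lipschitz_on_balls_def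
proof
  fix r :: real
  obtain L where L: "\<And>x y. norm x \<le> \<bar>r\<bar> \<Longrightarrow> norm y \<le> \<bar>r\<bar> \<Longrightarrow> norm (N x - N y) \<le> L * norm (x - y)"
    using assms[of "\<bar>r\<bar>"] by auto
  have "norm (N x - N y) \<le> \<bar>L\<bar> * norm (x - y)" if "norm x \<le> r" "norm y \<le> r" for x y
  proof -
    have "norm (N x - N y) \<le> L * norm (x - y)" using that by (intro L) auto
    also have "\<dots> \<le> \<bar>L\<bar> * norm (x - y)" by (intro mult_right_mono) auto
    finally show ?thesis .
  qed
  then show "\<exists>L\<ge>0. \<forall>x y. norm x \<le> r \<longrightarrow> norm y \<le> r \<longrightarrow> norm (N x - N y) \<le> L * norm (x - y)"
    by (intro exI[of _ "\<bar>L\<bar>"]) auto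
qed

lemma lipschitz_on_balls_continuous:
  assumes "lipschitz_on_balls N"
  shows "continuous_on S N"
proof -
  have "isCont N x" for x
  proof -
    obtain L where L: "0 \<le> L" "\<And>a b. norm a \<le> norm x + 1 \<Longrightarrow> norm b \<le> norm x + 1 \<Longrightarrow> norm (N a - N b) \<le> L * norm (a - b)"
      by (rule lipschitz_on_ballsD[OF assms, of "norm x + 1"]) blast
    have "((\<lambda>y. N y - N x) \<longlongrightarrow> 0) (at x)"
    proof (rule Lim_null_comparison)
      show "((\<lambda>y. L * norm (y - x)) \<longlongrightarrow> 0) (at x)"
        by (rule tendsto_eq_intros refl | simp)+
      have "\<forall>\<^sub>F y in at x. dist y x < 1"
        by (simp add: eventually_at) (meson zero_less_one)
      then show "\<forall>\<^sub>F y in at x. norm (N y - N x) \<le> L * norm (y - x)"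
      proof eventually_elim
        case (elim y)
        have "norm y \<le> norm x + 1"
          using norm_triangle_sub[of y x] elim by (simp add: dist_norm)
        then show ?case by (intro L) auto
      qed
    qed
    then show ?thesis unfolding isCont_def by (rule LIM_zero_cancel)
  qed
  then show ?thesis by (simp add: continuous_at_imp_continuous_on)
qed

definition radial_proj :: "real \<Rightarrow> 'a::real_normed_vector \<Rightarrow> 'a" where
  "radial_proj r x = (if norm x \<le> r then x else (r / norm x) *\<^sub>R x)"

lemma norm_radial_proj_le: "0 < r \<Longrightarrow> norm (radial_proj r x) \<le> r"
  by (auto simp: radial_proj_def)

text \<open>The triangle inequality alone gives the constant 2 in any normed space: when both points
  lie outside the ball, \<open>x - y\<close> is shrunk by the factor belonging to x, and the change
  of the factor costs at most the difference of the norms.\<close>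

lemma radial_proj_lipschitz:
  assumes r: "0 < r"
  shows "norm (radial_proj r x - radial_proj r y) \<le> 2 * norm (x - y)"
proof -
  have A: "norm (x - (r / norm y) *\<^sub>R y) \<le> 2 * norm (x - y)" if "norm x \<le> r" "r < norm y"
    for x y :: 'a
  proof -
    have "x - (r / norm y) *\<^sub>R y = (x - y) + (1 - r / norm y) *\<^sub>R y"
      by (simp add: algebra_simps)
    then have "norm (x - (r / norm y) *\<^sub>R y) \<le> norm (x - y) + norm ((1 - r / norm y) *\<^sub>R y)"
      by (metis norm_triangle_ineq)
    also have "norm ((1 - r / norm y) *\<^sub>R y) = norm y - r"
      unfolding norm_scaleR using that r by (auto simp: field_simps abs_if)
    also have "norm y - r \<le> norm (x - y)"
      using that norm_triangle_ineq2[of y x] by (simp add: norm_minus_commute)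
    finally show ?thesis by simp
  qed
  consider "norm x \<le> r" "norm y \<le> r" | "norm x \<le> r" "r < norm y" | "r < norm x" "norm y \<le> r"
    | "r < norm x" "r < norm y" by linarith
  then show ?thesis
  proof cases
    case 1 then show ?thesis by (simp add: radial_proj_def)
  next
    case 2 then show ?thesis using A by (simp add: radial_proj_def)
  next
    case 3 then show ?thesis using A[of y x] by (simp add: radial_proj_def norm_minus_commute)
  next
    case 4
    have pos: "0 < norm x" "0 < norm y" using 4 r by linarith+
    have le1: "r / norm x \<le> 1" using 4 pos by (simp add: divide_le_eq_1_pos)
    have "(r / norm x) *\<^sub>R x - (r / norm y) *\<^sub>R y
        = (r / norm x) *\<^sub>R (x - y) + (r / norm x - r / norm y) *\<^sub>R y"
      by (simp add: algebra_simps)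
    then have "norm ((r / norm x) *\<^sub>R x - (r / norm y) *\<^sub>R y)
        \<le> norm ((r / norm x) *\<^sub>R (x - y)) + norm ((r / norm x - r / norm y) *\<^sub>R y)"
      by (metis norm_triangle_ineq)
    also have "norm ((r / norm x) *\<^sub>R (x - y)) \<le> 1 * norm (x - y)"
      unfolding norm_scaleR using le1 r pos by (intro mult_right_mono) auto
    also have "norm ((r / norm x - r / norm y) *\<^sub>R y) = \<bar>r / norm x * (norm y - norm x)\<bar>"
    proof -
      have "norm ((r / norm x - r / norm y) *\<^sub>R y) = \<bar>(r / norm x - r / norm y) * norm y\<bar>"
        by (simp add: abs_mult)
      also have "(r / norm x - r / norm y) * norm y = r / norm x * (norm y - norm x)"
        using pos by (simp add: field_simps)
      finally show ?thesis .
    qed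
    also have "\<dots> = r / norm x * \<bar>norm y - norm x\<bar>" using pos r by (simp add: abs_mult)
    also have "\<dots> \<le> 1 * norm (x - y)"
      using le1 norm_triangle_ineq3[of y x] by (intro mult_mono) (auto simp: norm_minus_commute)
    finally show ?thesis using 4 by (simp add: radial_proj_def)
  qed
qed

section \<open>Mild solutions for a strongly continuous group of isometries\<close>

locale isometry_group =
  fixes R :: "real \<Rightarrow> 'a::{real_inner, banach} \<Rightarrow> 'a"
  assumes linear_R: "linear (R t)" and norm_R [simp]: "norm (R t x) = norm x"
    and R_0 [simp]: "R 0 x = x" and R_add: "R (s + t) x = R s (R t x)"
    and cont_R: "continuous_on UNIV (\<lambda>t. R t x)"
begin

lemma R_inv [simp]: "R (- t) (R t x) = x" "R t (R (- t) x) = x"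
  by (simp_all flip: R_add)

lemmas R_diff = linear_diff[OF linear_R] and R_sum = linear_add[OF linear_R]
  and R_scale = linear_scale[OF linear_R]

lemma bounded_linear_R: "bounded_linear (R t)"
  by (rule bounded_linear_intro[where K=1]) (auto simp: R_sum R_scale)

text \<open>Polarisation: the squared norm of a sum is preserved, and hence so is its mixed
  term.\<close>

lemma inner_R: "inner (R t x) (R t y) = inner x y"
proof -
  have "(norm (R t (x + y)))\<^sup>2 = (norm (x + y))\<^sup>2" by simp
  then show ?thesis
    unfolding R_sum by (simp only: power2_norm_eq_inner inner_add_left inner_add_right)
      (simp add: inner_commute power2_norm_eq_inner[symmetric])
qed

text \<open>Strong continuity becomes joint continuity because the maps are isometries: varying the
  argument under \<open>R (\<tau> s)\<close> costs exactly the norm of the variation, whatever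
  \<open>\<tau> s\<close> is.\<close>

lemma continuous_on_R [continuous_intros]:
  assumes \<tau>: "continuous_on S \<tau>" and \<phi>: "continuous_on S \<phi>"
  shows "continuous_on S (\<lambda>s. R (\<tau> s) (\<phi> s))"
  unfolding continuous_on_def
proof
  fix x assume x: "x \<in> S"
  have "((\<lambda>s. R (\<tau> s) (\<phi> s) - R (\<tau> s) (\<phi> x)) \<longlongrightarrow> 0) (at x within S)"
  proof (rule Lim_null_comparison[OF always_eventually])
    show "\<forall>s. norm (R (\<tau> s) (\<phi> s) - R (\<tau> s) (\<phi> x)) \<le> norm (\<phi> s - \<phi> x)"
      by (simp flip: R_diff)
    have "((\<lambda>s. \<phi> s - \<phi> x) \<longlongrightarrow> 0) (at x within S)"
      using \<phi> x by (simp add: continuous_on_def Lim_null[symmetric])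
    then show "((\<lambda>s. norm (\<phi> s - \<phi> x)) \<longlongrightarrow> 0) (at x within S)" by (rule tendsto_norm_zero)
  qed
  moreover have "((\<lambda>s. R (\<tau> s) (\<phi> x)) \<longlongrightarrow> R (\<tau> x) (\<phi> x)) (at x within S)"
    using continuous_on_compose2[OF cont_R \<tau>, of "\<phi> x"] x by (simp add: continuous_on_def)
  ultimately have "((\<lambda>s. (R (\<tau> s) (\<phi> s) - R (\<tau> s) (\<phi> x)) + R (\<tau> s) (\<phi> x)) \<longlongrightarrow> 0 + R (\<tau> x) (\<phi> x)) (at x within S)"
    by (rule tendsto_add)
  then show "((\<lambda>s. R (\<tau> s) (\<phi> s)) \<longlongrightarrow> R (\<tau> x) (\<phi> x)) (at x within S)" by simp
qed

text \<open>The variation of constants formula, in the rotating frame.\<close>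

definition mild :: "('a \<Rightarrow> 'a) \<Rightarrow> real \<Rightarrow> (real \<Rightarrow> 'a) \<Rightarrow> bool" where
  "mild N T Z \<longleftrightarrow> continuous_on {0..T} Z \<and>
     (\<forall>t\<in>{0..T}. R (- t) (Z t) = Z 0 + integral {0..t} (\<lambda>s. R (- s) (N (Z s))))"

lemma mild_subinterval: "mild N T Z \<Longrightarrow> \<tau> \<le> T \<Longrightarrow> mild N \<tau> Z"
  unfolding mild_def by (auto elim!: continuous_on_subset)

lemma mild_integrand:
  assumes N: "continuous_on UNIV N" and Z: "mild N T Z"
  shows "continuous_on {0..T} (\<lambda>s. R (- s) (N (Z s)))"
  using Z unfolding mild_def
  by (intro continuous_intros continuous_on_compose2[OF N]) auto

lemma mild_diff:
  assumes N: "continuous_on UNIV N" and Z: "mild N T Z" and st: "0 \<le> s" "s \<le> t" "t \<le> T"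
  shows "R (- t) (Z t) - R (- s) (Z s) = integral {s..t} (\<lambda>r. R (- r) (N (Z r)))"
proof -
  have "integral {0..s} (\<lambda>r. R (- r) (N (Z r))) + integral {s..t} (\<lambda>r. R (- r) (N (Z r)))
      = integral {0..t} (\<lambda>r. R (- r) (N (Z r)))"
    using st by (intro Henstock_Kurzweil_Integration.integral_combine integrable_continuous_real
        continuous_on_subset[OF mild_integrand[OF N Z]]) auto
  moreover have "R (- t) (Z t) = Z 0 + integral {0..t} (\<lambda>s. R (- s) (N (Z s)))"
    "R (- s) (Z s) = Z 0 + integral {0..s} (\<lambda>s. R (- s) (N (Z s)))"
    using Z st unfolding mild_def by auto
  ultimately show ?thesis by (simp add: algebra_simps)
qed

text \<open>The equation is autonomous. Shifted solutions are what
  \<open>mild_time_lipschitz\<close> compares with the original one.\<close>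

lemma mild_shift:
  assumes Nc: "continuous_on UNIV N" and Z: "mild N T Z" and h: "0 \<le> h" "h \<le> T"
  shows "mild N (T - h) (\<lambda>t. Z (t + h))"
  unfolding mild_def
proof (intro conjI ballI)
  show "continuous_on {0..T - h} (\<lambda>t. Z (t + h))"
    using Z h unfolding mild_def
    by (intro continuous_on_compose2[where g=Z and f="\<lambda>t. t + h"] continuous_intros) auto
  fix t assume t: "t \<in> {0..T - h}"
  have "integral {0..t} (\<lambda>s. R (- s) (N (Z (s + h)))) = integral {h..t+h} (\<lambda>s. R (- (s - h)) (N (Z s)))"
  proof -
    have "(\<lambda>s. R (- (s - h)) (N (Z s))) integrable_on {h..t + h}"
      using t h Z unfolding mild_def
      by (intro integrable_continuous_real continuous_intros continuous_on_compose2[OF Nc])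
        (auto elim: continuous_on_subset)
    from has_integral_affinity'[OF integrable_integral[OF this[folded cbox_interval]], of 1 h]
    show ?thesis by (simp add: integral_unique)
  qed
  also have "\<dots> = integral {h..t+h} (\<lambda>s. R h (R (- s) (N (Z s))))"
    by (simp flip: R_add)
  also have "\<dots> = R h (integral {h..t+h} (\<lambda>s. R (- s) (N (Z s))))"
    using t h by (intro integral_linear[OF _ bounded_linear_R, unfolded o_def] integrable_continuous_real
        continuous_on_subset[OF mild_integrand[OF Nc Z]]) auto
  also have "integral {h..t+h} (\<lambda>s. R (- s) (N (Z s))) = R (- (t + h)) (Z (t + h)) - R (- h) (Z h)"
    using t h by (intro mild_diff[OF Nc Z, symmetric]) auto
  also have "R h (R (- (t + h)) (Z (t + h)) - R (- h) (Z h)) = R (- t) (Z (t + h)) - Z h"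
    by (simp add: R_diff flip: R_add)
  finally show "R (- t) (Z (t + h)) = Z (0 + h) + integral {0..t} (\<lambda>s. R (- s) (N (Z (s + h))))"
    by simp
qed

text \<open>As \<open>R (- t)\<close> is an isometry, the distance of the solutions equals that of
  their representations in the rotating frame. There only the Lipschitz nonlinearity is integrated,
  and Gronwall's inequality finishes.\<close>

lemma mild_stability:
  assumes N: "lipschitz_on_balls N" and Z: "mild N T Z" and Z': "mild N T Z'"
    and L: "0 \<le> L" "\<And>x y. norm x \<le> r \<Longrightarrow> norm y \<le> r \<Longrightarrow> norm (N x - N y) \<le> L * norm (x - y)"
    and r: "\<And>t. t \<in> {0..T} \<Longrightarrow> norm (Z t) \<le> r" "\<And>t. t \<in> {0..T} \<Longrightarrow> norm (Z' t) \<le> r"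
    and t: "t \<in> {0..T}"
  shows "norm (Z t - Z' t) \<le> norm (Z 0 - Z' 0) * exp (L * t)"
proof (rule gronwall[OF _ L(1) _ t])
  have Nc: "continuous_on UNIV N" by (rule lipschitz_on_balls_continuous[OF N])
  have c: "continuous_on {0..T} Z" "continuous_on {0..T} Z'" using Z Z' by (auto simp: mild_def)
  show cd: "continuous_on {0..T} (\<lambda>t. norm (Z t - Z' t))" by (intro continuous_intros c)
  fix t assume t: "t \<in> {0..T}"
  let ?g = "\<lambda>Z s. R (- s) (N (Z s))"
  have int: "?g Z integrable_on {0..t}" "?g Z' integrable_on {0..t}"
    using t mild_integrand[OF Nc Z] mild_integrand[OF Nc Z']
    by (auto intro!: integrable_continuous_real elim: continuous_on_subset)
  have "norm (Z t - Z' t) = norm (R (- t) (Z t - Z' t))" by simp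
  also have "\<dots> = norm ((Z 0 - Z' 0) + integral {0..t} (\<lambda>s. ?g Z s - ?g Z' s))"
  proof -
    have "R (- t) (Z t) = Z 0 + integral {0..t} (?g Z)" "R (- t) (Z' t) = Z' 0 + integral {0..t} (?g Z')"
      using Z Z' t by (auto simp: mild_def)
    then have "R (- t) (Z t - Z' t) = (Z 0 - Z' 0) + (integral {0..t} (?g Z) - integral {0..t} (?g Z'))"
      by (simp add: R_diff)
    then show ?thesis by (simp add: integral_diff[OF int])
  qed
  also have "\<dots> \<le> norm (Z 0 - Z' 0) + norm (integral {0..t} (\<lambda>s. ?g Z s - ?g Z' s))"
    by (rule norm_triangle_ineq)
  also have "norm (integral {0..t} (\<lambda>s. ?g Z s - ?g Z' s)) \<le> integral {0..t} (\<lambda>s. L * norm (Z s - Z' s))"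
  proof (rule integral_norm_bound_integral)
    show "(\<lambda>s. ?g Z s - ?g Z' s) integrable_on {0..t}" by (intro integrable_diff int)
    show "(\<lambda>s. L * norm (Z s - Z' s)) integrable_on {0..t}"
      using t by (intro integrable_continuous_real continuous_intros continuous_on_subset[OF c(1)]
          continuous_on_subset[OF c(2)]) auto
    fix s assume s: "s \<in> {0..t}"
    have "norm (?g Z s - ?g Z' s) = norm (N (Z s) - N (Z' s))" by (simp flip: R_diff)
    also have "\<dots> \<le> L * norm (Z s - Z' s)" using s t r by (intro L) auto
    finally show "norm (?g Z s - ?g Z' s) \<le> L * norm (Z s - Z' s)" .
  qed
  finally show "norm (Z t - Z' t) \<le> norm (Z 0 - Z' 0) + L * integral {0..t} (\<lambda>t. norm (Z t - Z' t))"
    by simp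
qed

lemma mild_bounded:
  assumes "mild N T Z"
  obtains r where "0 < r" "\<And>t. t \<in> {0..T} \<Longrightarrow> norm (Z t) \<le> r"
proof -
  have "bounded (Z ` {0..T})"
    using assms by (intro compact_imp_bounded compact_continuous_image) (auto simp: mild_def)
  then show ?thesis using that by (auto simp: bounded_pos)
qed

lemma mild_unique:
  assumes N: "lipschitz_on_balls N" and Z: "mild N T Z" and Z': "mild N T Z'" and 0: "Z 0 = Z' 0"
    and t: "t \<in> {0..T}"
  shows "Z t = Z' t"
proof -
  obtain r r' where r: "\<And>t. t \<in> {0..T} \<Longrightarrow> norm (Z t) \<le> r" "\<And>t. t \<in> {0..T} \<Longrightarrow> norm (Z' t) \<le> r'"
    using mild_bounded[OF Z] mild_bounded[OF Z'] by metis
  obtain L where "0 \<le> L" "\<And>x y. norm x \<le> max r r' \<Longrightarrow> norm y \<le> max r r' \<Longrightarrow> norm (N x - N y) \<le> L * norm (x - y)"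
    by (rule lipschitz_on_ballsD[OF N, of "max r r'"]) blast
  from mild_stability[OF N Z Z' this _ _ t] r 0 show ?thesis
    by (simp add: max.coboundedI1 max.coboundedI2)
qed

text \<open>In the rotating frame the unknown \<open>R (- t) (Z t)\<close> obeys an ordinary
  integral equation whose right-hand side has the same Lipschitz constant as \<open>N\<close>, so
  the unbounded generator never appears.\<close>

lemma mild_exists_global:
  assumes T: "0 \<le> T" and L: "0 \<le> L" "\<And>x y. norm (N x - N y) \<le> L * norm (x - y)"
  shows "\<exists>Z. mild N T Z \<and> Z 0 = x0"
proof -
  have "lipschitz_on_balls N" unfolding lipschitz_on_balls_def using L by blast
  then have Nc: "continuous_on UNIV N" by (rule lipschitz_on_balls_continuous)
  have "\<exists>W. continuous_on {0..T} W \<and> (\<forall>t\<in>{0..T}. W t = x0 + integral {0..t} (\<lambda>s. R (- s) (N (R s (W s)))))"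
  proof (rule lipschitz_ode_exists[OF T L(1)])
    show "continuous_on {0..T} (\<lambda>s. R (- s) (N (R s (\<phi> s))))" if "continuous_on {0..T} \<phi>" for \<phi>
      by (intro continuous_intros continuous_on_compose2[OF Nc] that) auto
    show "norm (R (- s) (N (R s x)) - R (- s) (N (R s y))) \<le> L * norm (x - y)" for s x y
      using L(2)[of "R s x" "R s y"] by (simp flip: R_diff)
  qed
  then obtain W where W: "continuous_on {0..T} W"
    "\<And>t. t \<in> {0..T} \<Longrightarrow> W t = x0 + integral {0..t} (\<lambda>s. R (- s) (N (R s (W s))))" by blast
  have "W 0 = x0" using W(2)[of 0] T by simp
  moreover have "mild N T (\<lambda>t. R t (W t))"
    unfolding mild_def using W(2) \<open>W 0 = x0\<close> by (intro conjI continuous_intros W(1)) auto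
  ultimately show ?thesis by (intro exI[of _ "\<lambda>t. R t (W t)"]) simp
qed

text \<open>The truncated equation is globally solvable, and its solution never reaches the truncation radius.\<close>

lemma mild_exists:
  assumes T: "0 \<le> T" and N: "lipschitz_on_balls N"
    and bd: "\<And>\<tau> Z t. 0 \<le> \<tau> \<Longrightarrow> \<tau> \<le> T \<Longrightarrow> mild N \<tau> Z \<Longrightarrow> Z 0 = x0 \<Longrightarrow> t \<in> {0..\<tau>} \<Longrightarrow> norm (Z t) \<le> M"
  shows "\<exists>Z. mild N T Z \<and> Z 0 = x0"
proof -
  define r where "r = \<bar>M\<bar> + norm x0 + 1"
  have r: "0 < r" "M < r" "norm x0 < r"
    by (simp_all add: r_def add_nonneg_pos add_pos_nonneg) (smt (verit) norm_ge_zero)+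
  obtain L where L: "0 \<le> L" "\<And>x y. norm x \<le> r \<Longrightarrow> norm y \<le> r \<Longrightarrow> norm (N x - N y) \<le> L * norm (x - y)"
    by (rule lipschitz_on_ballsD[OF N, of r]) blast
  define N' where "N' x = N (radial_proj r x)" for x
  have "norm (N' x - N' y) \<le> L * 2 * norm (x - y)" for x y
  proof -
    have "norm (N' x - N' y) \<le> L * norm (radial_proj r x - radial_proj r y)"
      unfolding N'_def by (intro L norm_radial_proj_le r)
    also have "\<dots> \<le> L * (2 * norm (x - y))"
      by (intro mult_left_mono radial_proj_lipschitz r L)
    finally show ?thesis by simp
  qed
  then obtain Z where Z: "mild N' T Z" "Z 0 = x0"
    using mild_exists_global[OF T, of "L * 2" N' x0] L by auto
  have sub: "mild N \<tau> Z" if "\<tau> \<le> T" "\<And>t. t \<in> {0..\<tau>} \<Longrightarrow> norm (Z t) \<le> r" for \<tau>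
  proof -
    have "integral {0..t} (\<lambda>s. R (- s) (N' (Z s))) = integral {0..t} (\<lambda>s. R (- s) (N (Z s)))"
      if "t \<in> {0..\<tau>}" for t
      using that \<open>\<And>t. t \<in> {0..\<tau>} \<Longrightarrow> norm (Z t) \<le> r\<close>
      by (intro Henstock_Kurzweil_Integration.integral_cong) (auto simp: N'_def radial_proj_def)
    then show ?thesis
      using mild_subinterval[OF Z(1) that(1)] unfolding mild_def by auto
  qed
  have "norm (Z t) < r" if t: "t \<in> {0..T}" for t
  proof (rule ccontr)
    assume nt: "\<not> norm (Z t) < r"
    have cZ: "continuous_on {0..t} (\<lambda>t. norm (Z t))"
      using Z t unfolding mild_def by (intro continuous_intros) (auto elim: continuous_on_subset)
    \<comment> \<open>The times at which the radius has been reached; \<open>Inf S\<close> is the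
      first of them. Up to it the truncation is inactive, so the a priori bound M, which is below r,
      holds there and contradicts the definition of \<open>S\<close>.\<close>
    define S where "S = {s \<in> {0..t}. norm (Z s) \<in> {r..}}"
    have "closed S"
    proof -
      have "S = {0..t} \<inter> (\<lambda>t. norm (Z t)) -` {r..}" by (auto simp: S_def)
      then show ?thesis by (simp only: continuous_closed_preimage[OF cZ closed_atLeastAtMost closed_atLeast])
    qed
    moreover have "S \<noteq> {}" "bdd_below S" using nt t by (auto simp: S_def intro!: exI[of _ t] bdd_belowI[of _ 0])
    ultimately have i: "Inf S \<in> S" using closed_contains_Inf by blast
    have below: "norm (Z s) < r" if "s \<in> {0..<Inf S}" for s
    proof (rule ccontr)
      assume "\<not> norm (Z s) < r"
      then have "s \<in> S" using that i by (auto simp: S_def)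
      then have "Inf S \<le> s" by (rule cInf_lower[OF _ \<open>bdd_below S\<close>])
      then show False using that by simp
    qed
    have pos: "0 < Inf S" using i r Z(2) by (auto simp: S_def less_le)
    have le: "norm (Z s) \<le> r" if "s \<in> {0..Inf S}" for s
    proof -
      have "continuous_on (closure {0..<Inf S}) (\<lambda>t. norm (Z t))"
        using pos i by (intro continuous_on_subset[OF cZ]) (auto simp: S_def)
      from continuous_le_on_closure[OF this, of s r] below pos that show ?thesis
        by (auto simp: less_imp_le)
    qed
    have "mild N (Inf S) Z" by (rule sub) (use i t le in \<open>auto simp: S_def\<close>)
    from bd[OF _ _ this Z(2), of "Inf S"] i t have "norm (Z (Inf S)) \<le> M" by (auto simp: S_def)
    then show False using i r by (auto simp: S_def)
  qed
  then have "mild N T Z" by (intro sub) (auto intro: less_imp_le)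
  then show ?thesis using Z by blast
qed

text \<open>By \<open>mild_stability\<close> the increment over a step h at any time is controlled
  by the increment over [0,h]. The latter consists of the motion of the initial value under the free
  flow, of order h by \<open>dom\<close> (a way of saying that the initial value lies in the domain
  of the generator), and of an integral over an interval of length h.\<close>

lemma mild_time_lipschitz:
  assumes N: "lipschitz_on_balls N" and Z: "mild N T Z"
    and dom: "\<And>h. 0 \<le> h \<Longrightarrow> norm (R h (Z 0) - Z 0) \<le> C * h"
  obtains K where "0 \<le> K" "\<And>s t. s \<in> {0..T} \<Longrightarrow> t \<in> {0..T} \<Longrightarrow> norm (Z t - Z s) \<le> K * \<bar>t - s\<bar>"
proof -
  have Nc: "continuous_on UNIV N" by (rule lipschitz_on_balls_continuous[OF N])
  obtain r where r: "\<And>t. t \<in> {0..T} \<Longrightarrow> norm (Z t) \<le> r" using mild_bounded[OF Z] by metis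
  obtain L where L: "0 \<le> L" "\<And>x y. norm x \<le> r \<Longrightarrow> norm y \<le> r \<Longrightarrow> norm (N x - N y) \<le> L * norm (x - y)"
    by (rule lipschitz_on_ballsD[OF N, of r]) blast
  have "bounded ((\<lambda>s. R (- s) (N (Z s))) ` {0..T})"
    by (intro compact_imp_bounded compact_continuous_image mild_integrand[OF Nc Z]) simp
  then obtain B where B: "0 < B" "\<And>s. s \<in> {0..T} \<Longrightarrow> norm (R (- s) (N (Z s))) \<le> B"
    by (auto simp: bounded_pos)
  define K where "K = (\<bar>C\<bar> + B) * exp (L * T)"
  have first: "norm (Z h - Z 0) \<le> (\<bar>C\<bar> + B) * h" if h: "h \<in> {0..T}" for h
  proof -
    have e: "R (- h) (Z h) = Z 0 + integral {0..h} (\<lambda>s. R (- s) (N (Z s)))"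
      using Z h by (auto simp: mild_def)
    have "norm (integral {0..h} (\<lambda>s. R (- s) (N (Z s)))) \<le> B * (h - 0)"
      using h B by (intro integral_bound continuous_on_subset[OF mild_integrand[OF Nc Z]]) auto
    moreover have "Z h - Z 0 = (R h (Z 0) - Z 0) + R h (integral {0..h} (\<lambda>s. R (- s) (N (Z s))))"
      using arg_cong[OF e, of "R h"] by (simp add: R_sum)
    moreover have "norm (\<dots>) \<le> norm (R h (Z 0) - Z 0) + norm (integral {0..h} (\<lambda>s. R (- s) (N (Z s))))"
      by (rule order_trans[OF norm_triangle_ineq]) simp
    moreover have "norm (R h (Z 0) - Z 0) \<le> \<bar>C\<bar> * h"
      using dom[of h] h by (smt (verit, best) mult_right_mono atLeastAtMost_iff)
    ultimately show ?thesis by (simp add: algebra_simps)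
  qed
  have *: "norm (Z t - Z s) \<le> K * \<bar>t - s\<bar>" if st: "s \<in> {0..T}" "t \<in> {0..T}" "s \<le> t" for s t
  proof -
    define h where "h = t - s"
    have h: "0 \<le> h" "h \<le> T" "t = s + h" "s \<in> {0..T - h}" using st by (auto simp: h_def)
    have "norm (Z (s + h) - Z s) \<le> norm (Z (0 + h) - Z 0) * exp (L * s)"
      by (rule mild_stability[OF N mild_shift[OF Nc Z h(1,2)] mild_subinterval[OF Z] L _ _ h(4)])
        (use h r in auto)
    also have "\<dots> \<le> (\<bar>C\<bar> + B) * h * exp (L * T)"
      using first[of h] h B L st by (intro mult_mono mult_nonneg_nonneg) (auto intro: mult_left_mono)
    finally show ?thesis using h by (simp add: K_def mult_ac)
  qed
  have "norm (Z t - Z s) \<le> K * \<bar>t - s\<bar>" if st: "s \<in> {0..T}" "t \<in> {0..T}" for s t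
    using *[of s t] *[of t s] st by (cases "s \<le> t") (auto simp: norm_minus_commute abs_minus_commute)
  moreover have "0 \<le> K" using B by (auto simp: K_def)
  ultimately show ?thesis using that by blast
qed

end

section \<open>Rotations and forced scalar oscillators\<close>

interpretation rot: isometry_group "rot \<omega>" for \<omega>
  by (rule isometry_group.intro) (auto simp: linear_rot rot_add continuous_on_rot)

lemma sin_cos_mult_self: "sin a * (sin a * x) + cos a * (cos a * x) = (x::real)"
proof -
  have "sin a * (sin a * x) + cos a * (cos a * x) = ((sin a)\<^sup>2 + (cos a)\<^sup>2) * x"
    by (simp only: power2_eq_square distrib_right mult.assoc)
  then show ?thesis by simp
qed

lemma norm_fst_le_norm: "norm (fst z) \<le> norm z" and norm_snd_le_norm: "norm (snd z) \<le> norm z"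
  using norm_fst_le[of "fst z" "snd z"] norm_snd_le[of "snd z" "fst z"] by simp_all

lemma bounded_linear_coord_fst: "bounded_linear (\<lambda>z. coord (fst z) k)"
  and bounded_linear_coord_snd: "bounded_linear (\<lambda>z. coord (snd z) k)"
  using bounded_linear_compose[OF bounded_linear_coord bounded_linear_fst]
    bounded_linear_compose[OF bounded_linear_coord bounded_linear_snd] by auto

lemma rot_mild_coords:
  fixes z :: "real \<Rightarrow> ell2 \<times> ell2" and n :: "real \<Rightarrow> ell2"
  assumes n: "continuous_on {0..T} n" and t: "t \<in> {0..T}"
  shows "coord (fst (integral {0..t} (\<lambda>s. rot \<omega> (- s) (0, n s)))) k = integral {0..t} (\<lambda>s. - (sin (\<omega> k * s) * coord (n s) k))"
    "coord (snd (integral {0..t} (\<lambda>s. rot \<omega> (- s) (0, n s)))) k = integral {0..t} (\<lambda>s. cos (\<omega> k * s) * coord (n s) k)"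
proof -
  have "continuous_on {0..t} (\<lambda>s. rot \<omega> (- s) (0, n s))"
    using t by (intro continuous_intros continuous_on_subset[OF n]) auto
  then have int: "(\<lambda>s. rot \<omega> (- s) (0, n s)) integrable_on {0..t}"
    by (rule integrable_continuous_real)
  show "coord (fst (integral {0..t} (\<lambda>s. rot \<omega> (- s) (0, n s)))) k = integral {0..t} (\<lambda>s. - (sin (\<omega> k * s) * coord (n s) k))"
    using integral_linear[OF int bounded_linear_coord_fst[of k]] by (simp add: o_def coord_rot)
  show "coord (snd (integral {0..t} (\<lambda>s. rot \<omega> (- s) (0, n s)))) k = integral {0..t} (\<lambda>s. cos (\<omega> k * s) * coord (n s) k)"
    using integral_linear[OF int bounded_linear_coord_snd[of k]] by (simp add: o_def coord_rot)
qed

lemma pair_eqI: "(\<And>k. coord (fst x) k = coord (fst y) k) \<Longrightarrow> (\<And>k. coord (snd x) k = coord (snd y) k) \<Longrightarrow> x = y"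
  by (auto intro!: prod_eqI ell2_eqI)

text \<open>Each coordinate of a mild solution is an explicit solution of a forced scalar oscillator
  and can be differentiated, although the solution itself need not be differentiable in norm when
  the frequencies are unbounded.\<close>

lemma coord_derivs_of_rot_mild:
  fixes z :: "real \<Rightarrow> ell2 \<times> ell2" and n :: "real \<Rightarrow> ell2"
  assumes n: "continuous_on {0..T} n"
    and z: "\<And>t. t \<in> {0..T} \<Longrightarrow> rot \<omega> (- t) (z t) = z 0 + integral {0..t} (\<lambda>s. rot \<omega> (- s) (0, n s))"
    and t: "t \<in> {0..T}"
  shows "((\<lambda>t. coord (fst (z t)) k) has_real_derivative \<omega> k * coord (snd (z t)) k) (at t within {0..T})"
    "((\<lambda>t. coord (snd (z t)) k) has_real_derivative - \<omega> k * coord (fst (z t)) k + coord (n t) k) (at t within {0..T})"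
proof -
  define a where "a t = coord (fst (z 0)) k + integral {0..t} (\<lambda>s. - (sin (\<omega> k * s) * coord (n s) k))" for t
  define b where "b t = coord (snd (z 0)) k + integral {0..t} (\<lambda>s. cos (\<omega> k * s) * coord (n s) k)" for t
  have ab: "coord (fst (z r)) k = cos (\<omega> k * r) * a r + sin (\<omega> k * r) * b r"
    "coord (snd (z r)) k = cos (\<omega> k * r) * b r - sin (\<omega> k * r) * a r" if r: "r \<in> {0..T}" for r
  proof -
    have "z r = rot \<omega> r (z 0 + integral {0..r} (\<lambda>s. rot \<omega> (- s) (0, n s)))"
      using z[OF r] by (metis rot.R_inv(2))
    then show "coord (fst (z r)) k = cos (\<omega> k * r) * a r + sin (\<omega> k * r) * b r"
      "coord (snd (z r)) k = cos (\<omega> k * r) * b r - sin (\<omega> k * r) * a r"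
      by (simp_all only: coord_rot fst_add snd_add coord_add rot_mild_coords[OF n r] a_def b_def)
  qed
  have da: "(a has_real_derivative - (sin (\<omega> k * t) * coord (n t) k)) (at t within {0..T})"
    "(b has_real_derivative cos (\<omega> k * t) * coord (n t) k) (at t within {0..T})"
    unfolding a_def b_def
    by (rule derivative_eq_intros integral_has_real_derivative[OF _ t] continuous_intros n refl | simp)+
  have "((\<lambda>t. cos (\<omega> k * t) * a t + sin (\<omega> k * t) * b t) has_real_derivative
      \<omega> k * (cos (\<omega> k * t) * b t - sin (\<omega> k * t) * a t)) (at t within {0..T})"
    by (rule derivative_eq_intros da refl)+ (simp add: algebra_simps)
  then show "((\<lambda>t. coord (fst (z t)) k) has_real_derivative \<omega> k * coord (snd (z t)) k) (at t within {0..T})"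
    using t by (auto simp: ab intro: has_field_derivative_transform_within[OF _ zero_less_one])
  have "((\<lambda>t. cos (\<omega> k * t) * b t - sin (\<omega> k * t) * a t) has_real_derivative
      - \<omega> k * (cos (\<omega> k * t) * a t + sin (\<omega> k * t) * b t) + coord (n t) k) (at t within {0..T})"
    by (rule derivative_eq_intros da refl)+ (use sin_cos_mult_self[of "\<omega> k * t" "coord (n t) k"] in \<open>simp add: algebra_simps\<close>)
  then show "((\<lambda>t. coord (snd (z t)) k) has_real_derivative - \<omega> k * coord (fst (z t)) k + coord (n t) k) (at t within {0..T})"
    using t by (auto simp: ab intro: has_field_derivative_transform_within[OF _ zero_less_one])
qed

text \<open>The integrating factors cos and sin turn the oscillator equations into exact
  derivatives. Derivatives in the open interval suffice, the end points being reached by continuity;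
  this fits weak solutions, whose equation is required for positive times only.\<close>

lemma rot_mild_of_coord_derivs:
  fixes z :: "real \<Rightarrow> ell2 \<times> ell2" and n :: "real \<Rightarrow> ell2"
  assumes n: "continuous_on {0..T} n" and zc: "continuous_on {0..T} z"
    and d: "\<And>k t. 0 < t \<Longrightarrow> t < T \<Longrightarrow> ((\<lambda>t. coord (fst (z t)) k) has_real_derivative \<omega> k * coord (snd (z t)) k) (at t)"
      "\<And>k t. 0 < t \<Longrightarrow> t < T \<Longrightarrow> ((\<lambda>t. coord (snd (z t)) k) has_real_derivative - \<omega> k * coord (fst (z t)) k + coord (n t) k) (at t)"
    and t: "t \<in> {0..T}"
  shows "rot \<omega> (- t) (z t) = z 0 + integral {0..t} (\<lambda>s. rot \<omega> (- s) (0, n s))"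
proof (rule pair_eqI)
  fix k
  have cc: "continuous_on {0..t} (\<lambda>t. coord (fst (z t)) k)" "continuous_on {0..t} (\<lambda>t. coord (snd (z t)) k)"
    using t by (auto intro!: continuous_intros continuous_on_subset[OF zc])
  have "((\<lambda>s. - (sin (\<omega> k * s) * coord (n s) k)) has_integral
     (cos (\<omega> k * t) * coord (fst (z t)) k - sin (\<omega> k * t) * coord (snd (z t)) k)
     - (cos (\<omega> k * 0) * coord (fst (z 0)) k - sin (\<omega> k * 0) * coord (snd (z 0)) k)) {0..t}"
  proof (rule fundamental_theorem_of_calculus_interior)
    show "0 \<le> t" using t by simp
    show "continuous_on {0..t} (\<lambda>t. cos (\<omega> k * t) * coord (fst (z t)) k - sin (\<omega> k * t) * coord (snd (z t)) k)"
      by (intro continuous_intros cc)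
    fix s assume s: "s \<in> {0<..<t}"
    then have st: "0 < s" "s < T" using t by auto
    show "((\<lambda>t. cos (\<omega> k * t) * coord (fst (z t)) k - sin (\<omega> k * t) * coord (snd (z t)) k) has_vector_derivative
        - (sin (\<omega> k * s) * coord (n s) k)) (at s)"
      unfolding has_real_derivative_iff_has_vector_derivative[symmetric]
      by (rule derivative_eq_intros d st refl)+ (simp add: algebra_simps)
  qed
  then show "coord (fst (rot \<omega> (- t) (z t))) k = coord (fst (z 0 + integral {0..t} (\<lambda>s. rot \<omega> (- s) (0, n s)))) k"
    by (simp only: fst_add coord_add rot_mild_coords[OF n t] integral_unique) (simp add: coord_rot)
  have "((\<lambda>s. cos (\<omega> k * s) * coord (n s) k) has_integral
     (sin (\<omega> k * t) * coord (fst (z t)) k + cos (\<omega> k * t) * coord (snd (z t)) k)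
     - (sin (\<omega> k * 0) * coord (fst (z 0)) k + cos (\<omega> k * 0) * coord (snd (z 0)) k)) {0..t}"
  proof (rule fundamental_theorem_of_calculus_interior)
    show "0 \<le> t" using t by simp
    show "continuous_on {0..t} (\<lambda>t. sin (\<omega> k * t) * coord (fst (z t)) k + cos (\<omega> k * t) * coord (snd (z t)) k)"
      by (intro continuous_intros cc)
    fix s assume s: "s \<in> {0<..<t}"
    then have st: "0 < s" "s < T" using t by auto
    show "((\<lambda>t. sin (\<omega> k * t) * coord (fst (z t)) k + cos (\<omega> k * t) * coord (snd (z t)) k) has_vector_derivative
        cos (\<omega> k * s) * coord (n s) k) (at s)"
      unfolding has_real_derivative_iff_has_vector_derivative[symmetric]
      by (rule derivative_eq_intros d st refl)+
        (use sin_cos_mult_self[of "\<omega> k * s" "coord (n s) k"] in \<open>simp add: algebra_simps\<close>)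
  qed
  then show "coord (snd (rot \<omega> (- t) (z t))) k = coord (snd (z 0 + integral {0..t} (\<lambda>s. rot \<omega> (- s) (0, n s)))) k"
    by (simp only: snd_add coord_add rot_mild_coords[OF n t] integral_unique) (simp add: coord_rot)
qed

text \<open>The counterpart of \<open>ell2_limit_bound\<close> for pairs. The partial sums of both
  components are bounded together, so that the constant is not enlarged.\<close>

lemma pair_limit_bound:
  fixes x :: "'a \<Rightarrow> ell2 \<times> ell2"
  assumes ne: "F \<noteq> bot"
    and lim: "\<And>k. ((\<lambda>n. coord (fst (x n)) k) \<longlongrightarrow> coord (fst y) k) F"
      "\<And>k. ((\<lambda>n. coord (snd (x n)) k) \<longlongrightarrow> coord (snd y) k) F"
    and bd: "\<forall>\<^sub>F n in F. norm (x n) \<le> C"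
  shows "norm y \<le> C"
proof -
  have C: "0 \<le> C"
    using eventually_happens'[OF ne bd] norm_ge_zero order_trans by blast
  have le: "(\<Sum>k<K. (coord (fst y) k)\<^sup>2 + (coord (snd y) k)\<^sup>2) \<le> C\<^sup>2" for K
  proof (rule tendsto_upperbound[OF _ _ ne])
    show "((\<lambda>n. \<Sum>k<K. (coord (fst (x n)) k)\<^sup>2 + (coord (snd (x n)) k)\<^sup>2)
        \<longlongrightarrow> (\<Sum>k<K. (coord (fst y) k)\<^sup>2 + (coord (snd y) k)\<^sup>2)) F"
      by (intro tendsto_intros lim)
    show "\<forall>\<^sub>F n in F. (\<Sum>k<K. (coord (fst (x n)) k)\<^sup>2 + (coord (snd (x n)) k)\<^sup>2) \<le> C\<^sup>2"
      using bd
    proof eventually_elim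
      case (elim n)
      have "(\<Sum>k<K. (coord (fst (x n)) k)\<^sup>2 + (coord (snd (x n)) k)\<^sup>2) \<le> (norm (fst (x n)))\<^sup>2 + (norm (snd (x n)))\<^sup>2"
        unfolding sum.distrib by (intro add_mono sum_coord_le_norm)
      also have "\<dots> = (norm (x n))\<^sup>2" by (simp add: norm_prod_def)
      also have "\<dots> \<le> C\<^sup>2" using elim by (intro power_mono) auto
      finally show ?case .
    qed
  qed
  have sm: "(\<lambda>k. (coord (fst y) k)\<^sup>2 + (coord (snd y) k)\<^sup>2) sums ((norm (fst y))\<^sup>2 + (norm (snd y))\<^sup>2)"
    by (intro sums_add sums_norm_ell2)
  have "(norm (fst y))\<^sup>2 + (norm (snd y))\<^sup>2 \<le> C\<^sup>2"
    unfolding sums_unique[OF sm] by (rule suminf_le_const[OF sums_summable[OF sm] le])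
  then have "(norm y)\<^sup>2 \<le> C\<^sup>2" by (simp add: norm_prod_def)
  then show ?thesis using C power2_le_imp_le by blast
qed

text \<open>
  A solution that is Lipschitz in time lies in the domain of the generator: its difference quotients
  are bounded and converge coordinatewise. Continuity of the derivative v is obtained by
  comparing difference quotients at two times in the rotating frame.
\<close>

lemma rot_mild_regular:
  fixes z :: "real \<Rightarrow> ell2 \<times> ell2" and n :: "real \<Rightarrow> ell2"
  assumes T: "0 < T" and n: "continuous_on {0..T} n" and zc: "continuous_on {0..T} z"
    and z: "\<And>t. t \<in> {0..T} \<Longrightarrow> rot \<omega> (- t) (z t) = z 0 + integral {0..t} (\<lambda>s. rot \<omega> (- s) (0, n s))"
    and M: "0 \<le> M" "\<And>s t. s \<in> {0..T} \<Longrightarrow> t \<in> {0..T} \<Longrightarrow> norm (n t - n s) \<le> M * \<bar>t - s\<bar>"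
    and K: "0 \<le> K" "\<And>s t. s \<in> {0..T} \<Longrightarrow> t \<in> {0..T} \<Longrightarrow> norm (z t - z s) \<le> K * \<bar>t - s\<bar>"
  obtains v where "continuous_on {0..T} v"
    "\<And>t k. t \<in> {0..T} \<Longrightarrow> coord (fst (v t)) k = \<omega> k * coord (snd (z t)) k"
    "\<And>t k. t \<in> {0..T} \<Longrightarrow> coord (snd (v t)) k = - \<omega> k * coord (fst (z t)) k + coord (n t) k"
proof -
  define d1 where "d1 t k = \<omega> k * coord (snd (z t)) k" for t k
  define d2 where "d2 t k = - \<omega> k * coord (fst (z t)) k + coord (n t) k" for t k
  note d = coord_derivs_of_rot_mild[OF n z, folded d1_def d2_def]
  have dq1: "((\<lambda>r. coord (fst ((1 / (r - t)) *\<^sub>R (z r - z t))) k) \<longlongrightarrow> d1 t k) (at t within {0..T})"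
    if "t \<in> {0..T}" for t k
    using d(1)[OF _ that, of k] by (simp add: has_field_derivative_iff)
  have dq2: "((\<lambda>r. coord (snd ((1 / (r - t)) *\<^sub>R (z r - z t))) k) \<longlongrightarrow> d2 t k) (at t within {0..T})"
    if "t \<in> {0..T}" for t k
    using d(2)[OF _ that, of k] by (simp add: has_field_derivative_iff)
  have bd: "\<forall>\<^sub>F r in at t within {0..T}. norm ((1 / (r - t)) *\<^sub>R (z r - z t)) \<le> K" if "t \<in> {0..T}" for t
    unfolding eventually_at_filter
  proof (rule always_eventually, intro allI impI)
    fix r assume "r \<noteq> t" "r \<in> {0..T}"
    then show "norm ((1 / (r - t)) *\<^sub>R (z r - z t)) \<le> K"
      unfolding norm_scaleR using K(2)[OF that, of r] by (simp add: field_simps)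
  qed
  have ne: "at t within {0..T} \<noteq> bot" if "t \<in> {0..T}" for t
    using that T by (simp add: trivial_limit_within islimpt_Icc)
  have s1: "summable (\<lambda>k. (d1 t k)\<^sup>2)" if t: "t \<in> {0..T}" for t
  proof (rule ell2_limit_bound(1)[OF ne[OF t] _ _ K(1)])
    show "((\<lambda>r. coord (fst ((1 / (r - t)) *\<^sub>R (z r - z t))) k) \<longlongrightarrow> d1 t k) (at t within {0..T})" for k
      by (rule dq1[OF t])
    show "\<forall>\<^sub>F r in at t within {0..T}. norm (fst ((1 / (r - t)) *\<^sub>R (z r - z t))) \<le> K"
      using bd[OF t] by eventually_elim (rule order_trans[OF norm_fst_le_norm])
  qed
  have s2: "summable (\<lambda>k. (d2 t k)\<^sup>2)" if t: "t \<in> {0..T}" for t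
  proof (rule ell2_limit_bound(1)[OF ne[OF t] _ _ K(1)])
    show "((\<lambda>r. coord (snd ((1 / (r - t)) *\<^sub>R (z r - z t))) k) \<longlongrightarrow> d2 t k) (at t within {0..T})" for k
      by (rule dq2[OF t])
    show "\<forall>\<^sub>F r in at t within {0..T}. norm (snd ((1 / (r - t)) *\<^sub>R (z r - z t))) \<le> K"
      using bd[OF t] by eventually_elim (rule order_trans[OF norm_snd_le_norm])
  qed
  define v where "v t = (Ell (d1 t), Ell (d2 t))" for t
  have cv: "coord (fst (v t)) k = d1 t k" "coord (snd (v t)) k = d2 t k" if "t \<in> {0..T}" for t k
    using s1[OF that] s2[OF that] by (simp_all add: v_def coord_Ell)
  define W where "W t = rot \<omega> (- t) (v t)" for t
  \<comment> \<open>Shifting time by h turns the difference into the integral of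
    \<open>rot \<omega> (- r) (0, n (r + h) - n r)\<close> over [s,t]; the Lipschitz bound on
    \<open>n\<close> supplies the factor h that is divided out afterwards.\<close>
  have step: "norm (rot \<omega> (- t) (z (t + h) - z t) - rot \<omega> (- s) (z (s + h) - z s)) \<le> M * h * (t - s)"
    if st: "0 \<le> s" "s \<le> t" "0 \<le> h" "t + h \<le> T" for s t h
  proof -
    define g where "g = (\<lambda>r. rot \<omega> (- r) (0, n r))"
    have gc: "continuous_on {0..T} g" unfolding g_def by (intro continuous_intros n)
    have int: "g integrable_on {a..b}" if "0 \<le> a" "b \<le> T" for a b
      using that by (intro integrable_continuous_real continuous_on_subset[OF gc]) auto
    have diff: "rot \<omega> (- b) (z b) - rot \<omega> (- a) (z a) = integral {a..b} g" if "0 \<le> a" "a \<le> b" "b \<le> T" for a b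
    proof -
      have "integral {0..a} g + integral {a..b} g = integral {0..b} g"
        using that by (intro Henstock_Kurzweil_Integration.integral_combine int) auto
      then show ?thesis using z[of a] z[of b] that by (simp add: g_def algebra_simps)
    qed
    have shift: "rot \<omega> (- t) (z (t + h)) - rot \<omega> (- s) (z (s + h)) = integral {s..t} (\<lambda>r. rot \<omega> h (g (r + h)))"
    proof -
      have "integral {s + h..t + h} g = integral {s..t} (\<lambda>r. g (r + h))"
        using has_integral_affinity'[OF integrable_integral[OF int[of "s+h" "t+h", folded cbox_interval]], of 1 h] st
        by (simp add: integral_unique)
      moreover have "(\<lambda>r. g (r + h)) integrable_on {s..t}"
        by (intro integrable_continuous_real continuous_on_compose2[OF gc] continuous_intros) (use st in auto)
      ultimately have "integral {s..t} (\<lambda>r. rot \<omega> h (g (r + h))) = rot \<omega> h (integral {s + h..t + h} g)"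
        using integral_linear[OF _ rot.bounded_linear_R, of "\<lambda>r. g (r + h)" "{s..t}" \<omega> h] by (simp add: o_def)
      also have "\<dots> = rot \<omega> h (rot \<omega> (- (t + h)) (z (t + h)) - rot \<omega> (- (s + h)) (z (s + h)))"
        using diff[of "s + h" "t + h"] st by simp
      also have "\<dots> = rot \<omega> (- t) (z (t + h)) - rot \<omega> (- s) (z (s + h))"
        by (simp add: rot.R_diff flip: rot.R_add)
      finally show ?thesis by simp
    qed
    have "rot \<omega> (- t) (z (t + h) - z t) - rot \<omega> (- s) (z (s + h) - z s)
        = integral {s..t} (\<lambda>r. rot \<omega> h (g (r + h))) - integral {s..t} g"
      using shift diff[of s t] st by (simp add: rot.R_diff algebra_simps)
    also have "\<dots> = integral {s..t} (\<lambda>r. rot \<omega> h (g (r + h)) - g r)"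
      using st by (intro integral_diff[symmetric] int integrable_continuous_real continuous_intros
          continuous_on_compose2[OF gc]) auto
    also have "norm \<dots> \<le> M * h * (t - s)"
    proof (rule integral_bound)
      show "s \<le> t" by fact
      show "continuous_on {s..t} (\<lambda>r. rot \<omega> h (g (r + h)) - g r)"
        using st by (intro continuous_intros continuous_on_compose2[OF gc] continuous_on_subset[OF gc]) auto
      fix r assume r: "r \<in> {s..t}"
      have "rot \<omega> h (g (r + h)) - g r = rot \<omega> (- r) (0, n (r + h) - n r)"
        by (simp add: g_def flip: rot.R_add) (simp flip: rot.R_diff)
      then have "norm (rot \<omega> h (g (r + h)) - g r) = norm (n (r + h) - n r)"
        by simp
      also have "\<dots> \<le> M * h" using M(2)[of r "r + h"] r st by auto
      finally show "norm (rot \<omega> h (g (r + h)) - g r) \<le> M * h" .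
    qed
    finally show ?thesis .
  qed
  have right: "((\<lambda>h. coord (fst ((1 / h) *\<^sub>R (z (t + h) - z t))) k) \<longlongrightarrow> d1 t k) (at_right 0)"
    "((\<lambda>h. coord (snd ((1 / h) *\<^sub>R (z (t + h) - z t))) k) \<longlongrightarrow> d2 t k) (at_right 0)"
    if t: "0 \<le> t" "t < T" for t k
  proof -
    have f: "filterlim (\<lambda>h. t + h) (at t within {0..T}) (at_right 0)"
      unfolding filterlim_at
    proof
      have "\<forall>\<^sub>F h in at_right 0. h < T - t" "\<forall>\<^sub>F h in at_right (0::real). 0 < h"
        using t by (auto simp: eventually_at_right_less intro: eventually_at_rightI[of 0 "T - t"])
      then show "\<forall>\<^sub>F h in at_right 0. t + h \<in> {0..T} \<and> t + h \<noteq> t"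
        by eventually_elim (use t in auto)
      have "((\<lambda>h. t + h) \<longlongrightarrow> t + 0) (at_right 0)" by (intro tendsto_intros)
      then show "((\<lambda>h. t + h) \<longlongrightarrow> t) (at_right 0)" by simp
    qed
    show "((\<lambda>h. coord (fst ((1 / h) *\<^sub>R (z (t + h) - z t))) k) \<longlongrightarrow> d1 t k) (at_right 0)"
      using filterlim_compose[OF dq1 f, of k] t by simp
    show "((\<lambda>h. coord (snd ((1 / h) *\<^sub>R (z (t + h) - z t))) k) \<longlongrightarrow> d2 t k) (at_right 0)"
      using filterlim_compose[OF dq2 f, of k] t by simp
  qed
  have lip0: "norm (W t - W s) \<le> M * (t - s)" if st: "0 \<le> s" "s \<le> t" "t < T" for s t
  proof (rule pair_limit_bound[of "at_right (0::real)"])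
    let ?q = "\<lambda>t h. (1 / h) *\<^sub>R (z (t + h) - z t)"
    let ?x = "\<lambda>h. rot \<omega> (- t) (?q t h) - rot \<omega> (- s) (?q s h)"
    show "at_right (0::real) \<noteq> bot" by simp
    have T': "s \<in> {0..T}" "t \<in> {0..T}" using st by auto
    show "((\<lambda>h. coord (fst (?x h)) k) \<longlongrightarrow> coord (fst (W t - W s)) k) (at_right 0)"
      "((\<lambda>h. coord (snd (?x h)) k) \<longlongrightarrow> coord (snd (W t - W s)) k) (at_right 0)" for k
      unfolding fst_diff snd_diff coord_diff coord_rot W_def cv[OF T'(1)] cv[OF T'(2)]
      by (intro tendsto_intros right; use st in simp)+
    show "\<forall>\<^sub>F h in at_right 0. norm (?x h) \<le> M * (t - s)"
    proof (rule eventually_at_rightI[of 0 "T - t"])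
      show "0 < T - t" using st by simp
      fix h assume h: "h \<in> {0<..<T - t}"
      have "norm (?x h) = 1 / h * norm (rot \<omega> (- t) (z (t + h) - z t) - rot \<omega> (- s) (z (s + h) - z s))"
        using h unfolding rot.R_scale scaleR_diff_right[symmetric] norm_scaleR by simp
      also have "\<dots> \<le> 1 / h * (M * h * (t - s))"
        using h st by (intro mult_left_mono step) auto
      finally show "norm (?x h) \<le> M * (t - s)" using h by simp
    qed
  qed
  have lipT: "norm (W T - W s) \<le> M * (T - s)" if s: "0 \<le> s" "s < T" for s
  proof (rule pair_limit_bound[of "at T within {0..T}"])
    show "at T within {0..T} \<noteq> bot" using T by (intro ne) simp
    have T': "s \<in> {0..T}" "T \<in> {0..T}" using s by auto
    have c: "((\<lambda>t. d1 t k) \<longlongrightarrow> d1 T k) (at T within {0..T})" "((\<lambda>t. d2 t k) \<longlongrightarrow> d2 T k) (at T within {0..T})" for k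
    proof -
      have "continuous_on {0..T} (\<lambda>t. d1 t k)" "continuous_on {0..T} (\<lambda>t. d2 t k)"
        unfolding d1_def d2_def by (intro continuous_intros zc n)+
      then show "((\<lambda>t. d1 t k) \<longlongrightarrow> d1 T k) (at T within {0..T})" "((\<lambda>t. d2 t k) \<longlongrightarrow> d2 T k) (at T within {0..T})"
        using T by (auto simp: continuous_on_def)
    qed
    have ev: "\<forall>\<^sub>F t in at T within {0..T}. t \<in> {0..T} \<and> t \<noteq> T"
      by (simp add: eventually_at_filter)
    have ev2: "\<forall>\<^sub>F t in at T within {0..T}. s < t"
      using s by (intro order_tendstoD(1)[OF tendsto_ident_at])
    show "((\<lambda>t. coord (fst (W t - W s)) k) \<longlongrightarrow> coord (fst (W T - W s)) k) (at T within {0..T})" for k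
    proof (rule Lim_transform_eventually)
      show "((\<lambda>t. cos (\<omega> k * - t) * d1 t k + sin (\<omega> k * - t) * d2 t k - coord (fst (W s)) k)
          \<longlongrightarrow> coord (fst (W T - W s)) k) (at T within {0..T})"
        unfolding fst_diff coord_diff W_def[of T] coord_rot cv[OF T'(2)]
        by (intro tendsto_intros c)
      show "\<forall>\<^sub>F t in at T within {0..T}. cos (\<omega> k * - t) * d1 t k + sin (\<omega> k * - t) * d2 t k - coord (fst (W s)) k
          = coord (fst (W t - W s)) k"
        using ev by eventually_elim (simp add: W_def coord_rot cv)
    qed
    show "((\<lambda>t. coord (snd (W t - W s)) k) \<longlongrightarrow> coord (snd (W T - W s)) k) (at T within {0..T})" for k
    proof (rule Lim_transform_eventually)
      show "((\<lambda>t. cos (\<omega> k * - t) * d2 t k - sin (\<omega> k * - t) * d1 t k - coord (snd (W s)) k)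
          \<longlongrightarrow> coord (snd (W T - W s)) k) (at T within {0..T})"
        unfolding snd_diff coord_diff W_def[of T] coord_rot cv[OF T'(2)]
        by (intro tendsto_intros c)
      show "\<forall>\<^sub>F t in at T within {0..T}. cos (\<omega> k * - t) * d2 t k - sin (\<omega> k * - t) * d1 t k - coord (snd (W s)) k
          = coord (snd (W t - W s)) k"
        using ev by eventually_elim (simp add: W_def coord_rot cv)
    qed
    show "\<forall>\<^sub>F t in at T within {0..T}. norm (W t - W s) \<le> M * (T - s)"
      using ev ev2
    proof eventually_elim
      case (elim t)
      have "norm (W t - W s) \<le> M * (t - s)" using elim s by (intro lip0) auto
      also have "\<dots> \<le> M * (T - s)" using elim M by (intro mult_left_mono) auto
      finally show ?case .
    qed
  qed
  have lip1: "norm (W t - W s) \<le> M * \<bar>t - s\<bar>" if "s \<in> {0..T}" "t \<in> {0..T}" "s \<le> t" for s t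
    using lip0[of s t] lipT[of s] that by (cases "t = T"; cases "s = t") auto
  have lip: "norm (W t - W s) \<le> M * \<bar>t - s\<bar>" if "s \<in> {0..T}" "t \<in> {0..T}" for s t
    using lip1[of s t] lip1[of t s] that by (cases "s \<le> t") (auto simp: norm_minus_commute abs_minus_commute)
  have "M-lipschitz_on {0..T} W"
    using M(1) lip by (intro lipschitz_onI) (auto simp: dist_norm norm_minus_commute abs_minus_commute)
  then have "continuous_on {0..T} W" by (rule lipschitz_on_continuous_on)
  then have "continuous_on {0..T} (\<lambda>t. rot \<omega> t (W t))" by (intro continuous_intros)
  then have "continuous_on {0..T} v" by (simp add: W_def)
  then show ?thesis using that cv by (auto simp: d1_def d2_def)
qed

section \<open>Smooth functions and cutoffs\<close>

text \<open>Peeling off the innermost derivative lets closure under sums, products and inverses go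
  by induction on the order; \<open>smooth_iff\<close> translates the result into the iterated form
  used in \<open>test_fun\<close>.\<close>

primrec diffn :: "nat \<Rightarrow> (real \<Rightarrow> real) \<Rightarrow> bool" where
  "diffn 0 f \<longleftrightarrow> True"
| "diffn (Suc n) f \<longleftrightarrow> f differentiable_on UNIV \<and> diffn n (deriv f)"

definition smooth :: "(real \<Rightarrow> real) \<Rightarrow> bool" where "smooth f \<longleftrightarrow> (\<forall>n. diffn n f)"

lemma diffn_iff: "diffn n f \<longleftrightarrow> (\<forall>j<n. (deriv ^^ j) f differentiable_on UNIV)"
proof (induction n arbitrary: f)
  case (Suc n)
  have "(\<forall>j<Suc n. (deriv ^^ j) f differentiable_on UNIV) \<longleftrightarrow>
      f differentiable_on UNIV \<and> (\<forall>j<n. (deriv ^^ Suc j) f differentiable_on UNIV)"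
    by (simp only: All_less_Suc2) simp
  also have "\<dots> \<longleftrightarrow> f differentiable_on UNIV \<and> (\<forall>j<n. (deriv ^^ j) (deriv f) differentiable_on UNIV)"
    by (simp only: funpow_Suc_right o_apply)
  finally show ?case by (simp add: Suc)
qed simp

lemma smooth_iff: "smooth f \<longleftrightarrow> (\<forall>n. (deriv ^^ n) f differentiable_on UNIV)"
  unfolding smooth_def diffn_iff by blast

lemma differentiable_on_UNIV_iff: "f differentiable_on UNIV \<longleftrightarrow> (\<forall>x. (f has_real_derivative deriv f x) (at x))"
  for f :: "real \<Rightarrow> real"
  by (simp add: differentiable_on_def DERIV_deriv_iff_real_differentiable)

lemma diffn_SucI:
  assumes "\<And>x. (f has_real_derivative f' x) (at x)" "diffn n f'"
  shows "diffn (Suc n) f"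
proof -
  have "deriv f = f'" using assms(1) by (auto intro: DERIV_imp_deriv)
  then show ?thesis using assms by (simp add: differentiable_on_UNIV_iff)
qed

lemma diffn_SucD:
  assumes "diffn (Suc n) f"
  shows "(f has_real_derivative deriv f x) (at x)" "diffn n (deriv f)"
  using assms by (auto simp: differentiable_on_UNIV_iff)

lemma diffn_Suc_imp: "diffn (Suc n) f \<Longrightarrow> diffn n f"
  by (simp add: diffn_iff del: diffn.simps)

lemma diffn_const: "diffn n (\<lambda>_. c)"
  by (induction n arbitrary: c) (auto intro!: diffn_SucI[where f'="\<lambda>_. 0"] derivative_eq_intros simp del: diffn.simps(2))

lemma diffn_add: "diffn n f \<Longrightarrow> diffn n g \<Longrightarrow> diffn n (\<lambda>x. f x + g x)"
proof (induction n arbitrary: f g)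
  case (Suc n)
  show ?case
    by (rule diffn_SucI[where f'="\<lambda>x. deriv f x + deriv g x"])
      (auto intro!: derivative_intros diffn_SucD Suc.IH Suc.prems)
qed simp

lemma diffn_mult: "diffn n f \<Longrightarrow> diffn n g \<Longrightarrow> diffn n (\<lambda>x. f x * g x)"
proof (induction n arbitrary: f g)
  case (Suc n)
  note d = diffn_SucD[OF Suc.prems(1)] diffn_SucD[OF Suc.prems(2)]
  show ?case
  proof (rule diffn_SucI[where f'="\<lambda>x. deriv f x * g x + f x * deriv g x"])
    show "((\<lambda>x. f x * g x) has_real_derivative deriv f x * g x + f x * deriv g x) (at x)" for x
      by (rule derivative_eq_intros d refl)+ (simp add: algebra_simps)
    show "diffn n (\<lambda>x. deriv f x * g x + f x * deriv g x)"
      by (intro diffn_add Suc.IH d diffn_Suc_imp[OF Suc.prems(1)] diffn_Suc_imp[OF Suc.prems(2)])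
  qed
qed simp

lemma diffn_affine: "diffn n f \<Longrightarrow> diffn n (\<lambda>x. f (a * x + b))"
proof (induction n arbitrary: f)
  case (Suc n)
  note d = diffn_SucD[OF Suc.prems]
  show ?case
  proof (rule diffn_SucI[where f'="\<lambda>x. a * deriv f (a * x + b)"])
    have "((\<lambda>x. f (a * x + b)) has_real_derivative deriv f (a * x + b) * a) (at x)" for x
      by (rule DERIV_chain2[OF d(1)]) (auto intro!: derivative_eq_intros)
    then show "((\<lambda>x. f (a * x + b)) has_real_derivative a * deriv f (a * x + b)) (at x)" for x
      by (simp only: mult.commute[of a "deriv f (a * x + b)"])
    show "diffn n (\<lambda>x. a * deriv f (a * x + b))"
      by (intro diffn_mult diffn_const Suc.IH d)
  qed
qed simp

lemma diffn_inverse: "diffn n g \<Longrightarrow> (\<And>x. g x \<noteq> 0) \<Longrightarrow> diffn n (\<lambda>x. inverse (g x))"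
proof (induction n)
  case (Suc n)
  note d = diffn_SucD[OF Suc.prems(1)]
  have i: "diffn n (\<lambda>x. inverse (g x))" by (intro Suc.IH Suc.prems diffn_Suc_imp)
  show ?case
  proof (rule diffn_SucI[where f'="\<lambda>x. (-1) * (deriv g x * (inverse (g x) * inverse (g x)))"])
    show "((\<lambda>x. inverse (g x)) has_real_derivative (-1) * (deriv g x * (inverse (g x) * inverse (g x)))) (at x)" for x
      by (rule derivative_eq_intros d Suc.prems refl)+ (simp add: algebra_simps)
    show "diffn n (\<lambda>x. (-1) * (deriv g x * (inverse (g x) * inverse (g x))))"
      by (intro diffn_mult diffn_const i d)
  qed
qed simp

text \<open>The derivative is again a sine, with its phase shifted by a quarter period, so an
  induction for arbitrary b closes without a parallel statement for the cosine.\<close>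

lemma diffn_sin: "diffn n (\<lambda>x. sin (a * x + b))"
proof (induction n arbitrary: b)
  case (Suc n)
  show ?case
  proof (rule diffn_SucI[where f'="\<lambda>x. a * sin (a * x + (b + pi / 2))"])
    show "((\<lambda>x. sin (a * x + b)) has_real_derivative a * sin (a * x + (b + pi / 2))) (at x)" for x
    proof -
      have "sin (a * x + (b + pi / 2)) = cos (a * x + b)"
        by (simp add: sin_add flip: add.assoc)
      then show ?thesis by (auto intro!: derivative_eq_intros)
    qed
    show "diffn n (\<lambda>x. a * sin (a * x + (b + pi / 2)))" by (intro diffn_mult diffn_const Suc)
  qed
qed simp

lemma smooth_const [simp]: "smooth (\<lambda>_. c)" and smooth_add: "smooth f \<Longrightarrow> smooth g \<Longrightarrow> smooth (\<lambda>x. f x + g x)"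
  and smooth_mult: "smooth f \<Longrightarrow> smooth g \<Longrightarrow> smooth (\<lambda>x. f x * g x)"
  and smooth_affine: "smooth f \<Longrightarrow> smooth (\<lambda>x. f (a * x + b))"
  and smooth_inverse: "smooth f \<Longrightarrow> (\<And>x. f x \<noteq> 0) \<Longrightarrow> smooth (\<lambda>x. inverse (f x))"
  and smooth_sin: "smooth (\<lambda>x. sin (a * x + b))"
  by (auto simp: smooth_def diffn_const diffn_add diffn_mult diffn_affine diffn_inverse diffn_sin)

lemma smooth_sum: "(\<And>i. i \<in> A \<Longrightarrow> smooth (f i)) \<Longrightarrow> smooth (\<lambda>x. \<Sum>i\<in>A. f i x)"
  by (induction A rule: infinite_finite_induct) (auto intro: smooth_add)

lemma smoothD: "smooth f \<Longrightarrow> (f has_real_derivative deriv f x) (at x)" "smooth f \<Longrightarrow> smooth (deriv f)"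
  unfolding smooth_def using diffn_SucD by blast+

lemma smooth_continuous: "smooth f \<Longrightarrow> continuous_on S f"
  using smoothD(1) DERIV_isCont by (blast intro: continuous_at_imp_continuous_on)

lemma deriv_eqI: "(\<And>x. (f has_real_derivative f' x) (at x)) \<Longrightarrow> deriv f = f'"
  by (auto intro: DERIV_imp_deriv)

text \<open>The functions x^(-m) exp(-1/x), extended by zero to the left. Derivatives of members of
  this family are linear combinations of members, so smoothness is an induction for all m at
  once.\<close>

definition exp_inv :: "nat \<Rightarrow> real \<Rightarrow> real" where
  "exp_inv m x = (if x \<le> 0 then 0 else inverse x ^ m * exp (- inverse x))"

lemma exp_inv_tendsto_0: "(exp_inv m \<longlongrightarrow> 0) (at 0)"
proof -
  have "((\<lambda>y. y ^ m / exp y) \<longlongrightarrow> (0::real)) at_top" by (rule tendsto_power_div_exp_0)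
  from filterlim_compose[OF this filterlim_inverse_at_top_right]
  have l: "((\<lambda>x::real. inverse x ^ m / exp (inverse x)) \<longlongrightarrow> 0) (at_right 0)" .
  have "\<forall>\<^sub>F x in at_right 0. inverse x ^ m / exp (inverse x) = exp_inv m x"
    by (auto simp: exp_inv_def exp_minus divide_inverse intro!: eventually_at_rightI[of 0 1])
  with l have r: "(exp_inv m \<longlongrightarrow> 0) (at_right 0)" by (rule Lim_transform_eventually)
  have ev: "\<forall>\<^sub>F x in at_left 0. 0 = exp_inv m x"
    by (auto simp: exp_inv_def intro!: eventually_at_leftI[of "-1" 0])
  have "(exp_inv m \<longlongrightarrow> 0) (at_left 0)" by (rule Lim_transform_eventually[OF tendsto_const ev])
  with r show ?thesis by (simp add: filterlim_split_at)
qed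

lemma exp_inv_deriv:
  "(exp_inv m has_real_derivative exp_inv (m + 2) x + (- real m) * exp_inv (m + 1) x) (at x)"
proof -
  consider "x < 0" | "x = 0" | "x > 0" by linarith
  then show ?thesis
  proof cases
    case 1
    have "((\<lambda>_. 0) has_real_derivative 0) (at x)" by simp
    then have "(exp_inv m has_real_derivative 0) (at x)"
      by (rule has_field_derivative_transform_within_open[where S="{..<0}"]) (use 1 in \<open>auto simp: exp_inv_def\<close>)
    then show ?thesis using 1 by (simp add: exp_inv_def)
  next
    case 2
    \<comment> \<open>At 0 the difference quotient of \<open>exp_inv m\<close> is
      \<open>exp_inv (m + 1)\<close>, which tends to zero.\<close>
    have "((\<lambda>h. (exp_inv m (0 + h) - exp_inv m 0) / h) \<longlongrightarrow> 0) (at 0)"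
    proof (rule Lim_transform_eventually[OF exp_inv_tendsto_0[of "m + 1"]])
      show "\<forall>\<^sub>F h in at 0. exp_inv (m + 1) h = (exp_inv m (0 + h) - exp_inv m 0) / h"
        unfolding eventually_at_filter by (auto simp: exp_inv_def divide_inverse)
    qed
    then have "(exp_inv m has_real_derivative 0) (at 0)" by (simp only: DERIV_def)
    moreover have "exp_inv j 0 = 0" for j by (simp add: exp_inv_def)
    ultimately show ?thesis using 2 by simp
  next
    case 3
    have "((\<lambda>x. inverse x ^ m * exp (- inverse x)) has_real_derivative
        exp_inv (m + 2) x + (- real m) * exp_inv (m + 1) x) (at x)"
    proof -
      have "(inverse has_real_derivative - ((inverse x)\<^sup>2)) (at x)"
        using DERIV_inverse[of x UNIV] 3 by (simp add: power2_eq_square)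
      note d = DERIV_mult[OF DERIV_power[OF this, of m] DERIV_chain2[OF DERIV_exp DERIV_minus[OF this]]]
      show ?thesis
        by (rule DERIV_cong[OF d])
          (use 3 in \<open>cases m; simp add: exp_inv_def power2_eq_square algebra_simps\<close>)
    qed
    then show ?thesis
      by (rule has_field_derivative_transform_within_open[where S="{0<..}"]) (use 3 in \<open>auto simp: exp_inv_def\<close>)
  qed
qed

lemma smooth_exp_inv: "smooth (exp_inv m)"
proof -
  have "diffn n (exp_inv m)" for n
  proof (induction n arbitrary: m)
    case (Suc n)
    show ?case
    proof (rule diffn_SucI[where f'="\<lambda>x. exp_inv (m + 2) x + (- real m) * exp_inv (m + 1) x"])
      show "(exp_inv m has_real_derivative exp_inv (m + 2) x + (- real m) * exp_inv (m + 1) x) (at x)" for x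
        by (rule exp_inv_deriv)
      show "diffn n (\<lambda>x. exp_inv (m + 2) x + (- real m) * exp_inv (m + 1) x)"
        by (rule diffn_add[OF Suc diffn_mult[OF diffn_const Suc]])
    qed
  qed simp
  then show ?thesis by (simp add: smooth_def)
qed

text \<open>The usual transition from 0 to 1 on the unit interval, e(x) / (e(x) + e(1 - x)) with e =
  \<open>exp_inv 0\<close>. The argument is written \<open>- 1 * x + 1\<close> to fit
  \<open>smooth_affine\<close>.\<close>

definition smooth_step :: "real \<Rightarrow> real" where
  "smooth_step x = exp_inv 0 x * inverse (exp_inv 0 x + exp_inv 0 (- 1 * x + 1))"

lemma smooth_step_denom: "exp_inv 0 x + exp_inv 0 (- 1 * x + 1) > 0"
  by (auto simp: exp_inv_def add_pos_pos)

lemma smooth_smooth_step: "smooth smooth_step"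
  unfolding smooth_step_def
  by (intro smooth_mult smooth_inverse smooth_add smooth_exp_inv smooth_affine)
    (metis smooth_step_denom less_irrefl)

lemma smooth_step_0: "x \<le> 0 \<Longrightarrow> smooth_step x = 0"
  by (simp add: smooth_step_def exp_inv_def)

lemma smooth_step_1: "1 \<le> x \<Longrightarrow> smooth_step x = 1"
  by (simp add: smooth_step_def exp_inv_def)

lemma smooth_step_range: "0 \<le> smooth_step x" "smooth_step x \<le> 1"
proof -
  have p: "0 \<le> exp_inv 0 x" "0 \<le> exp_inv 0 (- 1 * x + 1)" by (simp_all add: exp_inv_def)
  show "0 \<le> smooth_step x" "smooth_step x \<le> 1"
    unfolding smooth_step_def using p smooth_step_denom[of x]
    by (auto simp: divide_inverse[symmetric] divide_le_eq_1)
qed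

lemma smooth_step_deriv_bounded: obtains C where "0 \<le> C" "\<And>x. \<bar>deriv smooth_step x\<bar> \<le> C"
proof -
  have "bounded (deriv smooth_step ` {0..1})"
    by (intro compact_imp_bounded compact_continuous_image smooth_continuous smoothD smooth_smooth_step) simp
  then obtain C where C: "0 < C" "\<And>x. x \<in> {0..1} \<Longrightarrow> \<bar>deriv smooth_step x\<bar> \<le> C"
    by (auto simp: bounded_pos)
  have "deriv smooth_step x = 0" if "x < 0" for x
  proof (rule DERIV_imp_deriv, rule has_field_derivative_transform_within_open[where S="{..<0}"])
    show "((\<lambda>_. 0) has_real_derivative 0) (at x)" by simp
  qed (use that in \<open>auto simp: smooth_step_0\<close>)
  moreover have "deriv smooth_step x = 0" if "1 < x" for x
  proof (rule DERIV_imp_deriv, rule has_field_derivative_transform_within_open[where S="{1<..}"])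
    show "((\<lambda>_. 1) has_real_derivative 0) (at x)" by simp
  qed (use that in \<open>auto simp: smooth_step_1\<close>)
  ultimately have "\<bar>deriv smooth_step x\<bar> \<le> C" for x
    using C by (cases "x < 0"; cases "1 < x") auto
  then show ?thesis using that C(1) less_imp_le by blast
qed

section \<open>Test functions on the interval\<close>

lemma test_funI:
  assumes "smooth \<phi>" "0 < a" "b < pi" "\<And>x. x \<notin> {a..b} \<Longrightarrow> \<phi> x = 0"
  shows "\<phi> \<in> test_fun"
  unfolding test_fun_def I_set_def using assms
  by (auto simp: smooth_iff[symmetric] intro!: exI[of _ "{a..b}"])

lemma test_fun_smooth: "\<phi> \<in> test_fun \<Longrightarrow> smooth \<phi>"
  by (simp add: test_fun_def smooth_iff)

lemma test_fun_deriv: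
  assumes "\<phi> \<in> test_fun"
  shows "deriv \<phi> \<in> test_fun"
proof -
  obtain K where K: "compact K" "K \<subseteq> I_set" "\<And>x. x \<notin> K \<Longrightarrow> \<phi> x = 0"
    using assms by (auto simp: test_fun_def)
  have "deriv \<phi> x = 0" if "x \<notin> K" for x
  proof (rule DERIV_imp_deriv, rule has_field_derivative_transform_within_open[where S="- K"])
    show "((\<lambda>_. 0) has_real_derivative 0) (at x)" by simp
  qed (use that K in \<open>auto simp: compact_imp_closed open_Compl\<close>)
  moreover have "smooth (deriv \<phi>)" using assms test_fun_smooth smoothD by blast
  ultimately show ?thesis using K unfolding test_fun_def by (auto simp: smooth_iff)
qed

lemma test_fun_funpow_deriv: "\<phi> \<in> test_fun \<Longrightarrow> (deriv ^^ n) \<phi> \<in> test_fun"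
  by (induction n) (auto intro: test_fun_deriv)

lemma test_fun_zero_ends:
  assumes "\<phi> \<in> test_fun"
  shows "\<phi> 0 = 0" "\<phi> pi = 0"
proof -
  obtain K where K: "K \<subseteq> I_set" "\<And>x. x \<notin> K \<Longrightarrow> \<phi> x = 0"
    using assms by (auto simp: test_fun_def)
  have "0 \<notin> K" "pi \<notin> K" using K(1) by (auto simp: I_set_def)
  then show "\<phi> 0 = 0" "\<phi> pi = 0" using K(2) by auto
qed

section \<open>The space L2\<close>

interpretation I_leb: finite_measure I_leb
  by (rule finite_measureI) (simp add: I_set_def emeasure_restrict_space space_restrict_space)

lemma L2_measurable [measurable_dest]: "u \<in> L2 \<Longrightarrow> u \<in> borel_measurable I_leb" by (simp add: L2_def)

lemma L2_square: "u \<in> L2 \<Longrightarrow> integrable I_leb (\<lambda>x. (u x)\<^sup>2)" by (simp add: L2_def)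

lemma L2_mult_integrable:
  assumes u: "u \<in> L2" and v: "v \<in> L2"
  shows "integrable I_leb (\<lambda>x. u x * v x)"
proof (rule Bochner_Integration.integrable_bound)
  show "integrable I_leb (\<lambda>x. (u x)\<^sup>2 + (v x)\<^sup>2)" using u v by (intro Bochner_Integration.integrable_add L2_square)
  show "(\<lambda>x. u x * v x) \<in> borel_measurable I_leb" using u v by measurable
  have "norm (a * b) \<le> norm (a\<^sup>2 + b\<^sup>2)" for a b :: real
  proof -
    have "0 \<le> (\<bar>a\<bar> - \<bar>b\<bar>)\<^sup>2" by simp
    then have "2 * (\<bar>a\<bar> * \<bar>b\<bar>) \<le> a\<^sup>2 + b\<^sup>2" by (simp add: power2_diff)
    moreover have "0 \<le> \<bar>a\<bar> * \<bar>b\<bar>" by simp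
    ultimately show ?thesis by (simp only: real_norm_def abs_mult)
  qed
  then show "AE x in I_leb. norm (u x * v x) \<le> norm ((u x)\<^sup>2 + (v x)\<^sup>2)" by simp
qed

lemma L2_bounded:
  assumes "u \<in> borel_measurable I_leb" "\<And>x. x \<in> I_set \<Longrightarrow> \<bar>u x\<bar> \<le> B"
  shows "u \<in> L2"
proof -
  have "integrable I_leb (\<lambda>x. (u x)\<^sup>2)"
  proof (rule I_leb.integrable_const_bound[where B="B\<^sup>2"])
    show "AE x in I_leb. norm ((u x)\<^sup>2) \<le> B\<^sup>2"
      using assms(2) by (intro AE_I2) (simp add: abs_le_square_iff[symmetric] order_trans[OF _ abs_ge_self])
  qed (use assms(1) in measurable)
  then show ?thesis using assms(1) by (simp add: L2_def)
qed

lemma L2_const [simp]: "(\<lambda>_. c) \<in> L2"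
  by (rule L2_bounded[where B="\<bar>c\<bar>"]) auto

lemma L2_integrable: "u \<in> L2 \<Longrightarrow> integrable I_leb u"
  using L2_mult_integrable[OF _ L2_const[of 1]] by simp

lemma L2_continuous:
  assumes "continuous_on {0..pi} u"
  shows "u \<in> L2"
proof -
  have "bounded (u ` {0..pi})" by (intro compact_imp_bounded compact_continuous_image assms) simp
  then obtain B where "\<forall>y\<in>u ` {0..pi}. norm y \<le> B" unfolding bounded_iff by blast
  then have B: "\<bar>u x\<bar> \<le> B" if "x \<in> {0..pi}" for x using that by simp
  have "continuous_on I_set u" by (rule continuous_on_subset[OF assms]) (auto simp: I_set_def)
  then have "u \<in> borel_measurable I_leb"
    by (rule continuous_imp_measurable_on_sets_lebesgue) (simp add: I_set_def)
  then show ?thesis using B by (intro L2_bounded[where B=B]) (auto simp: I_set_def)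
qed

lemma L2_add: "u \<in> L2 \<Longrightarrow> v \<in> L2 \<Longrightarrow> (\<lambda>x. u x + v x) \<in> L2"
  using L2_mult_integrable[of u v]
  by (auto simp: L2_def power2_sum mult.assoc)

lemma L2_scale: "u \<in> L2 \<Longrightarrow> (\<lambda>x. c * u x) \<in> L2"
  by (auto simp: L2_def power_mult_distrib)

lemma L2_diff: "u \<in> L2 \<Longrightarrow> v \<in> L2 \<Longrightarrow> (\<lambda>x. u x - v x) \<in> L2"
  using L2_add[OF _ L2_scale[of v "-1"]] by simp

lemma L2_sum: "(\<And>i. i \<in> A \<Longrightarrow> f i \<in> L2) \<Longrightarrow> (\<lambda>x. \<Sum>i\<in>A. f i x) \<in> L2"
  by (induction A rule: infinite_finite_induct) (auto intro: L2_add)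

text \<open>Completeness of Lebesgue measure makes this true. It gives measurability to
  representatives known only almost everywhere, such as those chosen in
  \<open>wderiv\<close>.\<close>

lemma I_leb_measurable_cong_AE:
  fixes u v :: "real \<Rightarrow> real"
  assumes u: "u \<in> borel_measurable I_leb" and ae: "AE x in I_leb. u x = v x"
  shows "v \<in> borel_measurable I_leb"
proof -
  have I: "I_set \<in> sets lebesgue" by (simp add: I_set_def)
  have "(\<lambda>x. if x \<in> I_set then u x else 0) \<in> borel_measurable lebesgue"
    using u borel_measurable_if[OF I, of u] by simp
  moreover have "AE x in lebesgue. (if x \<in> I_set then u x else 0) = (if x \<in> I_set then v x else 0)"
    using ae I by (subst (asm) AE_restrict_space_iff) (auto elim: eventually_mono)
  ultimately have "(\<lambda>x. if x \<in> I_set then v x else 0) \<in> borel_measurable lebesgue"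
    by (rule borel_measurable_AE)
  then show ?thesis using borel_measurable_if[OF I, of v] by simp
qed

lemma L2_cong_AE:
  assumes u: "u \<in> L2" and ae: "AE x in I_leb. u x = v x"
  shows "v \<in> L2"
proof -
  have v: "v \<in> borel_measurable I_leb"
    using I_leb_measurable_cong_AE[OF L2_measurable[OF u] ae] .
  have "integrable I_leb (\<lambda>x. (v x)\<^sup>2)"
    by (rule integrable_cong_AE_imp[OF L2_square[OF u]]) (use v ae in auto)
  then show ?thesis using v by (simp add: L2_def)
qed

lemma inner0_cong_AE:
  assumes "u \<in> L2" "v \<in> L2" "AE x in I_leb. u x = u' x" "AE x in I_leb. v x = v' x"
  shows "inner0 u v = inner0 u' v'"
  unfolding inner0_def
proof (rule integral_cong_AE)
  have [measurable]: "u' \<in> borel_measurable I_leb" "v' \<in> borel_measurable I_leb"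
    using L2_measurable[OF L2_cong_AE[OF assms(1,3)]] L2_measurable[OF L2_cong_AE[OF assms(2,4)]] by auto
  show "(\<lambda>x. u x * v x) \<in> borel_measurable I_leb" "(\<lambda>x. u' x * v' x) \<in> borel_measurable I_leb"
    using assms by measurable
qed (use assms(3,4) in auto)

lemma inner0_commute: "inner0 u v = inner0 v u" by (simp add: inner0_def mult.commute)

lemma inner0_add:
  "u \<in> L2 \<Longrightarrow> v \<in> L2 \<Longrightarrow> w \<in> L2 \<Longrightarrow> inner0 (\<lambda>x. u x + v x) w = inner0 u w + inner0 v w"
  by (simp add: inner0_def distrib_right L2_mult_integrable)

lemma inner0_scale: "inner0 (\<lambda>x. c * u x) v = c * inner0 u v"
  by (simp add: inner0_def mult.assoc)

lemma inner0_diff: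
  "u \<in> L2 \<Longrightarrow> v \<in> L2 \<Longrightarrow> w \<in> L2 \<Longrightarrow> inner0 (\<lambda>x. u x - v x) w = inner0 u w - inner0 v w"
  by (simp add: inner0_def left_diff_distrib L2_mult_integrable)

lemma inner0_add_right:
  "u \<in> L2 \<Longrightarrow> v \<in> L2 \<Longrightarrow> w \<in> L2 \<Longrightarrow> inner0 w (\<lambda>x. u x + v x) = inner0 w u + inner0 w v"
  using inner0_add[of u v w] by (simp add: inner0_commute)

lemma inner0_scale_right: "inner0 u (\<lambda>x. c * v x) = c * inner0 u v"
  using inner0_scale[of c v u] by (simp add: inner0_commute)

lemma inner0_diff_right:
  "u \<in> L2 \<Longrightarrow> v \<in> L2 \<Longrightarrow> w \<in> L2 \<Longrightarrow> inner0 w (\<lambda>x. u x - v x) = inner0 w u - inner0 w v"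
  using inner0_diff[of u v w] by (simp add: inner0_commute)

lemma inner0_sum:
  "(\<And>i. i \<in> A \<Longrightarrow> f i \<in> L2) \<Longrightarrow> v \<in> L2 \<Longrightarrow> inner0 (\<lambda>x. \<Sum>i\<in>A. f i x) v = (\<Sum>i\<in>A. inner0 (f i) v)"
  by (induction A rule: infinite_finite_induct) (auto simp: inner0_add L2_sum, simp_all add: inner0_def)

lemma inner0_nonneg: "0 \<le> inner0 u u"
  by (simp add: inner0_def)

lemma norm0_square: "(norm0 u)\<^sup>2 = inner0 u u"
  by (simp add: norm0_def inner0_nonneg)

lemma norm0_nonneg [simp]: "0 \<le> norm0 u" by (simp add: norm0_def inner0_nonneg)

lemma inner0_self: "inner0 u u = (LINT x|I_leb. (u x)\<^sup>2)" by (simp add: inner0_def power2_eq_square)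

lemma norm0_cong_AE: "u \<in> L2 \<Longrightarrow> AE x in I_leb. u x = v x \<Longrightarrow> norm0 u = norm0 v"
  by (simp add: norm0_def inner0_cong_AE[of u u v v])

text \<open>A discriminant argument for a semi-definite form: \<open>inner0 v v\<close> may vanish
  without \<open>v\<close> being the zero function, so the degenerate case is treated
  separately.\<close>

lemma Cauchy_Schwarz_L2:
  assumes u: "u \<in> L2" and v: "v \<in> L2"
  shows "\<bar>inner0 u v\<bar> \<le> norm0 u * norm0 v"
proof -
  have q: "0 \<le> inner0 u u - 2 * t * inner0 u v + t\<^sup>2 * inner0 v v" for t
  proof -
    have "0 \<le> inner0 (\<lambda>x. u x - t * v x) (\<lambda>x. u x - t * v x)" by (rule inner0_nonneg)
    also have "\<dots> = inner0 u u - 2 * t * inner0 u v + t\<^sup>2 * inner0 v v"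
      by (simp add: inner0_diff inner0_diff_right inner0_scale inner0_scale_right u v L2_diff L2_scale
          inner0_commute[of v u] power2_eq_square algebra_simps)
    finally show ?thesis .
  qed
  have "(inner0 u v)\<^sup>2 \<le> inner0 u u * inner0 v v"
  proof (cases "inner0 v v = 0")
    case True
    have "inner0 u v = 0"
    proof (rule ccontr)
      assume n: "inner0 u v \<noteq> 0"
      \<comment> \<open>When \<open>inner0 v v = 0\<close> the quadratic is affine in t, and this t
        makes it equal to -1.\<close>
      have "0 \<le> inner0 u u - 2 * ((inner0 u u + 1) / (2 * inner0 u v)) * inner0 u v"
        using q[of "(inner0 u u + 1) / (2 * inner0 u v)"] True by simp
      then show False using n by simp
    qed
    then show ?thesis using True by simp
  next
    case False
    then have p: "0 < inner0 v v" using inner0_nonneg[of v] by simp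
    have "0 \<le> (inner0 u u - 2 * (inner0 u v / inner0 v v) * inner0 u v + (inner0 u v / inner0 v v)\<^sup>2 * inner0 v v) * inner0 v v"
      by (rule mult_nonneg_nonneg[OF q]) (use p in simp)
    also have "\<dots> = inner0 u u * inner0 v v - (inner0 u v)\<^sup>2"
      using p by (simp add: field_simps power2_eq_square)
    finally show ?thesis by simp
  qed
  then have "sqrt ((inner0 u v)\<^sup>2) \<le> sqrt (inner0 u u * inner0 v v)" by (rule real_sqrt_le_mono)
  then show ?thesis by (simp add: norm0_def real_sqrt_mult)
qed

lemma norm0_triangle:
  assumes u: "u \<in> L2" and v: "v \<in> L2"
  shows "norm0 (\<lambda>x. u x + v x) \<le> norm0 u + norm0 v"
proof -
  have "(norm0 (\<lambda>x. u x + v x))\<^sup>2 = (norm0 u)\<^sup>2 + 2 * inner0 u v + (norm0 v)\<^sup>2"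
    unfolding norm0_square
    by (simp add: inner0_add inner0_add_right u v L2_add inner0_commute[of v u])
  also have "\<dots> \<le> (norm0 u)\<^sup>2 + 2 * (norm0 u * norm0 v) + (norm0 v)\<^sup>2"
    using Cauchy_Schwarz_L2[OF u v] by simp
  also have "\<dots> = (norm0 u + norm0 v)\<^sup>2" by (simp add: power2_sum)
  finally show ?thesis by (rule power2_le_imp_le) simp
qed

lemma norm0_scale: "norm0 (\<lambda>x. c * u x) = \<bar>c\<bar> * norm0 u"
  by (simp add: norm0_def inner0_scale inner0_scale_right real_sqrt_mult flip: mult.assoc)

lemma norm0_le_sup:
  assumes "u \<in> borel_measurable I_leb" "\<And>x. x \<in> I_set \<Longrightarrow> \<bar>u x\<bar> \<le> B"
  shows "norm0 u \<le> sqrt pi * B"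
proof -
  have u: "u \<in> L2" using assms by (rule L2_bounded)
  have B: "0 \<le> B" using assms(2)[of 1] pi_gt3 by (auto simp: I_set_def)
  have "inner0 u u \<le> (LINT x|I_leb. B\<^sup>2)"
    unfolding inner0_self
  proof (rule integral_mono[OF L2_square[OF u]])
    show "(u x)\<^sup>2 \<le> B\<^sup>2" if "x \<in> space I_leb" for x
      using assms(2)[of x] that by (simp add: abs_le_square_iff[symmetric] order_trans[OF _ abs_ge_self])
  qed simp
  also have "\<dots> = pi * B\<^sup>2"
    by (simp add: measure_restrict_space I_set_def)
  finally have "norm0 u \<le> sqrt (pi * B\<^sup>2)" unfolding norm0_def by (rule real_sqrt_le_mono)
  then show ?thesis using B by (simp add: real_sqrt_mult)
qed

section \<open>Weak derivatives\<close>

text \<open>The sets over which \<open>f\<close> integrates to zero contain the closed intervals and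
  are stable under complements (by the vanishing total integral) and countable disjoint unions, so
  they include all Borel sets. A Lebesgue set differs from a Borel set by a null set only.\<close>

lemma AE_zero_if_Icc_integrals_zero:
  fixes f :: "real \<Rightarrow> real"
  assumes f: "integrable lebesgue f" and 0: "(LINT x|lebesgue. f x) = 0"
    and Icc: "\<And>a b. (LINT x|lebesgue. indicator {a..b} x * f x) = 0"
  shows "AE x in lebesgue. f x = 0"
proof -
  have si: "set_integrable lebesgue A f" if "A \<in> sets lebesgue" for A
    unfolding set_integrable_def by (rule integrable_mult_indicator[OF that f])
  have borel: "(LINT x:A|lebesgue. f x) = 0" if "A \<in> sets borel" for A
  proof -
    let ?G = "range (\<lambda>(a, b). {a..b :: real})"
    have A: "A \<in> sigma_sets UNIV ?G"
      using that by (simp add: borel_eq_atLeastAtMost sets_measure_of)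
    have stable: "Int_stable ?G"
      by (auto simp: Int_stable_def image_iff)
    have sub: "sigma_sets UNIV ?G \<subseteq> sets lebesgue"
      by (metis borel_eq_atLeastAtMost sets_measure_of subset_UNIV Pow_UNIV sets_completionI_sets sets_lborel subsetI)
    have "?G \<subseteq> Pow UNIV" by simp
    from stable this A show ?thesis
    proof (induction rule: sigma_sets_induct_disjoint[consumes 3, case_names basic empty compl union])
      case (basic A)
      then show ?case using Icc by (auto simp: set_lebesgue_integral_def)
    next
      case empty
      show ?case by (simp add: set_lebesgue_integral_def)
    next
      case (compl A)
      have A: "A \<in> sets lebesgue" using compl sub by auto
      have "(LINT x:A|lebesgue. f x) + (LINT x:(UNIV - A)|lebesgue. f x) = (LINT x:(A \<union> (UNIV - A))|lebesgue. f x)"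
        using A by (intro set_integral_Un[symmetric] si) auto
      also have "\<dots> = 0" using 0 by (simp add: set_lebesgue_integral_def)
      finally show ?case using compl by simp
    next
      case (union A)
      have A: "A i \<in> sets lebesgue" for i using union sub by auto
      have "(LINT x:(\<Union>i. A i)|lebesgue. f x) = (\<Sum>i. (LINT x:(A i)|lebesgue. f x))"
        using union A by (intro lebesgue_integral_countable_add si) (auto simp: disjoint_family_on_def)
      then show ?case using union by simp
    qed
  qed
  have "(LINT x:A|lebesgue. f x) = (LINT x:A|lebesgue. 0)" if "A \<in> sets lebesgue" for A
  proof -
    note Am = that
    obtain S N N' where A: "A = S \<union> N" "N \<subseteq> N'" "N' \<in> null_sets lborel" "S \<in> sets lborel"
      using sets_completionE[OF Am] by metis
    have N': "N' \<in> null_sets lebesgue" using A(3) null_sets_completionI by blast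
    have "(LINT x:A|lebesgue. f x) = (LINT x:S|lebesgue. f x)"
      unfolding set_lebesgue_integral_def
    proof (rule integral_cong_AE)
      show "(\<lambda>x. indicat_real A x *\<^sub>R f x) \<in> borel_measurable lebesgue"
        using si[OF Am] by (auto simp: set_integrable_def)
      show "(\<lambda>x. indicat_real S x *\<^sub>R f x) \<in> borel_measurable lebesgue"
        using si[of S] A(4) by (auto simp: set_integrable_def)
      show "AE x in lebesgue. indicat_real A x *\<^sub>R f x = indicat_real S x *\<^sub>R f x"
        using AE_not_in[OF N'] by eventually_elim (use A(1,2) in \<open>auto simp: indicator_def\<close>)
    qed
    then show ?thesis using borel[of S] A(4) by (simp add: set_lebesgue_integral_def)
  qed
  then show ?thesis by (intro density_unique_real[OF f]) auto
qed

lemma I_set_sets [simp]: "I_set \<in> sets lebesgue" by (simp add: I_set_def)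

lemma L2_loc_integrable: "u \<in> L2 \<Longrightarrow> loc_integrable u"
  unfolding loc_integrable_def
proof (intro allI impI)
  fix K assume u: "u \<in> L2" and K: "compact K \<and> K \<subseteq> I_set"
  have Ks: "K \<in> sets lebesgue" using K by (simp add: compact_imp_closed lmeasurable_compact fmeasurableD)
  have "integrable lebesgue (\<lambda>x. if x \<in> I_set then u x else 0)"
    using L2_integrable[OF u] by (simp add: Lebesgue_Measure.integrable_restrict_UNIV)
  from integrable_mult_indicator[OF Ks this]
  have "integrable lebesgue (\<lambda>x. if x \<in> K then u x else 0)"
    by (rule Bochner_Integration.integrable_cong[THEN iffD1, rotated -1]) (use K in \<open>auto simp: indicator_def\<close>)
  then show "integrable (lebesgue_on K) u" using Ks by (simp add: Lebesgue_Measure.integrable_restrict_UNIV)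
qed

lemma loc_integrable_test_fun:
  assumes v: "loc_integrable v" and \<phi>: "\<phi> \<in> test_fun"
  shows "integrable I_leb (\<lambda>x. v x * \<phi> x)"
proof -
  obtain K where K: "compact K" "K \<subseteq> I_set" "\<And>x. x \<notin> K \<Longrightarrow> \<phi> x = 0"
    using \<phi> by (auto simp: test_fun_def)
  have Ks: "K \<in> sets lebesgue" using K by (simp add: compact_imp_closed lmeasurable_compact fmeasurableD)
  have c: "continuous_on S \<phi>" for S using \<phi> test_fun_smooth smooth_continuous by blast
  have "compact (\<phi> ` K)" by (intro compact_continuous_image c K)
  then obtain B where "\<forall>y\<in>\<phi> ` K. norm y \<le> B" unfolding bounded_iff using compact_imp_bounded bounded_iff by blast
  then have B: "\<bar>\<phi> x\<bar> \<le> B" if "x \<in> K" for x using that by auto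
  have vK: "integrable (lebesgue_on K) v" using v K by (auto simp: loc_integrable_def)
  have "integrable (lebesgue_on K) (\<lambda>x. v x * \<phi> x)"
  proof (rule Bochner_Integration.integrable_bound)
    show "integrable (lebesgue_on K) (\<lambda>x. B * v x)" using vK by simp
    have "\<phi> \<in> borel_measurable (lebesgue_on K)"
      by (rule continuous_imp_measurable_on_sets_lebesgue[OF c Ks])
    then show "(\<lambda>x. v x * \<phi> x) \<in> borel_measurable (lebesgue_on K)" using vK by auto
    show "AE x in lebesgue_on K. norm (v x * \<phi> x) \<le> norm (B * v x)"
    proof (rule AE_I2)
      fix x assume "x \<in> space (lebesgue_on K)"
      then have "\<bar>\<phi> x\<bar> \<le> \<bar>B\<bar>" using B[of x] by (simp add: space_restrict_space)
      then show "norm (v x * \<phi> x) \<le> norm (B * v x)"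
        by (simp add: abs_mult mult.commute[of "\<bar>v x\<bar>"] mult_right_mono)
    qed
  qed
  then have "integrable lebesgue (\<lambda>x. if x \<in> K then v x * \<phi> x else 0)"
    using Ks by (simp add: Lebesgue_Measure.integrable_restrict_UNIV)
  then have "integrable lebesgue (\<lambda>x. if x \<in> I_set then v x * \<phi> x else 0)"
    by (rule Bochner_Integration.integrable_cong[THEN iffD1, rotated -1]) (use K in auto)
  then show ?thesis by (simp add: Lebesgue_Measure.integrable_restrict_UNIV)
qed

text \<open>Products of two smooth steps with slope of order n converge boundedly to the indicator
  of an open subinterval. Hence the integral of \<open>v\<close> over compact subintervals vanishes,
  and \<open>AE_zero_if_Icc_integrals_zero\<close> applies to each restriction.\<close>

lemma fundamental_lemma:
  assumes v: "loc_integrable v" and 0: "\<And>\<phi>. \<phi> \<in> test_fun \<Longrightarrow> (LINT x|I_leb. v x * \<phi> x) = 0"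
  shows "AE x in I_leb. v x = 0"
proof -
  have Z: "(LINT x|lebesgue. (if x \<in> {c..d} then v x else 0)) = 0" if cd: "0 < c" "c < d" "d < pi" for c d
  proof -
    have sub: "{c..d} \<subseteq> I_set" using cd by (auto simp: I_set_def)
    have vi: "integrable (lebesgue_on {c..d}) v" using v sub by (auto simp: loc_integrable_def)
    define \<phi> where "\<phi> n x = smooth_step (real n * x + (- (real n * c))) * smooth_step ((- real n) * x + real n * d)" for n x
    have \<phi>0: "\<phi> n x = 0" if "x \<notin> {c..d}" for n x
    proof -
      have "real n * x \<le> real n * c \<or> real n * d \<le> real n * x"
        using that by (auto intro: mult_left_mono)
      then have "real n * x + (- (real n * c)) \<le> 0 \<or> (- real n) * x + real n * d \<le> 0" by auto
      then show ?thesis unfolding \<phi>_def using smooth_step_0 by auto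
    qed
    have sm: "smooth (\<phi> n)" for n
      unfolding \<phi>_def by (intro smooth_mult smooth_affine smooth_smooth_step)
    have test: "\<phi> n \<in> test_fun" for n
      by (rule test_funI[OF sm cd(1,3) \<phi>0])
    have "(LINT x|lebesgue_on {c..d}. v x * \<phi> n x) = (LINT x|I_leb. v x * \<phi> n x)" for n
    proof -
      have "(LINT x|lebesgue_on {c..d}. v x * \<phi> n x) = (LINT x|lebesgue. (if x \<in> {c..d} then v x * \<phi> n x else 0))"
        by (rule Lebesgue_Measure.integral_restrict_UNIV[symmetric]) simp
      also have "\<dots> = (LINT x|lebesgue. (if x \<in> I_set then v x * \<phi> n x else 0))"
        by (rule Bochner_Integration.integral_cong) (use sub \<phi>0 in \<open>auto simp: subset_iff\<close>)
      also have "\<dots> = (LINT x|I_leb. v x * \<phi> n x)"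
        by (rule Lebesgue_Measure.integral_restrict_UNIV) simp
      finally show ?thesis .
    qed
    then have z: "(LINT x|lebesgue_on {c..d}. v x * \<phi> n x) = 0" for n using 0[OF test] by simp
    have "(\<lambda>n. LINT x|lebesgue_on {c..d}. v x * \<phi> n x) \<longlonglongrightarrow> (LINT x|lebesgue_on {c..d}. v x * indicator {c<..<d} x)"
    proof (rule integral_dominated_convergence)
      have vm: "v \<in> borel_measurable (lebesgue_on {c..d})" using vi by auto
      have "indicat_real {c<..<d} \<in> borel_measurable lebesgue" by (intro borel_measurable_indicator) simp
      then have "indicat_real {c<..<d} \<in> borel_measurable (lebesgue_on {c..d})" by (rule measurable_restrict_space1)
      then show "(\<lambda>x. v x * indicat_real {c<..<d} x) \<in> borel_measurable (lebesgue_on {c..d})" using vm by auto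
      have "\<phi> n \<in> borel_measurable (lebesgue_on {c..d})" for n
        by (rule continuous_imp_measurable_on_sets_lebesgue[OF smooth_continuous[OF sm]]) simp
      then show "(\<lambda>x. v x * \<phi> n x) \<in> borel_measurable (lebesgue_on {c..d})" for n using vm by auto
      show "integrable (lebesgue_on {c..d}) (\<lambda>x. norm (v x))" using vi by simp
      show "AE x in lebesgue_on {c..d}. norm (v x * \<phi> n x) \<le> norm (v x)" for n
      proof (rule AE_I2)
        fix x
        have "\<bar>\<phi> n x\<bar> \<le> 1" unfolding \<phi>_def using smooth_step_range
          by (auto simp: abs_mult intro!: mult_le_one)
        then show "norm (v x * \<phi> n x) \<le> norm (v x)"
          using mult_left_mono[of "\<bar>\<phi> n x\<bar>" 1 "\<bar>v x\<bar>"] by (simp add: abs_mult)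
      qed
      show "AE x in lebesgue_on {c..d}. (\<lambda>n. v x * \<phi> n x) \<longlonglongrightarrow> v x * indicator {c<..<d} x"
      proof (rule AE_I2)
        fix x assume "x \<in> space (lebesgue_on {c..d})"
        then have x: "c \<le> x" "x \<le> d" by (auto simp: space_restrict_space)
        show "(\<lambda>n. v x * \<phi> n x) \<longlonglongrightarrow> v x * indicator {c<..<d} x"
        proof (cases "c < x \<and> x < d")
          case True
          obtain N :: nat where N: "1 / (x - c) + 1 / (d - x) < N" using reals_Archimedean2 by blast
          have "\<phi> n x = 1" if n: "N \<le> n" for n
          proof -
            have "1 / (x - c) < real n" "1 / (d - x) < real n"
              using N n True by (smt (verit) of_nat_le_iff divide_pos_pos)+
            then have "1 \<le> real n * x + (- (real n * c))" "1 \<le> (- real n) * x + real n * d"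
              using True by (auto simp: field_simps)
            then show ?thesis unfolding \<phi>_def by (simp add: smooth_step_1)
          qed
          then have "\<forall>\<^sub>F n in sequentially. v x * \<phi> n x = v x * indicator {c<..<d} x"
            using True by (intro eventually_sequentiallyI[of N]) auto
          then show ?thesis by (rule tendsto_eventually)
        next
          case False
          then have "x = c \<or> x = d" using x by auto
          then have "\<phi> n x = 0" for n by (auto simp: \<phi>_def smooth_step_0)
          then show ?thesis using False by (auto simp: indicator_def)
        qed
      qed
    qed
    then have "(LINT x|lebesgue_on {c..d}. v x * indicator {c<..<d} x) = 0"
      unfolding z by (simp add: LIMSEQ_const_iff)
    moreover have "(LINT x|lebesgue_on {c..d}. v x * indicator {c<..<d} x) = (LINT x|lebesgue_on {c..d}. v x)"
    proof (rule integral_cong_AE)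
      show "(\<lambda>x. v x) \<in> borel_measurable (lebesgue_on {c..d})" using vi by auto
      have "indicat_real {c<..<d} \<in> borel_measurable lebesgue" by (intro borel_measurable_indicator) simp
      then have "indicat_real {c<..<d} \<in> borel_measurable (lebesgue_on {c..d})" by (rule measurable_restrict_space1)
      then show "(\<lambda>x. v x * indicat_real {c<..<d} x) \<in> borel_measurable (lebesgue_on {c..d})" using vi by auto
      have "{c, d} \<in> null_sets lebesgue" by (simp add: negligible_iff_null_sets[symmetric])
      then have "AE x in lebesgue. x \<notin> {c, d}" by (rule AE_not_in)
      then have "AE x in lebesgue. x \<in> {c..d} \<longrightarrow> v x * indicat_real {c<..<d} x = v x"
        by eventually_elim auto
      then show "AE x in lebesgue_on {c..d}. v x * indicat_real {c<..<d} x = v x"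
        by (simp add: AE_restrict_space_iff)
    qed
    ultimately show ?thesis by (subst Lebesgue_Measure.integral_restrict_UNIV) auto
  qed
  have ae: "AE x in lebesgue. x \<in> {a..b} \<longrightarrow> v x = 0" if ab: "0 < a" "a < b" "b < pi" for a b
  proof -
    have "{a..b} \<subseteq> I_set" using ab by (auto simp: I_set_def)
    then have "integrable (lebesgue_on {a..b}) v" using v by (auto simp: loc_integrable_def)
    then have int: "integrable lebesgue (\<lambda>x. if x \<in> {a..b} then v x else 0)"
      by (subst Lebesgue_Measure.integrable_restrict_UNIV) auto
    have "AE x in lebesgue. (if x \<in> {a..b} then v x else 0) = 0"
    proof (rule AE_zero_if_Icc_integrals_zero[OF int Z[OF ab]])
      fix c d
      have e: "indicator {c..d} x * (if x \<in> {a..b} then v x else 0) = (if x \<in> {max a c..min b d} then v x else 0)" for x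
        by (auto simp: indicator_def)
      show "(LINT x|lebesgue. indicator {c..d} x * (if x \<in> {a..b} then v x else 0)) = 0"
      proof (cases "max a c < min b d")
        case True
        then show ?thesis unfolding e using ab by (intro Z) auto
      next
        case False
        have "{max a c..min b d} \<subseteq> {max a c}" using False by auto
        then have "negligible {max a c..min b d}" using negligible_subset negligible_sing by blast
        then have "AE x in lebesgue. x \<notin> {max a c..min b d}"
          by (intro AE_not_in) (simp add: negligible_iff_null_sets)
        then have "AE x in lebesgue. (if x \<in> {max a c..min b d} then v x else 0) = 0"
          by eventually_elim auto
        then show ?thesis unfolding e by (rule integral_eq_zero_AE)
      qed
    qed
    then show ?thesis by eventually_elim (auto split: if_splits)
  qed
  \<comment> \<open>Local integrability only gives information on compact subintervals; countably
    many of them exhaust the interval.\<close>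
  have "AE x in lebesgue. \<forall>n::nat. x \<in> {1 / (real n + 1)..pi - 1 / (real n + 1)} \<longrightarrow> v x = 0"
    unfolding AE_all_countable
  proof
    fix n :: nat
    have "0 < 1 / (real n + 1)" "1 / (real n + 1) \<le> 1" by simp_all
    then show "AE x in lebesgue. x \<in> {1 / (real n + 1)..pi - 1 / (real n + 1)} \<longrightarrow> v x = 0"
      using pi_gt3 by (intro ae) linarith+
  qed
  then have "AE x in lebesgue. x \<in> I_set \<longrightarrow> v x = 0"
  proof eventually_elim
    case (elim x)
    show ?case
    proof
      assume "x \<in> I_set"
      then have x: "0 < x" "0 < pi - x" by (auto simp: I_set_def)
      obtain n where n: "inverse (real (Suc n)) < min x (pi - x)" using reals_Archimedean[of "min x (pi - x)"] x by auto
      then have "x \<in> {1 / (real n + 1)..pi - 1 / (real n + 1)}" by (auto simp: inverse_eq_divide add.commute)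
      then show "v x = 0" using elim by blast
    qed
  qed
  then show ?thesis by (simp add: AE_restrict_space_iff)
qed

lemma has_weak_deriv_unique:
  assumes "has_weak_deriv k u v" "has_weak_deriv k u v'"
  shows "AE x in I_leb. v x = v' x"
proof -
  have l: "loc_integrable v" "loc_integrable v'" using assms by (auto simp: has_weak_deriv_def)
  have "AE x in I_leb. v x - v' x = 0"
  proof (rule fundamental_lemma)
    show "loc_integrable (\<lambda>x. v x - v' x)" using l by (auto simp: loc_integrable_def)
    fix \<phi> assume \<phi>: "\<phi> \<in> test_fun"
    have "(-1) ^ k * (LINT x|I_leb. v x * \<phi> x) = (-1) ^ k * (LINT x|I_leb. v' x * \<phi> x)"
      using assms \<phi> by (simp add: has_weak_deriv_def)
    then have "(LINT x|I_leb. v x * \<phi> x) = (LINT x|I_leb. v' x * \<phi> x)" by simp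
    then show "(LINT x|I_leb. (v x - v' x) * \<phi> x) = 0"
      by (simp add: left_diff_distrib loc_integrable_test_fun l \<phi>)
  qed
  then show ?thesis by simp
qed

lemma test_fun_L2: "\<phi> \<in> test_fun \<Longrightarrow> \<phi> \<in> L2"
  by (intro L2_continuous smooth_continuous test_fun_smooth)

lemma smooth_L2: "smooth \<phi> \<Longrightarrow> \<phi> \<in> L2"
  by (intro L2_continuous smooth_continuous)

text \<open>The weak derivative between L2 functions, phrased with \<open>inner0\<close>. Carrying
  membership in L2 along lets linear combinations, compositions and limits be handled without
  separate integrability conditions.\<close>

definition hw :: "nat \<Rightarrow> (real \<Rightarrow> real) \<Rightarrow> (real \<Rightarrow> real) \<Rightarrow> bool" where
  "hw k u v \<longleftrightarrow> u \<in> L2 \<and> v \<in> L2 \<and> (\<forall>\<phi>\<in>test_fun. inner0 u ((deriv ^^ k) \<phi>) = (-1) ^ k * inner0 v \<phi>)"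

lemma hw_iff: "hw k u v \<longleftrightarrow> u \<in> L2 \<and> v \<in> L2 \<and> has_weak_deriv k u v"
  by (auto simp: hw_def has_weak_deriv_def inner0_def L2_loc_integrable)

lemma hw_L2: "hw k u v \<Longrightarrow> u \<in> L2" "hw k u v \<Longrightarrow> v \<in> L2" by (auto simp: hw_def)

lemma hw_wderiv:
  assumes "hw k u v"
  shows "AE x in I_leb. wderiv k u x = v x" "wderiv k u \<in> L2" "hw k u (wderiv k u)"
proof -
  have "has_weak_deriv k u v" using assms by (simp add: hw_iff)
  then have w: "has_weak_deriv k u (wderiv k u)" unfolding wderiv_def by (rule someI[where P="has_weak_deriv k u"])
  show ae: "AE x in I_leb. wderiv k u x = v x"
    using has_weak_deriv_unique[OF w] assms by (simp add: hw_iff)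
  show "wderiv k u \<in> L2"
  proof (rule L2_cong_AE)
    show "AE x in I_leb. v x = wderiv k u x" using ae by eventually_elim simp
  qed (use assms in \<open>simp add: hw_iff\<close>)
  then show "hw k u (wderiv k u)" using assms w by (simp add: hw_iff)
qed

lemma hw_unique: "hw k u v \<Longrightarrow> hw k u v' \<Longrightarrow> AE x in I_leb. v x = v' x"
  using has_weak_deriv_unique by (auto simp: hw_iff)

lemma Hk_iff: "u \<in> Hk k \<longleftrightarrow> u \<in> L2 \<and> (\<forall>j\<le>k. \<exists>v. hw j u v)"
  by (auto simp: Hk_def hw_iff)

lemma hw_cong:
  assumes h: "hw k u v" and u: "AE x in I_leb. u x = u' x" and v: "AE x in I_leb. v x = v' x"
  shows "hw k u' v'"
proof -
  note L = hw_L2[OF h]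
  have "inner0 u' ((deriv ^^ k) \<phi>) = inner0 u ((deriv ^^ k) \<phi>)" "inner0 v' \<phi> = inner0 v \<phi>"
    if "\<phi> \<in> test_fun" for \<phi>
    using u v by (auto intro!: inner0_cong_AE[symmetric] L test_fun_L2 test_fun_funpow_deriv that)
  then show ?thesis using h L2_cong_AE[OF L(1) u] L2_cong_AE[OF L(2) v] by (simp add: hw_def)
qed

lemma hw_0: "u \<in> L2 \<Longrightarrow> hw 0 u u" by (simp add: hw_def)

lemma hw_add: "hw k u v \<Longrightarrow> hw k u' v' \<Longrightarrow> hw k (\<lambda>x. u x + u' x) (\<lambda>x. v x + v' x)"
  by (auto simp: hw_def L2_add inner0_add test_fun_L2 test_fun_funpow_deriv algebra_simps)

lemma hw_scale: "hw k u v \<Longrightarrow> hw k (\<lambda>x. c * u x) (\<lambda>x. c * v x)"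
  by (auto simp: hw_def L2_scale inner0_scale)

lemma hw_diff: "hw k u v \<Longrightarrow> hw k u' v' \<Longrightarrow> hw k (\<lambda>x. u x - u' x) (\<lambda>x. v x - v' x)"
  using hw_add[OF _ hw_scale[of k u' v' "-1"]] by simp

lemma hw_trans: "hw j u v \<Longrightarrow> hw k v w \<Longrightarrow> hw (j + k) u w"
  by (auto simp: hw_def funpow_add test_fun_funpow_deriv power_add)

text \<open>Derivatives of test functions are test functions, so testing \<open>u\<close> with
  derivatives of order j + k can be read in two ways. This identifies the higher weak derivatives of
  \<open>u\<close> as weak derivatives of the lower ones.\<close>

lemma hw_split:
  assumes "hw j u v" "hw (j + k) u w"
  shows "hw k v w"
  unfolding hw_def
proof (intro conjI ballI)
  fix \<phi> assume \<phi>: "\<phi> \<in> test_fun"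
  have "inner0 u ((deriv ^^ j) ((deriv ^^ k) \<phi>)) = (-1) ^ j * inner0 v ((deriv ^^ k) \<phi>)"
    using assms(1) test_fun_funpow_deriv[OF \<phi>] by (simp add: hw_def)
  moreover have "inner0 u ((deriv ^^ j) ((deriv ^^ k) \<phi>)) = (-1) ^ (j + k) * inner0 w \<phi>"
    using assms(2) \<phi> by (simp add: hw_def funpow_add)
  ultimately have "(-1) ^ j * inner0 v ((deriv ^^ k) \<phi>) = (-1) ^ j * ((-1) ^ k * inner0 w \<phi>)"
    by (simp add: power_add)
  then show "inner0 v ((deriv ^^ k) \<phi>) = (-1) ^ k * inner0 w \<phi>" by simp
qed (use assms hw_L2 in auto)

lemma tendsto_inner0:
  assumes u: "\<And>n. u n \<in> L2" "U \<in> L2" "w \<in> L2" and lim: "((\<lambda>n. norm0 (\<lambda>x. u n x - U x)) \<longlongrightarrow> 0) F"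
  shows "((\<lambda>n. inner0 (u n) w) \<longlongrightarrow> inner0 U w) F"
proof (rule LIM_zero_cancel, rule Lim_null_comparison[OF always_eventually])
  show "\<forall>n. norm (inner0 (u n) w - inner0 U w) \<le> norm0 (\<lambda>x. u n x - U x) * norm0 w"
    using Cauchy_Schwarz_L2[of "\<lambda>x. u _ x - U x" w] u by (simp add: L2_diff inner0_diff)
  show "((\<lambda>n. norm0 (\<lambda>x. u n x - U x) * norm0 w) \<longlongrightarrow> 0) F"
    using tendsto_mult_left_zero[OF lim] .
qed

text \<open>The weak derivative is a closed operator: both sides of the defining identity are
  continuous with respect to L2 convergence.\<close>

lemma hw_limit:
  assumes h: "\<And>n. hw k (u n) (v n)" and L: "U \<in> L2" "V' \<in> L2"
    and u: "(\<lambda>n. norm0 (\<lambda>x. u n x - U x)) \<longlonglongrightarrow> 0" and v: "(\<lambda>n. norm0 (\<lambda>x. v n x - V' x)) \<longlonglongrightarrow> 0"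
  shows "hw k U V'"
  unfolding hw_def
proof (intro conjI L ballI)
  fix \<phi> assume \<phi>: "\<phi> \<in> test_fun"
  note L' = test_fun_L2[OF \<phi>] test_fun_L2[OF test_fun_funpow_deriv[OF \<phi>]] hw_L2[OF h]
  have a: "(\<lambda>n. inner0 (u n) ((deriv ^^ k) \<phi>)) \<longlonglongrightarrow> inner0 U ((deriv ^^ k) \<phi>)"
    by (intro tendsto_inner0 L L' u)
  have b: "(\<lambda>n. (-1) ^ k * inner0 (v n) \<phi>) \<longlonglongrightarrow> (-1) ^ k * inner0 V' \<phi>"
    by (intro tendsto_mult tendsto_const tendsto_inner0 L L' v)
  have "inner0 (u n) ((deriv ^^ k) \<phi>) = (-1) ^ k * inner0 (v n) \<phi>" for n
    using h \<phi> by (simp add: hw_def)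
  then show "inner0 U ((deriv ^^ k) \<phi>) = (-1) ^ k * inner0 V' \<phi>"
    using LIMSEQ_unique[OF a] b by simp
qed

lemma I_leb_integral_continuous:
  fixes f :: "real \<Rightarrow> real"
  assumes "continuous_on {0..pi} f"
  shows "(LINT x|I_leb. f x) = integral {0..pi} f"
proof -
  have "(LINT x|I_leb. f x) = integral I_set f"
    by (rule lebesgue_integral_eq_integral) (use L2_integrable[OF L2_continuous[OF assms]] in auto)
  then show ?thesis by (simp add: I_set_def integral_open_interval_real)
qed

lemma inner0_deriv_parts:
  assumes f: "smooth f" and g: "smooth g"
  shows "inner0 (deriv f) g = f pi * g pi - f 0 * g 0 - inner0 f (deriv g)"
proof -
  have L: "deriv f \<in> L2" "deriv g \<in> L2" "f \<in> L2" "g \<in> L2" using f g by (auto intro: smooth_L2 smoothD)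
  have "inner0 (deriv f) g + inner0 f (deriv g) = (LINT x|I_leb. deriv f x * g x + f x * deriv g x)"
    unfolding inner0_def by (simp add: L2_mult_integrable L)
  also have "\<dots> = integral {0..pi} (\<lambda>x. deriv f x * g x + f x * deriv g x)"
    by (intro I_leb_integral_continuous continuous_intros smooth_continuous f g smoothD)
  also have "((\<lambda>x. deriv f x * g x + f x * deriv g x) has_integral f pi * g pi - f 0 * g 0) {0..pi}"
  proof (rule fundamental_theorem_of_calculus)
    fix x
    have "((\<lambda>x. f x * g x) has_real_derivative deriv f x * g x + f x * deriv g x) (at x)"
      by (rule DERIV_cong[OF DERIV_mult[OF smoothD(1)[OF f] smoothD(1)[OF g]]]) (simp add: mult.commute)
    then show "((\<lambda>x. f x * g x) has_vector_derivative deriv f x * g x + f x * deriv g x) (at x within {0..pi})"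
      by (simp add: has_real_derivative_iff_has_vector_derivative[symmetric] has_field_derivative_at_within)
  qed simp
  then have "integral {0..pi} (\<lambda>x. deriv f x * g x + f x * deriv g x) = f pi * g pi - f 0 * g 0"
    by (rule integral_unique)
  finally show ?thesis by simp
qed

lemma hw_smooth: "smooth u \<Longrightarrow> hw k u ((deriv ^^ k) u)"
proof (induction k arbitrary: u)
  case 0
  then show ?case by (simp add: hw_0 smooth_L2)
next
  case (Suc k)
  have "hw 1 u (deriv u)"
    unfolding hw_def
  proof (intro conjI ballI smooth_L2 smoothD Suc.prems)
    fix \<phi> assume \<phi>: "\<phi> \<in> test_fun"
    show "inner0 u ((deriv ^^ 1) \<phi>) = (-1) ^ 1 * inner0 (deriv u) \<phi>"
      using inner0_deriv_parts[OF Suc.prems test_fun_smooth[OF \<phi>]] by (simp add: test_fun_zero_ends[OF \<phi>])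
  qed
  from hw_trans[OF this Suc.IH[OF smoothD(2)[OF Suc.prems]]]
  show ?case by (simp add: funpow_Suc_right del: funpow.simps)
qed

subsection \<open>Cutoff functions exhausting the interval\<close>

text \<open>It vanishes within distance 1/(n+2) of the ends of the interval and equals 1 at distance
  at least 2/(n+2) from both.\<close>

definition cutoff :: "nat \<Rightarrow> real \<Rightarrow> real" where
  "cutoff n x = smooth_step ((real n + 2) * x + (-1)) * smooth_step ((- (real n + 2)) * x + ((real n + 2) * pi - 1))"

lemma smooth_cutoff: "smooth (cutoff n)"
  unfolding cutoff_def by (intro smooth_mult smooth_affine smooth_smooth_step)

lemma cutoff_range: "0 \<le> cutoff n x" "cutoff n x \<le> 1"
  unfolding cutoff_def using smooth_step_range by (auto intro: mult_le_one)

lemma cutoff_mult_test_fun: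
  assumes "smooth s"
  shows "(\<lambda>x. cutoff n x * s x) \<in> test_fun"
proof (rule test_funI[of _ "1 / (real n + 2)" "pi - 1 / (real n + 2)"])
  show "smooth (\<lambda>x. cutoff n x * s x)" by (intro smooth_mult smooth_cutoff assms)
  fix x assume "x \<notin> {1 / (real n + 2)..pi - 1 / (real n + 2)}"
  then have "x < 1 / (real n + 2) \<or> pi - x < 1 / (real n + 2)" by auto
  then have "(real n + 2) * x + (-1) \<le> 0 \<or> (- (real n + 2)) * x + ((real n + 2) * pi - 1) \<le> 0"
    by (auto simp: field_simps)
  then show "cutoff n x * s x = 0" by (auto simp: cutoff_def smooth_step_0)
qed auto

lemma smooth_step_deriv_0: "1 < x \<Longrightarrow> deriv smooth_step x = 0"
proof -
  assume x: "1 < x"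
  have "(smooth_step has_real_derivative 0) (at x)"
  proof (rule has_field_derivative_transform_within_open[where S="{1<..}"])
    show "((\<lambda>_. 1) has_real_derivative 0) (at x)" by simp
  qed (use x in \<open>auto simp: smooth_step_1\<close>)
  then show ?thesis by (rule DERIV_imp_deriv)
qed

lemma deriv_cutoff:
  "deriv (cutoff n) x =
    (real n + 2) * deriv smooth_step ((real n + 2) * x + (-1)) * smooth_step ((- (real n + 2)) * x + ((real n + 2) * pi - 1))
    - (real n + 2) * deriv smooth_step ((- (real n + 2)) * x + ((real n + 2) * pi - 1)) * smooth_step ((real n + 2) * x + (-1))"
proof (rule DERIV_imp_deriv)
  have d: "((\<lambda>x. smooth_step (a * x + b)) has_real_derivative deriv smooth_step (a * x + b) * a) (at x)" for a b
    by (rule DERIV_chain2[OF smoothD(1)[OF smooth_smooth_step]]) (auto intro!: derivative_eq_intros)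
  show "(cutoff n has_real_derivative
    (real n + 2) * deriv smooth_step ((real n + 2) * x + (-1)) * smooth_step ((- (real n + 2)) * x + ((real n + 2) * pi - 1))
    - (real n + 2) * deriv smooth_step ((- (real n + 2)) * x + ((real n + 2) * pi - 1)) * smooth_step ((real n + 2) * x + (-1))) (at x)"
    unfolding cutoff_def by (rule DERIV_cong[OF DERIV_mult[OF d d]]) (simp add: algebra_simps)
qed

lemma cutoff_eventually:
  assumes "x \<in> I_set"
  shows "\<forall>\<^sub>F n in sequentially. cutoff n x = 1 \<and> deriv (cutoff n) x = 0"
proof -
  have x: "0 < x" "0 < pi - x" using assms by (auto simp: I_set_def)
  obtain N :: nat where N: "2 / x + 2 / (pi - x) < N" using reals_Archimedean2 by blast
  show ?thesis
  proof (rule eventually_sequentiallyI[of N])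
    fix n assume n: "N \<le> n"
    have "2 / x < real n + 2" "2 / (pi - x) < real n + 2"
      using N n x by (smt (verit) of_nat_le_iff divide_pos_pos)+
    then have "2 < (real n + 2) * x" "2 < (real n + 2) * (pi - x)" using x by (simp_all add: pos_divide_less_eq)
    moreover have "(- (real n + 2)) * x + ((real n + 2) * pi - 1) = (real n + 2) * (pi - x) - 1"
      by (simp add: algebra_simps)
    ultimately have "1 < (real n + 2) * x + (-1)" "1 < (- (real n + 2)) * x + ((real n + 2) * pi - 1)"
      by linarith+
    then show "cutoff n x = 1 \<and> deriv (cutoff n) x = 0"
      unfolding deriv_cutoff by (simp add: cutoff_def smooth_step_1 smooth_step_deriv_0)
  qed
qed

text \<open>The derivative is of order n but lives in two boundary layers of width 2/(n+2). Against
  a function that is small near the ends, height and width balance.\<close>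

lemma deriv_cutoff_bound:
  obtains C where "0 \<le> C" "\<And>n x. \<bar>deriv (cutoff n) x\<bar> \<le> C * (real n + 2) * (indicator {..2 / (real n + 2)} x + indicator {pi - 2 / (real n + 2)..} x)"
proof -
  obtain C where C: "0 \<le> C" "\<And>x. \<bar>deriv smooth_step x\<bar> \<le> C" using smooth_step_deriv_bounded by blast
  have "\<bar>deriv (cutoff n) x\<bar> \<le> C * (real n + 2) * (indicator {..2 / (real n + 2)} x + indicator {pi - 2 / (real n + 2)..} x)" for n x
  proof -
    let ?m = "real n + 2"
    have 1: "\<bar>deriv smooth_step (?m * x + (-1))\<bar> \<le> C * indicator {..2 / ?m} x"
      using C(2) smooth_step_deriv_0[of "?m * x + (-1)"] by (auto simp: indicator_def field_simps)
    have 2: "\<bar>deriv smooth_step ((- ?m) * x + (?m * pi - 1))\<bar> \<le> C * indicator {pi - 2 / ?m..} x"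
      using C(2) smooth_step_deriv_0[of "(- ?m) * x + (?m * pi - 1)"] by (auto simp: indicator_def field_simps)
    have r: "\<bar>smooth_step y\<bar> \<le> 1" for y using smooth_step_range[of y] by simp
    have 3: "\<bar>?m * d * s\<bar> \<le> ?m * c" if "\<bar>d\<bar> \<le> c" "\<bar>s\<bar> \<le> 1" for d s c
    proof -
      have "\<bar>d\<bar> * \<bar>s\<bar> \<le> c * 1" using that by (intro mult_mono) auto
      then have "?m * (\<bar>d\<bar> * \<bar>s\<bar>) \<le> ?m * (c * 1)" by (intro mult_left_mono) auto
      then show ?thesis by (simp add: abs_mult mult.assoc)
    qed
    have "\<bar>deriv (cutoff n) x\<bar> \<le> ?m * (C * indicator {..2 / ?m} x) + ?m * (C * indicator {pi - 2 / ?m..} x)"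
      unfolding deriv_cutoff by (rule order_trans[OF abs_triangle_ineq4 add_mono[OF 3[OF 1 r] 3[OF 2 r]]])
    then show ?thesis by (simp add: algebra_simps)
  qed
  then show ?thesis using that C(1) by blast
qed

lemma norm0_tendsto_0:
  assumes m: "\<And>n. f n \<in> borel_measurable I_leb" and B: "\<And>n x. x \<in> I_set \<Longrightarrow> \<bar>f n x\<bar> \<le> B"
    and lim: "\<And>x. x \<in> I_set \<Longrightarrow> (\<lambda>n. f n x) \<longlonglongrightarrow> 0"
  shows "(\<lambda>n. norm0 (f n)) \<longlonglongrightarrow> 0"
proof -
  have "(\<lambda>n. LINT x|I_leb. (f n x)\<^sup>2) \<longlonglongrightarrow> (LINT x|I_leb. 0)"
  proof (rule integral_dominated_convergence)
    show "(\<lambda>x. (f n x)\<^sup>2) \<in> borel_measurable I_leb" for n using m by measurable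
    show "integrable I_leb (\<lambda>x. B\<^sup>2)" by simp
    show "AE x in I_leb. norm ((f n x)\<^sup>2) \<le> B\<^sup>2" for n
      using B by (intro AE_I2) (simp add: abs_le_square_iff[symmetric] order_trans[OF _ abs_ge_self])
    show "AE x in I_leb. (\<lambda>n. (f n x)\<^sup>2) \<longlonglongrightarrow> 0"
      using tendsto_power[OF lim, of _ 2] by (intro AE_I2) simp
  qed simp
  then have "(\<lambda>n. sqrt (LINT x|I_leb. (f n x)\<^sup>2)) \<longlonglongrightarrow> sqrt 0"
    by (intro tendsto_real_sqrt) simp
  then show ?thesis by (simp add: norm0_def inner0_self)
qed

lemma cutoff_tendsto:
  assumes s: "smooth s"
  shows "(\<lambda>n. norm0 (\<lambda>x. cutoff n x * s x - s x)) \<longlonglongrightarrow> 0"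
proof -
  have "compact (s ` {0..pi})" by (intro compact_continuous_image smooth_continuous s compact_Icc)
  then have "bounded (s ` {0..pi})" by (rule compact_imp_bounded)
  then obtain B0 where "\<forall>y\<in>s ` {0..pi}. norm y \<le> B0" unfolding bounded_iff by blast
  then have B0: "\<bar>s x\<bar> \<le> B0" if "x \<in> {0..pi}" for x using that by auto
  have sm: "smooth (\<lambda>x. cutoff n x * s x)" for n by (intro smooth_mult smooth_cutoff s)
  have m: "f \<in> borel_measurable I_leb" if "smooth f" for f using smooth_L2[OF that] by (rule L2_measurable)
  show ?thesis
  proof (rule norm0_tendsto_0[where B=B0])
    show "(\<lambda>x. cutoff n x * s x - s x) \<in> borel_measurable I_leb" for n
      using m[OF sm] m[OF s] by (intro borel_measurable_diff)
    fix n x assume x: "x \<in> I_set"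
    have "cutoff n x * s x - s x = (cutoff n x - 1) * s x" by (simp add: algebra_simps)
    moreover have "\<bar>cutoff n x - 1\<bar> \<le> 1" using cutoff_range[of n x] by auto
    ultimately have "\<bar>cutoff n x * s x - s x\<bar> \<le> 1 * \<bar>s x\<bar>"
      by (simp only: abs_mult) (rule mult_right_mono, auto)
    then show "\<bar>cutoff n x * s x - s x\<bar> \<le> B0" using B0[of x] x by (auto simp: I_set_def)
  next
    fix x assume x: "x \<in> I_set"
    have "\<forall>\<^sub>F n in sequentially. cutoff n x * s x - s x = 0"
      using cutoff_eventually[OF x] by eventually_elim simp
    then show "(\<lambda>n. cutoff n x * s x - s x) \<longlonglongrightarrow> 0" by (rule tendsto_eventually)
  qed
qed

text \<open>Near the boundary, the large derivative of the cutoff is compensated by the smallness of s.\<close>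

lemma cutoff_approx:
  assumes s: "smooth s" "s 0 = 0" "s pi = 0"
  shows "(\<lambda>n. norm0 (\<lambda>x. cutoff n x * s x - s x)) \<longlonglongrightarrow> 0"
    "(\<lambda>n. norm0 (\<lambda>x. deriv (\<lambda>x. cutoff n x * s x) x - deriv s x)) \<longlonglongrightarrow> 0"
proof -
  have "compact (deriv s ` {0..pi})"
    by (intro compact_continuous_image smooth_continuous smoothD s compact_Icc)
  then have "bounded (deriv s ` {0..pi})" by (rule compact_imp_bounded)
  then obtain D where "\<forall>y\<in>deriv s ` {0..pi}. norm y \<le> D" unfolding bounded_iff by blast
  then have D: "\<bar>deriv s x\<bar> \<le> D" if "x \<in> {0..pi}" for x using that by auto
  have D0: "0 \<le> D" using D[of 0] by simp
  have lip: "\<bar>s x - s y\<bar> \<le> D * \<bar>x - y\<bar>" if "x \<in> {0..pi}" "y \<in> {0..pi}" for x y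
    using field_differentiable_bound[of "{0..pi}" s "deriv s" D x y] that D smoothD(1)[OF s(1)]
    by (auto intro: has_field_derivative_at_within)
  obtain C where C: "0 \<le> C" "\<And>n x. \<bar>deriv (cutoff n) x\<bar> \<le> C * (real n + 2) * (indicator {..2 / (real n + 2)} x + indicator {pi - 2 / (real n + 2)..} x)"
    using deriv_cutoff_bound by blast
  have sm: "smooth (\<lambda>x. cutoff n x * s x)" for n by (intro smooth_mult smooth_cutoff s)
  have m: "f \<in> borel_measurable I_leb" if "smooth f" for f using smooth_L2[OF that] by (rule L2_measurable)
  show "(\<lambda>n. norm0 (\<lambda>x. cutoff n x * s x - s x)) \<longlonglongrightarrow> 0" by (rule cutoff_tendsto[OF s(1)])
  have dd: "deriv (\<lambda>x. cutoff n x * s x) x = deriv (cutoff n) x * s x + cutoff n x * deriv s x" for n x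
    by (rule DERIV_imp_deriv, rule DERIV_cong[OF DERIV_mult[OF smoothD(1)[OF smooth_cutoff] smoothD(1)[OF s(1)]]])
      (simp add: mult.commute)
  show "(\<lambda>n. norm0 (\<lambda>x. deriv (\<lambda>x. cutoff n x * s x) x - deriv s x)) \<longlonglongrightarrow> 0"
  \<comment> \<open>In each of the two layers (n+2) times |s| is at most 2 D, which gives 4 C D; the
    last D bounds the term in which the cutoff is compared with 1.\<close>
  proof (rule norm0_tendsto_0[where B="4 * C * D + D"])
    show "(\<lambda>x. deriv (\<lambda>x. cutoff n x * s x) x - deriv s x) \<in> borel_measurable I_leb" for n
      using m[OF smoothD(2)[OF sm]] m[OF smoothD(2)[OF s(1)]] by (intro borel_measurable_diff)
    fix n x assume xI: "x \<in> I_set"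
    then have x: "x \<in> {0..pi}" by (auto simp: I_set_def)
    let ?m = "real n + 2"
    have a: "?m * \<bar>s x\<bar> * indicator {..2 / ?m} x \<le> 2 * D"
    proof (cases "x \<le> 2 / ?m")
      case True
      have "\<bar>s x\<bar> \<le> D * x" using lip[of x 0] x s(2) by simp
      then have "?m * \<bar>s x\<bar> \<le> ?m * (D * x)" by (intro mult_left_mono) auto
      also have "\<dots> = D * (?m * x)" by simp
      also have "\<dots> \<le> D * 2" using True D0 by (intro mult_left_mono) (auto simp: field_simps)
      finally show ?thesis using True by simp
    qed (use D0 in simp)
    have b: "?m * \<bar>s x\<bar> * indicator {pi - 2 / ?m..} x \<le> 2 * D"
    proof (cases "pi - 2 / ?m \<le> x")
      case True
      have "\<bar>s x\<bar> \<le> D * (pi - x)" using lip[of x pi] x s(3) by simp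
      then have "?m * \<bar>s x\<bar> \<le> ?m * (D * (pi - x))" by (intro mult_left_mono) auto
      also have "\<dots> = D * (?m * (pi - x))" by simp
      also have "\<dots> \<le> D * 2" using True D0 by (intro mult_left_mono) (auto simp: field_simps)
      finally show ?thesis using True by simp
    qed (use D0 in simp)
    have "\<bar>deriv (cutoff n) x * s x\<bar> \<le> (C * ?m * (indicator {..2 / ?m} x + indicator {pi - 2 / ?m..} x)) * \<bar>s x\<bar>"
      unfolding abs_mult by (intro mult_right_mono C) simp
    also have "\<dots> = C * (?m * \<bar>s x\<bar> * indicator {..2 / ?m} x + ?m * \<bar>s x\<bar> * indicator {pi - 2 / ?m..} x)"
      by (simp add: algebra_simps)
    also have "\<dots> \<le> C * (2 * D + 2 * D)" by (intro mult_left_mono add_mono a b C)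
    finally have 1: "\<bar>deriv (cutoff n) x * s x\<bar> \<le> 4 * C * D" by simp
    have "\<bar>(cutoff n x - 1) * deriv s x\<bar> \<le> 1 * D"
      unfolding abs_mult using cutoff_range[of n x] D[OF x] by (intro mult_mono) auto
    moreover have "deriv (\<lambda>x. cutoff n x * s x) x - deriv s x = deriv (cutoff n) x * s x + (cutoff n x - 1) * deriv s x"
      unfolding dd by (simp add: algebra_simps)
    ultimately show "\<bar>deriv (\<lambda>x. cutoff n x * s x) x - deriv s x\<bar> \<le> 4 * C * D + D"
      using 1 by linarith
  next
    fix x assume x: "x \<in> I_set"
    have "\<forall>\<^sub>F n in sequentially. deriv (\<lambda>x. cutoff n x * s x) x - deriv s x = 0"
      using cutoff_eventually[OF x] by eventually_elim (simp add: dd)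
    then show "(\<lambda>n. deriv (\<lambda>x. cutoff n x * s x) x - deriv s x) \<longlonglongrightarrow> 0" by (rule tendsto_eventually)
  qed
qed

text \<open>Cutting off extends the defining identity from test functions to smooth functions that
  merely vanish at the ends. This is what allows testing with sines.\<close>

lemma hw_parts:
  assumes h: "hw 1 v v'" and s: "smooth s" "s 0 = 0" "s pi = 0"
  shows "inner0 v (deriv s) = - inner0 v' s"
proof -
  note L = hw_L2[OF h] smooth_L2[OF s(1)] smooth_L2[OF smoothD(2)[OF s(1)]]
  let ?\<phi> = "\<lambda>n x. cutoff n x * s x"
  have t: "?\<phi> n \<in> test_fun" for n by (rule cutoff_mult_test_fun[OF s(1)])
  have "(\<lambda>n. inner0 (deriv (?\<phi> n)) v) \<longlonglongrightarrow> inner0 (deriv s) v"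
    by (intro tendsto_inner0 cutoff_approx s L test_fun_L2 test_fun_deriv t)
  moreover have "(\<lambda>n. - inner0 (?\<phi> n) v') \<longlonglongrightarrow> - inner0 s v'"
    by (intro tendsto_minus tendsto_inner0 cutoff_approx s L test_fun_L2 t)
  moreover have e: "inner0 (deriv (?\<phi> n)) v = - inner0 (?\<phi> n) v'" for n
    using h t[of n] unfolding hw_def by (simp add: inner0_commute)
  ultimately have "inner0 (deriv s) v = - inner0 s v'" using LIMSEQ_unique by simp
  then show ?thesis by (simp add: inner0_commute)
qed

section \<open>Completeness of L2 and of the sine system\<close>

lemma L2_abs_integral_le:
  assumes "u \<in> L2"
  shows "(LINT x|I_leb. \<bar>u x\<bar>) \<le> sqrt pi * norm0 u"
proof -
  have a: "(\<lambda>x. \<bar>u x\<bar>) \<in> L2" using assms by (auto simp: L2_def)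
  have "(LINT x|I_leb. \<bar>u x\<bar>) = inner0 (\<lambda>x. \<bar>u x\<bar>) (\<lambda>_. 1)" by (simp add: inner0_def)
  also have "\<dots> \<le> norm0 (\<lambda>x. \<bar>u x\<bar>) * norm0 (\<lambda>_. 1)"
    using Cauchy_Schwarz_L2[OF a L2_const[of 1]] by simp
  also have "\<dots> \<le> norm0 (\<lambda>x. \<bar>u x\<bar>) * (sqrt pi * 1)"
    by (intro mult_left_mono norm0_le_sup) auto
  finally show ?thesis by (simp add: norm0_def inner0_self mult.commute)
qed

lemma Fatou_L2:
  assumes f: "\<And>j. f j \<in> L2" and F: "F \<in> borel_measurable I_leb"
    and lim: "AE x in I_leb. (\<lambda>j. f j x) \<longlonglongrightarrow> F x" and bd: "\<And>j. J \<le> j \<Longrightarrow> norm0 (f j) \<le> C"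
  shows "F \<in> L2" "norm0 F \<le> C"
proof -
  have C: "0 \<le> C" using order_trans[OF norm0_nonneg bd[of J]] by simp
  have "(\<integral>\<^sup>+x. ennreal ((F x)\<^sup>2) \<partial>I_leb) = (\<integral>\<^sup>+x. liminf (\<lambda>j. ennreal ((f j x)\<^sup>2)) \<partial>I_leb)"
  proof (rule nn_integral_cong_AE)
    show "AE x in I_leb. ennreal ((F x)\<^sup>2) = liminf (\<lambda>j. ennreal ((f j x)\<^sup>2))"
      using lim
    proof eventually_elim
      case (elim x)
      have "(\<lambda>j. ennreal ((f j x)\<^sup>2)) \<longlonglongrightarrow> ennreal ((F x)\<^sup>2)"
        by (intro tendsto_ennrealI tendsto_power elim)
      then show ?case by (rule lim_imp_Liminf[OF trivial_limit_sequentially, symmetric])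
    qed
  qed
  also have "\<dots> \<le> liminf (\<lambda>j. \<integral>\<^sup>+x. ennreal ((f j x)\<^sup>2) \<partial>I_leb)"
    by (rule nn_integral_liminf) (use f L2_measurable in measurable)
  also have "\<dots> \<le> limsup (\<lambda>j. \<integral>\<^sup>+x. ennreal ((f j x)\<^sup>2) \<partial>I_leb)"
    by (rule Liminf_le_Limsup) simp
  also have "\<dots> \<le> ennreal (C\<^sup>2)"
  proof (rule Limsup_bounded)
    have "(\<integral>\<^sup>+x. ennreal ((f j x)\<^sup>2) \<partial>I_leb) \<le> ennreal (C\<^sup>2)" if "J \<le> j" for j
    proof -
      have "(\<integral>\<^sup>+x. ennreal ((f j x)\<^sup>2) \<partial>I_leb) = ennreal (LINT x|I_leb. (f j x)\<^sup>2)"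
        by (rule nn_integral_eq_integral[OF L2_square[OF f]]) simp
      also have "(LINT x|I_leb. (f j x)\<^sup>2) = (norm0 (f j))\<^sup>2" by (simp add: norm0_square inner0_self)
      also have "ennreal \<dots> \<le> ennreal (C\<^sup>2)" using bd[OF that] by (intro ennreal_leI power_mono) auto
      finally show ?thesis .
    qed
    then show "\<forall>\<^sub>F j in sequentially. (\<integral>\<^sup>+x. ennreal ((f j x)\<^sup>2) \<partial>I_leb) \<le> ennreal (C\<^sup>2)"
      by (rule eventually_sequentiallyI)
  qed
  finally have le: "(\<integral>\<^sup>+x. ennreal ((F x)\<^sup>2) \<partial>I_leb) \<le> ennreal (C\<^sup>2)" .
  have int: "integrable I_leb (\<lambda>x. (F x)\<^sup>2)"
  proof (rule integrableI_bounded)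
    show "(\<lambda>x. (F x)\<^sup>2) \<in> borel_measurable I_leb" using F by measurable
    show "(\<integral>\<^sup>+x. ennreal (norm ((F x)\<^sup>2)) \<partial>I_leb) < \<infinity>"
      using le by (simp add: le_less_trans)
  qed
  then show "F \<in> L2" using F by (simp add: L2_def)
  have "ennreal (LINT x|I_leb. (F x)\<^sup>2) \<le> ennreal (C\<^sup>2)"
    using le nn_integral_eq_integral[OF int] by simp
  then have "(norm0 F)\<^sup>2 \<le> C\<^sup>2" by (simp add: norm0_square inner0_self)
  then show "norm0 F \<le> C" using C power2_le_imp_le by blast
qed

lemma norm0_diff_commute: "norm0 (\<lambda>x. u x - v x) = norm0 (\<lambda>x. v x - u x)"
  using norm0_scale[of "-1" "\<lambda>x. u x - v x"] by simp

text \<open>The Riesz-Fischer argument: along a subsequence with increments below powers of 1/2 the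
  increments are absolutely summable almost everywhere, since on a bounded interval L1 norms are
  controlled by L2 norms. \<open>Fatou_L2\<close> then turns the pointwise limit of the subsequence
  into an L2 limit of the whole sequence.\<close>

lemma L2_complete:
  fixes u :: "nat \<Rightarrow> real \<Rightarrow> real"
  assumes u: "\<And>n. u n \<in> L2"
    and cauchy: "\<And>e. 0 < e \<Longrightarrow> \<exists>N. \<forall>m\<ge>N. \<forall>n\<ge>N. norm0 (\<lambda>x. u m x - u n x) < e"
  obtains U where "U \<in> L2" "(\<lambda>n. norm0 (\<lambda>x. u n x - U x)) \<longlonglongrightarrow> 0"
proof -
  have "\<exists>N. \<forall>m\<ge>N. \<forall>n\<ge>N. norm0 (\<lambda>x. u m x - u n x) < (1/2) ^ j" for j :: nat
    by (rule cauchy) simp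
  then obtain N where N: "\<And>j m n. N j \<le> m \<Longrightarrow> N j \<le> n \<Longrightarrow> norm0 (\<lambda>x. u m x - u n x) < (1/2) ^ j"
    by metis
  \<comment> \<open>Summing the thresholds makes \<open>M j\<close> dominate \<open>N i\<close> for
    all i up to j, without choosing the thresholds monotone.\<close>
  define M where "M j = (\<Sum>i\<le>j. N i)" for j
  have MN: "N i \<le> M j" if "i \<le> j" for i j
    unfolding M_def using that by (intro member_le_sum) auto
  define s where "s j = u (M j)" for j
  define g where "g j x = s (Suc j) x - s j x" for j x
  have gL: "g j \<in> L2" for j unfolding g_def s_def by (intro L2_diff u)
  have g_le: "(LINT x|I_leb. \<bar>g j x\<bar>) \<le> sqrt pi * (1/2) ^ j" for j
  proof -
    have "norm0 (g j) < (1/2) ^ j" unfolding g_def s_def by (intro N MN) auto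
    then have "sqrt pi * norm0 (g j) \<le> sqrt pi * (1/2) ^ j" by (intro mult_left_mono) auto
    then show ?thesis using L2_abs_integral_le[OF gL[of j]] by linarith
  qed
  have "(\<integral>\<^sup>+x. (\<Sum>j. ennreal \<bar>g j x\<bar>) \<partial>I_leb) = (\<Sum>j. \<integral>\<^sup>+x. ennreal \<bar>g j x\<bar> \<partial>I_leb)"
    by (rule nn_integral_suminf) (use gL L2_measurable in measurable)
  also have "\<dots> \<le> (\<Sum>j. ennreal (sqrt pi * (1/2) ^ j))"
  proof (rule suminf_le)
    fix j
    have "(\<integral>\<^sup>+x. ennreal \<bar>g j x\<bar> \<partial>I_leb) = ennreal (LINT x|I_leb. \<bar>g j x\<bar>)"
      using L2_integrable[OF gL[of j]] by (intro nn_integral_eq_integral) auto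
    also have "\<dots> \<le> ennreal (sqrt pi * (1/2) ^ j)" by (intro ennreal_leI g_le)
    finally show "(\<integral>\<^sup>+x. ennreal \<bar>g j x\<bar> \<partial>I_leb) \<le> ennreal (sqrt pi * (1/2) ^ j)" .
  qed auto
  also have "\<dots> = ennreal (\<Sum>j. sqrt pi * (1/2) ^ j)"
    by (rule suminf_ennreal2) (auto intro!: summable_mult summable_geometric)
  also have "\<dots> < \<infinity>" by simp
  finally have fin: "(\<integral>\<^sup>+x. (\<Sum>j. ennreal \<bar>g j x\<bar>) \<partial>I_leb) \<noteq> \<infinity>" by simp
  have "AE x in I_leb. (\<Sum>j. ennreal \<bar>g j x\<bar>) \<noteq> \<infinity>"
    by (rule nn_integral_PInf_AE[OF _ fin]) (use gL L2_measurable in measurable)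
  then have conv: "AE x in I_leb. (\<lambda>j. s j x) \<longlonglongrightarrow> lim (\<lambda>j. s j x)"
  proof eventually_elim
    case (elim x)
    then have "summable (\<lambda>j. \<bar>g j x\<bar>)" by (intro summable_suminf_not_top) auto
    then have "summable (\<lambda>j. g j x)" by (rule summable_rabs_cancel)
    then have "(\<lambda>n. s 0 x + (\<Sum>j<n. g j x)) \<longlonglongrightarrow> s 0 x + (\<Sum>j. g j x)"
      by (intro tendsto_intros summable_LIMSEQ)
    moreover have "s 0 x + (\<Sum>j<n. g j x) = s n x" for n
      by (induction n) (auto simp: g_def)
    ultimately show ?case by (simp add: convergent_LIMSEQ_iff[symmetric] convergentI)
  qed
  define U where "U x = lim (\<lambda>j. s j x)" for x
  have sL: "s j \<in> L2" for j unfolding s_def by (rule u)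
  have Um: "U \<in> borel_measurable I_leb"
    unfolding U_def by (rule borel_measurable_lim_metric) (use sL L2_measurable in blast)
  have key: "(\<lambda>x. u n x - U x) \<in> L2 \<and> norm0 (\<lambda>x. u n x - U x) \<le> (1/2) ^ i" if "N i \<le> n" for n i
  proof -
    have l: "AE x in I_leb. (\<lambda>j. u n x - s j x) \<longlonglongrightarrow> u n x - U x"
      using conv unfolding U_def[symmetric] by eventually_elim (intro tendsto_intros)
    have m: "(\<lambda>x. u n x - U x) \<in> borel_measurable I_leb" using u[of n] Um L2_measurable by measurable
    have b: "norm0 (\<lambda>x. u n x - s j x) \<le> (1/2) ^ i" if "i \<le> j" for j
      unfolding s_def using N[OF \<open>N i \<le> n\<close> MN[OF that]] by simp
    show ?thesis
      using Fatou_L2[of "\<lambda>j x. u n x - s j x", OF L2_diff[OF u sL] m l b] by blast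
  qed
  have "(\<lambda>x. u (N 0) x - U x) \<in> L2" using key[of 0 "N 0"] by simp
  from L2_diff[OF u[of "N 0"] this] have "U \<in> L2" by simp
  moreover have "(\<lambda>n. norm0 (\<lambda>x. u n x - U x)) \<longlonglongrightarrow> 0"
  proof (rule LIMSEQ_I)
    fix r :: real assume "0 < r"
    then obtain i where i: "(1/2) ^ i < r" using real_arch_pow_inv[of r "1/2"] by auto
    have "norm (norm0 (\<lambda>x. u n x - U x) - 0) < r" if "N i \<le> n" for n
      using key[OF that] i by simp
    then show "\<exists>no. \<forall>n\<ge>no. norm (norm0 (\<lambda>x. u n x - U x) - 0) < r" by blast
  qed
  ultimately show ?thesis using that by blast
qed

section \<open>The orthonormal sine system and its completeness\<close>

definition freq :: "nat \<Rightarrow> real" where "freq k = real k + 1"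

lemma freq_pos [simp]: "0 < freq k" "freq k \<noteq> 0" and freq_ge_1: "1 \<le> freq k"
  by (simp_all add: freq_def)

text \<open>Modes are numbered from 0, so mode k has wave number k + 1; the factor normalises it in
  L2.\<close>

definition sine :: "nat \<Rightarrow> real \<Rightarrow> real" where "sine k x = sqrt (2 / pi) * sin (freq k * x)"
definition cosine :: "nat \<Rightarrow> real \<Rightarrow> real" where "cosine k x = sqrt (2 / pi) * cos (freq k * x)"

lemma deriv_sine: "deriv (sine k) = (\<lambda>x. freq k * cosine k x)"
  unfolding sine_def cosine_def by (rule deriv_eqI) (auto intro!: derivative_eq_intros)

lemma deriv_cosine: "deriv (cosine k) = (\<lambda>x. - freq k * sine k x)"
  unfolding sine_def cosine_def by (rule deriv_eqI) (auto intro!: derivative_eq_intros)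

lemma smooth_sine: "smooth (sine k)"
  using smooth_mult[OF smooth_const smooth_sin[of "freq k" 0]] by (simp add: sine_def[abs_def])

lemma smooth_cosine: "smooth (cosine k)"
proof -
  have "smooth (\<lambda>x. inverse (freq k) * deriv (sine k) x)"
    by (intro smooth_mult smooth_const smoothD smooth_sine)
  then show ?thesis by (simp add: deriv_sine mult.assoc[symmetric])
qed

lemma sine_ends [simp]: "sine k 0 = 0" "sine k pi = 0"
proof -
  have "sin (freq k * pi) = 0" using sin_npi[of "Suc k"] by (simp add: freq_def add.commute)
  then show "sine k 0 = 0" "sine k pi = 0" by (simp_all add: sine_def)
qed

lemma sine_L2 [simp]: "sine k \<in> L2" and cosine_L2 [simp]: "cosine k \<in> L2"
  by (simp_all add: smooth_L2 smooth_sine smooth_cosine)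

text \<open>One integration by parts, whose boundary term vanishes because of the sine. The
  left-hand side is symmetric in j and k, which yields the orthogonality of the sines.\<close>

lemma inner0_cosine: "freq j * freq k * inner0 (cosine j) (cosine k) = (freq j)\<^sup>2 * inner0 (sine j) (sine k)"
proof -
  have "inner0 (deriv (cosine j)) (sine k) = - inner0 (cosine j) (deriv (sine k))"
    using inner0_deriv_parts[OF smooth_cosine smooth_sine] by simp
  then have "- freq j * inner0 (sine j) (sine k) = - (freq k * inner0 (cosine j) (cosine k))"
    unfolding deriv_cosine deriv_sine inner0_scale inner0_scale_right .
  then show ?thesis by (simp add: power2_eq_square algebra_simps)
qed

text \<open>For equal indices sine and cosine have the same norm, and their squares add up to 2/pi
  at every point; for different ones the symmetric expression of \<open>inner0_cosine\<close>
  carries two different factors.\<close>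

lemma inner0_sine: "inner0 (sine j) (sine k) = (if j = k then 1 else 0)"
proof (cases "j = k")
  case True
  have "inner0 (cosine k) (cosine k) = inner0 (sine k) (sine k)"
    using inner0_cosine[of k k] by (simp add: power2_eq_square)
  moreover have "inner0 (sine k) (sine k) + inner0 (cosine k) (cosine k) = (LINT x|I_leb. 2 / pi)"
  proof -
    have "(sqrt (2 / pi) * a)\<^sup>2 = 2 / pi * a\<^sup>2" for a by (simp add: power_mult_distrib)
    then have "(sine k x)\<^sup>2 + (cosine k x)\<^sup>2 = 2 / pi" for x
      unfolding sine_def cosine_def by (simp only: distrib_left[symmetric] sin_cos_squared_add mult_1_right)
    then show ?thesis
      unfolding inner0_self by (simp add: L2_square flip: Bochner_Integration.integral_add)
  qed
  moreover have "(LINT x|I_leb. 2 / pi) = 2"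
    by (simp add: measure_restrict_space I_set_def)
  ultimately show ?thesis using True by simp
next
  case False
  have "(freq j)\<^sup>2 * inner0 (sine j) (sine k) = (freq k)\<^sup>2 * inner0 (sine j) (sine k)"
    using inner0_cosine[of j k] inner0_cosine[of k j] inner0_commute[of "sine j"] inner0_commute[of "cosine j"]
    by (simp add: mult.commute)
  moreover have "(freq j)\<^sup>2 \<noteq> (freq k)\<^sup>2" using False by (simp add: freq_def power2_eq_iff)
  ultimately show ?thesis using False by simp
qed

text \<open>The product formula for sin (m x) cos x lowers the power of the cosine at the price of
  the neighbouring frequencies m + 1 and m - 1; for m = 0 the function vanishes.\<close>

lemma inner0_sin_cos_power:
  assumes f: "f \<in> L2" and 0: "\<And>k. inner0 f (sine k) = 0"
  shows "inner0 f (\<lambda>x. sin (real m * x) * cos x ^ i) = 0"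
proof (induction i arbitrary: m)
  case 0
  show ?case
  proof (cases m)
    case (Suc k)
    have "inner0 f (sine k) = sqrt (2 / pi) * inner0 f (\<lambda>x. sin (real m * x))"
      unfolding sine_def inner0_scale_right by (simp add: Suc freq_def add.commute)
    then show ?thesis using assms(2)[of k] by simp
  qed (simp add: inner0_def)
next
  case (Suc i)
  have L: "(\<lambda>x. sin (real n * x) * cos x ^ i) \<in> L2" for n
    by (intro L2_continuous continuous_intros)
  show ?case
  proof (cases m)
    case (Suc n)
    have e: "sin (real m * x) * cos x ^ Suc i
        = 1/2 * (sin (real (Suc (Suc n)) * x) * cos x ^ i + sin (real n * x) * cos x ^ i)" for x
    proof -
      have "sin (real m * x) * cos x = (sin (real m * x + x) + sin (real m * x - x)) / 2"
        by (rule sin_times_cos)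
      moreover have "real m * x + x = real (Suc (Suc n)) * x" "real m * x - x = real n * x"
        by (simp_all add: Suc algebra_simps)
      ultimately have "sin (real m * x) * cos x = (sin (real (Suc (Suc n)) * x) + sin (real n * x)) / 2"
        by (simp only:)
      then have "sin (real m * x) * cos x * cos x ^ i = (sin (real (Suc (Suc n)) * x) + sin (real n * x)) / 2 * cos x ^ i"
        by (simp only:)
      then show ?thesis by (simp add: mult.assoc add_divide_distrib distrib_left distrib_right)
    qed
    show ?thesis unfolding e inner0_scale_right inner0_add_right[OF L L f] Suc.IH by simp
  qed (simp add: inner0_def)
qed

text \<open>
  A test function, divided by the sine, is a continuous function of the cosine, to which the
  Weierstrass theorem applies.
\<close>

lemma sine_complete:
  assumes f: "f \<in> L2" and 0: "\<And>k. inner0 f (sine k) = 0"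
  shows "AE x in I_leb. f x = 0"
proof (rule fundamental_lemma[OF L2_loc_integrable[OF f]])
  fix \<phi> assume \<phi>: "\<phi> \<in> test_fun"
  obtain K where K: "compact K" "K \<subseteq> I_set" "\<And>x. x \<notin> K \<Longrightarrow> \<phi> x = 0"
    using \<phi> by (auto simp: test_fun_def)
  note c\<phi> = smooth_continuous[OF test_fun_smooth[OF \<phi>]]
  define q where "q x = \<phi> x / sin x" for x
  have "isCont q x" for x
  proof (cases "x \<in> K")
    case True
    then have "sin x \<noteq> 0" using K(2) sin_gt_zero[of x] by (force simp: I_set_def)
    then show ?thesis unfolding q_def
      using c\<phi>[of UNIV] by (intro continuous_intros) (auto simp: continuous_on_eq_continuous_at)
  next
    case False
    have "open (- K)" using K(1) by (simp add: compact_imp_closed open_Compl)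
    then have "\<forall>\<^sub>F y in nhds x. q y = 0"
      using False K(3) by (auto simp: eventually_nhds q_def intro!: exI[of _ "- K"])
    then show ?thesis by (simp add: isCont_cong)
  qed
  then have qc: "continuous_on S q" for S by (simp add: continuous_at_imp_continuous_on)
  have G: "continuous_on {-1..1} (\<lambda>y. q (arccos y))"
    by (rule continuous_on_compose2[OF qc[of UNIV]]) (auto intro: continuous_intros)
  have "\<bar>inner0 f \<phi>\<bar> \<le> norm0 f * (sqrt pi * e)" if e: "0 < e" for e
  proof -
    obtain P where P: "real_polynomial_function P" "\<And>y. y \<in> {-1..1} \<Longrightarrow> \<bar>q (arccos y) - P y\<bar> < e"
      using Stone_Weierstrass_real_polynomial_function[OF _ G e] by auto
    obtain a n where Pa: "P = (\<lambda>y. \<Sum>i\<le>n. a i * y ^ i)"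
      using P(1) by (auto simp: real_polynomial_function_iff_sum)
    have L: "(\<lambda>x. sin x * cos x ^ i) \<in> L2" "(\<lambda>x. sin x * P (cos x)) \<in> L2" for i
      unfolding Pa by (intro L2_continuous continuous_intros)+
    have "inner0 f (\<lambda>x. sin x * P (cos x)) = inner0 (\<lambda>x. \<Sum>i\<le>n. a i * (sin x * cos x ^ i)) f"
      unfolding Pa inner0_commute[of f] by (simp add: sum_distrib_left mult_ac)
    also have "\<dots> = (\<Sum>i\<le>n. a i * inner0 (\<lambda>x. sin x * cos x ^ i) f)"
      by (simp add: inner0_sum L2_scale L f inner0_scale)
    also have "\<dots> = 0"
      using inner0_sin_cos_power[OF f 0, of 1] by (simp add: inner0_commute[of _ f])
    finally have "inner0 f \<phi> = inner0 f (\<lambda>x. \<phi> x - sin x * P (cos x))"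
      by (simp add: inner0_diff_right f test_fun_L2[OF \<phi>] L)
    also have "\<bar>\<dots>\<bar> \<le> norm0 f * norm0 (\<lambda>x. \<phi> x - sin x * P (cos x))"
      by (intro Cauchy_Schwarz_L2 f L2_diff test_fun_L2 \<phi> L)
    also have "\<dots> \<le> norm0 f * (sqrt pi * e)"
    proof (intro mult_left_mono norm0_le_sup)
      show "(\<lambda>x. \<phi> x - sin x * P (cos x)) \<in> borel_measurable I_leb"
        by (intro L2_measurable L2_diff test_fun_L2 \<phi> L)
      fix x assume "x \<in> I_set"
      then have x: "0 < x" "x < pi" by (auto simp: I_set_def)
      then have s: "0 < sin x" by (rule sin_gt_zero)
      have "\<bar>q x - P (cos x)\<bar> \<le> e" using P(2)[of "cos x"] x by (simp add: arccos_cos less_imp_le)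
      then have "\<bar>sin x\<bar> * \<bar>q x - P (cos x)\<bar> \<le> 1 * e" by (intro mult_mono) auto
      moreover have "\<phi> x - sin x * P (cos x) = sin x * (q x - P (cos x))"
        using s by (simp add: q_def right_diff_distrib)
      ultimately show "\<bar>\<phi> x - sin x * P (cos x)\<bar> \<le> e" by (simp add: abs_mult)
    qed simp
    finally show ?thesis .
  qed
  then have le: "\<bar>inner0 f \<phi>\<bar> \<le> (norm0 f * sqrt pi) * e" if "0 < e" for e using that by (simp add: mult.assoc)
  have "\<bar>inner0 f \<phi>\<bar> \<le> 0"
  proof (rule field_le_epsilon)
    fix e :: real assume e: "0 < e"
    have "\<bar>inner0 f \<phi>\<bar> \<le> (norm0 f * sqrt pi) * (e / (norm0 f * sqrt pi + 1))"
      using e by (intro le divide_pos_pos add_nonneg_pos mult_nonneg_nonneg) auto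
    also have "\<dots> \<le> e"
    proof -
      have p: "0 < norm0 f * sqrt pi + 1" by (intro add_nonneg_pos mult_nonneg_nonneg) auto
      have "norm0 f * sqrt pi * e \<le> e * (norm0 f * sqrt pi + 1)" using e by (simp add: algebra_simps)
      then show ?thesis using p by (simp only: times_divide_eq_right pos_divide_le_eq)
    qed
    finally show "\<bar>inner0 f \<phi>\<bar> \<le> 0 + e" by simp
  qed
  then show "(LINT x|I_leb. f x * \<phi> x) = 0" by (simp add: inner0_def)
qed

subsection \<open>The isometry between L2 and the square summable sequences\<close>

definition psum :: "(nat \<Rightarrow> real) \<Rightarrow> nat \<Rightarrow> real \<Rightarrow> real" where
  "psum a n x = (\<Sum>k<n. a k * sine k x)"

lemma psum_L2 [simp]: "psum a n \<in> L2"
  unfolding psum_def by (intro L2_sum L2_scale sine_L2)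

lemma smooth_psum: "smooth (psum a n)"
  unfolding psum_def by (intro smooth_sum smooth_mult smooth_const smooth_sine)

lemma inner0_psum: "u \<in> L2 \<Longrightarrow> inner0 (psum a n) u = (\<Sum>k<n. a k * inner0 u (sine k))"
  unfolding psum_def by (simp add: inner0_sum L2_scale inner0_scale) (simp add: inner0_commute)

lemma inner0_psum_sine: "inner0 (psum a n) (sine k) = (if k < n then a k else 0)"
proof -
  have "inner0 (psum a n) (sine k) = (\<Sum>i<n. if k = i then a i else 0)"
    unfolding inner0_psum[OF sine_L2] by (intro sum.cong) (auto simp: inner0_sine)
  then show ?thesis by simp
qed

definition cf :: "(real \<Rightarrow> real) \<Rightarrow> ell2" where "cf u = Ell (\<lambda>k. inner0 u (sine k))"

lemma bessel:
  assumes u: "u \<in> L2"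
  shows "(\<Sum>k<n. (inner0 u (sine k))\<^sup>2) \<le> (norm0 u)\<^sup>2"
proof -
  let ?s = "psum (\<lambda>k. inner0 u (sine k)) n"
  have "inner0 ?s u = (\<Sum>k<n. (inner0 u (sine k))\<^sup>2)"
    by (simp add: inner0_psum u power2_eq_square)
  moreover have "inner0 ?s ?s = (\<Sum>k<n. (inner0 u (sine k))\<^sup>2)"
    unfolding inner0_psum[OF psum_L2] by (intro sum.cong) (auto simp: inner0_psum_sine power2_eq_square)
  moreover have "0 \<le> inner0 (\<lambda>x. u x - ?s x) (\<lambda>x. u x - ?s x)" by (rule inner0_nonneg)
  ultimately show ?thesis
    by (simp add: inner0_diff inner0_diff_right u L2_diff inner0_commute[of u ?s] norm0_square)
qed

lemma coord_cf: "u \<in> L2 \<Longrightarrow> coord (cf u) k = inner0 u (sine k)"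
  unfolding cf_def by (subst coord_Ell[OF ell2_boundI(1)[OF bessel]]) auto

lemma norm0_psum_diff:
  assumes "m \<le> n"
  shows "(norm0 (\<lambda>x. psum a n x - psum a m x))\<^sup>2 = (\<Sum>k=m..<n. (a k)\<^sup>2)"
proof -
  have nn: "inner0 (psum a i) (psum a j) = (\<Sum>k<min i j. (a k)\<^sup>2)" for i j
  proof -
    have "inner0 (psum a i) (psum a j) = (\<Sum>k<i. if k < j then (a k)\<^sup>2 else 0)"
      unfolding inner0_psum[OF psum_L2] by (intro sum.cong) (auto simp: inner0_psum_sine power2_eq_square)
    also have "\<dots> = (\<Sum>k<min i j. (a k)\<^sup>2)"
      by (intro sum.mono_neutral_cong_right) auto
    finally show ?thesis .
  qed
  have "(norm0 (\<lambda>x. psum a n x - psum a m x))\<^sup>2 = (\<Sum>k<n. (a k)\<^sup>2) - (\<Sum>k<m. (a k)\<^sup>2)"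
    unfolding norm0_square using assms
    by (simp add: inner0_diff inner0_diff_right L2_diff nn min_absorb1 min_absorb2)
  also have "\<dots> = (\<Sum>k=m..<n. (a k)\<^sup>2)"
    using sum_diff_nat_ivl[of 0 m n "\<lambda>k. (a k)\<^sup>2"] assms by (simp add: atLeast0LessThan)
  finally show ?thesis .
qed

lemma psum_limit_exists:
  obtains U where "U \<in> L2" "(\<lambda>n. norm0 (\<lambda>x. psum (coord z) n x - U x)) \<longlonglongrightarrow> 0"
proof (rule L2_complete[of "psum (coord z)"])
  fix e :: real assume e: "0 < e"
  obtain N where N: "\<And>m n. N \<le> m \<Longrightarrow> norm (\<Sum>k=m..<n. (coord z k)\<^sup>2) < e\<^sup>2"
    using summable_Cauchy[THEN iffD1, OF summable_coord[of z]] e by (metis zero_less_power)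
  have *: "norm0 (\<lambda>x. psum (coord z) n x - psum (coord z) m x) < e" if "N \<le> m" "m \<le> n" for m n
  proof -
    have "(norm0 (\<lambda>x. psum (coord z) n x - psum (coord z) m x))\<^sup>2 < e\<^sup>2"
      using N[OF that(1), of n] by (simp add: norm0_psum_diff[OF that(2)])
    then show ?thesis using e by (simp add: power2_less_imp_less)
  qed
  have "norm0 (\<lambda>x. psum (coord z) m x - psum (coord z) n x) < e" if "N \<le> m" "N \<le> n" for m n
    using *[of m n] *[of n m] that norm0_diff_commute[of "psum (coord z) m"] by (cases "m \<le> n") auto
  then show "\<exists>N. \<forall>m\<ge>N. \<forall>n\<ge>N. norm0 (\<lambda>x. psum (coord z) m x - psum (coord z) n x) < e" by blast
qed (use that in auto)

lemma cf_of_psum_limit: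
  assumes U: "U \<in> L2" and lim: "(\<lambda>n. norm0 (\<lambda>x. psum (coord z) n x - U x)) \<longlonglongrightarrow> 0"
  shows "cf U = z"
proof (rule ell2_eqI)
  fix k
  have "(\<lambda>n. inner0 (psum (coord z) n) (sine k)) \<longlonglongrightarrow> inner0 U (sine k)"
    by (intro tendsto_inner0 lim U) auto
  moreover have "(\<lambda>n. inner0 (psum (coord z) n) (sine k)) \<longlonglongrightarrow> coord z k"
    by (rule tendsto_eventually, rule eventually_sequentiallyI[of "Suc k"]) (simp add: inner0_psum_sine)
  ultimately show "coord (cf U) k = coord z k" using LIMSEQ_unique coord_cf[OF U] by metis
qed

text \<open>Determined only up to almost everywhere equality, since \<open>L2\<close> consists of
  functions and not of classes; all that is used of it is its membership in \<open>L2\<close> and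
  its coefficients.\<close>

definition sy :: "ell2 \<Rightarrow> real \<Rightarrow> real" where "sy z = (SOME u. u \<in> L2 \<and> cf u = z)"

lemma sy_L2 [simp]: "sy z \<in> L2" and cf_sy [simp]: "cf (sy z) = z"
proof -
  obtain U where "U \<in> L2" "(\<lambda>n. norm0 (\<lambda>x. psum (coord z) n x - U x)) \<longlonglongrightarrow> 0" by (rule psum_limit_exists)
  then have "U \<in> L2 \<and> cf U = z" using cf_of_psum_limit by blast
  then have "sy z \<in> L2 \<and> cf (sy z) = z" unfolding sy_def by (rule someI[where P="\<lambda>u. u \<in> L2 \<and> cf u = z"])
  then show "sy z \<in> L2" "cf (sy z) = z" by auto
qed

lemma cf_add: "u \<in> L2 \<Longrightarrow> v \<in> L2 \<Longrightarrow> cf (\<lambda>x. u x + v x) = cf u + cf v"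
  by (rule ell2_eqI) (simp add: coord_cf L2_add inner0_add)

lemma cf_scale: "u \<in> L2 \<Longrightarrow> cf (\<lambda>x. c * u x) = c *\<^sub>R cf u"
  by (rule ell2_eqI) (simp add: coord_cf L2_scale inner0_scale)

lemma cf_diff: "u \<in> L2 \<Longrightarrow> v \<in> L2 \<Longrightarrow> cf (\<lambda>x. u x - v x) = cf u - cf v"
  by (rule ell2_eqI) (simp add: coord_cf L2_diff inner0_diff)

text \<open>Completeness of the sines in the form used below: almost everywhere equality of L2
  functions becomes equality of sequences.\<close>

lemma cf_eq_iff:
  assumes "u \<in> L2" "v \<in> L2"
  shows "cf u = cf v \<longleftrightarrow> (AE x in I_leb. u x = v x)"
proof
  assume "cf u = cf v"
  then have "inner0 u (sine k) = inner0 v (sine k)" for k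
    using coord_cf assms by metis
  then have "AE x in I_leb. u x - v x = 0"
    by (intro sine_complete L2_diff assms) (simp add: inner0_diff assms)
  then show "AE x in I_leb. u x = v x" by simp
next
  assume "AE x in I_leb. u x = v x"
  then have "inner0 u (sine k) = inner0 v (sine k)" for k
    by (intro inner0_cong_AE assms) auto
  then show "cf u = cf v" by (simp add: cf_def)
qed

lemma psum_tendsto:
  assumes u: "u \<in> L2"
  shows "(\<lambda>n. norm0 (\<lambda>x. psum (coord (cf u)) n x - u x)) \<longlonglongrightarrow> 0"
proof -
  obtain U where U: "U \<in> L2" and l: "(\<lambda>n. norm0 (\<lambda>x. psum (coord (cf u)) n x - U x)) \<longlonglongrightarrow> 0"
    by (rule psum_limit_exists)
  have ae: "AE x in I_leb. U x = u x" using cf_eq_iff[OF U u] cf_of_psum_limit[OF U l] by simp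
  have "norm0 (\<lambda>x. psum (coord (cf u)) n x - U x) = norm0 (\<lambda>x. psum (coord (cf u)) n x - u x)" for n
    by (intro norm0_cong_AE L2_diff U psum_L2) (use ae in auto)
  then show ?thesis using l by simp
qed

text \<open>Parseval's identity, from the L2 convergence of the partial sums to
  \<open>u\<close>.\<close>

lemma inner_cf: "u \<in> L2 \<Longrightarrow> v \<in> L2 \<Longrightarrow> inner (cf u) (cf v) = inner0 u v"
proof -
  assume u: "u \<in> L2" and v: "v \<in> L2"
  have "(\<lambda>n. inner0 (psum (coord (cf u)) n) v) \<longlonglongrightarrow> inner0 u v"
    by (intro tendsto_inner0 psum_tendsto u v psum_L2)
  moreover have "(\<lambda>n. \<Sum>k<n. coord (cf u) k * coord (cf v) k) \<longlonglongrightarrow> inner (cf u) (cf v)"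
    using sums_inner_ell2 by (simp add: sums_def)
  ultimately show ?thesis
    using LIMSEQ_unique by (simp add: inner0_psum v coord_cf)
qed

lemma norm_cf: "u \<in> L2 \<Longrightarrow> norm (cf u) = norm0 u"
  by (simp add: norm_eq_sqrt_inner inner_cf norm0_def)

section \<open>Sine series representation of the Sobolev spaces\<close>

text \<open>The inverse of minus the second derivative with zero boundary values, in sine
  coordinates. It recovers the coefficients of a function in \<open>V\<close> from its
  \<open>lap\<close>, and \<open>norm (J z)\<close> serves as the weak norm of a
  displacement.\<close>

definition J :: "ell2 \<Rightarrow> ell2" where "J = mulop (\<lambda>k. 1 / (freq k)\<^sup>2)"

lemma inverse_freq_square_le_1: "\<bar>1 / (freq k)\<^sup>2\<bar> \<le> 1"
proof -
  have "1 \<le> (freq k)\<^sup>2" using freq_ge_1[of k] by (rule one_le_power)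
  then show ?thesis by simp
qed

lemma coord_J: "coord (J z) k = coord z k / (freq k)\<^sup>2"
  unfolding J_def by (simp add: coord_mulop_bdd[OF inverse_freq_square_le_1])

lemma norm_J_le: "norm (J z) \<le> norm z"
  unfolding J_def using norm_mulop_le[OF inverse_freq_square_le_1] by simp

lemma bounded_linear_J: "bounded_linear J"
  unfolding J_def by (rule bounded_linear_mulop[OF inverse_freq_square_le_1])

lemma J_zero [simp]: "J 0 = 0"
  using linear_0[OF bounded_linear.linear[OF bounded_linear_J]] .

lemma J_diff: "J (x - y) = J x - J y"
  using linear_diff[OF bounded_linear.linear[OF bounded_linear_J]] .

lemma J_minus: "J (- x) = - J x"
  using linear_neg[OF bounded_linear.linear[OF bounded_linear_J]] .

lemma inner_J: "inner (J x) y = inner x (J y)"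
  by (simp add: inner_ell2_def coord_J mult.commute)

section \<open>Absolute convergence of the series and the embedding into C1\<close>

definition freq_inv :: ell2 where "freq_inv = Ell (\<lambda>k. 1 / freq k)"

lemma coord_freq_inv: "coord freq_inv k = 1 / freq k"
proof -
  have "summable (\<lambda>k. (1 / freq k)\<^sup>2)"
    using sums_summable[OF inverse_squares_sums] by (simp add: freq_def power_divide add.commute)
  then show ?thesis by (simp add: freq_inv_def coord_Ell)
qed

definition absell :: "ell2 \<Rightarrow> ell2" where "absell z = Ell (\<lambda>k. \<bar>coord z k\<bar>)"

lemma coord_absell: "coord (absell z) k = \<bar>coord z k\<bar>"
  unfolding absell_def by (simp add: coord_Ell summable_coord)

lemma norm_absell: "norm (absell z) = norm z"
  unfolding norm_ell2_def inner_ell2_def by (simp add: coord_absell)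

text \<open>Cauchy-Schwarz against the square summable sequence of inverse wave numbers. It makes
  the series for u and u_x converge absolutely and uniformly; the pointwise bounds on the cable term
  rest on this embedding.\<close>

lemma summable_coord_div_freq: "summable (\<lambda>k. \<bar>coord z k\<bar> / freq k)"
  and suminf_coord_div_freq_le: "(\<Sum>k. \<bar>coord z k\<bar> / freq k) \<le> norm z * norm freq_inv"
proof -
  have s: "(\<lambda>k. \<bar>coord z k\<bar> / freq k) sums inner (absell z) freq_inv"
    using sums_inner_ell2[of "absell z" freq_inv] by (simp add: coord_absell coord_freq_inv)
  then show "summable (\<lambda>k. \<bar>coord z k\<bar> / freq k)" by (rule sums_summable)
  show "(\<Sum>k. \<bar>coord z k\<bar> / freq k) \<le> norm z * norm freq_inv"
    using s norm_cauchy_schwarz[of "absell z" freq_inv] by (simp add: sums_unique[symmetric] norm_absell)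
qed

text \<open>The function u in V with \<open>- u_xx\<close> represented by z, and its derivative.\<close>

definition vfun :: "ell2 \<Rightarrow> real \<Rightarrow> real" where
  "vfun z x = (\<Sum>k. coord (J z) k * sine k x)"

definition vfun' :: "ell2 \<Rightarrow> real \<Rightarrow> real" where
  "vfun' z x = (\<Sum>k. coord (J z) k * (freq k * cosine k x))"

lemma abs_sine_le: "\<bar>sine k x\<bar> \<le> sqrt (2 / pi)" and abs_cosine_le: "\<bar>cosine k x\<bar> \<le> sqrt (2 / pi)"
  unfolding sine_def cosine_def abs_mult
  using mult_left_mono[OF abs_sin_le_one, of "sqrt (2 / pi)" "freq k * x"]
    mult_left_mono[OF abs_cos_le_one, of "sqrt (2 / pi)" "freq k * x"] by auto

lemma abs_vfun_term:
  "\<bar>coord (J z) k * sine k x\<bar> \<le> sqrt (2 / pi) * (\<bar>coord z k\<bar> / freq k)"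
  "\<bar>coord (J z) k * (freq k * cosine k x)\<bar> \<le> sqrt (2 / pi) * (\<bar>coord z k\<bar> / freq k)"
proof -
  have "\<bar>coord z k\<bar> / (freq k)\<^sup>2 \<le> \<bar>coord z k\<bar> / freq k"
    using self_le_power[of "freq k" 2] freq_ge_1[of k] by (intro divide_left_mono) auto
  then have "\<bar>coord (J z) k\<bar> * \<bar>sine k x\<bar> \<le> (\<bar>coord z k\<bar> / freq k) * sqrt (2 / pi)"
    by (intro mult_mono abs_sine_le) (auto simp: coord_J intro!: divide_nonneg_pos)
  then show "\<bar>coord (J z) k * sine k x\<bar> \<le> sqrt (2 / pi) * (\<bar>coord z k\<bar> / freq k)"
    by (simp add: abs_mult mult.commute)
  have "\<bar>coord (J z) k * (freq k * cosine k x)\<bar> = \<bar>coord z k\<bar> / freq k * \<bar>cosine k x\<bar>"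
    using freq_pos(1)[of k] by (simp add: coord_J abs_mult power2_eq_square del: freq_pos(1))
  also have "\<dots> \<le> \<bar>coord z k\<bar> / freq k * sqrt (2 / pi)"
    by (intro mult_left_mono abs_cosine_le divide_nonneg_pos) auto
  finally show "\<bar>coord (J z) k * (freq k * cosine k x)\<bar> \<le> sqrt (2 / pi) * (\<bar>coord z k\<bar> / freq k)"
    by (simp add: mult.commute)
qed

lemma deriv_psum: "deriv (psum a n) = (\<lambda>x. \<Sum>k<n. a k * (freq k * cosine k x))"
  unfolding psum_def
  by (rule deriv_eqI, intro DERIV_sum DERIV_cmult) (use smoothD(1)[OF smooth_sine] in \<open>simp add: deriv_sine\<close>)

lemma deriv2_psum: "(deriv ^^ 2) (psum (coord (J z)) n) = (\<lambda>x. - psum (coord z) n x)"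
proof -
  have "deriv (deriv (psum (coord (J z)) n)) = (\<lambda>x. \<Sum>k<n. coord (J z) k * (freq k * (- freq k * sine k x)))"
    unfolding deriv_psum
    by (rule deriv_eqI, intro DERIV_sum DERIV_cmult) (use smoothD(1)[OF smooth_cosine] in \<open>simp add: deriv_cosine\<close>)
  also have "\<dots> = (\<lambda>x. - psum (coord z) n x)"
    by (simp add: psum_def coord_J power2_eq_square sum_negf)
  finally show ?thesis by (simp add: numeral_2_eq_2)
qed

lemma vfun_uniform:
  "uniform_limit UNIV (\<lambda>n x. psum (coord (J z)) n x) (vfun z) sequentially"
  "uniform_limit UNIV (\<lambda>n x. deriv (psum (coord (J z)) n) x) (vfun' z) sequentially"
proof -
  have s: "summable (\<lambda>k. sqrt (2 / pi) * (\<bar>coord z k\<bar> / freq k))"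
    by (intro summable_mult summable_coord_div_freq)
  show "uniform_limit UNIV (\<lambda>n x. psum (coord (J z)) n x) (vfun z) sequentially"
    unfolding psum_def vfun_def[abs_def]
    by (rule Weierstrass_m_test[OF _ s]) (simp only: real_norm_def abs_vfun_term)
  show "uniform_limit UNIV (\<lambda>n x. deriv (psum (coord (J z)) n) x) (vfun' z) sequentially"
    unfolding deriv_psum vfun'_def[abs_def]
    by (rule Weierstrass_m_test[OF _ s]) (simp only: real_norm_def abs_vfun_term)
qed

lemma vfun_summable:
  "summable (\<lambda>k. coord (J z) k * sine k x)" "summable (\<lambda>k. coord (J z) k * (freq k * cosine k x))"
proof -
  have s: "summable (\<lambda>k. sqrt (2 / pi) * (\<bar>coord z k\<bar> / freq k))"
    by (intro summable_mult summable_coord_div_freq)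
  show "summable (\<lambda>k. coord (J z) k * sine k x)" "summable (\<lambda>k. coord (J z) k * (freq k * cosine k x))"
    by (rule summable_comparison_test'[OF s]; simp only: real_norm_def abs_vfun_term)+
qed

text \<open>The constant of the embedding: by \<open>vfun'_bound\<close> it bounds the sup norm of
  u_x in terms of the L2 norm of u_xx.\<close>

definition Cv :: real where "Cv = sqrt (2 / pi) * norm freq_inv"

lemma Cv_nonneg: "0 \<le> Cv" by (simp add: Cv_def)

lemma vfun'_bound: "\<bar>vfun' z x\<bar> \<le> Cv * norm z"
proof -
  have s: "summable (\<lambda>k. sqrt (2 / pi) * (\<bar>coord z k\<bar> / freq k))"
    by (intro summable_mult summable_coord_div_freq)
  have "\<bar>vfun' z x\<bar> \<le> (\<Sum>k. sqrt (2 / pi) * (\<bar>coord z k\<bar> / freq k))"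
    unfolding vfun'_def
    by (rule norm_suminf_le[OF _ s, where f="\<lambda>k. coord (J z) k * (freq k * cosine k x)", unfolded real_norm_def])
      (rule abs_vfun_term)
  also have "\<dots> = sqrt (2 / pi) * (\<Sum>k. \<bar>coord z k\<bar> / freq k)"
    by (rule suminf_mult[OF summable_coord_div_freq])
  also have "\<dots> \<le> sqrt (2 / pi) * (norm z * norm freq_inv)"
    by (intro mult_left_mono suminf_coord_div_freq_le) simp
  finally show ?thesis by (simp add: Cv_def mult_ac)
qed

lemma vfun_continuous: "continuous_on S (vfun z)" "continuous_on S (vfun' z)"
proof -
  have "continuous_on UNIV (vfun z)"
    by (rule uniform_limit_theorem[OF _ vfun_uniform(1)]) (auto intro: always_eventually smooth_continuous smooth_psum)
  then show "continuous_on S (vfun z)" by (rule continuous_on_subset) simp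
  have "continuous_on UNIV (vfun' z)"
    by (rule uniform_limit_theorem[OF _ vfun_uniform(2)]) (auto intro: always_eventually smooth_continuous smoothD smooth_psum)
  then show "continuous_on S (vfun' z)" by (rule continuous_on_subset) simp
qed

lemma vfun_L2 [simp]: "vfun z \<in> L2" "vfun' z \<in> L2"
  by (intro L2_continuous vfun_continuous)+

lemma vfun_ends: "vfun z 0 = 0" "vfun z pi = 0"
  by (simp_all add: vfun_def)

lemma vfun_add: "vfun (y + z) x = vfun y x + vfun z x" and vfun'_add: "vfun' (y + z) x = vfun' y x + vfun' z x"
  using vfun_summable[of y x] vfun_summable[of z x]
  by (simp_all add: vfun_def vfun'_def coord_J add_divide_distrib distrib_right suminf_add)

lemma vfun_scale: "vfun (c *\<^sub>R z) x = c * vfun z x" and vfun'_scale: "vfun' (c *\<^sub>R z) x = c * vfun' z x"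
proof -
  have "coord (J (c *\<^sub>R z)) k * y = c * (coord (J z) k * y)" for k y by (simp add: coord_J)
  then show "vfun (c *\<^sub>R z) x = c * vfun z x" "vfun' (c *\<^sub>R z) x = c * vfun' z x"
    unfolding vfun_def vfun'_def by (simp_all only: suminf_mult[OF vfun_summable(1)] suminf_mult[OF vfun_summable(2)])
qed

lemma vfun'_diff: "vfun' (y - z) x = vfun' y x - vfun' z x"
  using vfun'_add[of y "-1 *\<^sub>R z" x] vfun'_scale[of "-1" z x] by simp

lemma uniform_limit_norm0:
  assumes lim: "uniform_limit UNIV f F sequentially" and f: "\<And>n. f n \<in> L2" and F: "F \<in> L2"
  shows "(\<lambda>n. norm0 (\<lambda>x. f n x - F x)) \<longlonglongrightarrow> 0"
proof (rule tendstoI)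
  fix e :: real assume e: "0 < e"
  have d: "0 < e / (2 * sqrt pi)" using e by simp
  have "\<forall>\<^sub>F n in sequentially. \<forall>x\<in>UNIV. dist (f n x) (F x) < e / (2 * sqrt pi)"
    by (rule uniform_limitD[OF lim d])
  then show "\<forall>\<^sub>F n in sequentially. dist (norm0 (\<lambda>x. f n x - F x)) 0 < e"
  proof eventually_elim
    case (elim n)
    have "norm0 (\<lambda>x. f n x - F x) \<le> sqrt pi * (e / (2 * sqrt pi))"
      using elim by (intro norm0_le_sup L2_measurable L2_diff f F) (auto simp: dist_real_def less_imp_le)
    also have "\<dots> < e" using e by simp
    finally show ?case by simp
  qed
qed

lemma psum_vfun:
  "(\<lambda>n. norm0 (\<lambda>x. psum (coord (J z)) n x - vfun z x)) \<longlonglongrightarrow> 0"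
  "(\<lambda>n. norm0 (\<lambda>x. deriv (psum (coord (J z)) n) x - vfun' z x)) \<longlonglongrightarrow> 0"
  by (intro uniform_limit_norm0 vfun_uniform vfun_L2 smooth_L2 smoothD smooth_psum)+

text \<open>The partial sums and their first derivatives converge uniformly, their second
  derivatives only in L2; closedness of the weak derivative covers both cases.\<close>

lemma hw_vfun: "hw 1 (vfun z) (vfun' z)" "hw 2 (vfun z) (\<lambda>x. - sy z x)"
proof -
  show "hw 1 (vfun z) (vfun' z)"
  proof (rule hw_limit[OF _ _ _ psum_vfun])
    show "hw 1 (psum (coord (J z)) n) (deriv (psum (coord (J z)) n))" for n
      using hw_smooth[OF smooth_psum, of 1] by simp
  qed simp_all
  show "hw 2 (vfun z) (\<lambda>x. - sy z x)"
  proof (rule hw_limit[OF _ _ _ psum_vfun(1)])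
    show "hw 2 (psum (coord (J z)) n) (\<lambda>x. - psum (coord z) n x)" for n
      by (rule hw_smooth[OF smooth_psum[of "coord (J z)" n], of 2, unfolded deriv2_psum])
    have "norm0 (\<lambda>x. - psum (coord z) n x - - sy z x) = norm0 (\<lambda>x. psum (coord z) n x - sy z x)" for n
      using norm0_diff_commute[of "sy z" "psum (coord z) n"] by simp
    then show "(\<lambda>n. norm0 (\<lambda>x. - psum (coord z) n x - - sy z x)) \<longlonglongrightarrow> 0"
      using psum_tendsto[OF sy_L2[of z]] by simp
    show "(\<lambda>x. - sy z x) \<in> L2" using L2_scale[OF sy_L2[of z], of "-1"] by simp
  qed simp_all
qed

lemma norm_Hk_eq:
  assumes "\<And>j. j \<le> k \<Longrightarrow> hw j u (v j)"
  shows "norm_Hk k u = sqrt (\<Sum>j\<le>k. (norm0 (v j))\<^sup>2)"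
proof -
  have "norm0 (wderiv j u) = norm0 (v j)" if "j \<le> k" for j
    using hw_wderiv[OF assms[OF that]] by (intro norm0_cong_AE)
  then show ?thesis unfolding norm_Hk_def by simp
qed

lemma norm_Hk_1_eq:
  assumes "hw 1 u v"
  shows "norm_Hk 1 u = sqrt ((norm0 u)\<^sup>2 + (norm0 v)\<^sup>2)"
proof -
  have "hw j u (if j = 0 then u else v)" if "j \<le> 1" for j
    using that assms hw_0[OF hw_L2(1)[OF assms]] by (cases j) auto
  from norm_Hk_eq[OF this] show ?thesis by simp
qed

lemma cf_vfun: "cf (vfun z) = J z"
  by (rule cf_of_psum_limit[OF vfun_L2(1) psum_vfun(1)])

text \<open>The minus sign makes the weights in \<open>cf u = J (lap u)\<close> positive on
  \<open>V\<close>; there \<open>norm2 u\<close> is the norm of \<open>lap u\<close>.\<close>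

definition lap :: "(real \<Rightarrow> real) \<Rightarrow> ell2" where "lap u = - cf (wderiv 2 u)"

lemma hw_vfun_cong:
  assumes "AE x in I_leb. u x = vfun z x"
  shows "hw 1 u (vfun' z)" "hw 2 u (\<lambda>x. - sy z x)" "u \<in> L2"
proof -
  have ae: "AE x in I_leb. vfun z x = u x" using assms by eventually_elim simp
  show "hw 1 u (vfun' z)" "hw 2 u (\<lambda>x. - sy z x)"
    by (rule hw_cong[OF hw_vfun(1) ae] hw_cong[OF hw_vfun(2) ae]; simp)+
  show "u \<in> L2" by (rule L2_cong_AE[OF vfun_L2(1) ae])
qed

text \<open>Membership in \<open>H10\<close> takes two approximations: a partial sum of the series,
  smooth and zero at the ends, and then its product with a cutoff, which is a test function. The
  four errors, two in the function and two in its derivative, are each kept below e/4.\<close>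

lemma V_of_vfun:
  assumes ae: "AE x in I_leb. u x = vfun z x"
  shows "u \<in> V" "lap u = z" "cf u = J z"
    "AE x in I_leb. wderiv 1 u x = vfun' z x" "AE x in I_leb. wderiv 2 u x = - sy z x"
proof -
  note h = hw_vfun_cong[OF ae]
  show w1: "AE x in I_leb. wderiv 1 u x = vfun' z x" by (rule hw_wderiv(1)[OF h(1)])
  show w2: "AE x in I_leb. wderiv 2 u x = - sy z x" by (rule hw_wderiv(1)[OF h(2)])
  have "cf (wderiv 2 u) = cf (\<lambda>x. (-1) * sy z x)"
    using w2 by (subst cf_eq_iff) (auto intro: hw_wderiv(2)[OF h(2)] L2_scale[of "sy z" "-1", simplified])
  then show "lap u = z" using cf_scale[OF sy_L2[of z], of "-1"] by (simp add: lap_def)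
  show "cf u = J z"
    using cf_eq_iff[OF h(3) vfun_L2(1)] ae by (simp add: cf_vfun)
  have "\<exists>v. hw j u v" if "j \<le> 2" for j
  proof -
    have "j = 0 \<or> j = 1 \<or> j = 2" using that by auto
    then show ?thesis using hw_0[OF h(3)] h(1,2) by blast
  qed
  then have H2: "u \<in> Hk 2" using h(3) by (simp add: Hk_iff)
  then have H1: "u \<in> Hk 1" by (simp add: Hk_iff)
  have "\<exists>\<phi>\<in>test_fun. norm_Hk 1 (\<lambda>x. u x - \<phi> x) < e" if e: "0 < e" for e
  proof -
    have "\<forall>\<^sub>F n in sequentially. norm0 (\<lambda>x. psum (coord (J z)) n x - vfun z x) < e / 4"
      "\<forall>\<^sub>F n in sequentially. norm0 (\<lambda>x. deriv (psum (coord (J z)) n) x - vfun' z x) < e / 4"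
      using order_tendstoD(2)[OF psum_vfun(1), of "e/4"] order_tendstoD(2)[OF psum_vfun(2), of "e/4"] e by auto
    then have "\<forall>\<^sub>F n in sequentially. norm0 (\<lambda>x. psum (coord (J z)) n x - vfun z x) < e / 4
        \<and> norm0 (\<lambda>x. deriv (psum (coord (J z)) n) x - vfun' z x) < e / 4" by (rule eventually_conj)
    then obtain n where n: "norm0 (\<lambda>x. psum (coord (J z)) n x - vfun z x) < e / 4"
        "norm0 (\<lambda>x. deriv (psum (coord (J z)) n) x - vfun' z x) < e / 4"
      using eventually_happens'[OF trivial_limit_sequentially] by blast
    define s where "s = psum (coord (J z)) n"
    have s: "smooth s" "s 0 = 0" "s pi = 0" by (simp_all add: s_def smooth_psum) (simp_all add: psum_def)
    have "\<forall>\<^sub>F m in sequentially. norm0 (\<lambda>x. cutoff m x * s x - s x) < e / 4"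
      "\<forall>\<^sub>F m in sequentially. norm0 (\<lambda>x. deriv (\<lambda>x. cutoff m x * s x) x - deriv s x) < e / 4"
      using order_tendstoD(2)[OF cutoff_approx(1)[OF s], of "e/4"] order_tendstoD(2)[OF cutoff_approx(2)[OF s], of "e/4"] e by auto
    then have "\<forall>\<^sub>F m in sequentially. norm0 (\<lambda>x. cutoff m x * s x - s x) < e / 4
      \<and> norm0 (\<lambda>x. deriv (\<lambda>x. cutoff m x * s x) x - deriv s x) < e / 4" by (rule eventually_conj)
    then obtain m where m: "norm0 (\<lambda>x. cutoff m x * s x - s x) < e / 4"
      "norm0 (\<lambda>x. deriv (\<lambda>x. cutoff m x * s x) x - deriv s x) < e / 4"
      using eventually_happens'[OF trivial_limit_sequentially] by blast
    define \<phi> where "\<phi> x = cutoff m x * s x" for x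
    have \<phi>: "\<phi> \<in> test_fun" unfolding \<phi>_def by (rule cutoff_mult_test_fun[OF s(1)])
    have hh: "hw 1 (\<lambda>x. u x - \<phi> x) (\<lambda>x. vfun' z x - deriv \<phi> x)"
      using hw_diff[OF h(1) hw_smooth[OF test_fun_smooth[OF \<phi>], of 1]] by simp
    have L: "s \<in> L2" "deriv s \<in> L2" "\<phi> \<in> L2" "deriv \<phi> \<in> L2"
      by (intro smooth_L2 smoothD s(1) test_fun_smooth \<phi>)+
    have "norm0 (\<lambda>x. u x - \<phi> x) = norm0 (\<lambda>x. (vfun z x - s x) + (s x - \<phi> x))"
      by (rule norm0_cong_AE) (use ae L h(3) in \<open>auto intro: L2_diff\<close>)
    also have "\<dots> \<le> norm0 (\<lambda>x. vfun z x - s x) + norm0 (\<lambda>x. s x - \<phi> x)"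
      by (intro norm0_triangle L2_diff vfun_L2 L)
    also have "\<dots> < e / 4 + e / 4"
      using n(1) m(1) norm0_diff_commute[of "vfun z" s] norm0_diff_commute[of s \<phi>]
      by (simp add: s_def \<phi>_def)
    finally have 1: "norm0 (\<lambda>x. u x - \<phi> x) < e / 2" by simp
    have "norm0 (\<lambda>x. vfun' z x - deriv \<phi> x) = norm0 (\<lambda>x. (vfun' z x - deriv s x) + (deriv s x - deriv \<phi> x))"
      by simp
    also have "\<dots> \<le> norm0 (\<lambda>x. vfun' z x - deriv s x) + norm0 (\<lambda>x. deriv s x - deriv \<phi> x)"
      by (intro norm0_triangle L2_diff vfun_L2 L)
    also have "\<dots> < e / 4 + e / 4"
      using n(2) m(2) norm0_diff_commute[of "vfun' z" "deriv s"] norm0_diff_commute[of "deriv s" "deriv \<phi>"]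
      by (simp add: s_def \<phi>_def[abs_def])
    finally have 2: "norm0 (\<lambda>x. vfun' z x - deriv \<phi> x) < e / 2" by simp
    have "norm_Hk 1 (\<lambda>x. u x - \<phi> x) \<le> norm0 (\<lambda>x. u x - \<phi> x) + norm0 (\<lambda>x. vfun' z x - deriv \<phi> x)"
      unfolding norm_Hk_1_eq[OF hh] by (rule sqrt_sum_squares_le_sum) simp_all
    then show ?thesis using 1 2 \<phi> by (intro bexI[of _ \<phi>]) auto
  qed
  then have "u \<in> H10" using H1 by (simp add: H10_def)
  then show "u \<in> V" using H2 by (simp add: V_def)
qed

text \<open>Cosines do not vanish at the ends, so this integration by parts is where the zero
  boundary values of \<open>u\<close> enter. It holds for test functions and passes to their closure
  in the H1 norm.\<close>

lemma H10_parts: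
  assumes u: "u \<in> H10" and h: "hw 1 u v"
  shows "inner0 v (cosine k) = freq k * inner0 u (sine k)"
proof -
  let ?d = "inner0 v (cosine k) - freq k * inner0 u (sine k)"
  let ?c = "norm0 (cosine k) + freq k * norm0 (sine k)"
  have c: "0 \<le> ?c" by (simp add: freq_pos(1) less_imp_le)
  have "\<bar>?d\<bar> \<le> e * ?c" if e: "0 < e" for e
  proof -
    obtain \<phi> where \<phi>: "\<phi> \<in> test_fun" "norm_Hk 1 (\<lambda>x. u x - \<phi> x) < e"
      using u e by (auto simp: H10_def)
    note L = hw_L2[OF h] test_fun_L2[OF \<phi>(1)] test_fun_L2[OF test_fun_deriv[OF \<phi>(1)]]
    have hh: "hw 1 (\<lambda>x. u x - \<phi> x) (\<lambda>x. v x - deriv \<phi> x)"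
      using hw_diff[OF h hw_smooth[OF test_fun_smooth[OF \<phi>(1)], of 1]] by simp
    have b: "norm0 (\<lambda>x. u x - \<phi> x) \<le> e" "norm0 (\<lambda>x. v x - deriv \<phi> x) \<le> e"
      using \<phi>(2) real_sqrt_sum_squares_ge1[of "norm0 (\<lambda>x. u x - \<phi> x)" "norm0 (\<lambda>x. v x - deriv \<phi> x)"]
        real_sqrt_sum_squares_ge2[of "norm0 (\<lambda>x. v x - deriv \<phi> x)" "norm0 (\<lambda>x. u x - \<phi> x)"]
      unfolding norm_Hk_1_eq[OF hh] by linarith+
    have "inner0 (deriv \<phi>) (cosine k) = freq k * inner0 \<phi> (sine k)"
      using inner0_deriv_parts[OF test_fun_smooth[OF \<phi>(1)] smooth_cosine, of k]
        inner0_scale_right[of \<phi> "- freq k" "sine k"]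
      by (simp add: test_fun_zero_ends[OF \<phi>(1)] deriv_cosine)
    then have "?d = inner0 (\<lambda>x. v x - deriv \<phi> x) (cosine k) - freq k * inner0 (\<lambda>x. u x - \<phi> x) (sine k)"
      by (simp add: inner0_diff L algebra_simps)
    also have "\<bar>\<dots>\<bar> \<le> \<bar>inner0 (\<lambda>x. v x - deriv \<phi> x) (cosine k)\<bar> + freq k * \<bar>inner0 (\<lambda>x. u x - \<phi> x) (sine k)\<bar>"
      using abs_triangle_ineq4 by (simp add: abs_mult order_trans[OF abs_triangle_ineq4] less_imp_le)
    also have "\<dots> \<le> e * norm0 (cosine k) + freq k * (e * norm0 (sine k))"
    proof -
      have 1: "\<bar>inner0 (\<lambda>x. v x - deriv \<phi> x) (cosine k)\<bar> \<le> e * norm0 (cosine k)"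
        by (rule order_trans[OF Cauchy_Schwarz_L2[OF L2_diff[OF L(2,4)] cosine_L2] mult_right_mono[OF b(2) norm0_nonneg]])
      have 2: "\<bar>inner0 (\<lambda>x. u x - \<phi> x) (sine k)\<bar> \<le> e * norm0 (sine k)"
        by (rule order_trans[OF Cauchy_Schwarz_L2[OF L2_diff[OF L(1,3)] sine_L2] mult_right_mono[OF b(1) norm0_nonneg]])
      show ?thesis by (intro add_mono 1 mult_left_mono 2) (simp add: less_imp_le)
    qed
    finally show ?thesis by (simp add: algebra_simps)
  qed
  then have le: "\<bar>?d\<bar> \<le> e * ?c" if "0 < e" for e using that .
  have "\<bar>?d\<bar> \<le> 0"
  proof (rule field_le_epsilon)
    fix e :: real assume e: "0 < e"
    have p: "0 < ?c + 1" using c by simp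
    have "\<bar>?d\<bar> \<le> e / (?c + 1) * ?c" using e p by (intro le divide_pos_pos)
    also have "\<dots> \<le> e"
    proof -
      have "e * ?c \<le> e * (?c + 1)" using e by (intro mult_left_mono) auto
      then show ?thesis using p by (simp only: times_divide_eq_left pos_divide_le_eq)
    qed
    finally show "\<bar>?d\<bar> \<le> 0 + e" by simp
  qed
  then show ?thesis by simp
qed

lemma V_hw:
  assumes "u \<in> V"
  shows "hw 1 u (wderiv 1 u)" "hw 2 u (wderiv 2 u)" "hw 1 (wderiv 1 u) (wderiv 2 u)" "u \<in> L2"
    "wderiv 1 u \<in> L2" "wderiv 2 u \<in> L2"
proof -
  have "u \<in> Hk 2" using assms by (simp add: V_def)
  then have e: "\<exists>v. hw 1 u v" "\<exists>v. hw 2 u v" and L: "u \<in> L2" by (simp_all add: Hk_iff)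
  obtain v z where vz: "hw 1 u v" "hw 2 u z" using e by blast
  show h: "hw 1 u (wderiv 1 u)" "hw 2 u (wderiv 2 u)" "u \<in> L2" "wderiv 1 u \<in> L2" "wderiv 2 u \<in> L2"
    by (rule hw_wderiv[OF vz(1)] hw_wderiv[OF vz(2)] L)+
  show "hw 1 (wderiv 1 u) (wderiv 2 u)"
    by (rule hw_split[OF h(1)]) (use h(2) in \<open>simp add: numeral_2_eq_2\<close>)
qed

text \<open>The sine coefficients of u and of - u_xx are related by two integrations by parts,
  \<open>H10_parts\<close> against the cosine and \<open>hw_parts\<close> against the sine;
  completeness of the sines then gives equality almost everywhere.\<close>

lemma V_vfun:
  assumes u: "u \<in> V"
  shows "AE x in I_leb. u x = vfun (lap u) x"
proof -
  note h = V_hw[OF u]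
  have "coord (cf u) k = coord (cf (vfun (lap u))) k" for k
  proof -
    have a: "inner0 (wderiv 1 u) (cosine k) = freq k * inner0 u (sine k)"
      using u by (intro H10_parts h) (simp add: V_def)
    have b: "freq k * inner0 (wderiv 1 u) (cosine k) = - inner0 (wderiv 2 u) (sine k)"
      using hw_parts[OF h(3) smooth_sine, of k] by (simp add: deriv_sine inner0_scale_right)
    have "(freq k)\<^sup>2 * inner0 u (sine k) = coord (lap u) k"
      using b unfolding a by (simp add: lap_def coord_cf h power2_eq_square mult.assoc)
    then show ?thesis by (simp add: coord_cf h cf_vfun coord_J field_simps)
  qed
  then have "cf u = cf (vfun (lap u))" by (rule ell2_eqI)
  then show ?thesis using cf_eq_iff[OF h(4) vfun_L2(1)] by simp
qed

lemma vfun_V [simp]: "vfun z \<in> V" and lap_vfun [simp]: "lap (vfun z) = z"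
  using V_of_vfun[of "vfun z" z] by auto

lemma cf_V: "u \<in> V \<Longrightarrow> cf u = J (lap u)"
  using V_of_vfun(3)[OF V_vfun] .

lemma wderiv1_V: "u \<in> V \<Longrightarrow> AE x in I_leb. wderiv 1 u x = vfun' (lap u) x"
  using V_of_vfun(4)[OF V_vfun] .

lemma V_lincomb:
  assumes u: "u \<in> V" and v: "v \<in> V"
  shows "(\<lambda>x. a * u x + b * v x) \<in> V" "lap (\<lambda>x. a * u x + b * v x) = a *\<^sub>R lap u + b *\<^sub>R lap v"
proof -
  have "AE x in I_leb. a * u x + b * v x = vfun (a *\<^sub>R lap u + b *\<^sub>R lap v) x"
    using V_vfun[OF u] V_vfun[OF v] by eventually_elim (simp add: vfun_add vfun_scale)
  from V_of_vfun[OF this] show "(\<lambda>x. a * u x + b * v x) \<in> V"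
    "lap (\<lambda>x. a * u x + b * v x) = a *\<^sub>R lap u + b *\<^sub>R lap v" by auto
qed

lemma V_diff:
  assumes u: "u \<in> V" and v: "v \<in> V"
  shows "(\<lambda>x. u x - v x) \<in> V" "lap (\<lambda>x. u x - v x) = lap u - lap v"
  using V_lincomb[OF u v, of 1 "-1"] by simp_all

lemma inner2_V: "u \<in> V \<Longrightarrow> v \<in> V \<Longrightarrow> inner2 u v = inner (lap u) (lap v)"
  by (simp add: inner2_def lap_def inner_cf V_hw)

lemma norm2_V: "u \<in> V \<Longrightarrow> norm2 u = norm (lap u)"
  by (simp add: norm2_def inner2_V norm_eq_sqrt_inner)

text \<open>Although \<open>f\<close> need not be differentiable, its pairing with v_x expands in
  its cosine coefficients. For \<open>f\<close> equal to \<open>hz\<close> this produces the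
  coefficients of the cable force.\<close>

lemma sums_inner0_wderiv1:
  assumes f: "f \<in> L2" and v: "v \<in> V"
  shows "(\<lambda>k. coord (cf v) k * (freq k * inner0 f (cosine k))) sums inner0 f (wderiv 1 v)"
proof -
  have "(\<lambda>n. inner0 (deriv (psum (coord (J (lap v))) n)) f) \<longlonglongrightarrow> inner0 (vfun' (lap v)) f"
    by (intro tendsto_inner0 psum_vfun vfun_L2 f smooth_L2 smoothD smooth_psum)
  moreover have "inner0 (deriv (psum (coord (J (lap v))) n)) f
      = (\<Sum>k<n. coord (cf v) k * (freq k * inner0 f (cosine k)))" for n
    unfolding deriv_psum cf_V[OF v]
    by (simp add: inner0_sum L2_scale f inner0_scale) (simp add: inner0_commute)
  moreover have "inner0 (vfun' (lap v)) f = inner0 f (wderiv 1 v)"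
    unfolding inner0_commute[of _ f]
    by (rule inner0_cong_AE[OF f vfun_L2(2)]) (use wderiv1_V[OF v] in auto)
  ultimately show ?thesis by (simp add: sums_def)
qed

lemma freq_inner0_wderiv1:
  assumes u: "u \<in> V"
  shows "freq k * inner0 (wderiv 1 u) (cosine k) = coord (lap u) k"
  using hw_parts[OF V_hw(3)[OF u] smooth_sine, of k]
  by (simp add: deriv_sine inner0_scale_right lap_def coord_cf V_hw(6)[OF u])

lemma inner1_V:
  assumes u: "u \<in> V" and v: "v \<in> V"
  shows "inner1 u v = inner (lap u) (cf v)"
proof -
  have "(\<lambda>k. coord (cf v) k * coord (lap u) k) sums inner1 u v"
    using sums_inner0_wderiv1[OF V_hw(5)[OF u] v] unfolding freq_inner0_wderiv1[OF u] inner1_def .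
  moreover have "(\<lambda>k. coord (cf v) k * coord (lap u) k) sums inner (lap u) (cf v)"
    using sums_inner_ell2[of "lap u" "cf v"] by (simp add: mult.commute)
  ultimately show ?thesis by (rule sums_unique2)
qed

lemma norm1_V: "u \<in> V \<Longrightarrow> (norm1 u)\<^sup>2 = inner (lap u) (J (lap u))"
proof -
  assume u: "u \<in> V"
  have "(norm1 u)\<^sup>2 = inner1 u u" unfolding norm1_def inner1_def by (rule real_sqrt_pow2[OF inner0_nonneg])
  then show ?thesis using inner1_V[OF u u] by (simp add: cf_V u)
qed

section \<open>Boundary values and the fourth order domain\<close>

lemma zero_on_bd_V: "u \<in> V \<Longrightarrow> zero_on_bd u"
  unfolding zero_on_bd_def using V_vfun[of u] vfun_continuous(1) vfun_ends by blast

lemma integrable_indicator_I_leb: "A \<in> sets lebesgue \<Longrightarrow> integrable I_leb (indicat_real A)"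
  by (rule I_leb.integrable_const_bound[where B=1])
    (auto intro: measurable_restrict_space1[OF borel_measurable_indicator] simp del: borel_measurable_indicator_iff)

lemma integral_layer_le:
  assumes "0 \<le> d"
  shows "(LINT x|I_leb. indicator {..d} x) \<le> d" "(LINT x|I_leb. indicator {pi - d..} x) \<le> d"
proof -
  have *: "(LINT x|I_leb. indicator A x) \<le> d" if A: "A \<in> sets lebesgue" "A \<inter> I_set \<subseteq> {a..a + d}" for A a
  proof -
    have "(LINT x|I_leb. indicator A x) = measure I_leb (A \<inter> I_set)" by simp
    also have "\<dots> = measure lebesgue (A \<inter> I_set)" by (subst measure_restrict_space) auto
    also have "\<dots> \<le> measure lebesgue {a..a + d}"
      using A by (intro measure_mono_fmeasurable sets.Int) auto
    finally show ?thesis using assms by simp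
  qed
  show "(LINT x|I_leb. indicator {..d} x) \<le> d" by (rule *[of _ 0]) (auto simp: I_set_def)
  show "(LINT x|I_leb. indicator {pi - d..} x) \<le> d" by (rule *[of _ "pi - d"]) (auto simp: I_set_def)
qed

text \<open>The counterpart of \<open>H10_parts\<close> for boundary values given by a continuous
  representative U instead of by approximation. Testing with cutoff times cosine leaves a term with
  the derivative of the cutoff; it is of order n on layers of total length 4/(n+2), where U is small
  by continuity.\<close>

lemma zero_on_bd_parts:
  assumes h: "hw 1 z z1" and bd: "zero_on_bd z"
  shows "inner0 z1 (cosine k) = freq k * inner0 z (sine k)"
proof -
  obtain U where U: "continuous_on {0..pi} U" "AE x in I_leb. z x = U x" "U 0 = 0" "U pi = 0"
    using bd by (auto simp: zero_on_bd_def)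
  note Lz = hw_L2[OF h]
  have UL: "U \<in> L2" using L2_continuous[OF U(1)] .
  have hU: "hw 1 U z1" by (rule hw_cong[OF h U(2)]) simp
  define D where "D n x = deriv (cutoff n) x * cosine k x" for n x
  have Ds: "smooth (D n)" for n unfolding D_def by (intro smooth_mult smoothD smooth_cutoff smooth_cosine)
  have DL: "D n \<in> L2" for n by (rule smooth_L2[OF Ds])
  obtain C where C: "0 \<le> C" "\<And>n x. \<bar>deriv (cutoff n) x\<bar> \<le> C * (real n + 2) * (indicator {..2 / (real n + 2)} x + indicator {pi - 2 / (real n + 2)..} x)"
    using deriv_cutoff_bound by blast
  define c where "c = sqrt (2 / pi)"
  have c: "0 < c" by (simp add: c_def)
  have "(\<lambda>n. inner0 U (D n)) \<longlonglongrightarrow> 0"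
  proof (rule LIMSEQ_I)
    fix r :: real assume r: "0 < r"
    \<comment> \<open>Chosen so that the final bound, e times 4 C c, stays below r; the summand 1
      covers C = 0.\<close>
    define e where "e = r / (4 * C * c + 1)"
    have p: "0 < 4 * C * c + 1" using C(1) c by (intro add_nonneg_pos mult_nonneg_nonneg) auto
    have e: "0 < e" using r p by (simp add: e_def)
    obtain d1 where d1: "0 < d1" "\<And>x. x \<in> {0..pi} \<Longrightarrow> \<bar>x\<bar> < d1 \<Longrightarrow> \<bar>U x\<bar> < e"
      using U(1) e U(3) unfolding continuous_on_iff dist_real_def by (metis atLeastAtMost_iff diff_zero pi_ge_zero order_refl)
    obtain d2 where d2: "0 < d2" "\<And>x. x \<in> {0..pi} \<Longrightarrow> \<bar>x - pi\<bar> < d2 \<Longrightarrow> \<bar>U x\<bar> < e"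
      using U(1) e U(4) unfolding continuous_on_iff dist_real_def by (metis atLeastAtMost_iff diff_zero pi_ge_zero order_refl)
    obtain N :: nat where N: "2 / d1 + 2 / d2 < N" using reals_Archimedean2 by blast
    have "\<bar>inner0 U (D n)\<bar> < r" if n: "N \<le> n" for n
    proof -
      let ?m = "real n + 2"
      let ?i = "\<lambda>x. indicator {..2 / ?m} x + indicator {pi - 2 / ?m..} x :: real"
      have "2 / d1 < ?m" "2 / d2 < ?m"
        using N n d1(1) d2(1) by (smt (verit) of_nat_le_iff divide_pos_pos)+
      then have md: "2 / ?m < d1" "2 / ?m < d2" using d1(1) d2(1) by (simp_all add: field_simps)
      have int: "integrable I_leb (\<lambda>x. e * (C * ?m * ?i x * c))"
        by (intro Bochner_Integration.integrable_mult_right Bochner_Integration.integrable_mult_left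
            Bochner_Integration.integrable_add integrable_indicator_I_leb) auto
      have "\<bar>inner0 U (D n)\<bar> \<le> (LINT x|I_leb. \<bar>U x * D n x\<bar>)"
        unfolding inner0_def by (rule integral_abs_bound)
      also have "\<dots> \<le> (LINT x|I_leb. e * (C * ?m * ?i x * c))"
      proof (rule integral_mono[OF _ int])
        show "integrable I_leb (\<lambda>x. \<bar>U x * D n x\<bar>)" using L2_mult_integrable[OF UL DL] by simp
        fix x assume "x \<in> space I_leb"
        then have x: "x \<in> {0..pi}" by (auto simp: I_set_def)
        have D: "\<bar>D n x\<bar> \<le> C * ?m * ?i x * c"
          unfolding D_def abs_mult c_def using C(1)
          by (intro mult_mono C abs_cosine_le mult_nonneg_nonneg add_nonneg_nonneg) auto
        show "\<bar>U x * D n x\<bar> \<le> e * (C * ?m * ?i x * c)"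
        proof (cases "?i x = 0")
          case True
          then have "D n x = 0" using D by simp
          then show ?thesis using True by simp
        next
          case False
          then have "x \<le> 2 / ?m \<or> pi - 2 / ?m \<le> x" by (auto simp: indicator_def split: if_splits)
          then have "\<bar>U x\<bar> \<le> e" using d1(2)[OF x] d2(2)[OF x] md x by (auto intro: less_imp_le)
          then show ?thesis unfolding abs_mult using D e by (intro mult_mono) auto
        qed
      qed
      also have "\<dots> = e * C * ?m * c * ((LINT x|I_leb. indicator {..2 / ?m} x) + (LINT x|I_leb. indicator {pi - 2 / ?m..} x))"
      proof -
        have i: "integrable I_leb (indicat_real {..2 / ?m})" "integrable I_leb (indicat_real {pi - 2 / ?m..})"
          by (intro integrable_indicator_I_leb; simp)+
        have "(LINT x|I_leb. e * (C * ?m * ?i x * c)) = (LINT x|I_leb. (e * C * ?m * c) * ?i x)"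
          by (simp add: mult_ac)
        also have "\<dots> = e * C * ?m * c * (LINT x|I_leb. ?i x)" by (rule integral_mult_right_zero)
        finally show ?thesis using i by simp
      qed
      also have "\<dots> \<le> e * C * ?m * c * (2 / ?m + 2 / ?m)"
        using e C(1) c by (intro mult_left_mono add_mono integral_layer_le mult_nonneg_nonneg) auto
      also have "\<dots> = e * C * c * (?m * (2 / ?m + 2 / ?m))" by (simp only: mult_ac)
      also have "2 / ?m + 2 / ?m = 4 / ?m" by simp
      also have "?m * (4 / ?m) = 4"
        unfolding times_divide_eq_right by (rule nonzero_mult_div_cancel_left) linarith
      also have "e * C * c * 4 = e * (4 * C * c)" by simp
      also have "\<dots> < e * (4 * C * c + 1)" using e by simp
      also have "\<dots> = r" using p by (simp add: e_def)
      finally show ?thesis .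
    qed
    then show "\<exists>no. \<forall>n\<ge>no. norm (inner0 U (D n) - 0) < r" by auto
  qed
  moreover have "(\<lambda>n. inner0 (\<lambda>x. cutoff n x * sine k x) U) \<longlonglongrightarrow> inner0 (sine k) U"
    by (intro tendsto_inner0 cutoff_tendsto smooth_sine sine_L2 UL test_fun_L2 cutoff_mult_test_fun)
  ultimately have l1: "(\<lambda>n. inner0 U (D n) - freq k * inner0 (\<lambda>x. cutoff n x * sine k x) U) \<longlonglongrightarrow> 0 - freq k * inner0 (sine k) U"
    by (intro tendsto_intros)
  have eq: "inner0 U (D n) - freq k * inner0 (\<lambda>x. cutoff n x * sine k x) U
      = - inner0 (\<lambda>x. cutoff n x * cosine k x) z1" for n
  proof -
    let ?\<phi> = "\<lambda>x. cutoff n x * cosine k x"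
    have t: "?\<phi> \<in> test_fun" by (rule cutoff_mult_test_fun[OF smooth_cosine])
    have "deriv ?\<phi> = (\<lambda>x. D n x - freq k * (cutoff n x * sine k x))"
    proof (rule deriv_eqI)
      show "(?\<phi> has_real_derivative D n x - freq k * (cutoff n x * sine k x)) (at x)" for x
        by (rule DERIV_cong[OF DERIV_mult[OF smoothD(1)[OF smooth_cutoff] smoothD(1)[OF smooth_cosine]]])
          (simp add: D_def deriv_cosine algebra_simps)
    qed
    then have "inner0 U (deriv ?\<phi>) = inner0 U (D n) - freq k * inner0 (\<lambda>x. cutoff n x * sine k x) U"
      by (simp add: inner0_diff_right UL DL L2_scale test_fun_L2 cutoff_mult_test_fun smooth_sine inner0_scale_right
          inner0_commute[of U "\<lambda>x. cutoff n x * sine k x"])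
    moreover have "inner0 U (deriv ?\<phi>) = - inner0 ?\<phi> z1"
      using hU t by (simp add: hw_def inner0_commute[of z1])
    ultimately show ?thesis by simp
  qed
  have "(\<lambda>n. - inner0 (\<lambda>x. cutoff n x * cosine k x) z1) \<longlonglongrightarrow> - inner0 (cosine k) z1"
    by (intro tendsto_minus tendsto_inner0 cutoff_tendsto smooth_cosine cosine_L2 Lz test_fun_L2 cutoff_mult_test_fun)
  with l1[unfolded eq] have "0 - freq k * inner0 (sine k) U = - inner0 (cosine k) z1"
    by (rule LIMSEQ_unique)
  moreover have "inner0 (sine k) U = inner0 z (sine k)"
    unfolding inner0_commute[of "sine k"] by (rule inner0_cong_AE[symmetric]) (use Lz U(2) in auto)
  ultimately show ?thesis by (simp add: inner0_commute)
qed

lemma sy_minus_AE: "AE x in I_leb. sy (- y) x = - sy y x"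
  using cf_eq_iff[of "sy (- y)" "\<lambda>x. (-1) * sy y x"] L2_scale[OF sy_L2[of y], of "-1"] cf_scale[OF sy_L2[of y], of "-1"]
  by simp

lemma wderiv2_of_lap_J:
  assumes u: "u \<in> V" and y: "lap u = J y"
  shows "AE x in I_leb. wderiv 2 u x = vfun (- y) x"
proof -
  have "cf (wderiv 2 u) = cf (vfun (- y))" using y by (simp add: lap_def cf_vfun J_minus minus_equation_iff)
  then show ?thesis using cf_eq_iff[OF V_hw(6)[OF u] vfun_L2(1)] by simp
qed

lemma hw_of_lap_J:
  assumes u: "u \<in> V" and y: "lap u = J y"
  shows "hw 3 u (vfun' (- y))" "hw 4 u (sy y)"
proof -
  note h = hw_vfun_cong[OF wderiv2_of_lap_J[OF assms]]
  have "hw (2 + 1) u (vfun' (- y))" by (rule hw_trans[OF V_hw(2)[OF u] h(1)])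
  then show "hw 3 u (vfun' (- y))" by simp
  have "AE x in I_leb. - sy (- y) x = sy y x" using sy_minus_AE[of y] by eventually_elim simp
  then have "hw 2 (wderiv 2 u) (sy y)" by (rule hw_cong[OF h(2), rotated]) simp
  from hw_trans[OF V_hw(2)[OF u] this] show "hw 4 u (sy y)" by simp
qed

text \<open>That \<open>lap u\<close> lies in the range of \<open>J\<close> says that u_xx belongs
  to \<open>V\<close> again. From left to right the boundary condition on u_xx enters through
  \<open>zero_on_bd_parts\<close>; conversely \<open>y\<close> represents the fourth
  derivative.\<close>

lemma Dom_iff: "u \<in> Dom \<longleftrightarrow> u \<in> V \<and> (\<exists>y. lap u = J y)"
proof
  assume u: "u \<in> Dom"
  then have "u \<in> Hk 4" "u \<in> H10" and bd: "zero_on_bd (wderiv 2 u)" by (auto simp: Dom_def)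
  then have V: "u \<in> V" by (auto simp: V_def Hk_iff)
  have ex: "\<exists>v. hw 3 u v" "\<exists>v. hw 4 u v" using \<open>u \<in> Hk 4\<close> by (simp_all add: Hk_iff)
  obtain v3 v4 where v: "hw 3 u v3" "hw 4 u v4" using ex by blast
  have h1: "hw 1 (wderiv 2 u) v3" by (rule hw_split[OF V_hw(2)[OF V]]) (use v in simp)
  have h2: "hw 1 v3 v4" by (rule hw_split[OF v(1)]) (use v in simp)
  have "coord (lap u) k = coord (J (cf v4)) k" for k
  proof -
    have "freq k * inner0 v3 (cosine k) = - inner0 v4 (sine k)"
      using hw_parts[OF h2 smooth_sine, of k] by (simp add: deriv_sine inner0_scale_right)
    then have "(freq k)\<^sup>2 * inner0 (wderiv 2 u) (sine k) = - inner0 v4 (sine k)"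
      using zero_on_bd_parts[OF h1 bd, of k] by (simp add: power2_eq_square mult.assoc)
    then show ?thesis
      using hw_L2(2)[OF h2] by (simp add: lap_def coord_cf V_hw[OF V] coord_J field_simps)
  qed
  then have "lap u = J (cf v4)" by (rule ell2_eqI)
  then show "u \<in> V \<and> (\<exists>y. lap u = J y)" using V by blast
next
  assume "u \<in> V \<and> (\<exists>y. lap u = J y)"
  then obtain y where V: "u \<in> V" and y: "lap u = J y" by blast
  have "\<exists>v. hw j u v" if "j \<le> 4" for j
  proof -
    have "j = 0 \<or> j = 1 \<or> j = 2 \<or> j = 3 \<or> j = 4" using that by auto
    then show ?thesis using hw_0[OF V_hw(4)[OF V]] V_hw(1,2)[OF V] hw_of_lap_J[OF V y] by blast
  qed
  then have "u \<in> Hk 4" using V_hw(4)[OF V] by (simp add: Hk_iff)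
  moreover have "wderiv 2 u \<in> V" using wderiv2_of_lap_J[OF V y] by (rule V_of_vfun(1))
  ultimately show "u \<in> Dom" using V zero_on_bd_V by (auto simp: Dom_def V_def)
qed

text \<open>The L2 norm of the fourth derivative controls the lower ones: \<open>J\<close> does not
  increase norms, and the first and third derivatives are bounded in the sup norm by the embedding
  constant.\<close>

lemma norm_Hk_4_le:
  assumes u: "u \<in> V" and y: "lap u = J y"
  shows "norm_Hk 4 u \<le> (3 + 2 * (sqrt pi * Cv)) * norm y"
proof -
  define v where "v j = (if j = 0 then u else if j = 1 then wderiv 1 u else if j = 2 then wderiv 2 u
     else if j = 3 then vfun' (- y) else sy y)" for j :: nat
  have "hw j u (v j)" if "j \<le> 4" for j
  proof -
    have "j = 0 \<or> j = 1 \<or> j = 2 \<or> j = 3 \<or> j = 4" using that by auto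
    then show ?thesis
      using hw_0[OF V_hw(4)[OF u]] V_hw(1,2)[OF u] hw_of_lap_J[OF u y] by (auto simp: v_def)
  qed
  then have "norm_Hk 4 u = L2_set (\<lambda>j. norm0 (v j)) {..4}" by (simp add: norm_Hk_eq L2_set_def)
  also have "\<dots> \<le> (\<Sum>j\<le>4. norm0 (v j))" by (rule L2_set_le_sum) simp
  also have "\<dots> = norm0 u + norm0 (wderiv 1 u) + norm0 (wderiv 2 u) + norm0 (vfun' (- y)) + norm0 (sy y)"
    by (simp add: v_def eval_nat_numeral atMost_Suc)
  also have "\<dots> \<le> norm y + sqrt pi * Cv * norm y + norm y + sqrt pi * Cv * norm y + norm y"
  proof (intro add_mono)
    have n: "norm (lap u) \<le> norm y" unfolding y by (rule norm_J_le)
    show "norm0 u \<le> norm y"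
      using norm_J_le[of "lap u"] n by (simp add: norm_cf[OF V_hw(4)[OF u], symmetric] cf_V[OF u])
    have v': "norm0 (vfun' x) \<le> sqrt pi * Cv * norm x" for x
    proof -
      have "norm0 (vfun' x) \<le> sqrt pi * (Cv * norm x)"
        by (intro norm0_le_sup vfun'_bound L2_measurable vfun_L2)
      then show ?thesis by simp
    qed
    have "norm0 (wderiv 1 u) = norm0 (vfun' (lap u))"
      by (rule norm0_cong_AE[OF V_hw(5)[OF u] wderiv1_V[OF u]])
    also have "\<dots> \<le> sqrt pi * Cv * norm (lap u)" by (rule v')
    also have "\<dots> \<le> sqrt pi * Cv * norm y" by (intro mult_left_mono n) (simp add: Cv_nonneg)
    finally show "norm0 (wderiv 1 u) \<le> sqrt pi * Cv * norm y" .
    show "norm0 (wderiv 2 u) \<le> norm y" using n by (simp add: lap_def norm_cf V_hw(6)[OF u])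
    show "norm0 (vfun' (- y)) \<le> sqrt pi * Cv * norm y" using v'[of "- y"] by simp
    show "norm0 (sy y) \<le> norm y" by (simp add: norm_cf[symmetric])
  qed
  finally show ?thesis by (simp add: algebra_simps)
qed

subsection \<open>The dual space\<close>

lemma V_dual_lincomb: "F \<in> V_dual \<Longrightarrow> u \<in> V \<Longrightarrow> v \<in> V \<Longrightarrow> F (\<lambda>x. a * u x + b * v x) = a * F u + b * F v"
  by (simp add: V_dual_def)

lemma norm2_nonneg [simp]: "0 \<le> norm2 v"
  by (simp add: norm2_def inner2_def inner0_nonneg)

lemma V_scale:
  assumes "v \<in> V"
  shows "(\<lambda>x. c * v x) \<in> V" "norm2 (\<lambda>x. c * v x) = \<bar>c\<bar> * norm2 v" "F \<in> V_dual \<Longrightarrow> F (\<lambda>x. c * v x) = c * F v"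
  using V_lincomb[OF assms assms, of c 0] V_dual_lincomb[OF _ assms assms, of F c 0]
  by (simp_all add: norm2_V assms)

lemma zero_V: "(\<lambda>_. 0) \<in> V" "norm2 (\<lambda>_. 0) = 0"
  using V_scale(1,2)[OF vfun_V, of 0 0] by simp_all

text \<open>Boundedness of \<open>F\<close> makes the supremum in \<open>dual_norm\<close> a genuine
  upper bound on the unit ball, and homogeneity carries it to all of \<open>V\<close>.\<close>

lemma V_dual_bound:
  assumes F: "F \<in> V_dual" and v: "v \<in> V"
  shows "\<bar>F v\<bar> \<le> dual_norm F * norm2 v"
proof -
  obtain C where C: "\<And>v. v \<in> V \<Longrightarrow> \<bar>F v\<bar> \<le> C * norm2 v" using F unfolding V_dual_def by blast
  show ?thesis
  proof (cases "norm2 v = 0")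
    case True
    then show ?thesis using C[OF v] by simp
  next
    case False
    then have p: "0 < norm2 v" using norm2_nonneg[of v] by linarith
    let ?v = "\<lambda>x. inverse (norm2 v) * v x"
    have "bdd_above ((\<lambda>v. \<bar>F v\<bar>) ` {v \<in> V. norm2 v \<le> 1})"
    proof (rule bdd_aboveI2)
      fix w assume w: "w \<in> {v \<in> V. norm2 v \<le> 1}"
      have "\<bar>F w\<bar> \<le> \<bar>C\<bar> * norm2 w" using C[of w] w by (simp add: order_trans[OF _ mult_right_mono[OF abs_ge_self]])
      also have "\<dots> \<le> \<bar>C\<bar> * 1" using w by (intro mult_left_mono) auto
      finally show "\<bar>F w\<bar> \<le> \<bar>C\<bar>" by simp
    qed
    moreover have "?v \<in> {v \<in> V. norm2 v \<le> 1}" using V_scale[OF v] p by simp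
    ultimately have "\<bar>F ?v\<bar> \<le> dual_norm F" unfolding dual_norm_def by (intro cSUP_upper[where f="\<lambda>v. \<bar>F v\<bar>"])
    then have "inverse (norm2 v) * \<bar>F v\<bar> \<le> dual_norm F" using p by (simp add: V_scale(3)[OF v F] abs_mult)
    then show ?thesis using p by (simp add: field_simps)
  qed
qed

lemma dual_norm_le:
  assumes "\<And>v. v \<in> V \<Longrightarrow> \<bar>F v\<bar> \<le> C * norm2 v" "0 \<le> C"
  shows "dual_norm F \<le> C"
  unfolding dual_norm_def
proof (rule cSUP_least)
  show "{v \<in> V. norm2 v \<le> 1} \<noteq> {}" using zero_V by force
  fix v assume v: "v \<in> {v \<in> V. norm2 v \<le> 1}"
  have "\<bar>F v\<bar> \<le> C * norm2 v" using assms(1) v by simp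
  also have "\<dots> \<le> C * 1" using v assms(2) by (intro mult_left_mono) auto
  finally show "\<bar>F v\<bar> \<le> C" by simp
qed

lemma dual_norm_nonneg: "F \<in> V_dual \<Longrightarrow> 0 \<le> dual_norm F"
  using V_dual_bound[of F "vfun (Ell (\<lambda>k. if k = 0 then 1 else 0))"]
proof -
  assume F: "F \<in> V_dual"
  define z where "z = Ell (\<lambda>k. if k = 0 then 1 else 0)"
  have c: "coord z 0 = 1"
    unfolding z_def by (subst coord_Ell) (auto intro!: summable_finite[of "{0}"] split: if_splits)
  then have "0 < norm z" using abs_coord_le_norm[of z 0] by linarith
  moreover have "0 \<le> dual_norm F * norm z"
    using V_dual_bound[OF F vfun_V[of z]] by (simp add: norm2_V order_trans[OF abs_ge_zero])
  ultimately show ?thesis by (simp add: zero_le_mult_iff)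
qed

lemma V_dualI:
  assumes "\<And>u v a b. u \<in> V \<Longrightarrow> v \<in> V \<Longrightarrow> F (\<lambda>x. a * u x + b * v x) = a * F u + b * F v"
    and "\<And>v. v \<in> V \<Longrightarrow> \<bar>F v\<bar> \<le> C * norm2 v"
  shows "F \<in> V_dual"
  using assms unfolding V_dual_def by blast

lemma lap_functional_V_dual: "(\<lambda>v. inner x (lap v)) \<in> V_dual"
proof (rule V_dualI)
  show "inner x (lap (\<lambda>y. a * u y + b * v y)) = a * inner x (lap u) + b * inner x (lap v)"
    if "u \<in> V" "v \<in> V" for u v a b
    by (simp add: V_lincomb that inner_add_right)
  show "\<bar>inner x (lap v)\<bar> \<le> norm x * norm2 v" if "v \<in> V" for v
    using Cauchy_Schwarz_ineq2[of x "lap v"] by (simp add: norm2_V that)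
qed

lemma emb_eq: "u \<in> L2 \<Longrightarrow> v \<in> V \<Longrightarrow> emb u v = inner (J (cf u)) (lap v)"
  by (simp add: emb_def inner_cf[symmetric] V_hw(4) cf_V inner_J)

lemma V_dual_cong:
  assumes F: "F \<in> V_dual" and eq: "\<And>v. v \<in> V \<Longrightarrow> F v = G v"
  shows "G \<in> V_dual"
proof -
  obtain C where C: "\<And>v. v \<in> V \<Longrightarrow> \<bar>F v\<bar> \<le> C * norm2 v" using F unfolding V_dual_def by blast
  show ?thesis
  proof (rule V_dualI)
    show "G (\<lambda>x. a * u x + b * v x) = a * G u + b * G v" if "u \<in> V" "v \<in> V" for u v a b
      using V_dual_lincomb[OF F that] by (simp add: eq[symmetric] V_lincomb that)
    show "\<bar>G v\<bar> \<le> C * norm2 v" if "v \<in> V" for v using C[OF that] by (simp add: eq[OF that])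
  qed
qed

lemma dual_norm_cong: "(\<And>v. v \<in> V \<Longrightarrow> F v = G v) \<Longrightarrow> dual_norm F = dual_norm G"
  unfolding dual_norm_def by (intro SUP_cong) auto

section \<open>Time derivatives\<close>

lemma has_vector_derivative_iff_norm:
  fixes f :: "real \<Rightarrow> 'a::real_normed_vector"
  shows "(f has_vector_derivative v) (at t within S) \<longleftrightarrow>
    ((\<lambda>r. norm ((f r - f t) /\<^sub>R (r - t) - v)) \<longlongrightarrow> 0) (at t within S)"
proof -
  have e: "norm (f r - f t - (r - t) *\<^sub>R v) / norm (r - t) = norm ((f r - f t) /\<^sub>R (r - t) - v)" if "r \<noteq> t" for r
  proof -
    have "(f r - f t) /\<^sub>R (r - t) - v = (f r - f t - (r - t) *\<^sub>R v) /\<^sub>R (r - t)"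
      using that by (simp add: scaleR_diff_right)
    then show ?thesis by (simp add: divide_inverse mult.commute)
  qed
  have "((\<lambda>r. norm (f r - f t - (r - t) *\<^sub>R v) / norm (r - t)) \<longlongrightarrow> 0) (at t within S) \<longleftrightarrow>
    ((\<lambda>r. norm ((f r - f t) /\<^sub>R (r - t) - v)) \<longlongrightarrow> 0) (at t within S)"
    by (rule tendsto_cong, unfold eventually_at_filter, rule always_eventually) (use e in simp)
  then show ?thesis
    by (simp add: has_vector_derivative_def has_derivative_iff_norm bounded_linear_scaleR_left)
qed

text \<open>Time regularity is specified for representatives and a seminorm \<open>N\<close>. The
  linear map \<open>L\<close> into a normed space, which turns \<open>N\<close> into a norm,
  translates it into ordinary continuity and vector derivatives; \<open>L\<close> may identify
  functions that agree almost everywhere.\<close>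

locale represented_space =
  fixes X :: "('b \<Rightarrow> real) set" and N :: "('b \<Rightarrow> real) \<Rightarrow> real" and L :: "('b \<Rightarrow> real) \<Rightarrow> 'a::real_normed_vector"
  assumes lin_X: "u \<in> X \<Longrightarrow> v \<in> X \<Longrightarrow> (\<lambda>x. a * u x + b * v x) \<in> X"
    and lin_L: "u \<in> X \<Longrightarrow> v \<in> X \<Longrightarrow> L (\<lambda>x. a * u x + b * v x) = a *\<^sub>R L u + b *\<^sub>R L v"
    and N_eq: "u \<in> X \<Longrightarrow> N u = norm (L u)"
begin

lemma diff_X: "u \<in> X \<Longrightarrow> v \<in> X \<Longrightarrow> (\<lambda>x. u x - v x) \<in> X"
  and diff_L: "u \<in> X \<Longrightarrow> v \<in> X \<Longrightarrow> L (\<lambda>x. u x - v x) = L u - L v"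
  using lin_X[of u v 1 "-1"] lin_L[of u v 1 "-1"] by simp_all

lemma quotient_X: "u \<in> X \<Longrightarrow> v \<in> X \<Longrightarrow> (\<lambda>x. (u x - v x) / c) \<in> X"
  and quotient_L: "u \<in> X \<Longrightarrow> v \<in> X \<Longrightarrow> L (\<lambda>x. (u x - v x) / c) = (L u - L v) /\<^sub>R c"
  using lin_X[of u v "inverse c" "- inverse c"] lin_L[of u v "inverse c" "- inverse c"]
  by (simp_all add: divide_inverse algebra_simps)

lemma has_time_deriv_iff:
  "has_time_deriv X N T u v \<longleftrightarrow> (\<forall>t\<in>{0..T}. u t \<in> X \<and> v t \<in> X) \<and>
    (\<forall>t\<in>{0..T}. ((\<lambda>t. L (u t)) has_vector_derivative L (v t)) (at t within {0..T}))"
proof -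
  have "((\<lambda>r. N (\<lambda>x. (u r x - u t x) / (r - t) - v t x)) \<longlongrightarrow> 0) (at t within {0..T}) \<longleftrightarrow>
      ((\<lambda>t. L (u t)) has_vector_derivative L (v t)) (at t within {0..T})"
    if t: "t \<in> {0..T}" and uX: "\<And>t. t \<in> {0..T} \<Longrightarrow> u t \<in> X \<and> v t \<in> X" for t
    unfolding has_vector_derivative_iff_norm
  proof (rule tendsto_cong)
    show "\<forall>\<^sub>F r in at t within {0..T}. N (\<lambda>x. (u r x - u t x) / (r - t) - v t x) = norm ((L (u r) - L (u t)) /\<^sub>R (r - t) - L (v t))"
      unfolding eventually_at_filter
      by (rule always_eventually) (use t uX in \<open>simp add: N_eq diff_X diff_L quotient_X quotient_L\<close>)
  qed
  then show ?thesis unfolding has_time_deriv_def by blast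
qed

lemma Ck_0_iff:
  "u \<in> Ck 0 X N T \<longleftrightarrow> (\<forall>t\<in>{0..T}. u t \<in> X) \<and> continuous_on {0..T} (\<lambda>t. L (u t))"
proof -
  have "((\<lambda>r. N (\<lambda>x. u r x - u t x)) \<longlongrightarrow> 0) (at t within {0..T}) \<longleftrightarrow> ((\<lambda>r. L (u r)) \<longlongrightarrow> L (u t)) (at t within {0..T})"
    if t: "t \<in> {0..T}" and uX: "\<And>t. t \<in> {0..T} \<Longrightarrow> u t \<in> X" for t
  proof -
    have "((\<lambda>r. N (\<lambda>x. u r x - u t x)) \<longlongrightarrow> 0) (at t within {0..T}) \<longleftrightarrow> ((\<lambda>r. norm (L (u r) - L (u t))) \<longlongrightarrow> 0) (at t within {0..T})"
      by (rule tendsto_cong, unfold eventually_at_filter, rule always_eventually) (use t uX in \<open>simp add: N_eq diff_X diff_L\<close>)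
    also have "\<dots> \<longleftrightarrow> ((\<lambda>r. L (u r)) \<longlongrightarrow> L (u t)) (at t within {0..T})"
      unfolding tendsto_norm_zero_iff by (rule Lim_null[symmetric])
    finally show ?thesis .
  qed
  then show ?thesis by (auto simp: continuous_on_def)
qed

end

interpretation L2_rep: represented_space L2 norm0 cf
  by (rule represented_space.intro)
    (simp_all add: L2_add L2_scale cf_add cf_scale norm_cf)

interpretation V_rep: represented_space V norm2 lap
  by (rule represented_space.intro) (simp_all add: V_lincomb norm2_V)

text \<open>The full H4 norm is not an exact norm of coordinates, so
  \<open>represented_space\<close> does not fit; the one-sided estimate \<open>norm_Hk_4_le\<close>
  is enough for continuity.\<close>

lemma Ck_0_Dom:
  assumes u: "\<And>t. t \<in> {0..T} \<Longrightarrow> u t \<in> V" "\<And>t. t \<in> {0..T} \<Longrightarrow> lap (u t) = J (y t)"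
    and y: "continuous_on {0..T} y"
  shows "u \<in> Ck 0 Dom (norm_Hk 4) T"
proof -
  have "((\<lambda>r. norm_Hk 4 (\<lambda>x. u r x - u t x)) \<longlongrightarrow> 0) (at t within {0..T})" if t: "t \<in> {0..T}" for t
  proof (rule Lim_null_comparison)
    show "\<forall>\<^sub>F r in at t within {0..T}. norm (norm_Hk 4 (\<lambda>x. u r x - u t x)) \<le> (3 + 2 * (sqrt pi * Cv)) * norm (y r - y t)"
      unfolding eventually_at_filter
    proof (rule always_eventually, intro allI impI)
      fix r assume r: "r \<in> {0..T}"
      have "norm_Hk 4 (\<lambda>x. u r x - u t x) \<le> (3 + 2 * (sqrt pi * Cv)) * norm (y r - y t)"
        by (intro norm_Hk_4_le) (simp_all add: V_diff u[OF r] u[OF t] J_diff)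
      moreover have "0 \<le> norm_Hk 4 (\<lambda>x. u r x - u t x)"
        unfolding norm_Hk_def by (intro real_sqrt_ge_zero sum_nonneg) simp
      ultimately show "norm (norm_Hk 4 (\<lambda>x. u r x - u t x)) \<le> (3 + 2 * (sqrt pi * Cv)) * norm (y r - y t)"
        by simp
    qed
    have "((\<lambda>r. y r - y t) \<longlongrightarrow> 0) (at t within {0..T})"
      using y t by (simp add: continuous_on_def Lim_null[symmetric])
    then show "((\<lambda>r. (3 + 2 * (sqrt pi * Cv)) * norm (y r - y t)) \<longlongrightarrow> 0) (at t within {0..T})"
      by (intro tendsto_mult_right_zero tendsto_norm_zero)
  qed
  moreover have "u t \<in> Dom" if "t \<in> {0..T}" for t using u[OF that] by (auto simp: Dom_iff)
  ultimately show ?thesis by simp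
qed

section \<open>The cable nonlinearity\<close>

text \<open>\<open>dir\<close> and \<open>curv\<close> are its first and second derivatives. Bounds
  on \<open>dir\<close>, on \<open>curv\<close> and on the derivative of \<open>curv\<close> make
  the three functions Lipschitz with constants 1, 1 and 3.\<close>

definition arcl :: "real \<Rightarrow> real" where "arcl y = sqrt (1 + y\<^sup>2)"
definition dir :: "real \<Rightarrow> real" where "dir y = y / arcl y"
definition curv :: "real \<Rightarrow> real" where "curv y = 1 / arcl y ^ 3"

lemma arcl_ge_1: "1 \<le> arcl y" and arcl_pos: "0 < arcl y" and abs_le_arcl: "\<bar>y\<bar> \<le> arcl y"
proof -
  show 1: "1 \<le> arcl y" by (simp add: arcl_def)
  then show "0 < arcl y" by linarith
  show "\<bar>y\<bar> \<le> arcl y" unfolding arcl_def by (rule real_le_rsqrt) simp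
qed

lemma arcl_square: "(arcl y)\<^sup>2 = 1 + y\<^sup>2"
  by (simp add: arcl_def add_nonneg_nonneg)

lemma arcl_deriv: "(arcl has_real_derivative dir y) (at y)"
proof -
  have "0 < 1 + y\<^sup>2" by (simp add: add_pos_nonneg)
  then show ?thesis
    unfolding arcl_def[abs_def] dir_def
    by (auto intro!: derivative_eq_intros simp: arcl_def divide_simps)
qed

lemma dir_deriv: "(dir has_real_derivative curv y) (at y)"
proof -
  have n: "arcl y \<noteq> 0" using arcl_pos[of y] by simp
  have "((\<lambda>y. y / arcl y) has_real_derivative (1 * arcl y - y * dir y) / (arcl y * arcl y)) (at y)"
    by (intro DERIV_divide DERIV_ident arcl_deriv n)
  moreover have "(1 * arcl y - y * dir y) / (arcl y * arcl y) = curv y"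
  proof -
    have "arcl y - y * dir y = 1 / arcl y"
      using n arcl_square[of y] by (simp add: dir_def field_simps power2_eq_square)
    then show ?thesis by (simp add: curv_def power3_eq_cube)
  qed
  ultimately show ?thesis by (simp add: dir_def[abs_def])
qed

lemma curv_deriv: "(curv has_real_derivative - 3 * y / arcl y ^ 5) (at y)"
proof -
  have n: "arcl y \<noteq> 0" using arcl_pos[of y] by simp
  have "((\<lambda>y. 1 / arcl y ^ 3) has_real_derivative (0 * arcl y ^ 3 - 1 * (real 3 * (dir y * arcl y ^ (3 - Suc 0)))) / (arcl y ^ 3 * arcl y ^ 3)) (at y)"
    using n by (intro DERIV_divide DERIV_const DERIV_power arcl_deriv) simp
  moreover have "(0 * arcl y ^ 3 - 1 * (real 3 * (dir y * arcl y ^ (3 - Suc 0)))) / (arcl y ^ 3 * arcl y ^ 3) = - 3 * y / arcl y ^ 5"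
    using n by (simp add: dir_def field_simps eval_nat_numeral)
  ultimately show ?thesis by (simp add: curv_def[abs_def])
qed

lemma lipschitz_of_deriv_bound:
  fixes f :: "real \<Rightarrow> real"
  assumes "\<And>x. (f has_real_derivative f' x) (at x)" "\<And>x. \<bar>f' x\<bar> \<le> L"
  shows "\<bar>f x - f y\<bar> \<le> L * \<bar>x - y\<bar>"
  using field_differentiable_bound[of UNIV f f' L x y] assms by (auto intro: has_field_derivative_at_within)

lemma abs_dir_le: "\<bar>dir y\<bar> \<le> 1"
  using abs_le_arcl[of y] arcl_pos[of y] by (simp add: dir_def abs_divide)

lemma abs_curv_le: "\<bar>curv y\<bar> \<le> 1"
  unfolding curv_def abs_divide abs_one abs_of_pos[OF zero_less_power[OF arcl_pos]]
  using one_le_power[OF arcl_ge_1[of y], of 3] by (subst divide_le_eq_1_pos[OF zero_less_power[OF arcl_pos]])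

lemma arcl_lipschitz: "\<bar>arcl x - arcl y\<bar> \<le> \<bar>x - y\<bar>"
  using lipschitz_of_deriv_bound[OF arcl_deriv abs_dir_le] by simp

lemma dir_lipschitz: "\<bar>dir x - dir y\<bar> \<le> \<bar>x - y\<bar>"
  using lipschitz_of_deriv_bound[OF dir_deriv abs_curv_le] by simp

lemma curv_lipschitz: "\<bar>curv x - curv y\<bar> \<le> 3 * \<bar>x - y\<bar>"
proof (rule lipschitz_of_deriv_bound[OF curv_deriv])
  fix y
  have "\<bar>y\<bar> \<le> arcl y ^ 5"
    using abs_le_arcl[of y] self_le_power[OF arcl_ge_1[of y], of 5] by simp
  then show "\<bar>- 3 * y / arcl y ^ 5\<bar> \<le> 3"
    using arcl_pos[of y] by (simp add: abs_mult abs_divide divide_le_eq)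
qed

text \<open>Mean value inequality for \<open>arcl\<close> minus its linear part at y: on the segment
  the derivative \<open>dir t - dir y\<close> is at most |d|.\<close>

lemma arcl_taylor: "\<bar>arcl (y + d) - arcl y - dir y * d\<bar> \<le> d\<^sup>2"
proof -
  have "\<bar>(arcl (y + d) - dir y * (y + d)) - (arcl y - dir y * y)\<bar> \<le> \<bar>d\<bar> * \<bar>(y + d) - y\<bar>"
  proof (rule field_differentiable_bound[of "closed_segment y (y + d)", unfolded real_norm_def])
    fix t assume t: "t \<in> closed_segment y (y + d)"
    show "((\<lambda>t. arcl t - dir y * t) has_real_derivative dir t - dir y) (at t within closed_segment y (y + d))"
      by (auto intro!: derivative_eq_intros has_field_derivative_at_within[OF arcl_deriv])
    have "\<bar>t - y\<bar> \<le> \<bar>d\<bar>" using t by (auto simp: closed_segment_eq_real_ivl split: if_splits)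
    then show "\<bar>dir t - dir y\<bar> \<le> \<bar>d\<bar>" using dir_lipschitz[of t y] by linarith
  qed auto
  then show ?thesis by (simp add: power2_eq_square algebra_simps abs_mult_self_eq flip: abs_mult)
qed

lemma continuous_arcl: "continuous_on S arcl" and continuous_dir: "continuous_on S dir" and continuous_curv: "continuous_on S curv"
  using DERIV_isCont[OF arcl_deriv] DERIV_isCont[OF dir_deriv] DERIV_isCont[OF curv_deriv]
  by (auto intro: continuous_at_imp_continuous_on)

lemma norm0_mono:
  assumes f: "f \<in> borel_measurable I_leb" and g: "g \<in> L2" and le: "\<And>x. x \<in> I_set \<Longrightarrow> \<bar>f x\<bar> \<le> g x"
  shows "norm0 f \<le> norm0 g"
proof -
  have sq: "(f x)\<^sup>2 \<le> (g x)\<^sup>2" if "x \<in> I_set" for x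
    using le[OF that] by (simp add: abs_le_square_iff[symmetric])
  have int: "integrable I_leb (\<lambda>x. (f x)\<^sup>2)"
    by (rule Bochner_Integration.integrable_bound[OF L2_square[OF g]]) (use f sq in \<open>auto intro!: AE_I2\<close>)
  have "inner0 f f \<le> inner0 g g"
    unfolding inner0_self using sq by (intro integral_mono[OF int L2_square[OF g]]) auto
  then show ?thesis by (simp add: norm0_def)
qed

lemma norm0_abs: "norm0 (\<lambda>x. \<bar>u x\<bar>) = norm0 u" by (simp add: norm0_def inner0_self)

lemma L2_abs: "u \<in> L2 \<Longrightarrow> (\<lambda>x. \<bar>u x\<bar>) \<in> L2" by (auto simp: L2_def)

text \<open>The boundary term vanishes because of the sine, so that \<open>f\<close> may be the
  cable density, which need not be zero at the ends.\<close>

lemma inner0_parts_C1: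
  assumes f: "\<And>x. (f has_real_derivative f' x) (at x)" and c: "continuous_on UNIV f'"
  shows "freq k * inner0 f (cosine k) = - inner0 f' (sine k)"
proof -
  have cf: "continuous_on S f" for S using f DERIV_isCont by (blast intro: continuous_at_imp_continuous_on)
  have c': "continuous_on S f'" for S using c by (rule continuous_on_subset) simp
  have L: "f \<in> L2" "f' \<in> L2" by (intro L2_continuous cf c')+
  have "freq k * inner0 f (cosine k) = inner0 f (deriv (sine k))" by (simp add: deriv_sine inner0_scale_right)
  then have "inner0 f' (sine k) + freq k * inner0 f (cosine k) = (LINT x|I_leb. f' x * sine k x + f x * deriv (sine k) x)"
    unfolding inner0_def by (simp add: L2_mult_integrable L smooth_L2 smoothD smooth_sine)
  also have "\<dots> = integral {0..pi} (\<lambda>x. f' x * sine k x + f x * deriv (sine k) x)"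
    by (intro I_leb_integral_continuous continuous_intros smooth_continuous cf c' smooth_sine smoothD)
  also have "((\<lambda>x. f' x * sine k x + f x * deriv (sine k) x) has_integral f pi * sine k pi - f 0 * sine k 0) {0..pi}"
  proof (rule fundamental_theorem_of_calculus)
    fix x
    have "((\<lambda>x. f x * sine k x) has_real_derivative f' x * sine k x + f x * deriv (sine k) x) (at x)"
      by (rule DERIV_cong[OF DERIV_mult[OF f smoothD(1)[OF smooth_sine]]]) (simp add: mult.commute)
    then show "((\<lambda>x. f x * sine k x) has_vector_derivative f' x * sine k x + f x * deriv (sine k) x) (at x within {0..pi})"
      by (simp add: has_real_derivative_iff_has_vector_derivative[symmetric] has_field_derivative_at_within)
  qed simp
  then have "integral {0..pi} (\<lambda>x. f' x * sine k x + f x * deriv (sine k) x) = 0"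
    by (simp add: integral_unique)
  finally show ?thesis by simp
qed

text \<open>From here on the cable quantities are written in sequence coordinates, with
  \<open>wderiv 1 u\<close> replaced by its continuous representative \<open>vfun' z\<close>. They
  agree with the original ones almost everywhere and admit bounds at every point.
  \<open>slope0\<close> is the derivative of the parabola \<open>shape\<close>.\<close>

definition slope0 :: "fb_params \<Rightarrow> real \<Rightarrow> real" where "slope0 p x = cab_a p * (pi / 2 - x)"
definition slope :: "fb_params \<Rightarrow> ell2 \<Rightarrow> real \<Rightarrow> real" where "slope p z x = vfun' z x + slope0 p x"
definition len :: "fb_params \<Rightarrow> ell2 \<Rightarrow> real" where "len p z = (LINT x|I_leb. arcl (slope p z x))"
definition tens :: "fb_params \<Rightarrow> ell2 \<Rightarrow> real \<Rightarrow> real" where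
  "tens p z x = cab_b p * (len p 0 - len p z) - cab_c p * arcl (slope0 p x)"
definition hz :: "fb_params \<Rightarrow> ell2 \<Rightarrow> real \<Rightarrow> real" where "hz p z x = tens p z x * dir (slope p z x)"

lemma vfun_zero [simp]: "vfun' 0 x = 0" "vfun 0 x = 0"
  by (simp_all add: vfun'_def vfun_def)

lemma deriv_shape: "deriv (shape p) = slope0 p"
  unfolding shape_def[abs_def] slope0_def[abs_def]
  by (rule deriv_eqI) (auto intro!: derivative_eq_intros simp: field_simps power2_eq_square)

lemma continuous_slope0: "continuous_on S (slope0 p)"
  unfolding slope0_def[abs_def] by (intro continuous_intros)

lemma continuous_slope: "continuous_on S (slope p z)"
  unfolding slope_def[abs_def] by (intro continuous_intros vfun_continuous continuous_slope0)

lemma continuous_comp_slope: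
  assumes "\<And>S. continuous_on S f"
  shows "continuous_on S (\<lambda>x. f (slope p z x))" "continuous_on S (\<lambda>x. f (slope0 p x))"
  by (rule continuous_on_compose2[OF assms continuous_slope] continuous_on_compose2[OF assms continuous_slope0]; blast)+

lemma hz_L2: "hz p z \<in> L2"
  unfolding hz_def[abs_def] tens_def
  by (intro L2_continuous continuous_intros continuous_comp_slope continuous_arcl continuous_dir)

lemma Xi_vfun:
  assumes u: "u \<in> V"
  shows "AE x in I_leb. Xi p u x = arcl (slope p (lap u) x)"
  using wderiv1_V[OF u] by eventually_elim (simp add: Xi_def arcl_def slope_def deriv_shape)

lemma lap_zero_fun: "lap (\<lambda>_. 0) = 0"
  using V_of_vfun(2)[of "\<lambda>_. 0" 0] by simp

lemma xi0_AE: "AE x in I_leb. xi0 p x = arcl (slope0 p x)"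
  using Xi_vfun[OF zero_V(1), of p] unfolding xi0_def lap_zero_fun by (simp add: slope_def)

lemma wderiv1_measurable: "u \<in> V \<Longrightarrow> wderiv 1 u \<in> borel_measurable I_leb"
  by (intro L2_measurable V_hw)

lemma slope0_measurable: "slope0 p \<in> borel_measurable I_leb"
  by (intro L2_measurable L2_continuous continuous_slope0)

lemma Xi_measurable:
  assumes "u \<in> V"
  shows "Xi p u \<in> borel_measurable I_leb"
  unfolding Xi_def[abs_def] deriv_shape
  using wderiv1_measurable[OF assms] slope0_measurable[of p] by measurable

lemma arcl_slope_L2: "(\<lambda>x. arcl (slope p z x)) \<in> L2" "(\<lambda>x. arcl (slope0 p x)) \<in> L2"
  by (intro L2_continuous continuous_comp_slope continuous_arcl)+

lemma cable_len_V:
  assumes u: "u \<in> V"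
  shows "cable_len p u = len p (lap u)"
  unfolding cable_len_def len_def
  by (rule integral_cong_AE[OF Xi_measurable[OF u] L2_measurable[OF arcl_slope_L2(1)] Xi_vfun[OF u]])

lemma cable_len0_eq: "cable_len0 p = len p 0"
  unfolding cable_len0_def cable_len_V[OF zero_V(1)] lap_zero_fun ..

lemma h_cab_V:
  assumes u: "u \<in> V"
  shows "AE x in I_leb. h_cab p u x = hz p (lap u) x"
  using wderiv1_V[OF u] xi0_AE[of p]
proof eventually_elim
  case (elim x)
  show ?case
    unfolding h_cab_def hz_def tens_def cable_len_V[OF u] cable_len0_eq elim deriv_shape slope_def dir_def
    by (simp add: arcl_def)
qed

definition Pz :: "fb_params \<Rightarrow> ell2 \<Rightarrow> real" where
  "Pz p z = cab_b p / 2 * (len p z - len p 0)\<^sup>2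
     + cab_c p * (LINT x|I_leb. arcl (slope0 p x) * (arcl (slope p z x) - arcl (slope0 p x)))"

lemma Pi_cab_V:
  assumes u: "u \<in> V"
  shows "Pi_cab p u = Pz p (lap u)"
proof -
  have m: "xi0 p \<in> borel_measurable I_leb" unfolding xi0_def by (rule Xi_measurable[OF zero_V(1)])
  have "(LINT x|I_leb. xi0 p x * (Xi p u x - xi0 p x)) =
      (LINT x|I_leb. arcl (slope0 p x) * (arcl (slope p (lap u) x) - arcl (slope0 p x)))"
  proof (rule integral_cong_AE)
    show "(\<lambda>x. xi0 p x * (Xi p u x - xi0 p x)) \<in> borel_measurable I_leb"
      using m Xi_measurable[OF u] by measurable
    show "(\<lambda>x. arcl (slope0 p x) * (arcl (slope p (lap u) x) - arcl (slope0 p x))) \<in> borel_measurable I_leb"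
      by (intro borel_measurable_times borel_measurable_diff L2_measurable arcl_slope_L2)
    show "AE x in I_leb. xi0 p x * (Xi p u x - xi0 p x) = arcl (slope0 p x) * (arcl (slope p (lap u) x) - arcl (slope0 p x))"
      using Xi_vfun[OF u, of p] xi0_AE[of p] by eventually_elim simp
  qed
  then show ?thesis by (simp add: Pi_cab_def Pz_def cable_len_V[OF u] cable_len0_eq)
qed

lemma integral_abs_le_sup:
  assumes "f \<in> L2" "\<And>x. x \<in> I_set \<Longrightarrow> \<bar>f x\<bar> \<le> B"
  shows "\<bar>LINT x|I_leb. f x\<bar> \<le> pi * B"
proof -
  have "\<bar>LINT x|I_leb. f x\<bar> \<le> (LINT x|I_leb. \<bar>f x\<bar>)" by (rule integral_abs_bound)
  also have "\<dots> \<le> (LINT x|I_leb. B)"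
    using assms L2_integrable[OF assms(1)] by (intro integral_mono) auto
  also have "\<dots> = pi * B" by (simp add: measure_restrict_space I_set_def)
  finally show ?thesis .
qed

lemma slope_diff: "slope p z x - slope p w x = vfun' (z - w) x"
  by (simp add: slope_def vfun'_diff)

lemma abs_slope_diff_le: "\<bar>slope p z x - slope p w x\<bar> \<le> Cv * norm (z - w)"
  unfolding slope_diff by (rule vfun'_bound)

lemma len_lipschitz: "\<bar>len p z - len p w\<bar> \<le> pi * Cv * norm (z - w)"
proof -
  have "len p z - len p w = (LINT x|I_leb. arcl (slope p z x) - arcl (slope p w x))"
    unfolding len_def by (intro Bochner_Integration.integral_diff[symmetric] L2_integrable arcl_slope_L2)
  also have "\<bar>\<dots>\<bar> \<le> pi * (Cv * norm (z - w))"
  proof (rule integral_abs_le_sup)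
    show "(\<lambda>x. arcl (slope p z x) - arcl (slope p w x)) \<in> L2" by (intro L2_diff arcl_slope_L2)
    show "\<bar>arcl (slope p z x) - arcl (slope p w x)\<bar> \<le> Cv * norm (z - w)" for x
      using arcl_lipschitz[of "slope p z x" "slope p w x"] abs_slope_diff_le[of p z x w] by linarith
  qed
  finally show ?thesis by simp
qed

lemma len_diff_0_le:
  assumes "norm z \<le> r"
  shows "\<bar>len p z - len p 0\<bar> \<le> pi * Cv * r"
proof -
  have "pi * Cv * norm z \<le> pi * Cv * r" by (intro mult_left_mono assms) (simp add: Cv_nonneg)
  then show ?thesis using len_lipschitz[of p z 0, unfolded diff_0_right] by linarith
qed

text \<open>The sine coefficients of minus the x-derivative of \<open>hz\<close>: an integration by
  parts moves the derivative onto the sine. Square summability of this sequence is established in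
  \<open>coord_Cab\<close>.\<close>

definition Cab :: "fb_params \<Rightarrow> ell2 \<Rightarrow> ell2" where
  "Cab p z = Ell (\<lambda>k. freq k * inner0 (hz p z) (cosine k))"

locale cable =
  fixes p :: fb_params
  assumes a: "0 < cab_a p" and b: "0 \<le> cab_b p" and c: "0 \<le> cab_c p"
begin

lemma arcl_slope0_le: "x \<in> I_set \<Longrightarrow> \<bar>arcl (slope0 p x)\<bar> \<le> 1 + cab_a p * pi"
proof -
  assume x: "x \<in> I_set"
  have "\<bar>pi / 2 - x\<bar> \<le> pi" using x by (auto simp: I_set_def abs_if)
  then have "\<bar>slope0 p x\<bar> \<le> cab_a p * pi" unfolding slope0_def abs_mult using a by simp
  moreover have "\<bar>arcl (slope0 p x) - arcl 0\<bar> \<le> \<bar>slope0 p x - 0\<bar>" by (rule arcl_lipschitz)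
  moreover have "arcl 0 = 1" by (simp add: arcl_def)
  ultimately show ?thesis using arcl_pos[of "slope0 p x"] by linarith
qed

definition tens_bd :: "real \<Rightarrow> real" where
  "tens_bd r = cab_b p * (pi * Cv * r) + cab_c p * (1 + cab_a p * pi)"

lemma tens_bd_nonneg: "0 \<le> r \<Longrightarrow> 0 \<le> tens_bd r"
  unfolding tens_bd_def using a b c Cv_nonneg
  by (intro add_nonneg_nonneg mult_nonneg_nonneg) auto

lemma abs_tens_le:
  assumes x: "x \<in> I_set" and z: "norm z \<le> r"
  shows "\<bar>tens p z x\<bar> \<le> tens_bd r"
proof -
  have "\<bar>len p 0 - len p z\<bar> \<le> pi * Cv * r"
    using len_diff_0_le[OF z, of p] by (simp add: abs_minus_commute)
  then have "\<bar>cab_b p * (len p 0 - len p z)\<bar> \<le> cab_b p * (pi * Cv * r)"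
    unfolding abs_mult using b by (intro mult_mono) auto
  moreover have "\<bar>cab_c p * arcl (slope0 p x)\<bar> \<le> cab_c p * (1 + cab_a p * pi)"
    unfolding abs_mult using arcl_slope0_le[OF x] c by (intro mult_mono) auto
  ultimately show ?thesis unfolding tens_def tens_bd_def by linarith
qed

lemma tens_diff_le: "\<bar>tens p z x - tens p w x\<bar> \<le> cab_b p * (pi * Cv * norm (z - w))"
proof -
  have "tens p z x - tens p w x = cab_b p * (len p w - len p z)" by (simp add: tens_def algebra_simps)
  then show ?thesis
    using len_lipschitz[of p w z] b by (simp add: abs_mult mult_left_mono norm_minus_commute)
qed

text \<open>The difference of products is split so that only the tension at \<open>w\<close> has to
  be bounded; hence only \<open>w\<close> is confined to the ball.\<close>

lemma hz_diff_le:
  assumes x: "x \<in> I_set" and w: "norm w \<le> r"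
  shows "\<bar>hz p z x - hz p w x\<bar> \<le> (cab_b p * pi + tens_bd r) * Cv * norm (z - w)"
proof -
  have "hz p z x - hz p w x = (tens p z x - tens p w x) * dir (slope p z x)
      + tens p w x * (dir (slope p z x) - dir (slope p w x))"
    by (simp add: hz_def algebra_simps)
  also have "\<bar>\<dots>\<bar> \<le> cab_b p * (pi * Cv * norm (z - w)) * 1 + tens_bd r * (Cv * norm (z - w))"
  proof (rule order_trans[OF abs_triangle_ineq], unfold abs_mult, intro add_mono mult_mono)
    show "\<bar>dir (slope p z x) - dir (slope p w x)\<bar> \<le> Cv * norm (z - w)"
      using dir_lipschitz[of "slope p z x" "slope p w x"] abs_slope_diff_le[of p z x w] by linarith
    show "0 \<le> tens_bd r" using abs_tens_le[OF assms] by linarith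
    show "0 \<le> cab_b p * (pi * Cv * norm (z - w))" using b Cv_nonneg by simp
  qed (use tens_diff_le abs_dir_le abs_tens_le[OF assms] in auto)
  finally show ?thesis by (simp add: algebra_simps)
qed

subsection \<open>Lipschitz continuity of the nonlinearity\<close>

text \<open>The x-derivative of \<open>hz p z\<close> contains the second derivative of the
  displacement, which is only in L2. For finite sine sums everything is classical; the bounds
  obtained there are uniform in n and pass to the limit coordinate by coordinate.\<close>

definition trunc :: "nat \<Rightarrow> ell2 \<Rightarrow> ell2" where "trunc n = mulop (\<lambda>k. if k < n then 1 else 0)"

lemma coord_trunc: "coord (trunc n z) k = (if k < n then coord z k else 0)"
  unfolding trunc_def by (subst coord_mulop_bdd[where B=1]) auto

lemma norm_trunc_le: "norm (trunc n z) \<le> norm z"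
  unfolding trunc_def using norm_mulop_le[of "\<lambda>k. if k < n then 1 else 0" 1 z] by simp

lemma trunc_diff: "trunc n (x - y) = trunc n x - trunc n y"
  by (rule ell2_eqI) (simp add: coord_trunc)

lemma trunc_tendsto: "(\<lambda>n. trunc n z) \<longlonglongrightarrow> z"
proof -
  have "(\<lambda>n. mulop (\<lambda>k. if k < n then 1 else 0) z) \<longlonglongrightarrow> mulop (\<lambda>_. 1) z"
  proof (rule mulop_tendsto[where B=1])
    show "(\<lambda>n. if k < n then 1 else 0 :: real) \<longlonglongrightarrow> 1" for k
      by (rule tendsto_eventually, rule eventually_sequentiallyI[of "Suc k"]) simp
  qed auto
  moreover have "mulop (\<lambda>_. 1) z = z" by (rule ell2_eqI) (simp add: coord_mulop_bdd[where B=1])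
  ultimately show ?thesis by (simp add: trunc_def)
qed

lemma vfun'_trunc: "vfun' (trunc n z) = deriv (psum (coord (J z)) n)"
proof
  fix x
  have "vfun' (trunc n z) x = (\<Sum>k\<in>{..<n}. coord (J (trunc n z)) k * (freq k * cosine k x))"
    unfolding vfun'_def by (rule suminf_finite) (auto simp: coord_J coord_trunc)
  then show "vfun' (trunc n z) x = deriv (psum (coord (J z)) n) x"
    unfolding deriv_psum by (simp add: coord_J coord_trunc)
qed

lemma norm0_psum: "norm0 (psum (coord z) n) = norm (trunc n z)"
proof -
  have "cf (psum (coord z) n) = trunc n z"
    by (rule ell2_eqI) (simp add: coord_cf inner0_psum_sine coord_trunc)
  then show ?thesis using norm_cf[OF psum_L2] by metis
qed

definition slope_x :: "nat \<Rightarrow> ell2 \<Rightarrow> real \<Rightarrow> real" where "slope_x n z x = - psum (coord z) n x - cab_a p"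

lemma slope_trunc_deriv: "(slope p (trunc n z) has_real_derivative slope_x n z x) (at x)"
proof -
  have "(deriv (psum (coord (J z)) n) has_real_derivative - psum (coord z) n x) (at x)"
    using smoothD(1)[OF smoothD(2)[OF smooth_psum], of "coord (J z)" n x] deriv2_psum[of z n]
    by (simp add: numeral_2_eq_2)
  then show ?thesis
    unfolding slope_def[abs_def] vfun'_trunc slope_x_def slope0_def
    by (auto intro!: derivative_eq_intros)
qed

text \<open>The classical x-derivative of \<open>hz\<close> at a finite sine sum. The first term
  differentiates the tension, which depends on x only through \<open>slope0\<close>; the second
  differentiates the direction.\<close>

definition hz_x :: "nat \<Rightarrow> ell2 \<Rightarrow> real \<Rightarrow> real" where
  "hz_x n z x = cab_c p * cab_a p * dir (slope0 p x) * dir (slope p (trunc n z) x)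
     + tens p (trunc n z) x * (curv (slope p (trunc n z) x) * slope_x n z x)"

lemma hz_trunc_deriv: "(hz p (trunc n z) has_real_derivative hz_x n z x) (at x)"
proof -
  have s0: "(slope0 p has_real_derivative - cab_a p) (at x)" for x
    unfolding slope0_def[abs_def] by (auto intro!: derivative_eq_intros)
  have t: "(tens p (trunc n z) has_real_derivative cab_c p * cab_a p * dir (slope0 p x)) (at x)"
    unfolding tens_def[abs_def]
    by (auto intro!: derivative_eq_intros DERIV_chain2[OF arcl_deriv s0])
  have d: "((\<lambda>x. dir (slope p (trunc n z) x)) has_real_derivative curv (slope p (trunc n z) x) * slope_x n z x) (at x)"
    by (rule DERIV_chain2[OF dir_deriv slope_trunc_deriv])
  show ?thesis
    unfolding hz_def[abs_def] by (rule DERIV_cong[OF DERIV_mult[OF t d]]) (simp add: hz_x_def)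
qed

lemma continuous_slope_x: "continuous_on S (slope_x n z)"
  unfolding slope_x_def[abs_def] by (intro continuous_intros smooth_continuous smooth_psum)

lemma continuous_hz_x: "continuous_on S (hz_x n z)"
  unfolding hz_x_def[abs_def] tens_def
  by (intro continuous_intros continuous_comp_slope continuous_arcl continuous_dir continuous_curv continuous_slope_x)

lemma slope_x_L2: "slope_x n z \<in> L2" and hz_x_L2: "hz_x n z \<in> L2"
  by (intro L2_continuous continuous_slope_x continuous_hz_x)+

lemma hz_trunc_coord: "freq k * inner0 (hz p (trunc n z)) (cosine k) = - inner0 (hz_x n z) (sine k)"
  by (rule inner0_parts_C1[OF hz_trunc_deriv continuous_hz_x])

lemma norm0_slope_x_le: "norm0 (slope_x n z) \<le> norm z + cab_a p * sqrt pi"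
proof -
  have "norm0 (slope_x n z) = norm0 (\<lambda>x. (-1) * psum (coord z) n x + (- cab_a p))"
    by (simp add: slope_x_def[abs_def])
  also have "\<dots> \<le> norm0 (\<lambda>x. (-1) * psum (coord z) n x) + norm0 (\<lambda>_. - cab_a p)"
    by (intro norm0_triangle L2_scale psum_L2 L2_const)
  also have "norm0 (\<lambda>x. (-1) * psum (coord z) n x) = norm (trunc n z)"
    unfolding norm0_scale by (simp add: norm0_psum)
  also have "norm0 (\<lambda>_. - cab_a p) \<le> sqrt pi * cab_a p"
    by (rule norm0_le_sup) (use a in auto)
  finally show ?thesis using norm_trunc_le[of n z] by (simp add: mult.commute)
qed

lemma norm0_slope_x_diff: "norm0 (\<lambda>x. slope_x n z x - slope_x n w x) \<le> norm (z - w)"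
proof -
  have "slope_x n z x - slope_x n w x = (-1) * psum (coord (z - w)) n x" for x
    by (simp add: slope_x_def psum_def left_diff_distrib sum_subtractf)
  then have "norm0 (\<lambda>x. slope_x n z x - slope_x n w x) = norm0 (\<lambda>x. (-1) * psum (coord (z - w)) n x)"
    by simp
  also have "\<dots> = norm (trunc n (z - w))" unfolding norm0_scale by (simp add: norm0_psum)
  finally show ?thesis using norm_trunc_le[of n "z - w"] by simp
qed

text \<open>Collects the constants of \<open>norm0_hz_x_diff\<close>: the differentiated tension,
  the differences of tension and curvature multiplied by the second derivative, and the difference
  of the second derivatives.\<close>

definition lip_bd :: "real \<Rightarrow> real" where
  "lip_bd r = sqrt pi * (cab_c p * cab_a p * Cv)
     + (cab_b p * pi + 3 * tens_bd r) * Cv * (r + cab_a p * sqrt pi) + tens_bd r"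

text \<open>The second derivative enters linearly and is always multiplied by factors that the
  embedding into C1 controls in the sup norm. Of the four terms of the splitting, two carry
  \<open>slope_x\<close> itself, one carries its difference, and one contains neither.\<close>

lemma norm0_hz_x_diff:
  assumes z: "norm z \<le> r" and w: "norm w \<le> r"
  shows "norm0 (\<lambda>x. hz_x n z x - hz_x n w x) \<le> lip_bd r * norm (z - w)"
proof -
  let ?z = "trunc n z" and ?w = "trunc n w"
  let ?d = "norm (z - w)"
  have r: "0 \<le> r" using z norm_ge_zero order_trans by blast
  note M = tens_bd_nonneg[OF r]
  have dn: "norm (?z - ?w) \<le> ?d" unfolding trunc_diff[symmetric] by (rule norm_trunc_le)
  then have dC: "Cv * norm (?z - ?w) \<le> Cv * ?d" by (intro mult_left_mono Cv_nonneg)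
  define K0 where "K0 = cab_c p * cab_a p * (Cv * ?d)"
  define K1 where "K1 = (cab_b p * pi + 3 * tens_bd r) * (Cv * ?d)"
  define g where "g x = K0 + (K1 * \<bar>slope_x n z x\<bar> + tens_bd r * \<bar>slope_x n z x - slope_x n w x\<bar>)" for x
  have K0: "0 \<le> K0" using a c Cv_nonneg by (simp add: K0_def)
  have K1: "0 \<le> K1" using b M Cv_nonneg by (simp add: K1_def)
  have pw: "\<bar>hz_x n z x - hz_x n w x\<bar> \<le> g x" if x: "x \<in> I_set" for x
  proof -
    let ?y = "slope p ?z x" and ?v = "slope p ?w x"
    have yv: "\<bar>?y - ?v\<bar> \<le> Cv * ?d" using abs_slope_diff_le[of p ?z x ?w] dC by linarith
    have tz: "\<bar>tens p ?w x\<bar> \<le> tens_bd r" using norm_trunc_le[of n w] w by (intro abs_tens_le x) simp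
    have td: "\<bar>tens p ?z x - tens p ?w x\<bar> \<le> cab_b p * pi * (Cv * ?d)"
    proof -
      have "cab_b p * (pi * Cv * norm (?z - ?w)) \<le> cab_b p * (pi * (Cv * ?d))"
        unfolding mult.assoc by (rule mult_left_mono[OF mult_left_mono[OF dC] b]) simp
      then show ?thesis using tens_diff_le[of ?z x ?w] by (simp add: mult.assoc)
    qed
    have 1: "\<bar>cab_c p * cab_a p * dir (slope0 p x) * (dir ?y - dir ?v)\<bar> \<le> K0"
    proof -
      have "\<bar>dir (slope0 p x)\<bar> * \<bar>dir ?y - dir ?v\<bar> \<le> 1 * (Cv * ?d)"
        using dir_lipschitz[of ?y ?v] yv by (intro mult_mono abs_dir_le) auto
      then have "cab_c p * cab_a p * (\<bar>dir (slope0 p x)\<bar> * \<bar>dir ?y - dir ?v\<bar>) \<le> cab_c p * cab_a p * (1 * (Cv * ?d))"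
        using a c by (intro mult_left_mono) auto
      then show ?thesis using a c by (simp add: K0_def abs_mult mult.assoc)
    qed
    have 2: "\<bar>(tens p ?z x - tens p ?w x) * curv ?y * slope_x n z x\<bar> \<le> cab_b p * pi * (Cv * ?d) * 1 * \<bar>slope_x n z x\<bar>"
      unfolding abs_mult by (intro mult_mono td abs_curv_le mult_nonneg_nonneg) (use b Cv_nonneg in auto)
    have 3: "\<bar>tens p ?w x * (curv ?y - curv ?v) * slope_x n z x\<bar> \<le> tens_bd r * (3 * (Cv * ?d)) * \<bar>slope_x n z x\<bar>"
      unfolding abs_mult using curv_lipschitz[of ?y ?v] yv
      by (intro mult_mono tz mult_nonneg_nonneg) (use M Cv_nonneg in auto)
    have 4: "\<bar>tens p ?w x * curv ?v * (slope_x n z x - slope_x n w x)\<bar> \<le> tens_bd r * 1 * \<bar>slope_x n z x - slope_x n w x\<bar>"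
      unfolding abs_mult by (intro mult_mono tz abs_curv_le mult_nonneg_nonneg) (use M in auto)
    have t: "\<bar>q1 + q2\<bar> \<le> b1 + b2" if "\<bar>q1\<bar> \<le> b1" "\<bar>q2\<bar> \<le> b2" for q1 q2 b1 b2 :: real
      using that by (rule order_trans[OF abs_triangle_ineq add_mono])
    have eq: "hz_x n z x - hz_x n w x = cab_c p * cab_a p * dir (slope0 p x) * (dir ?y - dir ?v)
        + ((tens p ?z x - tens p ?w x) * curv ?y * slope_x n z x
        + (tens p ?w x * (curv ?y - curv ?v) * slope_x n z x
        + tens p ?w x * curv ?v * (slope_x n z x - slope_x n w x)))"
      by (simp add: hz_x_def algebra_simps)
    have g: "g x = K0 + (cab_b p * pi * (Cv * ?d) * 1 * \<bar>slope_x n z x\<bar>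
        + (tens_bd r * (3 * (Cv * ?d)) * \<bar>slope_x n z x\<bar> + tens_bd r * 1 * \<bar>slope_x n z x - slope_x n w x\<bar>))"
      unfolding g_def K1_def by (simp only: distrib_right mult.assoc mult_1_left mult_1_right add.assoc mult.left_commute[of 3])
    show ?thesis unfolding eq g by (rule t[OF 1 t[OF 2 t[OF 3 4]]])
  qed
  have L: "(\<lambda>x. \<bar>slope_x n z x\<bar>) \<in> L2" "(\<lambda>x. \<bar>slope_x n z x - slope_x n w x\<bar>) \<in> L2"
    by (intro L2_abs L2_diff slope_x_L2)+
  have gL: "g \<in> L2" unfolding g_def[abs_def] by (intro L2_add L2_scale L L2_const)
  have "norm0 (\<lambda>x. hz_x n z x - hz_x n w x) \<le> norm0 g"
    by (rule norm0_mono[OF L2_measurable[OF L2_diff[OF hz_x_L2 hz_x_L2]] gL pw])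
  also have "\<dots> \<le> norm0 (\<lambda>_. K0) + (norm0 (\<lambda>x. K1 * \<bar>slope_x n z x\<bar>)
      + norm0 (\<lambda>x. tens_bd r * \<bar>slope_x n z x - slope_x n w x\<bar>))"
    unfolding g_def[abs_def]
    by (rule order_trans[OF norm0_triangle add_left_mono[OF norm0_triangle]]) (intro L2_add L2_scale L L2_const)+
  also have "\<dots> \<le> sqrt pi * K0 + (K1 * (r + cab_a p * sqrt pi) + tens_bd r * ?d)"
  proof (intro add_mono)
    show "norm0 (\<lambda>_. K0) \<le> sqrt pi * K0" by (rule norm0_le_sup) (use K0 in auto)
    show "norm0 (\<lambda>x. K1 * \<bar>slope_x n z x\<bar>) \<le> K1 * (r + cab_a p * sqrt pi)"
      unfolding norm0_scale norm0_abs using K1 norm0_slope_x_le[of n z] z by (auto intro: mult_left_mono)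
    show "norm0 (\<lambda>x. tens_bd r * \<bar>slope_x n z x - slope_x n w x\<bar>) \<le> tens_bd r * ?d"
      unfolding norm0_scale norm0_abs using M norm0_slope_x_diff[of n z w] by (simp add: mult_left_mono)
  qed
  also have "\<dots> = lip_bd r * ?d" by (simp add: lip_bd_def K0_def K1_def algebra_simps)
  finally show ?thesis .
qed

lemma hz_coord_tendsto: "(\<lambda>n. freq k * inner0 (hz p (trunc n z)) (cosine k)) \<longlonglongrightarrow> freq k * inner0 (hz p z) (cosine k)"
proof -
  have "(\<lambda>n. norm0 (\<lambda>x. hz p (trunc n z) x - hz p z x)) \<longlonglongrightarrow> 0"
  proof (rule Lim_null_comparison[OF always_eventually])
    let ?C = "sqrt pi * ((cab_b p * pi + tens_bd (norm z)) * Cv)"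
    show "\<forall>n. norm (norm0 (\<lambda>x. hz p (trunc n z) x - hz p z x)) \<le> ?C * norm (trunc n z - z)"
    proof
      fix n
      have "norm0 (\<lambda>x. hz p (trunc n z) x - hz p z x) \<le> sqrt pi * ((cab_b p * pi + tens_bd (norm z)) * Cv * norm (trunc n z - z))"
        by (intro norm0_le_sup hz_diff_le L2_measurable L2_diff hz_L2) auto
      then show "norm (norm0 (\<lambda>x. hz p (trunc n z) x - hz p z x)) \<le> ?C * norm (trunc n z - z)" by (simp add: mult.assoc)
    qed
    have "(\<lambda>n. norm (trunc n z - z)) \<longlonglongrightarrow> 0"
      using trunc_tendsto[of z] by (simp add: tendsto_norm_zero_iff Lim_null[symmetric])
    then show "(\<lambda>n. ?C * norm (trunc n z - z)) \<longlonglongrightarrow> 0" by (rule tendsto_mult_right_zero)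
  qed
  then show ?thesis by (intro tendsto_mult tendsto_const tendsto_inner0 hz_L2 cosine_L2)
qed

text \<open>For truncated arguments Bessel's inequality bounds the coefficients by the L2 norm of
  the differentiated density; with K fixed, the finite sum passes to the limit as the truncation is
  removed.\<close>

lemma hz_coord_diff_le:
  assumes "norm z \<le> r" "norm w \<le> r"
  shows "(\<Sum>k<K. (freq k * inner0 (hz p z) (cosine k) - freq k * inner0 (hz p w) (cosine k))\<^sup>2) \<le> (lip_bd r * norm (z - w))\<^sup>2"
proof (rule LIMSEQ_le_const2)
  show "(\<lambda>n. \<Sum>k<K. (freq k * inner0 (hz p (trunc n z)) (cosine k) - freq k * inner0 (hz p (trunc n w)) (cosine k))\<^sup>2)
      \<longlonglongrightarrow> (\<Sum>k<K. (freq k * inner0 (hz p z) (cosine k) - freq k * inner0 (hz p w) (cosine k))\<^sup>2)"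
    by (intro tendsto_intros hz_coord_tendsto)
  have "(\<Sum>k<K. (freq k * inner0 (hz p (trunc n z)) (cosine k) - freq k * inner0 (hz p (trunc n w)) (cosine k))\<^sup>2) \<le> (lip_bd r * norm (z - w))\<^sup>2" for n
  proof -
    have L: "(\<lambda>x. hz_x n z x - hz_x n w x) \<in> L2" by (intro L2_diff hz_x_L2)
    have "(\<Sum>k<K. (freq k * inner0 (hz p (trunc n z)) (cosine k) - freq k * inner0 (hz p (trunc n w)) (cosine k))\<^sup>2)
        = (\<Sum>k<K. (inner0 (\<lambda>x. hz_x n z x - hz_x n w x) (sine k))\<^sup>2)"
      unfolding hz_trunc_coord by (intro sum.cong refl) (simp add: inner0_diff hz_x_L2 power2_commute)
    also have "\<dots> \<le> (norm0 (\<lambda>x. hz_x n z x - hz_x n w x))\<^sup>2" by (rule bessel[OF L])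
    also have "\<dots> \<le> (lip_bd r * norm (z - w))\<^sup>2" by (intro power_mono norm0_hz_x_diff assms) simp
    finally show ?thesis .
  qed
  then show "\<exists>N. \<forall>n\<ge>N. (\<Sum>k<K. (freq k * inner0 (hz p (trunc n z)) (cosine k) - freq k * inner0 (hz p (trunc n w)) (cosine k))\<^sup>2) \<le> (lip_bd r * norm (z - w))\<^sup>2"
    by blast
qed

lemma lip_bd_nonneg: "0 \<le> r \<Longrightarrow> 0 \<le> lip_bd r"
  unfolding lip_bd_def using a b c Cv_nonneg tens_bd_nonneg[of r]
  by (intro add_nonneg_nonneg mult_nonneg_nonneg) auto

text \<open>At z = 0 truncation changes nothing, so the sequence consists of coefficients of an L2
  function up to sign; \<open>hz_coord_diff_le\<close> carries summability from there to every
  z.\<close>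

lemma coord_Cab: "coord (Cab p z) k = freq k * inner0 (hz p z) (cosine k)"
proof -
  have t0: "trunc n 0 = 0" for n by (rule ell2_eqI) (simp add: coord_trunc)
  have 0: "summable (\<lambda>k. (freq k * inner0 (hz p 0) (cosine k))\<^sup>2)"
    using hz_trunc_coord[of _ 0 0] ell2_boundI(1)[OF bessel[OF hz_x_L2[of 0 0]]] by (simp add: t0)
  have "summable (\<lambda>k. (freq k * inner0 (hz p z) (cosine k) - freq k * inner0 (hz p 0) (cosine k))\<^sup>2)"
    by (rule ell2_boundI(1)[OF hz_coord_diff_le[of z "norm z" 0]]) (auto intro!: mult_nonneg_nonneg lip_bd_nonneg)
  from summable_square_add[OF this 0] show ?thesis unfolding Cab_def by (subst coord_Ell) auto
qed

lemma Cab_lipschitz: "norm z \<le> r \<Longrightarrow> norm w \<le> r \<Longrightarrow> norm (Cab p z - Cab p w) \<le> lip_bd r * norm (z - w)"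
proof (rule norm_ell2_leI)
  assume zw: "norm z \<le> r" "norm w \<le> r"
  show "(\<Sum>k<K. (coord (Cab p z - Cab p w) k)\<^sup>2) \<le> (lip_bd r * norm (z - w))\<^sup>2" for K
    using hz_coord_diff_le[OF zw] by (simp add: coord_Cab)
  have "0 \<le> r" using zw(1) norm_ge_zero order_trans by blast
  then show "0 \<le> lip_bd r * norm (z - w)" by (simp add: lip_bd_nonneg)
qed

lemma lipschitz_on_balls_Cab: "lipschitz_on_balls (Cab p)"
  by (rule lipschitz_on_ballsI) (use Cab_lipschitz in blast)

lemma inner0_hz_wderiv1:
  assumes v: "v \<in> V"
  shows "inner0 (hz p z) (wderiv 1 v) = inner (Cab p z) (cf v)"
proof -
  have "(\<lambda>k. coord (cf v) k * coord (Cab p z) k) sums inner0 (hz p z) (wderiv 1 v)"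
    using sums_inner0_wderiv1[OF hz_L2 v] by (simp add: coord_Cab)
  moreover have "(\<lambda>k. coord (cf v) k * coord (Cab p z) k) sums inner (Cab p z) (cf v)"
    using sums_inner_ell2[of "Cab p z" "cf v"] by (simp add: mult.commute)
  ultimately show ?thesis by (rule sums_unique2)
qed

subsection \<open>The potential\<close>

text \<open>The interpolation inequality between u, u_x and u_xx, source of the mixed product of
  norms in \<open>Pz_taylor\<close>.\<close>

lemma inner0_vfun'_le: "(norm0 (vfun' w))\<^sup>2 \<le> norm w * norm (J w)"
proof -
  have "norm0 (vfun' w) = norm1 (vfun w)"
    unfolding norm1_def inner1_def norm0_def[symmetric]
    by (rule norm0_cong_AE[OF vfun_L2(2)]) (use wderiv1_V[OF vfun_V, of w] in auto)
  then have "(norm0 (vfun' w))\<^sup>2 = inner w (J w)" by (simp add: norm1_V)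
  also have "\<dots> \<le> norm w * norm (J w)" by (rule norm_cauchy_schwarz)
  finally show ?thesis .
qed

text \<open>The cable force is minus the gradient of the potential. The remainders are quadratic in
  the first derivative of the increment, and interpolation trades this for the product of its strong
  and its weak norm; along a mild solution only the weak norm of an increment is known to be of the
  order of the time step.\<close>

lemma Pz_taylor:
  assumes z: "norm z \<le> r"
  shows "\<bar>Pz p (z + w) - Pz p z + inner (Cab p z) (J w)\<bar> \<le> (tens_bd r + cab_b p * pi) * (norm w * norm (J w))"
proof -
  let ?n = "(norm0 (vfun' w))\<^sup>2"
  define \<rho> where "\<rho> x = arcl (slope p (z + w) x) - arcl (slope p z x) - dir (slope p z x) * vfun' w x" for x
  have sl: "slope p (z + w) x = slope p z x + vfun' w x" for x by (simp add: slope_def vfun'_add)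
  have \<rho>b: "\<bar>\<rho> x\<bar> \<le> (vfun' w x)\<^sup>2" for x unfolding \<rho>_def sl by (rule arcl_taylor)
  have c\<rho>: "continuous_on S \<rho>" for S
    unfolding \<rho>_def[abs_def] by (intro continuous_intros continuous_comp_slope continuous_arcl continuous_dir vfun_continuous)
  have \<rho>L: "\<rho> \<in> L2" by (intro L2_continuous c\<rho>)
  have dL: "(\<lambda>x. dir (slope p z x)) \<in> L2" by (intro L2_continuous continuous_comp_slope continuous_dir)
  have int_bd: "\<bar>LINT x|I_leb. m x * \<rho> x\<bar> \<le> B * ?n" if m: "m \<in> L2" "\<And>x. x \<in> I_set \<Longrightarrow> \<bar>m x\<bar> \<le> B" for m B
  proof -
    have "\<bar>LINT x|I_leb. m x * \<rho> x\<bar> \<le> (LINT x|I_leb. \<bar>m x * \<rho> x\<bar>)" by (rule integral_abs_bound)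
    also have "\<dots> \<le> (LINT x|I_leb. B * (vfun' w x)\<^sup>2)"
    proof (rule integral_mono)
      show "integrable I_leb (\<lambda>x. \<bar>m x * \<rho> x\<bar>)" using L2_mult_integrable[OF m(1) \<rho>L] by simp
      show "integrable I_leb (\<lambda>x. B * (vfun' w x)\<^sup>2)" using L2_square[OF vfun_L2(2)] by simp
      show "\<bar>m x * \<rho> x\<bar> \<le> B * (vfun' w x)\<^sup>2" if "x \<in> space I_leb" for x
        unfolding abs_mult using m(2)[of x] that \<rho>b[of x] by (intro mult_mono) auto
    qed
    also have "\<dots> = B * ?n" by (simp add: norm0_square inner0_self)
    finally show ?thesis .
  qed
  define \<Delta> where "\<Delta> = len p (z + w) - len p z"
  define R1 where "R1 = (LINT x|I_leb. \<rho> x)"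
  define R2 where "R2 = (LINT x|I_leb. arcl (slope0 p x) * \<rho> x)"
  have i: "integrable I_leb (\<lambda>x. dir (slope p z x) * vfun' w x)" "integrable I_leb \<rho>"
    by (intro L2_mult_integrable L2_integrable dL vfun_L2 \<rho>L)+
  have \<Delta>_eq: "\<Delta> = inner0 (\<lambda>x. dir (slope p z x)) (vfun' w) + R1"
  proof -
    have "\<Delta> = (LINT x|I_leb. arcl (slope p (z + w) x) - arcl (slope p z x))"
      unfolding \<Delta>_def len_def by (intro Bochner_Integration.integral_diff[symmetric] L2_integrable arcl_slope_L2)
    also have "\<dots> = (LINT x|I_leb. dir (slope p z x) * vfun' w x + \<rho> x)"
      by (simp add: \<rho>_def)
    also have "\<dots> = inner0 (\<lambda>x. dir (slope p z x)) (vfun' w) + R1"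
      unfolding inner0_def R1_def by (rule Bochner_Integration.integral_add[OF i])
    finally show ?thesis .
  qed
  have adL: "(\<lambda>x. arcl (slope0 p x) * dir (slope p z x)) \<in> L2"
    by (intro L2_continuous continuous_intros continuous_comp_slope continuous_arcl continuous_dir)
  have second: "(LINT x|I_leb. arcl (slope0 p x) * (arcl (slope p (z + w) x) - arcl (slope0 p x)))
      - (LINT x|I_leb. arcl (slope0 p x) * (arcl (slope p z x) - arcl (slope0 p x)))
      = inner0 (\<lambda>x. arcl (slope0 p x) * dir (slope p z x)) (vfun' w) + R2"
  proof -
    have "(LINT x|I_leb. arcl (slope0 p x) * (arcl (slope p (z + w) x) - arcl (slope0 p x)))
      - (LINT x|I_leb. arcl (slope0 p x) * (arcl (slope p z x) - arcl (slope0 p x)))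
      = (LINT x|I_leb. arcl (slope0 p x) * (arcl (slope p (z + w) x) - arcl (slope0 p x))
          - arcl (slope0 p x) * (arcl (slope p z x) - arcl (slope0 p x)))"
      by (intro Bochner_Integration.integral_diff[symmetric] L2_mult_integrable L2_diff arcl_slope_L2)
    also have "\<dots> = (LINT x|I_leb. (arcl (slope0 p x) * dir (slope p z x)) * vfun' w x + arcl (slope0 p x) * \<rho> x)"
      by (simp add: \<rho>_def algebra_simps)
    also have "\<dots> = inner0 (\<lambda>x. arcl (slope0 p x) * dir (slope p z x)) (vfun' w) + R2"
      unfolding inner0_def R2_def
      by (intro Bochner_Integration.integral_add L2_mult_integrable adL vfun_L2 arcl_slope_L2 \<rho>L)
    finally show ?thesis .
  qed
  have "hz p z x = - (cab_b p * (len p z - len p 0)) * dir (slope p z x)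
      - cab_c p * (arcl (slope0 p x) * dir (slope p z x))" for x
    by (simp add: hz_def tens_def algebra_simps)
  then have "hz p z = (\<lambda>x. - (cab_b p * (len p z - len p 0)) * dir (slope p z x)
      - cab_c p * (arcl (slope0 p x) * dir (slope p z x)))" by (rule ext)
  then have "inner0 (hz p z) (vfun' w) = - (cab_b p * (len p z - len p 0)) * inner0 (\<lambda>x. dir (slope p z x)) (vfun' w)
      - cab_c p * inner0 (\<lambda>x. arcl (slope0 p x) * dir (slope p z x)) (vfun' w)"
    by (simp only: inner0_diff[OF L2_scale[OF dL] L2_scale[OF adL] vfun_L2(2)] inner0_scale)
  moreover have "inner0 (hz p z) (vfun' w) = inner (Cab p z) (J w)"
  proof -
    have "inner0 (hz p z) (vfun' w) = inner0 (hz p z) (wderiv 1 (vfun w))"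
      by (rule inner0_cong_AE[OF hz_L2 vfun_L2(2)]) (use wderiv1_V[OF vfun_V, of w] in auto)
    then show ?thesis by (simp only: inner0_hz_wderiv1[OF vfun_V] cf_vfun)
  qed
  moreover have "Pz p (z + w) - Pz p z = cab_b p * (len p z - len p 0) * \<Delta> + cab_b p / 2 * \<Delta>\<^sup>2
      + cab_c p * (inner0 (\<lambda>x. arcl (slope0 p x) * dir (slope p z x)) (vfun' w) + R2)"
    unfolding second[symmetric] Pz_def \<Delta>_def by (simp add: power2_eq_square algebra_simps)
  \<comment> \<open>The linear terms cancel. What remains is the second-order part of the length,
    the square of the change of length and the second-order part of the weighted length.\<close>
  ultimately have "Pz p (z + w) - Pz p z + inner (Cab p z) (J w)
      = cab_b p * (len p z - len p 0) * R1 + cab_b p / 2 * \<Delta>\<^sup>2 + cab_c p * R2"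
    unfolding \<Delta>_eq by (simp add: algebra_simps)
  moreover have "\<bar>cab_b p * (len p z - len p 0) * R1\<bar> \<le> cab_b p * (pi * Cv * r) * ?n"
  proof -
    note len_diff_0_le[OF z, of p]
    moreover have "\<bar>R1\<bar> \<le> ?n" using int_bd[of "\<lambda>_. 1" 1] by (simp add: R1_def)
    ultimately show ?thesis unfolding abs_mult using b Cv_nonneg order_trans[OF norm_ge_zero z] by (intro mult_mono mult_nonneg_nonneg) auto
  qed
  moreover have "\<bar>cab_b p / 2 * \<Delta>\<^sup>2\<bar> \<le> cab_b p * pi * ?n"
  proof -
    have "\<bar>\<Delta>\<bar> \<le> (LINT x|I_leb. \<bar>arcl (slope p (z + w) x) - arcl (slope p z x)\<bar>)"
    proof -
      have "\<Delta> = (LINT x|I_leb. arcl (slope p (z + w) x) - arcl (slope p z x))"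
        unfolding \<Delta>_def len_def by (intro Bochner_Integration.integral_diff[symmetric] L2_integrable arcl_slope_L2)
      then show ?thesis by (simp only:) (rule integral_abs_bound)
    qed
    also have "\<dots> \<le> (LINT x|I_leb. \<bar>vfun' w x\<bar>)"
    proof (rule integral_mono)
      show "integrable I_leb (\<lambda>x. \<bar>arcl (slope p (z + w) x) - arcl (slope p z x)\<bar>)"
        by (intro L2_integrable L2_abs L2_diff arcl_slope_L2)
      show "integrable I_leb (\<lambda>x. \<bar>vfun' w x\<bar>)" by (intro L2_integrable L2_abs vfun_L2)
      show "\<bar>arcl (slope p (z + w) x) - arcl (slope p z x)\<bar> \<le> \<bar>vfun' w x\<bar>" for x
        using arcl_lipschitz[of "slope p (z + w) x" "slope p z x"] by (simp add: sl)
    qed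
    also have "\<dots> \<le> sqrt pi * norm0 (vfun' w)" by (rule L2_abs_integral_le[OF vfun_L2(2)])
    finally have "\<bar>\<Delta>\<bar>\<^sup>2 \<le> (sqrt pi * norm0 (vfun' w))\<^sup>2" by (intro power_mono) auto
    then have "\<Delta>\<^sup>2 \<le> pi * ?n" by (simp add: power_mult_distrib)
    then have "cab_b p / 2 * \<Delta>\<^sup>2 \<le> cab_b p / 2 * (pi * ?n)" using b by (intro mult_left_mono) auto
    also have "\<dots> \<le> cab_b p * (pi * ?n)" using b by (intro mult_right_mono) auto
    finally show ?thesis using b by (simp add: mult.assoc abs_mult)
  qed
  moreover have "\<bar>cab_c p * R2\<bar> \<le> cab_c p * (1 + cab_a p * pi) * ?n"
  proof -
    have "\<bar>R2\<bar> \<le> (1 + cab_a p * pi) * ?n" unfolding R2_def by (intro int_bd arcl_slope_L2 arcl_slope0_le)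
    then have "cab_c p * \<bar>R2\<bar> \<le> cab_c p * ((1 + cab_a p * pi) * ?n)" using c by (intro mult_left_mono) auto
    then show ?thesis using c by (simp add: abs_mult mult.assoc)
  qed
  ultimately have "\<bar>Pz p (z + w) - Pz p z + inner (Cab p z) (J w)\<bar> \<le> (tens_bd r + cab_b p * pi) * ?n"
    unfolding tens_bd_def by (simp add: algebra_simps)
  also have "\<dots> \<le> (tens_bd r + cab_b p * pi) * (norm w * norm (J w))"
    using b tens_bd_nonneg[of r] order_trans[OF norm_ge_zero z] by (intro mult_left_mono inner0_vfun'_le add_nonneg_nonneg) auto
  finally show ?thesis .
qed

text \<open>Only the weighted length term can be negative; as arc length densities are positive, its
  integrand is at least minus the square of the density at rest.\<close>

lemma Pz_lower: "- (cab_c p * (LINT x|I_leb. (arcl (slope0 p x))\<^sup>2)) \<le> Pz p z"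
proof -
  have "- (LINT x|I_leb. (arcl (slope0 p x))\<^sup>2) = (LINT x|I_leb. - (arcl (slope0 p x))\<^sup>2)" by simp
  also have "\<dots> \<le> (LINT x|I_leb. arcl (slope0 p x) * (arcl (slope p z x) - arcl (slope0 p x)))"
  proof (rule integral_mono)
    show "integrable I_leb (\<lambda>x. - (arcl (slope0 p x))\<^sup>2)" using L2_square[OF arcl_slope_L2(2)] by simp
    show "integrable I_leb (\<lambda>x. arcl (slope0 p x) * (arcl (slope p z x) - arcl (slope0 p x)))"
      by (intro L2_mult_integrable L2_diff arcl_slope_L2)
    show "- (arcl (slope0 p x))\<^sup>2 \<le> arcl (slope0 p x) * (arcl (slope p z x) - arcl (slope0 p x))" for x
      using mult_nonneg_nonneg[OF less_imp_le[OF arcl_pos[of "slope0 p x"]] less_imp_le[OF arcl_pos[of "slope p z x"]]]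
      by (simp add: power2_eq_square algebra_simps)
  qed
  finally have "cab_c p * - (LINT x|I_leb. (arcl (slope0 p x))\<^sup>2)
      \<le> cab_c p * (LINT x|I_leb. arcl (slope0 p x) * (arcl (slope p z x) - arcl (slope0 p x)))"
    using c by (intro mult_left_mono) auto
  moreover have "0 \<le> cab_b p / 2 * (len p z - len p 0)\<^sup>2" using b by simp
  ultimately show ?thesis unfolding Pz_def by simp
qed

end

section \<open>Lipschitz continuity on balls\<close>

lemma lipschitz_on_balls_linear:
  assumes "bounded_linear f"
  shows "lipschitz_on_balls f"
proof (rule lipschitz_on_ballsI)
  obtain K where K: "\<And>x. norm (f x) \<le> norm x * K" using bounded_linear.bounded[OF assms] by blast
  have "norm (f x - f y) \<le> K * norm (x - y)" for x y
    using K[of "x - y"] linear_diff[OF bounded_linear.linear[OF assms]] by (simp add: mult.commute)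
  then show "\<exists>L. \<forall>x y. norm x \<le> r \<longrightarrow> norm y \<le> r \<longrightarrow> norm (f x - f y) \<le> L * norm (x - y)" for r by blast
qed

lemma lipschitz_on_balls_const: "lipschitz_on_balls (\<lambda>_. c)"
  by (rule lipschitz_on_ballsI) (auto intro: exI[of _ 0])

lemma lipschitz_on_balls_add:
  assumes "lipschitz_on_balls f" "lipschitz_on_balls g"
  shows "lipschitz_on_balls (\<lambda>x. f x + g x)"
proof (rule lipschitz_on_ballsI)
  fix r :: real
  obtain L where L: "\<And>x y. norm x \<le> r \<Longrightarrow> norm y \<le> r \<Longrightarrow> norm (f x - f y) \<le> L * norm (x - y)"
    using lipschitz_on_ballsD[OF assms(1)] by metis
  obtain M where M: "\<And>x y. norm x \<le> r \<Longrightarrow> norm y \<le> r \<Longrightarrow> norm (g x - g y) \<le> M * norm (x - y)"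
    using lipschitz_on_ballsD[OF assms(2)] by metis
  have "norm ((f x + g x) - (f y + g y)) \<le> (L + M) * norm (x - y)" if "norm x \<le> r" "norm y \<le> r" for x y
  proof -
    have e: "(f x + g x) - (f y + g y) = (f x - f y) + (g x - g y)" by simp
    show ?thesis
      unfolding e distrib_right
      using norm_triangle_ineq[of "f x - f y" "g x - g y"] L[OF that] M[OF that] by linarith
  qed
  then show "\<exists>L. \<forall>x y. norm x \<le> r \<longrightarrow> norm y \<le> r \<longrightarrow> norm ((f x + g x) - (f y + g y)) \<le> L * norm (x - y)" by blast
qed

lemma lipschitz_on_balls_compose_linear:
  assumes f: "lipschitz_on_balls f" and l: "bounded_linear l"
  shows "lipschitz_on_balls (\<lambda>x. f (l x))"
proof (rule lipschitz_on_ballsI)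
  fix r :: real assume r: "0 \<le> r"
  obtain K where K: "0 < K" "\<And>x. norm (l x) \<le> norm x * K" using bounded_linear.pos_bounded[OF l] by blast
  obtain L where L: "0 \<le> L" "\<And>x y. norm x \<le> r * K \<Longrightarrow> norm y \<le> r * K \<Longrightarrow> norm (f x - f y) \<le> L * norm (x - y)"
    using lipschitz_on_ballsD[OF f] by metis
  have "norm (f (l x) - f (l y)) \<le> (L * K) * norm (x - y)" if "norm x \<le> r" "norm y \<le> r" for x y
  proof -
    have b: "norm (l z) \<le> r * K" if "norm z \<le> r" for z
      using K(2)[of z] mult_right_mono[OF that, of K] K(1) by linarith
    have "norm (f (l x) - f (l y)) \<le> L * norm (l x - l y)" by (intro L b that)
    also have "l x - l y = l (x - y)" using linear_diff[OF bounded_linear.linear[OF l]] by simp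
    also have "L * norm (l (x - y)) \<le> L * (norm (x - y) * K)" by (intro mult_left_mono K L)
    finally show ?thesis by (simp add: mult_ac)
  qed
  then show "\<exists>L. \<forall>x y. norm x \<le> r \<longrightarrow> norm y \<le> r \<longrightarrow> norm (f (l x) - f (l y)) \<le> L * norm (x - y)" by blast
qed

lemma lipschitz_on_balls_post_linear:
  assumes f: "lipschitz_on_balls f" and l: "bounded_linear l"
  shows "lipschitz_on_balls (\<lambda>x. l (f x))"
proof (rule lipschitz_on_ballsI)
  fix r :: real
  obtain K where K: "0 < K" "\<And>x. norm (l x) \<le> norm x * K" using bounded_linear.pos_bounded[OF l] by blast
  obtain L where L: "\<And>x y. norm x \<le> r \<Longrightarrow> norm y \<le> r \<Longrightarrow> norm (f x - f y) \<le> L * norm (x - y)"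
    using lipschitz_on_ballsD[OF f] by metis
  have "norm (l (f x) - l (f y)) \<le> (K * L) * norm (x - y)" if "norm x \<le> r" "norm y \<le> r" for x y
  proof -
    have "norm (l (f x) - l (f y)) \<le> norm (f x - f y) * K"
      using K(2)[of "f x - f y"] linear_diff[OF bounded_linear.linear[OF l]] by simp
    also have "\<dots> \<le> (L * norm (x - y)) * K" using K(1) by (intro mult_right_mono L that) simp
    finally show ?thesis by (simp add: mult_ac)
  qed
  then show "\<exists>L. \<forall>x y. norm x \<le> r \<longrightarrow> norm y \<le> r \<longrightarrow> norm (l (f x) - l (f y)) \<le> L * norm (x - y)" by blast
qed

lemma lipschitz_on_balls_bounded:
  assumes "lipschitz_on_balls f"
  obtains B where "\<And>x. norm x \<le> r \<Longrightarrow> norm (f x) \<le> B"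
proof (cases "0 \<le> r")
  case True
  obtain L where L: "0 \<le> L" "\<And>x y. norm x \<le> r \<Longrightarrow> norm y \<le> r \<Longrightarrow> norm (f x - f y) \<le> L * norm (x - y)"
    using lipschitz_on_ballsD[OF assms] by metis
  have "norm (f x) \<le> norm (f 0) + L * r" if "norm x \<le> r" for x
    using L(2)[of x 0] that True norm_triangle_sub[of "f x" "f 0"] mult_left_mono[OF that L(1)] by simp
  then show ?thesis using that by blast
next
  case False
  then have "\<not> norm x \<le> r" for x :: 'a using norm_ge_zero[of x] by linarith
  then show ?thesis using that by blast
qed

text \<open>Products inherit the property because the factors are bounded on balls.\<close>

lemma lipschitz_on_balls_bilinear:
  assumes bl: "bounded_bilinear bil" and f: "lipschitz_on_balls f" and g: "lipschitz_on_balls g"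
  shows "lipschitz_on_balls (\<lambda>x. bil (f x) (g x))"
proof (rule lipschitz_on_ballsI)
  fix r :: real assume r: "0 \<le> r"
  obtain K where K: "0 < K" "\<And>a b. norm (bil a b) \<le> norm a * norm b * K" using bounded_bilinear.pos_bounded[OF bl] by blast
  obtain L where L: "0 \<le> L" "\<And>x y. norm x \<le> r \<Longrightarrow> norm y \<le> r \<Longrightarrow> norm (f x - f y) \<le> L * norm (x - y)"
    using lipschitz_on_ballsD[OF f] by metis
  obtain M where M: "0 \<le> M" "\<And>x y. norm x \<le> r \<Longrightarrow> norm y \<le> r \<Longrightarrow> norm (g x - g y) \<le> M * norm (x - y)"
    using lipschitz_on_ballsD[OF g] by metis
  obtain A where A: "\<And>x. norm x \<le> r \<Longrightarrow> norm (f x) \<le> A" using lipschitz_on_balls_bounded[OF f] by metis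
  obtain B where B: "\<And>x. norm x \<le> r \<Longrightarrow> norm (g x) \<le> B" using lipschitz_on_balls_bounded[OF g] by metis
  have "norm (bil (f x) (g x) - bil (f y) (g y)) \<le> ((L * B + A * M) * K) * norm (x - y)"
    if xy: "norm x \<le> r" "norm y \<le> r" for x y
  proof -
    have "bil (f x) (g x) - bil (f y) (g y) = bil (f x - f y) (g x) + bil (f y) (g x - g y)"
      using bounded_bilinear.diff_left[OF bl] bounded_bilinear.diff_right[OF bl] by simp
    then have "norm (bil (f x) (g x) - bil (f y) (g y)) \<le> norm (bil (f x - f y) (g x)) + norm (bil (f y) (g x - g y))"
      by (simp add: norm_triangle_ineq)
    also have "\<dots> \<le> norm (f x - f y) * norm (g x) * K + norm (f y) * norm (g x - g y) * K"
      by (intro add_mono K)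
    also have "\<dots> \<le> (L * norm (x - y)) * B * K + A * (M * norm (x - y)) * K"
      using L(1) M(1) K(1) order_trans[OF norm_ge_zero A[OF xy(1)]]
      by (intro add_mono mult_right_mono mult_mono L M A B xy) auto
    finally show ?thesis by (simp add: algebra_simps)
  qed
  then show "\<exists>L. \<forall>x y. norm x \<le> r \<longrightarrow> norm y \<le> r \<longrightarrow> norm (bil (f x) (g x) - bil (f y) (g y)) \<le> L * norm (x - y)" by blast
qed

lemma isometry_group_prod:
  assumes "isometry_group R1" "isometry_group R2"
  shows "isometry_group (\<lambda>t z. (R1 t (fst z), R2 t (snd z)))"
proof -
  interpret R1: isometry_group R1 by fact
  interpret R2: isometry_group R2 by fact
  show ?thesis
  proof (rule isometry_group.intro)
    show "linear (\<lambda>z. (R1 t (fst z), R2 t (snd z)))" for t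
      by (rule linearI) (simp_all add: R1.R_sum R2.R_sum R1.R_scale R2.R_scale)
  qed (auto simp: norm_prod_def R1.R_add R2.R_add intro!: continuous_on_Pair R1.cont_R R2.cont_R)
qed

section \<open>Time derivatives in the dual space\<close>

lemma V_dual_lin:
  assumes "F \<in> V_dual" "G \<in> V_dual"
  shows "(\<lambda>v. a * F v + b * G v) \<in> V_dual"
proof (rule V_dualI)
  show "a * F (\<lambda>x. \<alpha> * u x + \<gamma> * v x) + b * G (\<lambda>x. \<alpha> * u x + \<gamma> * v x)
      = \<alpha> * (a * F u + b * G u) + \<gamma> * (a * F v + b * G v)" if "u \<in> V" "v \<in> V" for u v \<alpha> \<gamma>
    by (simp add: V_dual_lincomb[OF assms(1) that] V_dual_lincomb[OF assms(2) that] algebra_simps)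
  show "\<bar>a * F v + b * G v\<bar> \<le> (\<bar>a\<bar> * dual_norm F + \<bar>b\<bar> * dual_norm G) * norm2 v" if v: "v \<in> V" for v
  proof -
    have "\<bar>a * F v + b * G v\<bar> \<le> \<bar>a\<bar> * \<bar>F v\<bar> + \<bar>b\<bar> * \<bar>G v\<bar>"
      using abs_triangle_ineq[of "a * F v" "b * G v"] by (simp add: abs_mult)
    also have "\<dots> \<le> \<bar>a\<bar> * (dual_norm F * norm2 v) + \<bar>b\<bar> * (dual_norm G * norm2 v)"
      by (intro add_mono mult_left_mono V_dual_bound assms v) auto
    finally show ?thesis by (simp add: algebra_simps)
  qed
qed

lemma has_time_deriv_dual_eval:
  assumes d: "has_time_deriv V_dual dual_norm T F G" and v: "v \<in> V" and t: "t \<in> {0..T}"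
  shows "((\<lambda>t. F t v) has_vector_derivative G t v) (at t within {0..T})"
  unfolding has_vector_derivative_iff_norm
proof (rule Lim_null_comparison)
  have D: "\<And>t. t \<in> {0..T} \<Longrightarrow> F t \<in> V_dual \<and> G t \<in> V_dual"
    and l: "((\<lambda>r. dual_norm (\<lambda>x. (F r x - F t x) / (r - t) - G t x)) \<longlongrightarrow> 0) (at t within {0..T})"
    using d t by (auto simp: has_time_deriv_def)
  show "\<forall>\<^sub>F r in at t within {0..T}. norm (norm ((F r v - F t v) /\<^sub>R (r - t) - G t v))
      \<le> dual_norm (\<lambda>x. (F r x - F t x) / (r - t) - G t x) * norm2 v"
    unfolding eventually_at_filter
  proof (rule always_eventually, intro allI impI)
    fix r assume r: "r \<in> {0..T}"
    have "(\<lambda>v. 1 * (inverse (r - t) * F r v + (- inverse (r - t)) * F t v) + (-1) * G t v) \<in> V_dual"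
      using D[OF r] D[OF t] by (intro V_dual_lin) auto
    then have "(\<lambda>v. (F r v - F t v) / (r - t) - G t v) \<in> V_dual"
      by (simp add: divide_inverse algebra_simps)
    from V_dual_bound[OF this v]
    show "norm (norm ((F r v - F t v) /\<^sub>R (r - t) - G t v)) \<le> dual_norm (\<lambda>x. (F r x - F t x) / (r - t) - G t x) * norm2 v"
      by (simp add: divide_inverse mult.commute)
  qed
  show "((\<lambda>r. dual_norm (\<lambda>x. (F r x - F t x) / (r - t) - G t x) * norm2 v) \<longlongrightarrow> 0) (at t within {0..T})"
    by (rule tendsto_mult_left_zero[OF l])
qed

lemma dual_norm_lap_le: "dual_norm (\<lambda>v. inner x (lap v)) \<le> norm x"
  by (rule dual_norm_le) (auto simp: norm2_V Cauchy_Schwarz_ineq2)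

text \<open>Functionals on \<open>V\<close> represented by sequences through \<open>lap\<close> have
  a dual norm at most that of the sequence, so differentiating the representing sequence is
  enough.\<close>

lemma has_time_deriv_dualI:
  assumes F: "\<And>t v. t \<in> {0..T} \<Longrightarrow> v \<in> V \<Longrightarrow> F t v = inner (x t) (lap v)"
    and G: "\<And>t v. t \<in> {0..T} \<Longrightarrow> v \<in> V \<Longrightarrow> G t v = inner (y t) (lap v)"
    and d: "\<And>t. t \<in> {0..T} \<Longrightarrow> (x has_vector_derivative y t) (at t within {0..T})"
  shows "has_time_deriv V_dual dual_norm T F G"
  unfolding has_time_deriv_def
proof (intro ballI conjI)
  fix t assume t: "t \<in> {0..T}"
  show "F t \<in> V_dual" by (rule V_dual_cong[OF lap_functional_V_dual[of "x t"]]) (simp add: F[OF t])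
  show "G t \<in> V_dual" by (rule V_dual_cong[OF lap_functional_V_dual[of "y t"]]) (simp add: G[OF t])
  show "((\<lambda>r. dual_norm (\<lambda>v. (F r v - F t v) / (r - t) - G t v)) \<longlongrightarrow> 0) (at t within {0..T})"
  proof (rule Lim_null_comparison)
    show "((\<lambda>r. norm ((x r - x t) /\<^sub>R (r - t) - y t)) \<longlongrightarrow> 0) (at t within {0..T})"
      using d[OF t] by (simp add: has_vector_derivative_iff_norm)
    show "\<forall>\<^sub>F r in at t within {0..T}. norm (dual_norm (\<lambda>v. (F r v - F t v) / (r - t) - G t v)) \<le> norm ((x r - x t) /\<^sub>R (r - t) - y t)"
      unfolding eventually_at_filter
    proof (rule always_eventually, intro allI impI)
      fix r assume r: "r \<in> {0..T}"
      have "dual_norm (\<lambda>v. (F r v - F t v) / (r - t) - G t v) = dual_norm (\<lambda>v. inner ((x r - x t) /\<^sub>R (r - t) - y t) (lap v))"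
        by (rule dual_norm_cong) (simp add: F[OF r] F[OF t] G[OF t] inner_diff_left divide_inverse mult.commute)
      then show "norm (dual_norm (\<lambda>v. (F r v - F t v) / (r - t) - G t v)) \<le> norm ((x r - x t) /\<^sub>R (r - t) - y t)"
        using dual_norm_lap_le dual_norm_nonneg[OF lap_functional_V_dual] by simp
    qed
  qed
qed

lemma Ck_0_dualI:
  assumes F: "\<And>t v. t \<in> {0..T} \<Longrightarrow> v \<in> V \<Longrightarrow> F t v = inner (x t) (lap v)"
    and c: "continuous_on {0..T} x"
  shows "F \<in> Ck 0 V_dual dual_norm T"
proof -
  have "((\<lambda>r. dual_norm (\<lambda>v. F r v - F t v)) \<longlongrightarrow> 0) (at t within {0..T})" if t: "t \<in> {0..T}" for t
  proof (rule Lim_null_comparison)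
    have "((\<lambda>r. x r - x t) \<longlongrightarrow> 0) (at t within {0..T})"
      using c t by (simp add: continuous_on_def Lim_null[symmetric])
    then show "((\<lambda>r. norm (x r - x t)) \<longlongrightarrow> 0) (at t within {0..T})" by (rule tendsto_norm_zero)
    show "\<forall>\<^sub>F r in at t within {0..T}. norm (dual_norm (\<lambda>v. F r v - F t v)) \<le> norm (x r - x t)"
      unfolding eventually_at_filter
    proof (rule always_eventually, intro allI impI)
      fix r assume r: "r \<in> {0..T}"
      have "dual_norm (\<lambda>v. F r v - F t v) = dual_norm (\<lambda>v. inner (x r - x t) (lap v))"
        by (rule dual_norm_cong) (simp add: F[OF r] F[OF t] inner_diff_left)
      then show "norm (dual_norm (\<lambda>v. F r v - F t v)) \<le> norm (x r - x t)"
        using dual_norm_lap_le dual_norm_nonneg[OF lap_functional_V_dual] by simp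
    qed
  qed
  moreover have "F t \<in> V_dual" if "t \<in> {0..T}" for t
    by (rule V_dual_cong[OF lap_functional_V_dual[of "x t"]]) (simp add: F[OF that])
  ultimately show ?thesis by simp
qed

lemma within_Icc_ne_bot: "0 < T \<Longrightarrow> t \<in> {0..T} \<Longrightarrow> at t within {0..T} \<noteq> bot" for t :: real
  by (simp add: trivial_limit_within islimpt_Icc)

lemma vector_derivative_unique_Icc:
  assumes "0 < T" "t \<in> {0..T}" "(f has_vector_derivative a) (at t within {0..T})" "(f has_vector_derivative b) (at t within {0..T})"
  shows "a = b"
  using vector_derivative_unique_within[OF within_Icc_ne_bot[OF assms(1,2)] assms(3,4)] .

text \<open>\<open>dt\<close> picks some derivative. Once one is known to exist, every choice has
  the same coefficients, because derivatives within a non-degenerate interval are unique; the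
  representative itself stays undetermined.\<close>

lemma dt_props:
  assumes T: "0 < T" and d: "has_time_deriv L2 norm0 T u v"
  shows "has_time_deriv L2 norm0 T u (dt T u)" "\<And>t. t \<in> {0..T} \<Longrightarrow> cf (dt T u t) = cf (v t)"
    "\<And>t. t \<in> {0..T} \<Longrightarrow> dt T u t \<in> L2"
proof -
  show h: "has_time_deriv L2 norm0 T u (dt T u)"
    unfolding time_deriv_def using d by (rule someI[where P="has_time_deriv L2 norm0 T u"])
  fix t assume t: "t \<in> {0..T}"
  show "cf (dt T u t) = cf (v t)"
    using vector_derivative_unique_Icc[OF T t] h d t unfolding L2_rep.has_time_deriv_iff by blast
  show "dt T u t \<in> L2" using h t unfolding L2_rep.has_time_deriv_iff by blast
qed

text \<open>Two choices by \<open>SOME\<close> are nested, and functionals are arbitrary off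
  \<open>V\<close>. The chosen first derivative is known to agree with \<open>F\<close> on
  \<open>V\<close> only, but the dual norm sees no more than that, so \<open>G\<close> is a
  derivative of the chosen one too.\<close>

lemma dtt_dual_eqI:
  assumes T: "0 < T" and d: "has_time_deriv V_dual dual_norm T (\<lambda>t. emb (u t)) F"
    and d2: "has_time_deriv V_dual dual_norm T F G" and v: "v \<in> V" and t: "t \<in> {0..T}"
  shows "dtt_dual T u t v = G t v"
    "((\<lambda>t. F t v) has_vector_derivative dtt_dual T u t v) (at t within {0..T})"
proof -
  let ?F = "time_deriv V_dual dual_norm T (\<lambda>t. emb (u t))"
  have h: "has_time_deriv V_dual dual_norm T (\<lambda>t. emb (u t)) ?F"
    unfolding time_deriv_def using d by (rule someI[where P="has_time_deriv V_dual dual_norm T (\<lambda>t. emb (u t))"])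
  have FF: "?F r w = F r w" if "r \<in> {0..T}" "w \<in> V" for r w
    by (rule vector_derivative_unique_Icc[OF T that(1) has_time_deriv_dual_eval[OF h that(2,1)]
          has_time_deriv_dual_eval[OF d that(2,1)]])
  have "has_time_deriv V_dual dual_norm T ?F G"
    unfolding has_time_deriv_def
  proof (intro ballI conjI)
    fix r assume r: "r \<in> {0..T}"
    show "?F r \<in> V_dual" using h r by (simp add: has_time_deriv_def)
    show "G r \<in> V_dual" using d2 r by (simp add: has_time_deriv_def)
    have l: "((\<lambda>s. dual_norm (\<lambda>x. (F s x - F r x) / (s - r) - G r x)) \<longlongrightarrow> 0) (at r within {0..T})"
      using d2 r by (simp add: has_time_deriv_def)
    show "((\<lambda>s. dual_norm (\<lambda>x. (?F s x - ?F r x) / (s - r) - G r x)) \<longlongrightarrow> 0) (at r within {0..T})"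
    proof (rule Lim_transform_eventually[OF l])
      show "\<forall>\<^sub>F s in at r within {0..T}. dual_norm (\<lambda>x. (F s x - F r x) / (s - r) - G r x)
          = dual_norm (\<lambda>x. (?F s x - ?F r x) / (s - r) - G r x)"
        unfolding eventually_at_filter
        by (rule always_eventually) (auto intro!: dual_norm_cong simp: FF FF[OF r])
    qed
  qed
  then have h2: "has_time_deriv V_dual dual_norm T ?F (dtt_dual T u)"
    unfolding dtt_dual_def[abs_def] time_deriv_def[of _ _ _ "?F"] by (rule someI[where P="has_time_deriv V_dual dual_norm T ?F"])
  have e: "((\<lambda>t. ?F t v) has_vector_derivative dtt_dual T u t v) (at t within {0..T})"
    by (rule has_time_deriv_dual_eval[OF h2 v t])
  show "((\<lambda>t. F t v) has_vector_derivative dtt_dual T u t v) (at t within {0..T})"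
    by (rule has_vector_derivative_transform[OF t _ e]) (simp add: FF v)
  then show "dtt_dual T u t v = G t v"
    by (rule vector_derivative_unique_Icc[OF T t _ has_time_deriv_dual_eval[OF d2 v t]])
qed

text \<open>Links the two notions of time derivative: on \<open>V\<close> the dual derivative of the
  embedded function is the pairing with its L2 derivative, so \<open>dtt_dual\<close> differentiates
  \<open>inner0 (dt T u t) v\<close> in t.\<close>

lemma weak_time_props:
  assumes T: "0 < T" and V: "u \<in> Ck 0 V norm2 T" and L: "u \<in> Ck 1 L2 norm0 T"
    and D: "(\<lambda>t. emb (u t)) \<in> Ck 2 V_dual dual_norm T"
  shows "continuous_on {0..T} (\<lambda>t. lap (u t))" "continuous_on {0..T} (\<lambda>t. cf (dt T u t))"
    "\<And>t. t \<in> {0..T} \<Longrightarrow> u t \<in> V" "\<And>t. t \<in> {0..T} \<Longrightarrow> dt T u t \<in> L2"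
    "\<And>t. t \<in> {0..T} \<Longrightarrow> ((\<lambda>t. cf (u t)) has_vector_derivative cf (dt T u t)) (at t within {0..T})"
    "\<And>t v. t \<in> {0..T} \<Longrightarrow> v \<in> V \<Longrightarrow> ((\<lambda>t. inner0 (dt T u t) v) has_vector_derivative dtt_dual T u t v) (at t within {0..T})"
proof -
  show c: "continuous_on {0..T} (\<lambda>t. lap (u t))" and uV: "\<And>t. t \<in> {0..T} \<Longrightarrow> u t \<in> V"
    using V unfolding V_rep.Ck_0_iff by auto
  obtain v1 where v1: "v1 \<in> Ck 0 L2 norm0 T" "has_time_deriv L2 norm0 T u v1" using L by auto
  note p = dt_props[OF T v1(2)]
  show "\<And>t. t \<in> {0..T} \<Longrightarrow> dt T u t \<in> L2" by (rule p(3))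
  have "continuous_on {0..T} (\<lambda>t. cf (v1 t))" using v1(1) unfolding L2_rep.Ck_0_iff by auto
  then show "continuous_on {0..T} (\<lambda>t. cf (dt T u t))" by (rule continuous_on_eq) (simp add: p(2))
  show d: "((\<lambda>t. cf (u t)) has_vector_derivative cf (dt T u t)) (at t within {0..T})" if "t \<in> {0..T}" for t
    using p(1) that unfolding L2_rep.has_time_deriv_iff by blast
  have uL: "u t \<in> L2" if "t \<in> {0..T}" for t using V_hw(4)[OF uV[OF that]] .
  obtain F G where FG: "has_time_deriv V_dual dual_norm T (\<lambda>t. emb (u t)) F" "has_time_deriv V_dual dual_norm T F G"
    using D by (auto simp: numeral_2_eq_2)
  fix t v assume t: "t \<in> {0..T}" and v: "v \<in> V"
  have F: "F r v = inner0 (dt T u r) v" if r: "r \<in> {0..T}" for r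
  proof (rule vector_derivative_unique_Icc[OF T r])
    show "((\<lambda>t. emb (u t) v) has_vector_derivative F r v) (at r within {0..T})"
      by (rule has_time_deriv_dual_eval[OF FG(1) v r])
    have "((\<lambda>t. inner (cf (u t)) (cf v)) has_vector_derivative inner (cf (dt T u r)) (cf v)) (at r within {0..T})"
      by (rule bounded_linear.has_vector_derivative[OF bounded_linear_inner_left d[OF r]])
    then have "((\<lambda>t. inner (cf (u t)) (cf v)) has_vector_derivative inner0 (dt T u r) v) (at r within {0..T})"
      by (simp add: inner_cf p(3)[OF r] V_hw(4)[OF v])
    then show "((\<lambda>t. emb (u t) v) has_vector_derivative inner0 (dt T u r) v) (at r within {0..T})"
      by (rule has_vector_derivative_transform[OF r, rotated]) (simp add: emb_def inner_cf uL V_hw(4)[OF v])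
  qed
  show "((\<lambda>t. inner0 (dt T u t) v) has_vector_derivative dtt_dual T u t v) (at t within {0..T})"
    by (rule has_vector_derivative_transform[OF t _ dtt_dual_eqI(2)[OF T FG v t]]) (simp add: F)
qed

section \<open>Properties of the rotation flow in terms of J\<close>

text \<open>Differentiable coordinates alone do not give a derivative in norm. With a continuous
  candidate \<open>y\<close> one integrates coordinatewise and applies the fundamental theorem in
  \<open>ell2\<close>.\<close>

lemma ell2_deriv_of_coords:
  fixes x y :: "real \<Rightarrow> ell2"
  assumes y: "continuous_on {0..T} y"
    and d: "\<And>k t. t \<in> {0..T} \<Longrightarrow> ((\<lambda>t. coord (x t) k) has_real_derivative coord (y t) k) (at t within {0..T})"
    and t: "t \<in> {0..T}"
  shows "(x has_vector_derivative y t) (at t within {0..T})"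
proof -
  have e: "x r = x 0 + integral {0..r} y" if r: "r \<in> {0..T}" for r
  proof (rule ell2_eqI)
    fix k
    have int: "y integrable_on {0..r}" by (intro integrable_continuous_real continuous_on_subset[OF y]) (use r in auto)
    have "((\<lambda>t. coord (y t) k) has_integral (coord (x r) k - coord (x 0) k)) {0..r}"
    proof (rule fundamental_theorem_of_calculus)
      fix s assume "s \<in> {0..r}"
      then have "((\<lambda>t. coord (x t) k) has_real_derivative coord (y s) k) (at s within {0..T})" using r by (intro d) auto
      then show "((\<lambda>t. coord (x t) k) has_vector_derivative coord (y s) k) (at s within {0..r})"
        unfolding has_real_derivative_iff_has_vector_derivative
        by (rule has_vector_derivative_within_subset) (use r in auto)
    qed (use r in auto)
    then have "integral {0..r} (\<lambda>t. coord (y t) k) = coord (x r) k - coord (x 0) k" by (rule integral_unique)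
    then show "coord (x r) k = coord (x 0 + integral {0..r} y) k"
      using integral_linear[OF int bounded_linear_coord[of k]] by (simp add: o_def)
  qed
  have "((\<lambda>r. x 0 + integral {0..r} y) has_vector_derivative 0 + y t) (at t within {0..T})"
    by (intro has_vector_derivative_add has_vector_derivative_const integral_has_vector_derivative y t)
  then have "((\<lambda>r. x 0 + integral {0..r} y) has_vector_derivative y t) (at t within {0..T})" by simp
  then show ?thesis by (rule has_vector_derivative_transform[OF t, rotated]) (rule e)
qed

text \<open>The natural frequencies of a beam grow with the square of the wave number, so that
  \<open>J\<close> exactly cancels the unbounded factor.\<close>

definition om :: "real \<Rightarrow> nat \<Rightarrow> real" where "om c k = c * (freq k)\<^sup>2"

text \<open>The generator multiplies by c times the squared wave number; applying \<open>J\<close>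
  removes that square and leaves derivatives that are continuous in norm.\<close>

lemma rot_mild_J_derivs:
  fixes z :: "real \<Rightarrow> ell2 \<times> ell2" and n :: "real \<Rightarrow> ell2"
  assumes n: "continuous_on {0..T} n" and zc: "continuous_on {0..T} z"
    and z: "\<And>t. t \<in> {0..T} \<Longrightarrow> rot (om c) (- t) (z t) = z 0 + integral {0..t} (\<lambda>s. rot (om c) (- s) (0, n s))"
    and t: "t \<in> {0..T}"
  shows "((\<lambda>t. J (fst (z t))) has_vector_derivative c *\<^sub>R snd (z t)) (at t within {0..T})"
    "((\<lambda>t. J (snd (z t))) has_vector_derivative - c *\<^sub>R fst (z t) + J (n t)) (at t within {0..T})"
proof -
  note d = coord_derivs_of_rot_mild[OF n z]
  have cJ: "continuous_on {0..T} (\<lambda>t. J (n t))" by (intro bounded_linear.continuous_on[OF bounded_linear_J] n)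
  show "((\<lambda>t. J (fst (z t))) has_vector_derivative c *\<^sub>R snd (z t)) (at t within {0..T})"
  proof (rule ell2_deriv_of_coords[OF _ _ t])
    show "continuous_on {0..T} (\<lambda>t. c *\<^sub>R snd (z t))" by (intro continuous_intros zc)
    fix k s assume s: "s \<in> {0..T}"
    have "((\<lambda>t. coord (fst (z t)) k / (freq k)\<^sup>2) has_real_derivative om c k * coord (snd (z s)) k / (freq k)\<^sup>2) (at s within {0..T})"
      by (rule DERIV_cdivide[OF d(1)[OF _ s]])
    then show "((\<lambda>t. coord (J (fst (z t))) k) has_real_derivative coord (c *\<^sub>R snd (z s)) k) (at s within {0..T})"
      by (simp add: coord_J om_def)
  qed
  show "((\<lambda>t. J (snd (z t))) has_vector_derivative - c *\<^sub>R fst (z t) + J (n t)) (at t within {0..T})"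
  proof (rule ell2_deriv_of_coords[OF _ _ t])
    show "continuous_on {0..T} (\<lambda>t. - c *\<^sub>R fst (z t) + J (n t))" by (intro continuous_intros zc cJ)
    fix k s assume s: "s \<in> {0..T}"
    have "((\<lambda>t. coord (snd (z t)) k / (freq k)\<^sup>2) has_real_derivative (- om c k * coord (fst (z s)) k + coord (n s) k) / (freq k)\<^sup>2) (at s within {0..T})"
      by (rule DERIV_cdivide[OF d(2)[OF _ s]])
    then show "((\<lambda>t. coord (J (snd (z t))) k) has_real_derivative coord (- c *\<^sub>R fst (z s) + J (n s)) k) (at s within {0..T})"
      by (simp add: coord_J om_def add_divide_distrib diff_divide_distrib)
  qed
qed

text \<open>Elements of the range of \<open>J\<close> lie in the domain of the generator: the
  increments of sine and cosine are at most c times the squared wave number times |h|, and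
  \<open>J\<close> divides by that square.\<close>

lemma rot_domain_lipschitz:
  assumes c: "0 \<le> c"
  shows "norm (rot (om c) h (J a, J b) - (J a, J b)) \<le> 2 * c * (norm a + norm b) * \<bar>h\<bar>"
proof -
  have sb: "\<bar>sin (om c k * h) / (freq k)\<^sup>2\<bar> \<le> c * \<bar>h\<bar>" and cb: "\<bar>(cos (om c k * h) - 1) / (freq k)\<^sup>2\<bar> \<le> c * \<bar>h\<bar>" for k
  proof -
    have x: "\<bar>om c k * h\<bar> = (c * \<bar>h\<bar>) * (freq k)\<^sup>2" using c by (simp add: om_def abs_mult)
    have s: "\<bar>sin (om c k * h)\<bar> \<le> (c * \<bar>h\<bar>) * (freq k)\<^sup>2" using abs_sin_x_le_abs_x[of "om c k * h"] unfolding x .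
    then show "\<bar>sin (om c k * h) / (freq k)\<^sup>2\<bar> \<le> c * \<bar>h\<bar>" by (simp add: abs_divide divide_le_eq)
    have "\<bar>cos (om c k * h) - cos 0\<bar> \<le> 1 * \<bar>om c k * h - 0\<bar>"
      by (rule lipschitz_of_deriv_bound[where f'="\<lambda>x. - sin x"]) (auto intro!: derivative_eq_intros)
    then have "\<bar>cos (om c k * h) - 1\<bar> \<le> (c * \<bar>h\<bar>) * (freq k)\<^sup>2" using x by simp
    then show "\<bar>(cos (om c k * h) - 1) / (freq k)\<^sup>2\<bar> \<le> c * \<bar>h\<bar>" by (simp add: abs_divide divide_le_eq)
  qed
  let ?d = "rot (om c) h (J a, J b) - (J a, J b)"
  have 1: "fst ?d = mulop (\<lambda>k. (cos (om c k * h) - 1) / (freq k)\<^sup>2) a + mulop (\<lambda>k. sin (om c k * h) / (freq k)\<^sup>2) b"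
    by (rule ell2_eqI, simp only: fst_diff snd_diff fst_conv snd_conv coord_diff coord_add coord_rot coord_J
        coord_mulop_bdd[OF sb] coord_mulop_bdd[OF cb]) (simp add: algebra_simps diff_divide_distrib)
  have 2: "snd ?d = mulop (\<lambda>k. (cos (om c k * h) - 1) / (freq k)\<^sup>2) b - mulop (\<lambda>k. sin (om c k * h) / (freq k)\<^sup>2) a"
    by (rule ell2_eqI, simp only: fst_diff snd_diff fst_conv snd_conv coord_diff coord_add coord_rot coord_J
        coord_mulop_bdd[OF sb] coord_mulop_bdd[OF cb]) (simp add: algebra_simps diff_divide_distrib)
  have "norm (fst ?d) \<le> c * \<bar>h\<bar> * norm a + c * \<bar>h\<bar> * norm b"
    unfolding 1 by (rule order_trans[OF norm_triangle_ineq add_mono[OF norm_mulop_le[OF cb] norm_mulop_le[OF sb]]])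
  moreover have "norm (snd ?d) \<le> c * \<bar>h\<bar> * norm b + c * \<bar>h\<bar> * norm a"
    unfolding 2 by (rule order_trans[OF norm_triangle_ineq4 add_mono[OF norm_mulop_le[OF cb] norm_mulop_le[OF sb]]])
  moreover have "norm ?d \<le> norm (fst ?d) + norm (snd ?d)"
    unfolding norm_prod_def by (rule sqrt_sum_squares_le_sum) simp_all
  ultimately show ?thesis by (simp add: algebra_simps)
qed

text \<open>Sines are eigenfunctions; testing the weak equation with them extracts single
  coordinates.\<close>

lemma lap_sine: "sine k \<in> V" "lap (sine k) = Ell (\<lambda>i. if i = k then (freq k)\<^sup>2 else 0)"
  "inner x (lap (sine k)) = (freq k)\<^sup>2 * coord x k" "inner x (cf (sine k)) = coord x k"
proof -
  define z where "z = Ell (\<lambda>i. if i = k then (freq k)\<^sup>2 else 0)"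
  have cz: "coord z i = (if i = k then (freq k)\<^sup>2 else 0)" for i
    unfolding z_def by (subst coord_Ell) (auto intro!: summable_finite[of "{k}"] split: if_splits)
  have "vfun z x = (\<Sum>i\<in>{k}. coord (J z) i * sine i x)" for x
    unfolding vfun_def by (rule suminf_finite) (auto simp: coord_J cz)
  then have v: "vfun z = sine k" by (auto simp: coord_J cz)
  show "sine k \<in> V" using vfun_V[of z] by (simp add: v)
  have "lap (sine k) = z" using lap_vfun[of z] by (simp only: v)
  then show l: "lap (sine k) = Ell (\<lambda>i. if i = k then (freq k)\<^sup>2 else 0)" by (simp only: z_def)
  have "inner x (lap (sine k)) = (\<Sum>i\<in>{k}. coord x i * coord z i)"
    unfolding l z_def[symmetric] inner_ell2_def by (rule suminf_finite) (auto simp: cz)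
  then show "inner x (lap (sine k)) = (freq k)\<^sup>2 * coord x k" by (simp add: cz)
  have "inner x (cf (sine k)) = (\<Sum>i\<in>{k}. coord x i * coord (J z) i)"
    unfolding v[symmetric] cf_vfun inner_ell2_def by (rule suminf_finite) (auto simp: cz coord_J)
  then show "inner x (cf (sine k)) = coord x k" by (simp add: cz coord_J)
qed

lemma test_fun_V: assumes \<phi>: "\<phi> \<in> test_fun" shows "\<phi> \<in> V"
proof -
  have H: "\<phi> \<in> Hk j" for j
    using hw_smooth[OF test_fun_smooth[OF \<phi>]] test_fun_L2[OF \<phi>] by (auto simp: Hk_iff)
  have "hw 1 (\<lambda>x. \<phi> x - \<phi> x) (\<lambda>_. 0)" using hw_smooth[OF smooth_const[of 0], of 1] by simp
  then have "norm_Hk 1 (\<lambda>x. \<phi> x - \<phi> x) = sqrt ((norm0 (\<lambda>x. \<phi> x - \<phi> x))\<^sup>2 + (norm0 (\<lambda>_. 0))\<^sup>2)" by (rule norm_Hk_1_eq)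
  also have "\<dots> = 0" by (simp add: norm0_def inner0_def)
  finally have "\<phi> \<in> H10" using H[of 1] \<phi> unfolding H10_def by force
  then show ?thesis using H by (simp add: V_def)
qed

text \<open>Test functions lie in \<open>V\<close>, where the pairing of \<open>hz\<close> with the
  derivative is already known through \<open>Cab\<close>.\<close>

lemma (in cable) hw_hz: "hw 1 (hz p z) (\<lambda>x. - sy (Cab p z) x)"
  unfolding hw_def
proof (intro conjI ballI hz_L2)
  have m: "- sy (Cab p z) x = (-1) * sy (Cab p z) x" for x by simp
  show "(\<lambda>x. - sy (Cab p z) x) \<in> L2" using L2_scale[OF sy_L2[of "Cab p z"], of "-1"] by simp
  fix \<phi> assume \<phi>: "\<phi> \<in> test_fun"
  have "AE x in I_leb. deriv \<phi> x = wderiv 1 \<phi> x"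
    using hw_unique[OF hw_smooth[OF test_fun_smooth[OF \<phi>], of 1] V_hw(1)[OF test_fun_V[OF \<phi>]]] by simp
  then have "inner0 (hz p z) (deriv \<phi>) = inner0 (hz p z) (wderiv 1 \<phi>)"
    by (intro inner0_cong_AE hz_L2 test_fun_L2 test_fun_deriv \<phi>) auto
  also have "\<dots> = inner0 (sy (Cab p z)) \<phi>"
    using inner0_hz_wderiv1[OF test_fun_V[OF \<phi>], of z] inner_cf[OF sy_L2[of "Cab p z"] test_fun_L2[OF \<phi>]] by simp
  finally show "inner0 (hz p z) ((deriv ^^ 1) \<phi>) = (-1) ^ 1 * inner0 (\<lambda>x. - sy (Cab p z) x) \<phi>"
    unfolding m inner0_scale by simp
qed

section \<open>The fish-bone system as a semilinear evolution equation\<close>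

lemma has_vector_derivative_iff_quotient:
  fixes f :: "real \<Rightarrow> 'a::real_normed_vector"
  shows "(f has_vector_derivative v) (at t within S) \<longleftrightarrow> ((\<lambda>r. (f r - f t) /\<^sub>R (r - t)) \<longlongrightarrow> v) (at t within S)"
  unfolding has_vector_derivative_iff_norm tendsto_norm_zero_iff by (rule Lim_null[symmetric])

text \<open>In the rotating frame the solution is continuously differentiable, and rotating does not
  change norms. The linear part thus drops out, and only the work of the forcing against the
  velocity remains.\<close>

lemma rot_energy_deriv:
  fixes z :: "real \<Rightarrow> ell2 \<times> ell2"
  assumes n: "continuous_on {0..T} n"
    and z: "\<And>t. t \<in> {0..T} \<Longrightarrow> rot \<omega> (- t) (z t) = z 0 + integral {0..t} (\<lambda>s. rot \<omega> (- s) (0, n s))"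
    and t: "t \<in> {0..T}"
  shows "((\<lambda>t. (norm (z t))\<^sup>2) has_real_derivative 2 * inner (snd (z t)) (n t)) (at t within {0..T})"
proof -
  let ?W = "\<lambda>t. z 0 + integral {0..t} (\<lambda>s. rot \<omega> (- s) (0, n s))"
  have c: "continuous_on {0..T} (\<lambda>s. rot \<omega> (- s) (0, n s))" by (intro continuous_intros n)
  have "(?W has_vector_derivative 0 + rot \<omega> (- t) (0, n t)) (at t within {0..T})"
    by (intro has_vector_derivative_add has_vector_derivative_const integral_has_vector_derivative c t)
  then have W: "(?W has_vector_derivative rot \<omega> (- t) (0, n t)) (at t within {0..T})" by simp
  have i: "inner (rot \<omega> (- t) (z t)) (rot \<omega> (- t) (0, n t)) = inner (snd (z t)) (n t)"
    unfolding rot.inner_R by (simp add: inner_prod_def)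
  have "((\<lambda>t. inner (?W t) (?W t)) has_vector_derivative inner (?W t) (rot \<omega> (- t) (0, n t)) + inner (rot \<omega> (- t) (0, n t)) (?W t)) (at t within {0..T})"
    by (rule bounded_bilinear.has_vector_derivative[OF bounded_bilinear_inner W W])
  then have "((\<lambda>t. inner (?W t) (?W t)) has_vector_derivative 2 * inner (snd (z t)) (n t)) (at t within {0..T})"
    unfolding z[OF t, symmetric] inner_commute[of _ "rot \<omega> (- t) (z t)"] i by (simp only: mult_2)
  then show ?thesis
    unfolding has_real_derivative_iff_has_vector_derivative
  proof (rule has_vector_derivative_transform[OF t, rotated])
    fix s assume "s \<in> {0..T}"
    show "(norm (z s))\<^sup>2 = inner (?W s) (?W s)"
      unfolding z[OF \<open>s \<in> {0..T}\<close>, symmetric] rot.inner_R by (rule power2_norm_eq_inner)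
  qed
qed

text \<open>Symmetry of \<open>J\<close> factorises the increment as the pairing of
  \<open>J (x r) - J (x t)\<close> with \<open>x r + x t\<close>, so differentiability in the weak
  norm suffices.\<close>

lemma quadratic_J_deriv:
  assumes x: "continuous_on S x" and d: "((\<lambda>t. J (x t)) has_vector_derivative \<xi>) (at t within S)" and t: "t \<in> S"
  shows "((\<lambda>t. inner (x t) (J (x t))) has_real_derivative 2 * inner (x t) \<xi>) (at t within S)"
  unfolding has_field_derivative_iff
proof -
  have D: "((\<lambda>r. (J (x r) - J (x t)) /\<^sub>R (r - t)) \<longlongrightarrow> \<xi>) (at t within S)"
    using d by (simp add: has_vector_derivative_iff_quotient)
  have xl: "(x \<longlongrightarrow> x t) (at t within S)" using x t by (simp add: continuous_on_def)
  have "((\<lambda>r. inner ((J (x r) - J (x t)) /\<^sub>R (r - t)) (x r + x t)) \<longlongrightarrow> inner \<xi> (x t + x t)) (at t within S)"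
    by (intro tendsto_inner D tendsto_add xl tendsto_const)
  moreover have "inner ((J (x r) - J (x t)) /\<^sub>R (r - t)) (x r + x t) = (inner (x r) (J (x r)) - inner (x t) (J (x t))) / (r - t)" for r
  proof -
    have "inner (J (x r) - J (x t)) (x r + x t) = inner (x r) (J (x r)) - inner (x t) (J (x t))"
      using inner_J[of "x t" "x r"]
      by (simp add: inner_diff_left inner_add_right inner_commute[of "J (x r)"] inner_commute[of "J (x t)" "x t"])
    then show ?thesis by (simp add: divide_inverse mult.commute)
  qed
  moreover have "inner \<xi> (x t + x t) = 2 * inner (x t) \<xi>" by (simp add: inner_add_right inner_commute)
  ultimately show "((\<lambda>r. (inner (x r) (J (x r)) - inner (x t) (J (x t))) / (r - t)) \<longlongrightarrow> 2 * inner (x t) \<xi>) (at t within S)"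
    by simp
qed

text \<open>
  Although \<open>\<xi>\<close> is only the derivative of x in the weaker norm, the quadratic remainder in the expansion
  of the potential is controlled by the product of the strong and the weak norm of the increment.
\<close>

lemma (in cable) Pz_deriv:
  assumes x: "continuous_on S x" and d: "((\<lambda>t. J (x t)) has_vector_derivative \<xi>) (at t within S)" and t: "t \<in> S"
  shows "((\<lambda>t. Pz p (x t)) has_real_derivative - inner (Cab p (x t)) \<xi>) (at t within S)"
  unfolding has_field_derivative_iff
proof -
  let ?D = "\<lambda>r. (J (x r) - J (x t)) /\<^sub>R (r - t)"
  let ?C = "tens_bd (norm (x t)) + cab_b p * pi"
  have D: "(?D \<longlongrightarrow> \<xi>) (at t within S)"
    using d by (simp add: has_vector_derivative_iff_quotient)
  have xl: "((\<lambda>r. x r - x t) \<longlongrightarrow> 0) (at t within S)" using x t by (simp add: continuous_on_def Lim_null[symmetric])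
  have "((\<lambda>r. (Pz p (x r) - Pz p (x t)) / (r - t) + inner (Cab p (x t)) (?D r)) \<longlongrightarrow> 0) (at t within S)"
  proof (rule Lim_null_comparison)
    have "((\<lambda>r. ?C * (norm (x r - x t) * norm (?D r))) \<longlongrightarrow> ?C * (0 * norm \<xi>)) (at t within S)"
      by (intro tendsto_mult tendsto_const tendsto_norm D tendsto_norm_zero xl)
    then show "((\<lambda>r. ?C * (norm (x r - x t) * norm (?D r))) \<longlongrightarrow> 0) (at t within S)" by simp
    show "\<forall>\<^sub>F r in at t within S. norm ((Pz p (x r) - Pz p (x t)) / (r - t) + inner (Cab p (x t)) (?D r))
        \<le> ?C * (norm (x r - x t) * norm (?D r))"
      unfolding eventually_at_filter
    proof (rule always_eventually, intro allI impI)
      fix r assume r: "r \<noteq> t"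
      have "\<bar>Pz p (x t + (x r - x t)) - Pz p (x t) + inner (Cab p (x t)) (J (x r - x t))\<bar>
          \<le> ?C * (norm (x r - x t) * norm (J (x r - x t)))"
        by (rule Pz_taylor) simp
      then have "\<bar>Pz p (x r) - Pz p (x t) + inner (Cab p (x t)) (J (x r) - J (x t))\<bar> / \<bar>r - t\<bar>
          \<le> ?C * (norm (x r - x t) * norm (J (x r) - J (x t))) / \<bar>r - t\<bar>"
        by (intro divide_right_mono) (simp_all add: J_diff)
      moreover have "\<bar>Pz p (x r) - Pz p (x t) + inner (Cab p (x t)) (J (x r) - J (x t))\<bar> / \<bar>r - t\<bar>
          = norm ((Pz p (x r) - Pz p (x t)) / (r - t) + inner (Cab p (x t)) (?D r))"
      proof -
        have "(Pz p (x r) - Pz p (x t)) / (r - t) + inner (Cab p (x t)) (?D r)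
            = (Pz p (x r) - Pz p (x t) + inner (Cab p (x t)) (J (x r) - J (x t))) / (r - t)"
          unfolding inner_scaleR_right add_divide_distrib by (simp only: divide_inverse_commute)
        then show ?thesis by (simp only: abs_divide real_norm_def)
      qed
      moreover have "?C * (norm (x r - x t) * norm (J (x r) - J (x t))) / \<bar>r - t\<bar> = ?C * (norm (x r - x t) * norm (?D r))"
        by (simp add: divide_inverse mult_ac)
      ultimately show "norm ((Pz p (x r) - Pz p (x t)) / (r - t) + inner (Cab p (x t)) (?D r))
          \<le> ?C * (norm (x r - x t) * norm (?D r))" by simp
    qed
  qed
  moreover have "((\<lambda>r. inner (Cab p (x t)) (?D r)) \<longlongrightarrow> inner (Cab p (x t)) \<xi>) (at t within S)"
    by (intro tendsto_inner tendsto_const D)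
  ultimately have "((\<lambda>r. (Pz p (x r) - Pz p (x t)) / (r - t) + inner (Cab p (x t)) (?D r) - inner (Cab p (x t)) (?D r))
      \<longlongrightarrow> 0 - inner (Cab p (x t)) \<xi>) (at t within S)"
    by (rule tendsto_diff)
  then show "((\<lambda>r. (Pz p (x r) - Pz p (x t)) / (r - t)) \<longlongrightarrow> - inner (Cab p (x t)) \<xi>) (at t within S)" by simp
qed

text \<open>The curves x, q and r stand for - u_xx, u_t and the dual element u_tt, the latter
  represented through \<open>lap\<close>. Each is differentiated only after applying
  \<open>J\<close>, which is all that a mild solution offers.\<close>

lemma construct_time_props:
  assumes T: "0 < T" and x: "continuous_on {0..T} x" and q: "continuous_on {0..T} q" and r: "continuous_on {0..T} r"
    and dx': "\<forall>t\<in>{0..T}. ((\<lambda>t. J (x t)) has_vector_derivative q t) (at t within {0..T})"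
    and dq': "\<forall>t\<in>{0..T}. ((\<lambda>t. J (q t)) has_vector_derivative r t) (at t within {0..T})"
  defines "u \<equiv> \<lambda>t. vfun (x t)"
  shows "u \<in> Ck 0 V norm2 T" "u \<in> Ck 1 L2 norm0 T" "(\<lambda>t. emb (u t)) \<in> Ck 2 V_dual dual_norm T"
    "\<And>t. t \<in> {0..T} \<Longrightarrow> dt T u t \<in> L2" "\<And>t. t \<in> {0..T} \<Longrightarrow> cf (dt T u t) = q t"
    "\<And>t v. t \<in> {0..T} \<Longrightarrow> v \<in> V \<Longrightarrow> dtt_dual T u t v = inner (r t) (lap v)"
proof -
  note dx = dx'[rule_format] and dq = dq'[rule_format]
  show "u \<in> Ck 0 V norm2 T" unfolding V_rep.Ck_0_iff u_def by (simp add: x)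
  have d: "has_time_deriv L2 norm0 T u (\<lambda>t. sy (q t))"
    unfolding L2_rep.has_time_deriv_iff u_def using dx by (simp add: cf_vfun)
  moreover have "(\<lambda>t. sy (q t)) \<in> Ck 0 L2 norm0 T" unfolding L2_rep.Ck_0_iff by (simp add: q)
  ultimately have "u \<in> Ck (Suc 0) L2 norm0 T" unfolding Ck.simps(2) by blast
  then show "u \<in> Ck 1 L2 norm0 T" by (simp only: One_nat_def)
  show "dt T u t \<in> L2" "cf (dt T u t) = q t" if "t \<in> {0..T}" for t
    using dt_props(2,3)[OF T d that] by simp_all
  have d1: "has_time_deriv V_dual dual_norm T (\<lambda>t. emb (u t)) (\<lambda>t. emb (sy (q t)))"
  proof (rule has_time_deriv_dualI)
    show "emb (u t) v = inner (J (J (x t))) (lap v)" if "v \<in> V" for t v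
      by (simp add: u_def emb_eq that cf_vfun)
    show "emb (sy (q t)) v = inner (J (q t)) (lap v)" if "v \<in> V" for t v
      by (simp add: emb_eq that)
    show "((\<lambda>t. J (J (x t))) has_vector_derivative J (q t)) (at t within {0..T})" if "t \<in> {0..T}" for t
      by (rule bounded_linear.has_vector_derivative[OF bounded_linear_J dx[OF that]])
  qed
  have d2: "has_time_deriv V_dual dual_norm T (\<lambda>t. emb (sy (q t))) (\<lambda>t v. inner (r t) (lap v))"
    by (rule has_time_deriv_dualI[OF _ _ dq]) (simp_all add: emb_eq)
  have "(\<lambda>t v. inner (r t) (lap v)) \<in> Ck 0 V_dual dual_norm T"
    by (rule Ck_0_dualI[OF _ r]) simp
  then have "(\<lambda>t. emb (sy (q t))) \<in> Ck (Suc 0) V_dual dual_norm T"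
    using d2 unfolding Ck.simps(2) by blast
  then have "(\<lambda>t. emb (u t)) \<in> Ck (Suc (Suc 0)) V_dual dual_norm T"
    using d1 unfolding Ck.simps(2)[of "Suc 0"] by blast
  then show "(\<lambda>t. emb (u t)) \<in> Ck 2 V_dual dual_norm T" by (simp only: numeral_2_eq_2)
  show "dtt_dual T u t v = inner (r t) (lap v)" if "t \<in> {0..T}" "v \<in> V" for t v
    by (rule dtt_dual_eqI(1)[OF T d1 d2 that(2,1)])
qed

type_synonym state = "(ell2 \<times> ell2) \<times> (ell2 \<times> ell2)"

locale fishbone = cable p for p :: fb_params +
  fixes g :: "real \<Rightarrow> real"
  assumes g: "g \<in> L2" and eps: "0 < eps p" and ell: "0 < ell p" and S: "0 < S_par p" and kap: "0 \<le> kap p"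
begin

text \<open>
  A state \<open>((x, q), (y, s))\<close> encodes x = lap w, q = cf w_t, y = cth lap \<open>\<theta>\<close> and s = cf \<open>\<theta>\<close>_t; the factor cth
  makes the linear part of the torsional equation a rotation.
\<close>

definition cth :: real where "cth = sqrt (3 * eps p) / ell p"

lemma cth_pos: "0 < cth" using eps ell by (simp add: cth_def)

text \<open>Dividing the torsional equation by one third of the square of \<open>ell p\<close>
  leaves this coefficient in front of the fourth derivative, so \<open>cth\<close> is the factor of
  the torsional frequencies.\<close>

lemma cth_square: "cth * cth = 3 * eps p / (ell p)\<^sup>2"
  using eps by (simp add: cth_def power2_eq_square)

definition th :: "state \<Rightarrow> ell2" where "th z = (1 / cth) *\<^sub>R fst (snd z)"

definition edge :: "real \<Rightarrow> ell2 \<Rightarrow> ell2 \<Rightarrow> ell2" where "edge c x y = x + c *\<^sub>R y"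

text \<open>The vertical equation without its inertial and fourth order terms, moved to the right
  and written in sine coefficients. Here \<open>fst (fst z)\<close> represents - w_xx, which
  explains the sign of the bracket with \<open>P_par p\<close>, and \<open>J (th z)\<close>
  represents \<theta>.\<close>

definition n1 :: "state \<Rightarrow> ell2" where
  "n1 z = (- mu p) *\<^sub>R snd (fst z)
     + (P_par p - S_par p * inner (fst (fst z)) (J (fst (fst z)))) *\<^sub>R fst (fst z)
     + (Cab p (edge (ell p) (fst (fst z)) (th z)) + Cab p (edge (- ell p) (fst (fst z)) (th z)))
     + cf g + (- (bet p * Ups p)) *\<^sub>R snd (snd z) + (- eta p) *\<^sub>R J (th z)"

definition n2 :: "state \<Rightarrow> ell2" where
  "n2 z = (3 / (ell p)\<^sup>2) *\<^sub>R ((- zeta p) *\<^sub>R snd (snd z) + (- kap p) *\<^sub>R th z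
     + (ell p *\<^sub>R Cab p (edge (ell p) (fst (fst z)) (th z)) + (- ell p) *\<^sub>R Cab p (edge (- ell p) (fst (fst z)) (th z))))"

definition N :: "state \<Rightarrow> state" where "N z = ((0, n1 z), (0, n2 z))"

definition R :: "real \<Rightarrow> state \<Rightarrow> state" where
  "R t z = (rot (om 1) t (fst z), rot (om cth) t (snd z))"

sublocale flow: isometry_group R
  unfolding R_def[abs_def] by (intro isometry_group_prod rot.isometry_group_axioms)

lemma state_linear:
  "bounded_linear (\<lambda>z::state. fst (fst z))" "bounded_linear (\<lambda>z::state. snd (fst z))"
  "bounded_linear th" "bounded_linear (\<lambda>z::state. snd (snd z))"
  "bounded_linear (\<lambda>z. edge c (fst (fst z)) (th z))"
proof -
  show 1: "bounded_linear (\<lambda>z::state. fst (fst z))" "bounded_linear (\<lambda>z::state. snd (fst z))"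
    "bounded_linear (\<lambda>z::state. snd (snd z))"
    by (intro bounded_linear_compose[OF bounded_linear_fst] bounded_linear_compose[OF bounded_linear_snd]
        bounded_linear_fst bounded_linear_snd)+
  show 2: "bounded_linear th"
    unfolding th_def[abs_def]
    by (intro bounded_linear_compose[OF bounded_linear_scaleR_right] bounded_linear_compose[OF bounded_linear_fst] bounded_linear_snd)
  show "bounded_linear (\<lambda>z. edge c (fst (fst z)) (th z))"
    unfolding edge_def by (intro bounded_linear_add 1 bounded_linear_compose[OF bounded_linear_scaleR_right] 2)
qed

lemma lipschitz_on_balls_n1: "lipschitz_on_balls n1"
  unfolding n1_def[abs_def]
proof (intro lipschitz_on_balls_add)
  have "bounded_linear (\<lambda>z::state. J (fst (fst z)))"
    by (rule bounded_linear_compose[OF bounded_linear_J state_linear(1)])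
  then have "lipschitz_on_balls (\<lambda>z::state. inner (fst (fst z)) (J (fst (fst z))))"
    by (intro lipschitz_on_balls_bilinear[OF bounded_bilinear_inner] lipschitz_on_balls_linear state_linear)
  then have "lipschitz_on_balls (\<lambda>z::state. (- S_par p) *\<^sub>R inner (fst (fst z)) (J (fst (fst z))))"
    by (rule lipschitz_on_balls_post_linear[OF _ bounded_linear_scaleR_right])
  from lipschitz_on_balls_add[OF lipschitz_on_balls_const[of "P_par p"] this]
  have "lipschitz_on_balls (\<lambda>z::state. P_par p - S_par p * inner (fst (fst z)) (J (fst (fst z))))"
    by simp
  then show "lipschitz_on_balls (\<lambda>z::state. (P_par p - S_par p * inner (fst (fst z)) (J (fst (fst z)))) *\<^sub>R fst (fst z))"
    by (rule lipschitz_on_balls_bilinear[OF bounded_bilinear_scaleR _ lipschitz_on_balls_linear[OF state_linear(1)]])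
qed (intro lipschitz_on_balls_const lipschitz_on_balls_linear bounded_linear_compose[OF bounded_linear_scaleR_right] state_linear
    bounded_linear_compose[OF bounded_linear_J]
    lipschitz_on_balls_compose_linear[OF lipschitz_on_balls_Cab])+

lemma lipschitz_on_balls_n2: "lipschitz_on_balls n2"
  unfolding n2_def[abs_def]
  by (intro lipschitz_on_balls_post_linear[OF _ bounded_linear_scaleR_right] lipschitz_on_balls_add
      lipschitz_on_balls_linear[OF bounded_linear_compose[OF bounded_linear_scaleR_right state_linear(4)]]
      lipschitz_on_balls_linear[OF bounded_linear_compose[OF bounded_linear_scaleR_right state_linear(3)]]
      lipschitz_on_balls_compose_linear[OF lipschitz_on_balls_Cab state_linear(5)])

lemma lipschitz_on_balls_N: "lipschitz_on_balls N"
proof -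
  have 1: "bounded_linear (\<lambda>x::ell2. ((0::ell2, x), (0::ell2, 0::ell2)))" "bounded_linear (\<lambda>x::ell2. ((0::ell2, 0::ell2), (0::ell2, x)))"
    by (intro bounded_linear_Pair bounded_linear_zero bounded_linear_ident)+
  have "lipschitz_on_balls (\<lambda>z. ((0::ell2, n1 z), (0::ell2, 0::ell2)))"
    using lipschitz_on_balls_post_linear[OF lipschitz_on_balls_n1 1(1)] .
  moreover have "lipschitz_on_balls (\<lambda>z. ((0::ell2, 0::ell2), (0::ell2, n2 z)))"
    using lipschitz_on_balls_post_linear[OF lipschitz_on_balls_n2 1(2)] .
  ultimately have "lipschitz_on_balls (\<lambda>z. ((0::ell2, n1 z), (0::ell2, 0::ell2)) + ((0, 0), (0, n2 z)))" by (rule lipschitz_on_balls_add)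
  then show ?thesis unfolding N_def[abs_def] by (simp only: add_Pair add_0_left add_0_right)
qed

lemma continuous_n: "continuous_on A n1" "continuous_on A n2" "continuous_on A N"
  by (intro lipschitz_on_balls_continuous lipschitz_on_balls_n1 lipschitz_on_balls_n2 lipschitz_on_balls_N)+

lemma mild_iff:
  "flow.mild N T Z \<longleftrightarrow> continuous_on {0..T} Z \<and>
    (\<forall>t\<in>{0..T}. rot (om 1) (- t) (fst (Z t)) = fst (Z 0) + integral {0..t} (\<lambda>s. rot (om 1) (- s) (0, n1 (Z s)))) \<and>
    (\<forall>t\<in>{0..T}. rot (om cth) (- t) (snd (Z t)) = snd (Z 0) + integral {0..t} (\<lambda>s. rot (om cth) (- s) (0, n2 (Z s))))"
proof -
  have "(R (- t) (Z t) = Z 0 + integral {0..t} (\<lambda>s. R (- s) (N (Z s)))) \<longleftrightarrow>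
      rot (om 1) (- t) (fst (Z t)) = fst (Z 0) + integral {0..t} (\<lambda>s. rot (om 1) (- s) (0, n1 (Z s))) \<and>
      rot (om cth) (- t) (snd (Z t)) = snd (Z 0) + integral {0..t} (\<lambda>s. rot (om cth) (- s) (0, n2 (Z s)))"
    if Z: "continuous_on {0..T} Z" and t: "t \<in> {0..T}" for t
  proof -
    have "continuous_on {0..t} (\<lambda>s. R (- s) (N (Z s)))"
      using t by (intro continuous_intros continuous_on_compose2[OF continuous_n(3)[of UNIV]] continuous_on_subset[OF Z]) auto
    then have int: "(\<lambda>s. R (- s) (N (Z s))) integrable_on {0..t}" by (rule integrable_continuous_real)
    have "fst (integral {0..t} (\<lambda>s. R (- s) (N (Z s)))) = integral {0..t} (\<lambda>s. rot (om 1) (- s) (0, n1 (Z s)))"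
      "snd (integral {0..t} (\<lambda>s. R (- s) (N (Z s)))) = integral {0..t} (\<lambda>s. rot (om cth) (- s) (0, n2 (Z s)))"
      using integral_linear[OF int bounded_linear_fst] integral_linear[OF int bounded_linear_snd]
      by (simp_all add: o_def R_def N_def)
    moreover have "fst (R (- t) (Z t)) = rot (om 1) (- t) (fst (Z t))" "snd (R (- t) (Z t)) = rot (om cth) (- t) (snd (Z t))"
      by (simp_all add: R_def)
    ultimately show ?thesis by (simp only: prod_eq_iff[of "R (- t) (Z t)"] fst_add snd_add)
  qed
  then show ?thesis unfolding flow.mild_def by blast
qed

lemma continuous_n_Z:
  assumes "continuous_on {0..T} Z"
  shows "continuous_on {0..T} (\<lambda>t. n1 (Z t))" "continuous_on {0..T} (\<lambda>t. n2 (Z t))" "continuous_on {0..T} (\<lambda>t. th (Z t))"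
  using continuous_on_compose2[OF continuous_n(1)[of UNIV] assms] continuous_on_compose2[OF continuous_n(2)[of UNIV] assms]
    bounded_linear.continuous_on[OF state_linear(3) assms] by auto

lemma mild_J_derivs:
  assumes Z: "flow.mild N T Z" and t: "t \<in> {0..T}"
  shows "((\<lambda>t. J (fst (fst (Z t)))) has_vector_derivative snd (fst (Z t))) (at t within {0..T})"
    "((\<lambda>t. J (snd (fst (Z t)))) has_vector_derivative - fst (fst (Z t)) + J (n1 (Z t))) (at t within {0..T})"
    "((\<lambda>t. J (th (Z t))) has_vector_derivative snd (snd (Z t))) (at t within {0..T})"
    "((\<lambda>t. J (snd (snd (Z t)))) has_vector_derivative - cth *\<^sub>R fst (snd (Z t)) + J (n2 (Z t))) (at t within {0..T})"
proof -
  have c: "continuous_on {0..T} Z" using Z by (simp add: mild_iff)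
  have c12: "continuous_on {0..T} (\<lambda>t. fst (Z t))" "continuous_on {0..T} (\<lambda>t. snd (Z t))" by (intro continuous_intros c)+
  have z1: "rot (om 1) (- t) (fst (Z t)) = fst (Z 0) + integral {0..t} (\<lambda>s. rot (om 1) (- s) (0, n1 (Z s)))"
    and z2: "rot (om cth) (- t) (snd (Z t)) = snd (Z 0) + integral {0..t} (\<lambda>s. rot (om cth) (- s) (0, n2 (Z s)))"
    if "t \<in> {0..T}" for t using Z that by (auto simp: mild_iff)
  note d1 = rot_mild_J_derivs[OF continuous_n_Z(1)[OF c] c12(1) z1 t]
  note d2 = rot_mild_J_derivs[OF continuous_n_Z(2)[OF c] c12(2) z2 t]
  show "((\<lambda>t. J (fst (fst (Z t)))) has_vector_derivative snd (fst (Z t))) (at t within {0..T})"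
    "((\<lambda>t. J (snd (fst (Z t)))) has_vector_derivative - fst (fst (Z t)) + J (n1 (Z t))) (at t within {0..T})"
    "((\<lambda>t. J (snd (snd (Z t)))) has_vector_derivative - cth *\<^sub>R fst (snd (Z t)) + J (n2 (Z t))) (at t within {0..T})"
    using d1 d2 by simp_all
  have "((\<lambda>t. (1 / cth) *\<^sub>R J (fst (snd (Z t)))) has_vector_derivative (1 / cth) *\<^sub>R (cth *\<^sub>R snd (snd (Z t)))) (at t within {0..T})"
    by (rule bounded_linear.has_vector_derivative[OF bounded_linear_scaleR_right d2(1)])
  then show "((\<lambda>t. J (th (Z t))) has_vector_derivative snd (snd (Z t))) (at t within {0..T})"
    using cth_pos linear_scale[OF bounded_linear.linear[OF bounded_linear_J]] by (simp add: th_def)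
qed

subsection \<open>Weak solutions are mild solutions\<close>

definition St :: "(real \<Rightarrow> real) \<Rightarrow> (real \<Rightarrow> real) \<Rightarrow> (real \<Rightarrow> real) \<Rightarrow> (real \<Rightarrow> real) \<Rightarrow> state" where
  "St w v \<theta> \<phi> = ((lap w, cf v), (cth *\<^sub>R lap \<theta>, cf \<phi>))"

lemma th_St [simp]: "th (St w v \<theta> \<phi>) = lap \<theta>"
  using cth_pos by (simp add: th_def St_def)

lemma V_shift:
  assumes w: "w \<in> V" and \<theta>: "\<theta> \<in> V"
  shows "(\<lambda>y. w y + c * \<theta> y) \<in> V" "lap (\<lambda>y. w y + c * \<theta> y) = edge c (lap w) (lap \<theta>)"
  using V_lincomb[OF w \<theta>, of 1 c] by (simp_all add: edge_def)

lemma h_shift_AE: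
  assumes w: "w \<in> V" and \<theta>: "\<theta> \<in> V"
  shows "AE x in I_leb. h_cab p (\<lambda>y. w y + ell p * \<theta> y) x = hz p (edge (ell p) (lap w) (lap \<theta>)) x"
    "AE x in I_leb. h_cab p (\<lambda>y. w y - ell p * \<theta> y) x = hz p (edge (- ell p) (lap w) (lap \<theta>)) x"
  using h_cab_V[OF V_shift(1)[OF assms], of p "ell p"] h_cab_V[OF V_shift(1)[OF assms], of p "- ell p"]
  by (simp_all only: V_shift(2)[OF assms]) simp

lemma f_cab_AE:
  assumes w: "w \<in> V" and \<theta>: "\<theta> \<in> V"
  shows "AE x in I_leb. hz p (edge (ell p) (lap w) (lap \<theta>)) x + hz p (edge (- ell p) (lap w) (lap \<theta>)) x = f_cab p w \<theta> x"
    "AE x in I_leb. ell p * (hz p (edge (ell p) (lap w) (lap \<theta>)) x - hz p (edge (- ell p) (lap w) (lap \<theta>)) x) = fbar_cab p w \<theta> x"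
  using h_shift_AE[OF assms] by (eventually_elim, simp add: f_cab_def fbar_cab_def)+

lemma inner0_f_cab:
  assumes w: "w \<in> V" and \<theta>: "\<theta> \<in> V" and v: "v \<in> V"
  shows "inner0 (f_cab p w \<theta>) (wderiv 1 v) = inner (Cab p (edge (ell p) (lap w) (lap \<theta>)) + Cab p (edge (- ell p) (lap w) (lap \<theta>))) (cf v)"
    "inner0 (fbar_cab p w \<theta>) (wderiv 1 v) = ell p * inner (Cab p (edge (ell p) (lap w) (lap \<theta>)) - Cab p (edge (- ell p) (lap w) (lap \<theta>))) (cf v)"
proof -
  have "inner0 (f_cab p w \<theta>) (wderiv 1 v) = inner0 (\<lambda>x. hz p (edge (ell p) (lap w) (lap \<theta>)) x + hz p (edge (- ell p) (lap w) (lap \<theta>)) x) (wderiv 1 v)"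
    by (rule inner0_cong_AE[symmetric]) (use f_cab_AE(1)[OF w \<theta>] V_hw(5)[OF v] in \<open>auto intro: L2_add hz_L2\<close>)
  then show "inner0 (f_cab p w \<theta>) (wderiv 1 v) = inner (Cab p (edge (ell p) (lap w) (lap \<theta>)) + Cab p (edge (- ell p) (lap w) (lap \<theta>))) (cf v)"
    by (simp only: inner0_add[OF hz_L2 hz_L2 V_hw(5)[OF v]] inner0_hz_wderiv1[OF v] inner_add_left)
  have "inner0 (fbar_cab p w \<theta>) (wderiv 1 v) = inner0 (\<lambda>x. ell p * (hz p (edge (ell p) (lap w) (lap \<theta>)) x - hz p (edge (- ell p) (lap w) (lap \<theta>)) x)) (wderiv 1 v)"
    by (rule inner0_cong_AE[symmetric]) (use f_cab_AE(2)[OF w \<theta>] V_hw(5)[OF v] L2_scale[OF L2_diff[OF hz_L2 hz_L2]] in auto)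
  then show "inner0 (fbar_cab p w \<theta>) (wderiv 1 v) = ell p * inner (Cab p (edge (ell p) (lap w) (lap \<theta>)) - Cab p (edge (- ell p) (lap w) (lap \<theta>))) (cf v)"
    by (simp only: inner0_scale inner0_diff[OF hz_L2 hz_L2 V_hw(5)[OF v]] inner0_hz_wderiv1[OF v] inner_diff_left)
qed

text \<open>Separates the unbounded part, paired with \<open>lap v\<close>, from the rest, which is
  continuous in the energy norm and is paired with \<open>cf v\<close>.\<close>

lemma weak_equation_1:
  assumes w: "w \<in> V" and \<theta>: "\<theta> \<in> V" and v: "v \<in> V" and dw: "dw \<in> L2" and d\<theta>: "d\<theta> \<in> L2"
  shows "mu p * inner0 dw v + inner2 w v + (S_par p * (norm1 w)\<^sup>2 - P_par p) * inner1 w v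
      - inner0 (f_cab p w \<theta>) (wderiv 1 v) - inner0 (\<lambda>x. g x - bet p * Ups p * d\<theta> x - eta p * \<theta> x) v
    = inner (lap w) (lap v) - inner (n1 (St w dw \<theta> d\<theta>)) (cf v)"
proof -
  have vL: "v \<in> L2" "\<theta> \<in> L2" using V_hw(4) v \<theta> by auto
  have "inner0 (\<lambda>x. g x - bet p * Ups p * d\<theta> x - eta p * \<theta> x) v
      = inner0 g v - bet p * Ups p * inner0 d\<theta> v - eta p * inner0 \<theta> v"
    by (simp only: inner0_diff[OF L2_diff[OF g L2_scale[OF d\<theta>]] L2_scale[OF vL(2)] vL(1)]
        inner0_diff[OF g L2_scale[OF d\<theta>] vL(1)] inner0_scale)
  moreover have "inner (n1 (St w dw \<theta> d\<theta>)) (cf v) = - mu p * inner0 dw v + (P_par p - S_par p * inner (lap w) (J (lap w))) * inner (lap w) (cf v)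
      + inner (Cab p (edge (ell p) (lap w) (lap \<theta>)) + Cab p (edge (- ell p) (lap w) (lap \<theta>))) (cf v)
      + inner0 g v - bet p * Ups p * inner0 d\<theta> v - eta p * inner0 \<theta> v"
    unfolding n1_def th_St
    by (simp add: St_def inner_add_left inner_diff_left inner_cf dw d\<theta> g vL cf_V[OF \<theta>, symmetric])
  ultimately show ?thesis
    unfolding inner0_f_cab[OF w \<theta> v] inner2_V[OF w v] inner1_V[OF w v] norm1_V[OF w]
    by (simp add: algebra_simps)
qed

lemma weak_equation_2:
  assumes w: "w \<in> V" and \<theta>: "\<theta> \<in> V" and v: "v \<in> V" and d\<theta>: "d\<theta> \<in> L2"
  shows "zeta p * inner0 d\<theta> v + eps p * inner2 \<theta> v + kap p * inner1 \<theta> v - inner0 (fbar_cab p w \<theta>) (wderiv 1 v)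
    = (ell p)\<^sup>2 / 3 * (cth * inner (cth *\<^sub>R lap \<theta>) (lap v) - inner (n2 (St w dw \<theta> d\<theta>)) (cf v))"
proof -
  have vL: "v \<in> L2" using V_hw(4) v by auto
  have e: "(ell p)\<^sup>2 / 3 * (cth * (cth * a)) = eps p * a" for a
    using ell cth_square by (simp add: mult.assoc[symmetric] power2_eq_square)
  have n: "(ell p)\<^sup>2 / 3 * (3 / (ell p)\<^sup>2 * a) = a" for a using ell by simp
  let ?C = "\<lambda>c. Cab p (edge c (lap w) (lap \<theta>))"
  have "inner (n2 (St w dw \<theta> d\<theta>)) (cf v) = 3 / (ell p)\<^sup>2 * (- zeta p * inner0 d\<theta> v - kap p * inner (lap \<theta>) (cf v)
      + ell p * inner (?C (ell p) - ?C (- ell p)) (cf v))"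
    unfolding n2_def th_St
    by (simp add: St_def inner_add_left inner_diff_left inner_cf d\<theta> vL right_diff_distrib)
  then have m: "(ell p)\<^sup>2 / 3 * inner (n2 (St w dw \<theta> d\<theta>)) (cf v) = - zeta p * inner0 d\<theta> v - kap p * inner (lap \<theta>) (cf v)
      + ell p * inner (?C (ell p) - ?C (- ell p)) (cf v)" by (simp only: n)
  show ?thesis
    unfolding right_diff_distrib inner_scaleR_left e m inner0_f_cab[OF w \<theta> v] inner2_V[OF \<theta> v] inner1_V[OF \<theta> v]
    by simp
qed

text \<open>Testing with single sines turns the weak equations into the scalar oscillators of
  \<open>rot_mild_of_coord_derivs\<close>; the continuity of the state that it requires is part of
  the notion of weak solution.\<close>

lemma weak_imp_mild:
  assumes T: "0 < T" and ws: "weak_solution p g T w0 w1 \<theta>0 \<theta>1 w \<theta>"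
    and init: "w0 \<in> V" "w1 \<in> L2" "\<theta>0 \<in> V" "\<theta>1 \<in> L2"
  defines "Z \<equiv> \<lambda>t. St (w t) (dt T w t) (\<theta> t) (dt T \<theta> t)"
  shows "flow.mild N T Z" "Z 0 = St w0 w1 \<theta>0 \<theta>1"
    "\<And>t. t \<in> {0..T} \<Longrightarrow> w t \<in> V" "\<And>t. t \<in> {0..T} \<Longrightarrow> \<theta> t \<in> V"
    "\<And>t. t \<in> {0..T} \<Longrightarrow> dt T w t \<in> L2" "\<And>t. t \<in> {0..T} \<Longrightarrow> dt T \<theta> t \<in> L2"
proof -
  have reg: "u \<in> Ck 0 V norm2 T" "u \<in> Ck 1 L2 norm0 T" "(\<lambda>t. emb (u t)) \<in> Ck 2 V_dual dual_norm T" if "u = w \<or> u = \<theta>" for u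
    using ws that unfolding weak_solution_def by auto
  note pw = weak_time_props[OF T reg[OF disjI1[OF refl]]] and pt = weak_time_props[OF T reg[OF disjI2[OF refl]]]
  show V: "\<And>t. t \<in> {0..T} \<Longrightarrow> w t \<in> V" "\<And>t. t \<in> {0..T} \<Longrightarrow> \<theta> t \<in> V"
    and L: "\<And>t. t \<in> {0..T} \<Longrightarrow> dt T w t \<in> L2" "\<And>t. t \<in> {0..T} \<Longrightarrow> dt T \<theta> t \<in> L2"
    by (fact pw(3) pt(3) pw(4) pt(4))+
  have ae: "AE x in I_leb. w 0 x = w0 x" "AE x in I_leb. dt T w 0 x = w1 x"
    "AE x in I_leb. \<theta> 0 x = \<theta>0 x" "AE x in I_leb. dt T \<theta> 0 x = \<theta>1 x"
    using ws by (auto simp: weak_solution_def)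
  have T0: "0 \<in> {0..T}" using T by simp
  have lap0: "lap u = lap u'" if "u \<in> V" "u' \<in> V" "AE x in I_leb. u x = u' x" for u u'
  proof -
    have "AE x in I_leb. u x = vfun (lap u') x" using that(3) V_vfun[OF that(2)] by eventually_elim simp
    then show ?thesis by (rule V_of_vfun(2))
  qed
  have "cf (dt T w 0) = cf w1" "cf (dt T \<theta> 0) = cf \<theta>1"
    using cf_eq_iff[OF L(1)[OF T0] init(2)] cf_eq_iff[OF L(2)[OF T0] init(4)] ae by auto
  then show "Z 0 = St w0 w1 \<theta>0 \<theta>1"
    using lap0[OF V(1)[OF T0] init(1) ae(1)] lap0[OF V(2)[OF T0] init(3) ae(3)] by (simp add: Z_def St_def)
  have Zc: "continuous_on {0..T} Z"
    unfolding Z_def St_def by (intro continuous_intros pw pt)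
  have sub: "{0<..T} \<subseteq> {0..T}" by auto
  \<comment> \<open>The equations solved for the second derivatives. They are available for positive
    times, which covers the open interval used below.\<close>
  have eqs: "dtt_dual T w t v = - inner (lap (w t)) (lap v) + inner (n1 (Z t)) (cf v)"
    "dtt_dual T \<theta> t v = - cth * inner (cth *\<^sub>R lap (\<theta> t)) (lap v) + inner (n2 (Z t)) (cf v)"
    if t: "t \<in> {0<..T}" and v: "v \<in> V" for t v
  proof -
    have t': "t \<in> {0..T}" using t by simp
    have "dtt_dual T w t v + mu p * inner0 (dt T w t) v + inner2 (w t) v
          + (S_par p * (norm1 (w t))\<^sup>2 - P_par p) * inner1 (w t) v
          - inner0 (f_cab p (w t) (\<theta> t)) (wderiv 1 v)
        = inner0 (\<lambda>x. g x - bet p * Ups p * dt T \<theta> t x - eta p * \<theta> t x) v"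
      "(ell p)\<^sup>2 / 3 * dtt_dual T \<theta> t v + zeta p * inner0 (dt T \<theta> t) v
          + eps p * inner2 (\<theta> t) v + kap p * inner1 (\<theta> t) v
          - inner0 (fbar_cab p (w t) (\<theta> t)) (wderiv 1 v) = 0"
      using ws t v unfolding weak_solution_def by blast+
    then have 1: "dtt_dual T w t v + (inner (lap (w t)) (lap v) - inner (n1 (Z t)) (cf v)) = 0"
      and 2: "(ell p)\<^sup>2 / 3 * dtt_dual T \<theta> t v + (ell p)\<^sup>2 / 3 * (cth * inner (cth *\<^sub>R lap (\<theta> t)) (lap v) - inner (n2 (Z t)) (cf v)) = 0"
      using weak_equation_1[OF V[OF t'] v L[OF t']] weak_equation_2[OF V[OF t'] v L(2)[OF t'], of "dt T w t"]
      unfolding Z_def by linarith+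
    show "dtt_dual T w t v = - inner (lap (w t)) (lap v) + inner (n1 (Z t)) (cf v)" using 1 by linarith
    have "(ell p)\<^sup>2 / 3 * (dtt_dual T \<theta> t v + (cth * inner (cth *\<^sub>R lap (\<theta> t)) (lap v) - inner (n2 (Z t)) (cf v))) = 0"
      using 2 by (simp only: distrib_left)
    then have "dtt_dual T \<theta> t v + (cth * inner (cth *\<^sub>R lap (\<theta> t)) (lap v) - inner (n2 (Z t)) (cf v)) = 0"
      using ell by simp
    then show "dtt_dual T \<theta> t v = - cth * inner (cth *\<^sub>R lap (\<theta> t)) (lap v) + inner (n2 (Z t)) (cf v)" by linarith
  qed
  \<comment> \<open>The displacement coordinates are those of \<open>cf (u t)\<close> times the
    squared wave number, so each of them is differentiable although \<open>lap (u t)\<close> need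
    not be so in norm.\<close>
  have coords: "((\<lambda>t. coord (lap (u t)) k) has_real_derivative (freq k)\<^sup>2 * coord (cf (dt T u t)) k) (at t)"
    "((\<lambda>t. coord (cf (dt T u t)) k) has_real_derivative dtt_dual T u t (sine k)) (at t)"
    if u: "u = w \<or> u = \<theta>" and t: "0 < t" "t < T" for u k t
  proof -
    note pu = weak_time_props[OF T reg[OF u]]
    have t': "t \<in> {0..T}" and at: "at t within {0..T} = at t" using t by (auto simp: at_within_Icc_at)
    have "((\<lambda>t. coord (cf (u t)) k) has_vector_derivative coord (cf (dt T u t)) k) (at t within {0..T})"
      by (rule bounded_linear.has_vector_derivative[OF bounded_linear_coord pu(5)[OF t']])
    then have "((\<lambda>t. (freq k)\<^sup>2 * coord (cf (u t)) k) has_real_derivative (freq k)\<^sup>2 * coord (cf (dt T u t)) k) (at t within {0..T})"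
      unfolding has_real_derivative_iff_has_vector_derivative[symmetric] by (rule DERIV_cmult)
    then have "((\<lambda>t. coord (lap (u t)) k) has_real_derivative (freq k)\<^sup>2 * coord (cf (dt T u t)) k) (at t within {0..T})"
      by (rule has_field_derivative_transform_within[OF _ zero_less_one t']) (simp add: cf_V pu(3) coord_J)
    then show "((\<lambda>t. coord (lap (u t)) k) has_real_derivative (freq k)\<^sup>2 * coord (cf (dt T u t)) k) (at t)" by (simp only: at)
    have "((\<lambda>t. inner0 (dt T u t) (sine k)) has_real_derivative dtt_dual T u t (sine k)) (at t within {0..T})"
      unfolding has_real_derivative_iff_has_vector_derivative by (rule pu(6)[OF t' lap_sine(1)])
    then have "((\<lambda>t. coord (cf (dt T u t)) k) has_real_derivative dtt_dual T u t (sine k)) (at t within {0..T})"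
      by (rule has_field_derivative_transform_within[OF _ zero_less_one t']) (simp add: coord_cf pu(4))
    then show "((\<lambda>t. coord (cf (dt T u t)) k) has_real_derivative dtt_dual T u t (sine k)) (at t)" by (simp only: at)
  qed
  show "flow.mild N T Z"
    unfolding mild_iff
  proof (intro conjI ballI Zc)
    fix t assume t: "t \<in> {0..T}"
    show "rot (om 1) (- t) (fst (Z t)) = fst (Z 0) + integral {0..t} (\<lambda>s. rot (om 1) (- s) (0, n1 (Z s)))"
    proof (rule rot_mild_of_coord_derivs[OF continuous_n_Z(1)[OF Zc] _ _ _ t])
      show "continuous_on {0..T} (\<lambda>t. fst (Z t))" by (intro continuous_intros Zc)
      fix k s assume s: "0 < s" "s < T"
      then have s': "s \<in> {0<..T}" by simp
      show "((\<lambda>t. coord (fst (fst (Z t))) k) has_real_derivative om 1 k * coord (snd (fst (Z s))) k) (at s)"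
        using coords(1)[OF disjI1[OF refl] s, of k] by (simp add: Z_def St_def om_def)
      show "((\<lambda>t. coord (snd (fst (Z t))) k) has_real_derivative - om 1 k * coord (fst (fst (Z s))) k + coord (n1 (Z s)) k) (at s)"
        using coords(2)[OF disjI1[OF refl] s, of k] unfolding eqs(1)[OF s' lap_sine(1)] lap_sine(3,4)
        by (simp add: Z_def St_def om_def)
    qed
    show "rot (om cth) (- t) (snd (Z t)) = snd (Z 0) + integral {0..t} (\<lambda>s. rot (om cth) (- s) (0, n2 (Z s)))"
    proof (rule rot_mild_of_coord_derivs[OF continuous_n_Z(2)[OF Zc] _ _ _ t])
      show "continuous_on {0..T} (\<lambda>t. snd (Z t))" by (intro continuous_intros Zc)
      fix k s assume s: "0 < s" "s < T"
      then have s': "s \<in> {0<..T}" by simp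
      show "((\<lambda>t. coord (fst (snd (Z t))) k) has_real_derivative om cth k * coord (snd (snd (Z s))) k) (at s)"
        using DERIV_cmult[OF coords(1)[OF disjI2[OF refl] s, of k], of cth] by (simp add: Z_def St_def om_def mult.assoc)
      show "((\<lambda>t. coord (snd (snd (Z t))) k) has_real_derivative - om cth k * coord (fst (snd (Z s))) k + coord (n2 (Z s)) k) (at s)"
        using coords(2)[OF disjI2[OF refl] s, of k] unfolding eqs(2)[OF s' lap_sine(1)] lap_sine(3,4)
        by (simp add: Z_def St_def om_def mult.assoc)
    qed
  qed
qed

subsection \<open>Mild solutions yield weak solutions\<close>

text \<open>The functions synthesised from the displacement coordinates solve the system; the two
  rewritings of the weak form are read backwards.\<close>

lemma mild_imp_weak:
  assumes T: "0 < T" and Z: "flow.mild N T Z" and Z0: "Z 0 = St w0 w1 \<theta>0 \<theta>1"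
    and init: "w0 \<in> V" "w1 \<in> L2" "\<theta>0 \<in> V" "\<theta>1 \<in> L2"
  shows "weak_solution p g T w0 w1 \<theta>0 \<theta>1 (\<lambda>t. vfun (fst (fst (Z t)))) (\<lambda>t. vfun (th (Z t)))"
proof -
  let ?w = "\<lambda>t. vfun (fst (fst (Z t)))" and ?\<theta> = "\<lambda>t. vfun (th (Z t))"
  have c: "continuous_on {0..T} Z" using Z by (simp add: mild_iff)
  note cn = continuous_n_Z[OF c]
  have cJ: "continuous_on {0..T} (\<lambda>t. J (n1 (Z t)))" "continuous_on {0..T} (\<lambda>t. J (n2 (Z t)))"
    by (intro bounded_linear.continuous_on[OF bounded_linear_J] cn)+
  have c1: "continuous_on {0..T} (\<lambda>t. fst (fst (Z t)))" "continuous_on {0..T} (\<lambda>t. snd (fst (Z t)))"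
    "continuous_on {0..T} (\<lambda>t. - fst (fst (Z t)) + J (n1 (Z t)))" "continuous_on {0..T} (\<lambda>t. snd (snd (Z t)))"
    "continuous_on {0..T} (\<lambda>t. - cth *\<^sub>R fst (snd (Z t)) + J (n2 (Z t)))"
    by (intro continuous_intros c cJ)+
  have d: "\<forall>t\<in>{0..T}. ((\<lambda>t. J (fst (fst (Z t)))) has_vector_derivative snd (fst (Z t))) (at t within {0..T})"
    "\<forall>t\<in>{0..T}. ((\<lambda>t. J (snd (fst (Z t)))) has_vector_derivative - fst (fst (Z t)) + J (n1 (Z t))) (at t within {0..T})"
    "\<forall>t\<in>{0..T}. ((\<lambda>t. J (th (Z t))) has_vector_derivative snd (snd (Z t))) (at t within {0..T})"
    "\<forall>t\<in>{0..T}. ((\<lambda>t. J (snd (snd (Z t)))) has_vector_derivative - cth *\<^sub>R fst (snd (Z t)) + J (n2 (Z t))) (at t within {0..T})"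
    using mild_J_derivs[OF Z] by blast+
  note pw = construct_time_props[OF T c1(1,2,3) d(1,2)]
  note pt = construct_time_props[OF T cn(3) c1(4,5) d(3,4)]
  have T0: "0 \<in> {0..T}" using T by simp
  have St: "St (?w t) (dt T ?w t) (?\<theta> t) (dt T ?\<theta> t) = Z t" if t: "t \<in> {0..T}" for t
    unfolding St_def pw(5)[OF t] pt(5)[OF t] lap_vfun using cth_pos by (simp add: th_def)
  have z0: "fst (fst (Z 0)) = lap w0" "snd (fst (Z 0)) = cf w1" "th (Z 0) = lap \<theta>0" "snd (snd (Z 0)) = cf \<theta>1"
    unfolding Z0 th_St by (simp_all add: St_def)
  show ?thesis
    unfolding weak_solution_def
  proof (intro conjI ballI)
    fix u assume "u \<in> {?w, ?\<theta>}"
    then have "u = ?w \<or> u = ?\<theta>" by blast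
    then show "u \<in> Ck 0 V norm2 T" "u \<in> Ck 1 L2 norm0 T" "(\<lambda>t. emb (u t)) \<in> Ck 2 V_dual dual_norm T"
      using pw(1-3) pt(1-3) by blast+
  next
    show "AE x in I_leb. ?w 0 x = w0 x" using V_vfun[OF init(1)] unfolding z0 by eventually_elim simp
    show "AE x in I_leb. ?\<theta> 0 x = \<theta>0 x" using V_vfun[OF init(3)] unfolding z0 by eventually_elim simp
    show "AE x in I_leb. dt T ?w 0 x = w1 x"
      using cf_eq_iff[OF pw(4)[OF T0] init(2)] pw(5)[OF T0] z0 by simp
    show "AE x in I_leb. dt T ?\<theta> 0 x = \<theta>1 x"
      using cf_eq_iff[OF pt(4)[OF T0] init(4)] pt(5)[OF T0] z0 by simp
  next
    fix t v \<phi> assume "t \<in> {0<..T}" and v: "v \<in> V" and \<phi>: "\<phi> \<in> V"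
    then have t: "t \<in> {0..T}" by simp
    have J: "inner (J x) (lap v) = inner x (cf v)" if "v \<in> V" for x v by (simp add: cf_V that inner_J)
    have 1: "dtt_dual T ?w t v = - inner (lap (?w t)) (lap v) + inner (n1 (Z t)) (cf v)"
      unfolding pw(6)[OF t v] by (simp add: inner_diff_left J[OF v])
    have 2: "dtt_dual T ?\<theta> t \<phi> = - cth * inner (cth *\<^sub>R lap (?\<theta> t)) (lap \<phi>) + inner (n2 (Z t)) (cf \<phi>)"
    proof -
      have "fst (snd (Z t)) = cth *\<^sub>R lap (?\<theta> t)" using cth_pos by (simp add: th_def)
      then show ?thesis unfolding pt(6)[OF t \<phi>] by (simp only: inner_add_left J[OF \<phi>] inner_scaleR_left)
    qed
    show "dtt_dual T ?w t v + mu p * inner0 (dt T ?w t) v + inner2 (?w t) v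
          + (S_par p * (norm1 (?w t))\<^sup>2 - P_par p) * inner1 (?w t) v
          - inner0 (f_cab p (?w t) (?\<theta> t)) (wderiv 1 v)
        = inner0 (\<lambda>x. g x - bet p * Ups p * dt T ?\<theta> t x - eta p * ?\<theta> t x) v"
      using weak_equation_1[OF vfun_V vfun_V v pw(4)[OF t] pt(4)[OF t], of "fst (fst (Z t))" "th (Z t)"]
      unfolding St[OF t] 1 by linarith
    have "(ell p)\<^sup>2 / 3 * dtt_dual T ?\<theta> t \<phi> = - ((ell p)\<^sup>2 / 3 * (cth * inner (cth *\<^sub>R lap (?\<theta> t)) (lap \<phi>) - inner (n2 (Z t)) (cf \<phi>)))"
      unfolding 2 by (simp only: mult_minus_right[symmetric] minus_diff_eq mult_minus_left) simp
    then show "(ell p)\<^sup>2 / 3 * dtt_dual T ?\<theta> t \<phi> + zeta p * inner0 (dt T ?\<theta> t) \<phi>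
          + eps p * inner2 (?\<theta> t) \<phi> + kap p * inner1 (?\<theta> t) \<phi>
          - inner0 (fbar_cab p (?w t) (?\<theta> t)) (wderiv 1 \<phi>) = 0"
      using weak_equation_2[OF vfun_V vfun_V \<phi> pt(4)[OF t], of "th (Z t)" "fst (fst (Z t))" "dt T ?w t"]
      unfolding St[OF t] by linarith
  qed
qed

end

section \<open>The energy identity\<close>

lemma inner_J_nonneg: "0 \<le> inner x (J x)"
proof -
  have "inner x (J x) = (norm1 (vfun x))\<^sup>2" by (simp add: norm1_V)
  then show ?thesis by simp
qed

context fishbone
begin

text \<open>The total energy in state coordinates. By the choice of \<open>cth\<close>, the single
  term with \<open>snd z\<close> covers both the torsional kinetic energy and the torsional fourth
  order energy weighted by \<open>eps p\<close>.\<close>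

definition Et :: "state \<Rightarrow> real" where
  "Et z = (norm (fst z))\<^sup>2 / 2 + (ell p)\<^sup>2 / 6 * (norm (snd z))\<^sup>2 + kap p / 2 * inner (th z) (J (th z))
     + Pz p (edge (ell p) (fst (fst z)) (th z)) + Pz p (edge (- ell p) (fst (fst z)) (th z))
     + S_par p / 4 * (inner (fst (fst z)) (J (fst (fst z))))\<^sup>2 - P_par p / 2 * inner (fst (fst z)) (J (fst (fst z)))
     - inner (cf g) (J (fst (fst z)))"

definition dissip :: "state \<Rightarrow> real" where
  "dissip z = - mu p * (norm (snd (fst z)))\<^sup>2 - zeta p * (norm (snd (snd z)))\<^sup>2
     - bet p * Ups p * inner (snd (snd z)) (snd (fst z)) - eta p * inner (J (th z)) (snd (fst z))"

lemma E_tot_St: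
  assumes w: "w \<in> V" and \<theta>: "\<theta> \<in> V" and v: "v \<in> L2" and \<phi>: "\<phi> \<in> L2"
  shows "E_tot p g w v \<theta> \<phi> = Et (St w v \<theta> \<phi>)"
proof -
  have m: "(\<lambda>x. w x - ell p * \<theta> x) = (\<lambda>x. w x + (- ell p) * \<theta> x)" by simp
  have Pi: "Pi_cab p (\<lambda>x. w x + c * \<theta> x) = Pz p (edge c (lap w) (lap \<theta>))" for c
    unfolding Pi_cab_V[OF V_shift(1)[OF w \<theta>]] V_shift(2)[OF w \<theta>] ..
  have e: "(ell p)\<^sup>2 / 6 * (norm (cth *\<^sub>R lap \<theta>))\<^sup>2 = eps p / 2 * (norm (lap \<theta>))\<^sup>2"
    using cth_square ell by (simp add: power_mult_distrib power2_eq_square[of cth])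
  have n4: "norm1 w ^ 4 = ((norm1 w)\<^sup>2)\<^sup>2" by (simp flip: power_mult)
  have gw: "inner0 g w = inner (cf g) (J (lap w))" using inner_cf[OF g V_hw(4)[OF w]] by (simp add: cf_V[OF w])
  have s: "(norm z)\<^sup>2 = (norm (fst z))\<^sup>2 + (norm (snd z))\<^sup>2" for z :: "ell2 \<times> ell2" by (simp add: norm_prod_def)
  have "Et (St w v \<theta> \<phi>) = ((norm (lap w))\<^sup>2 + (norm (cf v))\<^sup>2) / 2 + (ell p)\<^sup>2 / 6 * ((norm (cth *\<^sub>R lap \<theta>))\<^sup>2 + (norm (cf \<phi>))\<^sup>2)
      + kap p / 2 * inner (lap \<theta>) (J (lap \<theta>)) + Pz p (edge (ell p) (lap w) (lap \<theta>)) + Pz p (edge (- ell p) (lap w) (lap \<theta>))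
      + S_par p / 4 * (inner (lap w) (J (lap w)))\<^sup>2 - P_par p / 2 * inner (lap w) (J (lap w)) - inner (cf g) (J (lap w))"
    unfolding Et_def th_St s unfolding St_def fst_conv snd_conv ..
  then show ?thesis
    unfolding E_tot_def E_lin_def m Pi n4 gw norm1_V[OF w] norm1_V[OF \<theta>] norm2_V[OF w] norm2_V[OF \<theta>]
      norm_cf[OF v] norm_cf[OF \<phi>] distrib_left e
    by (simp add: add_divide_distrib)
qed

text \<open>The quadratic parts are handled by \<open>rot_energy_deriv\<close> and
  \<open>quadratic_J_deriv\<close>, the cable potentials by \<open>Pz_deriv\<close>, and the load is
  linear in the weak variable. The conservative forces in \<open>n1\<close> and \<open>n2\<close>
  cancel against the derivatives of their potentials, leaving the damping and the coupling
  terms.\<close>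

lemma Et_deriv:
  assumes Z: "flow.mild N T Z" and t: "t \<in> {0..T}"
  shows "((\<lambda>t. Et (Z t)) has_real_derivative dissip (Z t)) (at t within {0..T})"
proof -
  define x where "x t = fst (fst (Z t))" for t
  define q where "q t = snd (fst (Z t))" for t
  define s where "s t = snd (snd (Z t))" for t
  define y where "y t = th (Z t)" for t
  have c: "continuous_on {0..T} Z" using Z by (simp add: mild_iff)
  have cx: "continuous_on {0..T} x" unfolding x_def by (intro continuous_intros c)
  have cy: "continuous_on {0..T} y" unfolding y_def by (rule continuous_n_Z(3)[OF c])
  have ce: "continuous_on {0..T} (\<lambda>t. edge a (x t) (y t))" for a
    unfolding edge_def by (intro continuous_intros cx cy)
  have dx: "((\<lambda>t. J (x t)) has_vector_derivative q t) (at t within {0..T})"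
    and dy: "((\<lambda>t. J (y t)) has_vector_derivative s t) (at t within {0..T})"
    using mild_J_derivs(1,3)[OF Z t] by (simp_all add: x_def q_def y_def s_def)
  have Je: "J (edge a u v) = J u + a *\<^sub>R J v" for a u v
    unfolding edge_def using linear_add[OF bounded_linear.linear[OF bounded_linear_J]] linear_scale[OF bounded_linear.linear[OF bounded_linear_J]] by simp
  have de: "((\<lambda>t. J (edge a (x t) (y t))) has_vector_derivative q t + a *\<^sub>R s t) (at t within {0..T})" for a
    unfolding Je by (intro has_vector_derivative_add dx bounded_linear.has_vector_derivative[OF bounded_linear_scaleR_right] dy)
  have z1: "rot (om 1) (- t) (fst (Z t)) = fst (Z 0) + integral {0..t} (\<lambda>s. rot (om 1) (- s) (0, n1 (Z s)))"
    and z2: "rot (om cth) (- t) (snd (Z t)) = snd (Z 0) + integral {0..t} (\<lambda>s. rot (om cth) (- s) (0, n2 (Z s)))"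
    if "t \<in> {0..T}" for t using Z that by (auto simp: mild_iff)
  have d1: "((\<lambda>t. (norm (fst (Z t)))\<^sup>2) has_real_derivative 2 * inner (q t) (n1 (Z t))) (at t within {0..T})"
    using rot_energy_deriv[OF continuous_n_Z(1)[OF c] z1 t] by (simp add: q_def)
  have d2: "((\<lambda>t. (norm (snd (Z t)))\<^sup>2) has_real_derivative 2 * inner (s t) (n2 (Z t))) (at t within {0..T})"
    using rot_energy_deriv[OF continuous_n_Z(2)[OF c] z2 t] by (simp add: s_def)
  have dg: "((\<lambda>t. inner (cf g) (J (x t))) has_real_derivative inner (cf g) (q t)) (at t within {0..T})"
    unfolding has_real_derivative_iff_has_vector_derivative
    by (rule bounded_linear.has_vector_derivative[OF bounded_linear_inner_right dx])
  note dqx = quadratic_J_deriv[OF cx dx t] and dqy = quadratic_J_deriv[OF cy dy t]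
  note dP = Pz_deriv[OF ce de t]
  let ?A = "inner (x t) (J (x t))"
  let ?C = "\<lambda>a. Cab p (edge a (x t) (y t))"
  have d: "((\<lambda>t. Et (Z t)) has_real_derivative
      2 * inner (q t) (n1 (Z t)) / 2 + (ell p)\<^sup>2 / 6 * (2 * inner (s t) (n2 (Z t))) + kap p / 2 * (2 * inner (y t) (s t))
      + - inner (?C (ell p)) (q t + ell p *\<^sub>R s t) + - inner (?C (- ell p)) (q t + (- ell p) *\<^sub>R s t)
      + S_par p / 4 * (of_nat 2 * (2 * inner (x t) (q t) * ?A ^ (2 - Suc 0))) - P_par p / 2 * (2 * inner (x t) (q t))
      - inner (cf g) (q t)) (at t within {0..T})"
    unfolding Et_def x_def[symmetric] y_def[symmetric]
    by (intro DERIV_add DERIV_diff DERIV_cmult DERIV_cdivide d1 d2 dg dqx dqy dP DERIV_power)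
  have e1: "2 * inner (q t) (n1 (Z t)) / 2 = - mu p * (norm (q t))\<^sup>2 + (P_par p - S_par p * ?A) * inner (x t) (q t)
      + inner (?C (ell p)) (q t) + inner (?C (- ell p)) (q t) + inner (cf g) (q t) - bet p * Ups p * inner (s t) (q t)
      - eta p * inner (J (y t)) (q t)"
    unfolding n1_def x_def[symmetric] y_def[symmetric] q_def[symmetric] s_def[symmetric]
    by (simp add: inner_add_right inner_diff_right power2_norm_eq_inner inner_commute)
  have e2: "(ell p)\<^sup>2 / 6 * (2 * inner (s t) (n2 (Z t))) = - zeta p * (norm (s t))\<^sup>2 - kap p * inner (y t) (s t)
      + ell p * inner (?C (ell p)) (s t) - ell p * inner (?C (- ell p)) (s t)"
    using ell unfolding n2_def x_def[symmetric] y_def[symmetric] q_def[symmetric] s_def[symmetric]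
    by (simp add: inner_add_right inner_diff_right power2_norm_eq_inner inner_commute)
  show ?thesis
    by (rule DERIV_cong[OF d], unfold e1 e2 dissip_def q_def[symmetric] s_def[symmetric] y_def[symmetric])
      (simp add: inner_add_right inner_diff_right algebra_simps)
qed

lemma Et_integral:
  assumes Z: "flow.mild N T Z" and st: "0 \<le> s" "s \<le> t" "t \<le> T"
  shows "((\<lambda>\<tau>. dissip (Z \<tau>)) has_integral (Et (Z t) - Et (Z s))) {s..t}"
proof (rule fundamental_theorem_of_calculus[OF st(2)])
  fix r assume "r \<in> {s..t}"
  then show "((\<lambda>t. Et (Z t)) has_vector_derivative dissip (Z r)) (at r within {s..t})"
    using Et_deriv[OF Z, of r] st unfolding has_real_derivative_iff_has_vector_derivative[symmetric]
    by (auto elim: has_field_derivative_subset)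
qed

lemma weak_energy_identity:
  assumes T: "0 < T" and ws: "weak_solution p g T w0 w1 \<theta>0 \<theta>1 w \<theta>"
    and init: "w0 \<in> V" "w1 \<in> L2" "\<theta>0 \<in> V" "\<theta>1 \<in> L2" and st: "0 \<le> s" "s \<le> t" "t \<le> T"
  shows "energy_at p g T w \<theta> t + mu p * integral {s..t} (\<lambda>\<tau>. (norm0 (dt T w \<tau>))\<^sup>2)
      + zeta p * integral {s..t} (\<lambda>\<tau>. (norm0 (dt T \<theta> \<tau>))\<^sup>2)
    = energy_at p g T w \<theta> s - bet p * Ups p * integral {s..t} (\<lambda>\<tau>. inner0 (dt T \<theta> \<tau>) (dt T w \<tau>))
      - eta p * integral {s..t} (\<lambda>\<tau>. inner0 (\<theta> \<tau>) (dt T w \<tau>))"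
proof -
  define Z where "Z t = St (w t) (dt T w t) (\<theta> t) (dt T \<theta> t)" for t
  note W = weak_imp_mild[OF T ws init, folded Z_def]
  have c: "continuous_on {0..T} Z" using W(1) by (simp add: mild_iff)
  have cs: "continuous_on {s..t} Z" by (rule continuous_on_subset[OF c]) (use st in auto)
  have E: "energy_at p g T w \<theta> r = Et (Z r)" if "r \<in> {0..T}" for r
    unfolding energy_at_def Z_def by (rule E_tot_St[OF W(3-6)[OF that]])
  have e: "(norm0 (dt T w r))\<^sup>2 = (norm (snd (fst (Z r))))\<^sup>2" "(norm0 (dt T \<theta> r))\<^sup>2 = (norm (snd (snd (Z r))))\<^sup>2"
    "inner0 (dt T \<theta> r) (dt T w r) = inner (snd (snd (Z r))) (snd (fst (Z r)))"
    "inner0 (\<theta> r) (dt T w r) = inner (J (th (Z r))) (snd (fst (Z r)))" if "r \<in> {s..t}" for r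
  proof -
    have r: "r \<in> {0..T}" using that st by auto
    show "(norm0 (dt T w r))\<^sup>2 = (norm (snd (fst (Z r))))\<^sup>2" "(norm0 (dt T \<theta> r))\<^sup>2 = (norm (snd (snd (Z r))))\<^sup>2"
      "inner0 (dt T \<theta> r) (dt T w r) = inner (snd (snd (Z r))) (snd (fst (Z r)))"
      by (simp_all add: Z_def St_def norm_cf inner_cf W(5,6)[OF r])
    have "J (th (Z r)) = cf (\<theta> r)" unfolding Z_def th_St by (rule cf_V[OF W(4)[OF r], symmetric])
    then show "inner0 (\<theta> r) (dt T w r) = inner (J (th (Z r))) (snd (fst (Z r)))"
      by (simp add: Z_def St_def inner_cf W(5)[OF r] V_hw(4)[OF W(4)[OF r]])
  qed
  note ct = bounded_linear.continuous_on[OF bounded_linear_compose[OF bounded_linear_J state_linear(3)] cs]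
  have i: "(\<lambda>r. (norm (snd (fst (Z r))))\<^sup>2) integrable_on {s..t}" "(\<lambda>r. (norm (snd (snd (Z r))))\<^sup>2) integrable_on {s..t}"
    "(\<lambda>r. inner (snd (snd (Z r))) (snd (fst (Z r)))) integrable_on {s..t}"
    "(\<lambda>r. inner (J (th (Z r))) (snd (fst (Z r)))) integrable_on {s..t}"
    by (intro integrable_continuous_real continuous_intros cs ct)+
  let ?I = "\<lambda>f. integral {s..t} f"
  have "((\<lambda>r. dissip (Z r)) has_integral
      - mu p * ?I (\<lambda>r. (norm (snd (fst (Z r))))\<^sup>2) - zeta p * ?I (\<lambda>r. (norm (snd (snd (Z r))))\<^sup>2)
      - bet p * Ups p * ?I (\<lambda>r. inner (snd (snd (Z r))) (snd (fst (Z r)))) - eta p * ?I (\<lambda>r. inner (J (th (Z r))) (snd (fst (Z r))))) {s..t}"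
    unfolding dissip_def by (intro has_integral_diff has_integral_mult_right integrable_integral i)
  from has_integral_unique[OF Et_integral[OF W(1) st] this]
  have "Et (Z t) - Et (Z s) = - mu p * ?I (\<lambda>r. (norm0 (dt T w r))\<^sup>2) - zeta p * ?I (\<lambda>r. (norm0 (dt T \<theta> r))\<^sup>2)
      - bet p * Ups p * ?I (\<lambda>r. inner0 (dt T \<theta> r) (dt T w r)) - eta p * ?I (\<lambda>r. inner0 (\<theta> r) (dt T w r))"
    by (simp only: e cong: Henstock_Kurzweil_Integration.integral_cong)
  moreover have "s \<in> {0..T}" "t \<in> {0..T}" using st by auto
  ultimately show ?thesis by (simp add: E)
qed

section \<open>Global existence and uniqueness\<close>

text \<open>Growth no faster than the square of the norm is what Gronwall's inequality asks for; the
  term with \<theta> is bounded by the state through \<open>J\<close> and the factor 1 /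
  cth.\<close>

lemma dissip_le: "\<exists>D\<ge>0. \<forall>z. dissip z \<le> D * (norm z)\<^sup>2"
proof (intro exI conjI allI)
  let ?D = "\<bar>mu p\<bar> + \<bar>zeta p\<bar> + \<bar>bet p * Ups p\<bar> + \<bar>eta p\<bar> * (1 / cth)"
  show "0 \<le> ?D" using cth_pos by simp
  fix z :: state
  have n: "norm (snd (fst z)) \<le> norm z" "norm (snd (snd z)) \<le> norm z" "norm (fst (snd z)) \<le> norm z"
    using norm_fst_le[of "fst z" "snd z"] norm_snd_le[of "snd z" "fst z"] norm_snd_le_norm[of "fst z"]
      norm_snd_le_norm[of "snd z"] norm_fst_le_norm[of "snd z"] by simp_all
  have Jt: "norm (J (th z)) \<le> 1 / cth * norm z"
  proof -
    have "norm (th z) = 1 / cth * norm (fst (snd z))" using cth_pos by (simp add: th_def)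
    also have "\<dots> \<le> 1 / cth * norm z" using cth_pos by (intro mult_left_mono n) auto
    finally show ?thesis using norm_J_le[of "th z"] by linarith
  qed
  have a: "- (c * r) \<le> \<bar>c\<bar> * b" if "\<bar>r\<bar> \<le> b" for c r b :: real
    using mult_left_mono[OF that abs_ge_zero[of c]] abs_ge_minus_self[of "c * r"] by (simp add: abs_mult)
  have sq: "\<bar>(norm u)\<^sup>2\<bar> \<le> (norm z)\<^sup>2" if "norm u \<le> norm z" for u :: ell2
    using power_mono[OF that, of 2] by simp
  have i1: "\<bar>inner (snd (snd z)) (snd (fst z))\<bar> \<le> (norm z)\<^sup>2"
    using Cauchy_Schwarz_ineq2[of "snd (snd z)" "snd (fst z)"] mult_mono[OF n(2,1)] by (simp add: power2_eq_square)
  have i2: "\<bar>inner (J (th z)) (snd (fst z))\<bar> \<le> 1 / cth * (norm z)\<^sup>2"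
    using Cauchy_Schwarz_ineq2[of "J (th z)" "snd (fst z)"] mult_mono[OF Jt n(1)] cth_pos by (simp add: power2_eq_square)
  have "dissip z \<le> \<bar>mu p\<bar> * (norm z)\<^sup>2 + \<bar>zeta p\<bar> * (norm z)\<^sup>2 + \<bar>bet p * Ups p\<bar> * (norm z)\<^sup>2 + \<bar>eta p\<bar> * (1 / cth * (norm z)\<^sup>2)"
    unfolding dissip_def
    using a[OF sq[OF n(1)], of "mu p"] a[OF sq[OF n(2)], of "zeta p"] a[OF i1, of "bet p * Ups p"] a[OF i2, of "eta p"]
    by linarith
  then show "dissip z \<le> ?D * (norm z)\<^sup>2" by (simp add: algebra_simps)
qed

lemma Et_coercive: "\<exists>m>0. \<exists>K. \<forall>z. m * (norm z)\<^sup>2 \<le> Et z + K"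
proof (intro exI conjI allI)
  \<comment> \<open>Half of the weight 1/2 of \<open>fst z\<close> in the energy is spent on
    absorbing the load.\<close>
  let ?m = "min (1 / 4) ((ell p)\<^sup>2 / 6)"
  let ?c = "cab_c p * (LINT x|I_leb. (arcl (slope0 p x))\<^sup>2)"
  \<comment> \<open>The contributions are the lower bounds of the two cable potentials, the
    completed square of the quartic minus the compressive term, and the remainder of Young's
    inequality for the load.\<close>
  let ?K = "2 * ?c + (P_par p)\<^sup>2 / (4 * S_par p) + (norm (cf g))\<^sup>2"
  show "0 < ?m" using ell by simp
  fix z :: state
  let ?x = "fst (fst z)" and ?A = "inner (fst (fst z)) (J (fst (fst z)))"
  have "0 \<le> S_par p / 4 * (?A - P_par p / S_par p)\<^sup>2" using S by simp
  also have "\<dots> = S_par p / 4 * ?A\<^sup>2 - P_par p / 2 * ?A + (P_par p)\<^sup>2 / (4 * S_par p)"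
    using S by (simp add: power2_eq_square field_simps)
  finally have q: "0 \<le> S_par p / 4 * ?A\<^sup>2 - P_par p / 2 * ?A + (P_par p)\<^sup>2 / (4 * S_par p)" .
  have "inner (cf g) (J ?x) \<le> norm (cf g) * norm (J ?x)" by (rule norm_cauchy_schwarz)
  also have "\<dots> \<le> norm (cf g) * norm (fst z)"
    by (intro mult_left_mono order_trans[OF norm_J_le norm_fst_le_norm]) simp
  also have "\<dots> \<le> (norm (cf g))\<^sup>2 + (norm (fst z))\<^sup>2 / 4"
    using zero_le_power2[of "norm (cf g) - norm (fst z) / 2"] by (simp add: power2_diff power_divide)
  finally have gx: "inner (cf g) (J ?x) \<le> (norm (cf g))\<^sup>2 + (norm (fst z))\<^sup>2 / 4" .
  have k: "0 \<le> kap p / 2 * inner (th z) (J (th z))" using kap inner_J_nonneg by simp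
  have "?m * (norm (fst z))\<^sup>2 \<le> 1 / 4 * (norm (fst z))\<^sup>2" "?m * (norm (snd z))\<^sup>2 \<le> (ell p)\<^sup>2 / 6 * (norm (snd z))\<^sup>2"
    by (intro mult_right_mono; simp)+
  moreover have "?m * (norm z)\<^sup>2 = ?m * (norm (fst z))\<^sup>2 + ?m * (norm (snd z))\<^sup>2"
    unfolding distrib_left[symmetric] by (simp add: norm_prod_def)
  ultimately show "?m * (norm z)\<^sup>2 \<le> Et z + ?K"
    unfolding Et_def using q gx k Pz_lower[of "edge (ell p) ?x (th z)"] Pz_lower[of "edge (- ell p) ?x (th z)"] by linarith
qed

text \<open>Gronwall's inequality is applied to m times the squared norm, which by coercivity lies
  below the energy plus K. The resulting bound depends only on the data and T and holds on every
  shorter interval, as \<open>mild_exists\<close> demands.\<close>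

lemma mild_solution_exists:
  assumes T: "0 \<le> T"
  shows "\<exists>Z. flow.mild N T Z \<and> Z 0 = Z0"
proof -
  obtain D where D: "0 \<le> D" "\<And>z. dissip z \<le> D * (norm z)\<^sup>2" using dissip_le by blast
  obtain m K where m: "0 < m" "\<And>z. m * (norm z)\<^sup>2 \<le> Et z + K" using Et_coercive by blast
  define C where "C = (Et Z0 + K) * exp (D / m * T) / m"
  have K: "0 \<le> Et Z0 + K" using m(1) order_trans[OF mult_nonneg_nonneg m(2)[of Z0]] by simp
  show ?thesis
  proof (rule flow.mild_exists[OF T lipschitz_on_balls_N])
    fix \<tau> Z t assume \<tau>: "0 \<le> \<tau>" "\<tau> \<le> T" and Z: "flow.mild N \<tau> Z" and Z0: "Z 0 = Z0" and t: "t \<in> {0..\<tau>}"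
    have c: "continuous_on {0..\<tau>} Z" using Z by (simp add: mild_iff)
    have cu: "continuous_on {0..\<tau>} (\<lambda>t. m * (norm (Z t))\<^sup>2)" by (intro continuous_intros c)
    have "m * (norm (Z t))\<^sup>2 \<le> (Et Z0 + K) * exp (D / m * t)"
    proof (rule gronwall[OF cu _ _ t])
      show "0 \<le> D / m" using D m by simp
      fix r assume r: "r \<in> {0..\<tau>}"
      have "continuous_on {0..r} (\<lambda>t. D * (norm (Z t))\<^sup>2)"
        by (rule continuous_on_subset[where s="{0..\<tau>}"]) (use r in \<open>auto intro!: continuous_intros c\<close>)
      then have "(\<lambda>t. D * (norm (Z t))\<^sup>2) integrable_on {0..r}" by (rule integrable_continuous_real)
      then have "((\<lambda>t. D * (norm (Z t))\<^sup>2) has_integral integral {0..r} (\<lambda>t. D * (norm (Z t))\<^sup>2)) {0..r}" by (rule integrable_integral)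
      moreover have "((\<lambda>\<tau>. dissip (Z \<tau>)) has_integral (Et (Z r) - Et (Z 0))) {0..r}"
        using Et_integral[OF Z, of 0 r] r by simp
      ultimately have "Et (Z r) - Et (Z 0) \<le> integral {0..r} (\<lambda>t. D * (norm (Z t))\<^sup>2)"
        using has_integral_le D(2) by blast
      moreover have "integral {0..r} (\<lambda>t. D * (norm (Z t))\<^sup>2) = D / m * integral {0..r} (\<lambda>t. m * (norm (Z t))\<^sup>2)"
        using m(1) by simp
      ultimately show "m * (norm (Z r))\<^sup>2 \<le> (Et Z0 + K) + D / m * integral {0..r} (\<lambda>t. m * (norm (Z t))\<^sup>2)"
        using m(2)[of "Z r"] unfolding Z0 by linarith
    qed
    also have "\<dots> \<le> (Et Z0 + K) * exp (D / m * T)"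
      using t \<tau> D m K by (intro mult_left_mono) (auto intro!: mult_left_mono divide_right_mono)
    finally have "(norm (Z t))\<^sup>2 \<le> C" using m(1) unfolding C_def by (simp add: field_simps)
    then show "norm (Z t) \<le> sqrt C" by (rule real_le_rsqrt)
  qed
qed

lemma weak_solution_exists:
  assumes T: "0 < T" and init: "w0 \<in> V" "w1 \<in> L2" "\<theta>0 \<in> V" "\<theta>1 \<in> L2"
  shows "\<exists>w \<theta>. weak_solution p g T w0 w1 \<theta>0 \<theta>1 w \<theta>"
proof -
  obtain Z where Z: "flow.mild N T Z" "Z 0 = St w0 w1 \<theta>0 \<theta>1" using mild_solution_exists[OF less_imp_le[OF T]] by blast
  show ?thesis using mild_imp_weak[OF T Z init] by blast
qed

lemma weak_solution_unique:
  assumes T: "0 < T" and ws: "weak_solution p g T w0 w1 \<theta>0 \<theta>1 w \<theta>" "weak_solution p g T w0 w1 \<theta>0 \<theta>1 w' \<theta>'"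
    and init: "w0 \<in> V" "w1 \<in> L2" "\<theta>0 \<in> V" "\<theta>1 \<in> L2" and t: "t \<in> {0..T}"
  shows "AE x in I_leb. w t x = w' t x" "AE x in I_leb. \<theta> t x = \<theta>' t x"
proof -
  note W = weak_imp_mild[OF T ws(1) init] and W' = weak_imp_mild[OF T ws(2) init]
  have e: "AE x in I_leb. u x = u' x" if "u \<in> V" "u' \<in> V" "lap u = lap u'" for u u'
    using V_vfun[OF that(1)] V_vfun[OF that(2)] unfolding that(3) by eventually_elim simp
  have "St (w t) (dt T w t) (\<theta> t) (dt T \<theta> t) = St (w' t) (dt T w' t) (\<theta>' t) (dt T \<theta>' t)"
    by (rule flow.mild_unique[OF lipschitz_on_balls_N W(1) W'(1) _ t]) (simp only: W(2) W'(2))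
  then have "lap (w t) = lap (w' t)" "lap (\<theta> t) = lap (\<theta>' t)" using cth_pos by (simp_all add: St_def)
  then show "AE x in I_leb. w t x = w' t x" "AE x in I_leb. \<theta> t x = \<theta>' t x"
    using e W(3,4)[OF t] W'(3,4)[OF t] by blast+
qed

end

section \<open>Strong solutions\<close>

text \<open>The last two conclusions read the evolution equation backwards: once the derivative v
  exists, c times the state is \<open>J\<close> of a square summable pair, so for non-zero c the
  state lies in the domain of the generator.\<close>

lemma rot_mild_C1:
  fixes z :: "real \<Rightarrow> ell2 \<times> ell2" and n :: "real \<Rightarrow> ell2"
  assumes T: "0 < T" and n: "continuous_on {0..T} n" and zc: "continuous_on {0..T} z"
    and z: "\<forall>t\<in>{0..T}. rot (om c) (- t) (z t) = z 0 + integral {0..t} (\<lambda>s. rot (om c) (- s) (0, n s))"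
    and M: "0 \<le> M" "\<And>s t. s \<in> {0..T} \<Longrightarrow> t \<in> {0..T} \<Longrightarrow> norm (n t - n s) \<le> M * \<bar>t - s\<bar>"
    and K: "0 \<le> K" "\<And>s t. s \<in> {0..T} \<Longrightarrow> t \<in> {0..T} \<Longrightarrow> norm (z t - z s) \<le> K * \<bar>t - s\<bar>"
  obtains v where "continuous_on {0..T} v"
    "\<And>t. t \<in> {0..T} \<Longrightarrow> ((\<lambda>t. fst (z t)) has_vector_derivative fst (v t)) (at t within {0..T})"
    "\<And>t. t \<in> {0..T} \<Longrightarrow> ((\<lambda>t. snd (z t)) has_vector_derivative snd (v t)) (at t within {0..T})"
    "\<And>t. t \<in> {0..T} \<Longrightarrow> c *\<^sub>R snd (z t) = J (fst (v t))"
    "\<And>t. t \<in> {0..T} \<Longrightarrow> c *\<^sub>R fst (z t) = J (n t - snd (v t))"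
proof -
  note z' = z[rule_format]
  obtain v where v: "continuous_on {0..T} v"
    "\<And>t k. t \<in> {0..T} \<Longrightarrow> coord (fst (v t)) k = om c k * coord (snd (z t)) k"
    "\<And>t k. t \<in> {0..T} \<Longrightarrow> coord (snd (v t)) k = - om c k * coord (fst (z t)) k + coord (n t) k"
    using rot_mild_regular[OF T n zc z' M K] by blast
  note d = coord_derivs_of_rot_mild[OF n z']
  show ?thesis
  proof (rule that[OF v(1)])
    fix t assume t: "t \<in> {0..T}"
    show "((\<lambda>t. fst (z t)) has_vector_derivative fst (v t)) (at t within {0..T})"
    proof (rule ell2_deriv_of_coords[OF _ _ t])
      show "continuous_on {0..T} (\<lambda>t. fst (v t))" by (intro continuous_intros v)
      show "((\<lambda>t. coord (fst (z t)) k) has_real_derivative coord (fst (v s)) k) (at s within {0..T})" if "s \<in> {0..T}" for k s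
        unfolding v(2)[OF that] by (rule d(1)[OF _ that])
    qed
    show "((\<lambda>t. snd (z t)) has_vector_derivative snd (v t)) (at t within {0..T})"
    proof (rule ell2_deriv_of_coords[OF _ _ t])
      show "continuous_on {0..T} (\<lambda>t. snd (v t))" by (intro continuous_intros v)
      show "((\<lambda>t. coord (snd (z t)) k) has_real_derivative coord (snd (v s)) k) (at s within {0..T})" if "s \<in> {0..T}" for k s
        unfolding v(3)[OF that] by (rule d(2)[OF _ that])
    qed
    show "c *\<^sub>R snd (z t) = J (fst (v t))" "c *\<^sub>R fst (z t) = J (n t - snd (v t))"
      by (rule ell2_eqI, simp add: coord_J v(2,3)[OF t] om_def)+
  qed
qed

lemma strong_regularI:
  assumes T: "0 < T" and L: "u \<in> Ck 1 L2 norm0 T" and V': "\<forall>t\<in>{0..T}. u t \<in> V"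
    and lap': "\<forall>t\<in>{0..T}. lap (u t) = J (y t)" and y: "continuous_on {0..T} y"
    and x': "continuous_on {0..T} x'" and r: "continuous_on {0..T} r"
    and dx': "\<forall>t\<in>{0..T}. ((\<lambda>t. lap (u t)) has_vector_derivative x' t) (at t within {0..T})"
    and dq': "\<forall>t\<in>{0..T}. ((\<lambda>t. cf (dt T u t)) has_vector_derivative r t) (at t within {0..T})"
  shows "strong_regular T u" "\<And>t. t \<in> {0..T} \<Longrightarrow> dt T (dt T u) t \<in> L2" "\<And>t. t \<in> {0..T} \<Longrightarrow> cf (dt T (dt T u) t) = r t"
proof -
  note V = V'[rule_format] and lap = lap'[rule_format] and dx = dx'[rule_format] and dq = dq'[rule_format]
  obtain v1 where "has_time_deriv L2 norm0 T u v1" using L by auto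
  note p = dt_props[OF T this]
  have d2: "has_time_deriv L2 norm0 T (dt T u) (\<lambda>t. sy (r t))"
    unfolding L2_rep.has_time_deriv_iff using p(3) dq by simp
  note p2 = dt_props[OF T d2]
  show "dt T (dt T u) t \<in> L2" "cf (dt T (dt T u) t) = r t" if "t \<in> {0..T}" for t
    using p2(2,3)[OF that] by simp_all
  have "(\<lambda>t. sy (r t)) \<in> Ck 0 L2 norm0 T" unfolding L2_rep.Ck_0_iff by (simp add: r)
  then have "dt T u \<in> Ck (Suc 0) L2 norm0 T" using d2 unfolding Ck.simps(2) by blast
  then have "u \<in> Ck (Suc (Suc 0)) L2 norm0 T" using p(1) unfolding Ck.simps(2)[of "Suc 0"] by blast
  then have C2: "u \<in> Ck 2 L2 norm0 T" by (simp only: numeral_2_eq_2)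
  have "has_time_deriv V norm2 T u (\<lambda>t. vfun (x' t))"
    unfolding V_rep.has_time_deriv_iff using V dx by simp
  moreover have "(\<lambda>t. vfun (x' t)) \<in> Ck 0 V norm2 T" unfolding V_rep.Ck_0_iff by (simp add: x')
  ultimately have "u \<in> Ck (Suc 0) V norm2 T" unfolding Ck.simps(2) by blast
  then have "u \<in> Ck 1 V norm2 T" by (simp only: One_nat_def)
  then show "strong_regular T u" unfolding strong_regular_def using C2 Ck_0_Dom[OF V lap y] by blast
qed

lemma cf_zero_imp_AE_zero:
  assumes "u \<in> L2" "cf u = 0"
  shows "AE x in I_leb. u x = 0"
proof -
  have "cf (\<lambda>x. 0 * u x) = 0" "(\<lambda>x. 0 * u x) \<in> L2" using cf_scale[OF assms(1), of 0] L2_scale[OF assms(1), of 0] by simp_all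
  then show ?thesis using cf_eq_iff[OF assms(1), of "\<lambda>x. 0 * u x"] assms(2) by simp
qed

lemma cf_wderiv_Dom:
  assumes u: "u \<in> V" and y: "lap u = J y"
  shows "wderiv 4 u \<in> L2" "cf (wderiv 4 u) = y" "zero_on_bd (wderiv 2 u)"
proof -
  note h = hw_wderiv[OF hw_of_lap_J(2)[OF assms]]
  show "wderiv 4 u \<in> L2" by (rule h(2))
  then show "cf (wderiv 4 u) = y" using cf_eq_iff[of "wderiv 4 u" "sy y"] h(1) by simp
  show "zero_on_bd (wderiv 2 u)"
    by (rule zero_on_bd_V[OF V_of_vfun(1)[OF wderiv2_of_lap_J[OF assms]]])
qed

context fishbone
begin

lemma cf_wderiv_f_cab:
  assumes w: "w \<in> V" and \<theta>: "\<theta> \<in> V"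
  shows "wderiv 1 (f_cab p w \<theta>) \<in> L2" "cf (wderiv 1 (f_cab p w \<theta>))
      = - (Cab p (edge (ell p) (lap w) (lap \<theta>)) + Cab p (edge (- ell p) (lap w) (lap \<theta>)))"
    "wderiv 1 (fbar_cab p w \<theta>) \<in> L2" "cf (wderiv 1 (fbar_cab p w \<theta>))
      = - ell p *\<^sub>R (Cab p (edge (ell p) (lap w) (lap \<theta>)) - Cab p (edge (- ell p) (lap w) (lap \<theta>)))"
proof -
  let ?z1 = "edge (ell p) (lap w) (lap \<theta>)" and ?z2 = "edge (- ell p) (lap w) (lap \<theta>)"
  have L: "(\<lambda>x. (-1) * sy z x) \<in> L2" for z by (rule L2_scale[OF sy_L2])
  have h: "hw 1 (hz p z) (\<lambda>x. (-1) * sy (Cab p z) x)" for z using hw_hz[of z] by simp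
  have "hw 1 (f_cab p w \<theta>) (\<lambda>x. (-1) * sy (Cab p ?z1) x + (-1) * sy (Cab p ?z2) x)"
    by (rule hw_cong[OF hw_add[OF h h] f_cab_AE(1)[OF w \<theta>]]) simp
  note h1 = hw_wderiv[OF this]
  have "hw 1 (fbar_cab p w \<theta>) (\<lambda>x. ell p * ((-1) * sy (Cab p ?z1) x - (-1) * sy (Cab p ?z2) x))"
    by (rule hw_cong[OF hw_scale[OF hw_diff[OF h h]] f_cab_AE(2)[OF w \<theta>]]) simp
  note h2 = hw_wderiv[OF this]
  show "wderiv 1 (f_cab p w \<theta>) \<in> L2" "wderiv 1 (fbar_cab p w \<theta>) \<in> L2" by (fact h1(2) h2(2))+
  have "cf (wderiv 1 (f_cab p w \<theta>)) = cf (\<lambda>x. (-1) * sy (Cab p ?z1) x + (-1) * sy (Cab p ?z2) x)"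
    by (rule cf_eq_iff[THEN iffD2, OF h1(2) L2_add[OF L L] h1(1)])
  then show "cf (wderiv 1 (f_cab p w \<theta>)) = - (Cab p ?z1 + Cab p ?z2)"
    by (simp only: cf_add[OF L L] cf_scale[OF sy_L2] cf_sy) simp
  have "cf (wderiv 1 (fbar_cab p w \<theta>)) = cf (\<lambda>x. ell p * ((-1) * sy (Cab p ?z1) x - (-1) * sy (Cab p ?z2) x))"
    by (rule cf_eq_iff[THEN iffD2, OF h2(2) L2_scale[OF L2_diff[OF L L]] h2(1)])
  then show "cf (wderiv 1 (fbar_cab p w \<theta>)) = - ell p *\<^sub>R (Cab p ?z1 - Cab p ?z2)"
    by (simp only: cf_scale[OF L2_diff[OF L L]] cf_diff[OF L L] cf_scale[OF sy_L2] cf_sy) (simp add: algebra_simps)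
qed

text \<open>The form of \<open>Z 0\<close> puts the initial state into the domain of the generator,
  so the solution is Lipschitz in time. The nonlinearity along it is then Lipschitz as well, and
  \<open>rot_mild_C1\<close> applies to each of the two rotations.\<close>

lemma mild_time_regular:
  assumes T: "0 < T" and Z: "flow.mild N T Z" and Z0: "Z 0 = ((J a, J b), (J c, J d))"
  obtains v1 v2 where "continuous_on {0..T} v1" "continuous_on {0..T} v2"
    "\<And>t. t \<in> {0..T} \<Longrightarrow> ((\<lambda>t. fst (fst (Z t))) has_vector_derivative fst (v1 t)) (at t within {0..T})"
    "\<And>t. t \<in> {0..T} \<Longrightarrow> ((\<lambda>t. snd (fst (Z t))) has_vector_derivative snd (v1 t)) (at t within {0..T})"
    "\<And>t. t \<in> {0..T} \<Longrightarrow> ((\<lambda>t. fst (snd (Z t))) has_vector_derivative fst (v2 t)) (at t within {0..T})"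
    "\<And>t. t \<in> {0..T} \<Longrightarrow> ((\<lambda>t. snd (snd (Z t))) has_vector_derivative snd (v2 t)) (at t within {0..T})"
    "\<And>t. t \<in> {0..T} \<Longrightarrow> fst (fst (Z t)) = J (n1 (Z t) - snd (v1 t))"
    "\<And>t. t \<in> {0..T} \<Longrightarrow> cth *\<^sub>R fst (snd (Z t)) = J (n2 (Z t) - snd (v2 t))"
proof -
  have c: "continuous_on {0..T} Z"
    and z1: "\<forall>t\<in>{0..T}. rot (om 1) (- t) (fst (Z t)) = fst (Z 0) + integral {0..t} (\<lambda>s. rot (om 1) (- s) (0, n1 (Z s)))"
    and z2: "\<forall>t\<in>{0..T}. rot (om cth) (- t) (snd (Z t)) = snd (Z 0) + integral {0..t} (\<lambda>s. rot (om cth) (- s) (0, n2 (Z s)))"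
    using Z unfolding mild_iff by blast+
  have cz: "continuous_on {0..T} (\<lambda>t. fst (Z t))" "continuous_on {0..T} (\<lambda>t. snd (Z t))" by (intro continuous_intros c)+
  let ?C = "2 * 1 * (norm a + norm b) + 2 * cth * (norm c + norm d)"
  have dom: "norm (R h (Z 0) - Z 0) \<le> ?C * h" if h: "0 \<le> h" for h
  proof -
    let ?d = "R h (Z 0) - Z 0"
    have "norm (fst ?d) \<le> 2 * 1 * (norm a + norm b) * \<bar>h\<bar>" "norm (snd ?d) \<le> 2 * cth * (norm c + norm d) * \<bar>h\<bar>"
      unfolding R_def Z0 fst_diff snd_diff fst_conv snd_conv
      by (intro rot_domain_lipschitz zero_le_one less_imp_le[OF cth_pos])+
    moreover have "norm ?d \<le> norm (fst ?d) + norm (snd ?d)"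
      unfolding norm_prod_def[of ?d] by (rule sqrt_sum_squares_le_sum) simp_all
    ultimately show ?thesis using h by (simp add: distrib_right)
  qed
  obtain K where K: "0 \<le> K" "\<And>s t. s \<in> {0..T} \<Longrightarrow> t \<in> {0..T} \<Longrightarrow> norm (Z t - Z s) \<le> K * \<bar>t - s\<bar>"
    using flow.mild_time_lipschitz[OF lipschitz_on_balls_N Z dom] by blast
  have K': "norm (fst (Z t) - fst (Z s)) \<le> K * \<bar>t - s\<bar>" "norm (snd (Z t) - snd (Z s)) \<le> K * \<bar>t - s\<bar>"
    if "s \<in> {0..T}" "t \<in> {0..T}" for s t
    using order_trans[OF norm_fst_le_norm K(2)[OF that]] order_trans[OF norm_snd_le_norm K(2)[OF that]] by simp_all
  obtain r where r: "\<And>t. t \<in> {0..T} \<Longrightarrow> norm (Z t) \<le> r" using flow.mild_bounded[OF Z] by metis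
  have lip: "\<exists>M\<ge>0. \<forall>s\<in>{0..T}. \<forall>t\<in>{0..T}. norm (n (Z t) - n (Z s)) \<le> M * \<bar>t - s\<bar>"
    if n: "lipschitz_on_balls n" for n :: "state \<Rightarrow> ell2"
  proof -
    obtain L where L: "0 \<le> L" "\<And>x y. norm x \<le> r \<Longrightarrow> norm y \<le> r \<Longrightarrow> norm (n x - n y) \<le> L * norm (x - y)"
      by (rule lipschitz_on_ballsD[OF n, of r]) blast
    have "norm (n (Z t) - n (Z s)) \<le> (L * K) * \<bar>t - s\<bar>" if "s \<in> {0..T}" "t \<in> {0..T}" for s t
      using L(2)[OF r r, OF that(2,1)] mult_left_mono[OF K(2)[OF that] L(1)] by simp
    then show ?thesis using mult_nonneg_nonneg[OF L(1) K(1)] by blast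
  qed
  obtain M1 where M1: "0 \<le> M1" "\<And>s t. s \<in> {0..T} \<Longrightarrow> t \<in> {0..T} \<Longrightarrow> norm (n1 (Z t) - n1 (Z s)) \<le> M1 * \<bar>t - s\<bar>"
    using lip[OF lipschitz_on_balls_n1] by blast
  obtain M2 where M2: "0 \<le> M2" "\<And>s t. s \<in> {0..T} \<Longrightarrow> t \<in> {0..T} \<Longrightarrow> norm (n2 (Z t) - n2 (Z s)) \<le> M2 * \<bar>t - s\<bar>"
    using lip[OF lipschitz_on_balls_n2] by blast
  obtain v1 where v1: "continuous_on {0..T} v1"
    "\<And>t. t \<in> {0..T} \<Longrightarrow> ((\<lambda>t. fst (fst (Z t))) has_vector_derivative fst (v1 t)) (at t within {0..T})"
    "\<And>t. t \<in> {0..T} \<Longrightarrow> ((\<lambda>t. snd (fst (Z t))) has_vector_derivative snd (v1 t)) (at t within {0..T})"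
    "\<And>t. t \<in> {0..T} \<Longrightarrow> 1 *\<^sub>R snd (fst (Z t)) = J (fst (v1 t))"
    "\<And>t. t \<in> {0..T} \<Longrightarrow> 1 *\<^sub>R fst (fst (Z t)) = J (n1 (Z t) - snd (v1 t))"
    by (rule rot_mild_C1[OF T continuous_n_Z(1)[OF c] cz(1) z1 M1 K(1) K'(1)]) blast+
  obtain v2 where v2: "continuous_on {0..T} v2"
    "\<And>t. t \<in> {0..T} \<Longrightarrow> ((\<lambda>t. fst (snd (Z t))) has_vector_derivative fst (v2 t)) (at t within {0..T})"
    "\<And>t. t \<in> {0..T} \<Longrightarrow> ((\<lambda>t. snd (snd (Z t))) has_vector_derivative snd (v2 t)) (at t within {0..T})"
    "\<And>t. t \<in> {0..T} \<Longrightarrow> cth *\<^sub>R snd (snd (Z t)) = J (fst (v2 t))"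
    "\<And>t. t \<in> {0..T} \<Longrightarrow> cth *\<^sub>R fst (snd (Z t)) = J (n2 (Z t) - snd (v2 t))"
    by (rule rot_mild_C1[OF T continuous_n_Z(2)[OF c] cz(2) z2 M2 K(1) K'(2)]) blast+
  show ?thesis by (rule that[OF v1(1) v2(1) v1(2,3) v2(2,3) _ v2(5)]) (use v1(5) in \<open>simp_all only: scaleR_one\<close>)
qed

lemma weak_solution_strong:
  assumes T: "0 < T" and ws: "weak_solution p g T w0 w1 \<theta>0 \<theta>1 w \<theta>"
    and init: "w0 \<in> Dom" "w1 \<in> V" "\<theta>0 \<in> Dom" "\<theta>1 \<in> V"
  shows "strong_regular T w \<and> strong_regular T \<theta> \<and> solves_pointwise p g T w \<theta>"
proof -
  define Z where "Z t = St (w t) (dt T w t) (\<theta> t) (dt T \<theta> t)" for t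
  obtain a b where i0: "w0 \<in> V" "lap w0 = J a" "\<theta>0 \<in> V" "lap \<theta>0 = J b" using init unfolding Dom_iff by blast
  note W = weak_imp_mild[OF T ws i0(1) V_hw(4)[OF init(2)] i0(3) V_hw(4)[OF init(4)], folded Z_def]
  have "Z 0 = ((J a, J (lap w1)), (J (cth *\<^sub>R b), J (lap \<theta>1)))"
    unfolding W(2) St_def i0 cf_V[OF init(2)] cf_V[OF init(4)]
    by (simp only: linear_scale[OF bounded_linear.linear[OF bounded_linear_J]])
  then obtain v1 v2 where v: "continuous_on {0..T} v1" "continuous_on {0..T} v2"
    "\<And>t. t \<in> {0..T} \<Longrightarrow> ((\<lambda>t. fst (fst (Z t))) has_vector_derivative fst (v1 t)) (at t within {0..T})"
    "\<And>t. t \<in> {0..T} \<Longrightarrow> ((\<lambda>t. snd (fst (Z t))) has_vector_derivative snd (v1 t)) (at t within {0..T})"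
    "\<And>t. t \<in> {0..T} \<Longrightarrow> ((\<lambda>t. fst (snd (Z t))) has_vector_derivative fst (v2 t)) (at t within {0..T})"
    "\<And>t. t \<in> {0..T} \<Longrightarrow> ((\<lambda>t. snd (snd (Z t))) has_vector_derivative snd (v2 t)) (at t within {0..T})"
    "\<And>t. t \<in> {0..T} \<Longrightarrow> fst (fst (Z t)) = J (n1 (Z t) - snd (v1 t))"
    "\<And>t. t \<in> {0..T} \<Longrightarrow> cth *\<^sub>R fst (snd (Z t)) = J (n2 (Z t) - snd (v2 t))"
    by (rule mild_time_regular[OF T W(1)]) blast
  have c: "continuous_on {0..T} Z" using W(1) by (simp add: mild_iff)
  have L1: "u \<in> Ck 1 L2 norm0 T" if "u = w \<or> u = \<theta>" for u using ws that unfolding weak_solution_def by auto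
  \<comment> \<open>The equation solved for its fourth order term: \<open>yw t\<close> turns out to
    be the coefficient sequence of w_xxxx.\<close>
  define yw where "yw t = n1 (Z t) - snd (v1 t)" for t
  \<comment> \<open>Two factors \<open>cth\<close> are removed, one from the scaling of the state
    and one from the frequencies of the rotation.\<close>
  define y\<theta> where "y\<theta> t = (1 / (cth * cth)) *\<^sub>R (n2 (Z t) - snd (v2 t))" for t
  have cy: "continuous_on {0..T} yw" "continuous_on {0..T} y\<theta>"
    unfolding yw_def y\<theta>_def by (intro continuous_intros v continuous_n_Z[OF c])+
  have cv: "continuous_on {0..T} (\<lambda>t. fst (v1 t))" "continuous_on {0..T} (\<lambda>t. snd (v1 t))"
    "continuous_on {0..T} (\<lambda>t. (1 / cth) *\<^sub>R fst (v2 t))" "continuous_on {0..T} (\<lambda>t. snd (v2 t))"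
    by (intro continuous_intros v)+
  have zs: "fst (fst (Z t)) = lap (w t)" "snd (fst (Z t)) = cf (dt T w t)" "snd (snd (Z t)) = cf (dt T \<theta> t)"
    "fst (snd (Z t)) = cth *\<^sub>R lap (\<theta> t)" "th (Z t) = lap (\<theta> t)" for t
    unfolding Z_def th_St by (simp_all only: St_def fst_conv snd_conv)
  have lw: "lap (w t) = J (yw t)" if "t \<in> {0..T}" for t using v(7)[OF that] by (simp only: zs yw_def)
  have l\<theta>: "lap (\<theta> t) = J (y\<theta> t)" if "t \<in> {0..T}" for t
  proof -
    have "J (y\<theta> t) = (1 / (cth * cth)) *\<^sub>R (cth *\<^sub>R (cth *\<^sub>R lap (\<theta> t)))"
      unfolding y\<theta>_def linear_scale[OF bounded_linear.linear[OF bounded_linear_J]] v(8)[OF that, symmetric] zs ..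
    then show ?thesis using cth_pos by simp
  qed
  have d\<theta>: "((\<lambda>t. lap (\<theta> t)) has_vector_derivative (1 / cth) *\<^sub>R fst (v2 t)) (at t within {0..T})" if "t \<in> {0..T}" for t
    using bounded_linear.has_vector_derivative[OF bounded_linear_scaleR_right[of "1 / cth"] v(5)[OF that]] cth_pos
    by (simp add: zs)
  have "\<forall>t\<in>{0..T}. w t \<in> V" "\<forall>t\<in>{0..T}. lap (w t) = J (yw t)"
    "\<forall>t\<in>{0..T}. ((\<lambda>t. lap (w t)) has_vector_derivative fst (v1 t)) (at t within {0..T})"
    "\<forall>t\<in>{0..T}. ((\<lambda>t. cf (dt T w t)) has_vector_derivative snd (v1 t)) (at t within {0..T})"
    using W(3) lw v(3,4) unfolding zs by blast+
  note rw = strong_regularI[OF T L1[OF disjI1[OF refl]] this(1,2) cy(1) cv(1,2) this(3,4)]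
  have "\<forall>t\<in>{0..T}. \<theta> t \<in> V" "\<forall>t\<in>{0..T}. lap (\<theta> t) = J (y\<theta> t)"
    "\<forall>t\<in>{0..T}. ((\<lambda>t. lap (\<theta> t)) has_vector_derivative (1 / cth) *\<^sub>R fst (v2 t)) (at t within {0..T})"
    "\<forall>t\<in>{0..T}. ((\<lambda>t. cf (dt T \<theta> t)) has_vector_derivative snd (v2 t)) (at t within {0..T})"
    using W(4) l\<theta> d\<theta> v(6) unfolding zs by blast+
  note r\<theta> = strong_regularI[OF T L1[OF disjI2[OF refl]] this(1,2) cy(2) cv(3,4) this(3,4)]
  have sub: "t \<in> {0..T}" if "t \<in> {0<..<T}" for t using that by auto
  \<comment> \<open>Both sides are in L2 and have the same sine coefficients, so they agree almost
    everywhere in x, and this at every t of the closed interval.\<close>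
  have eqs: "AE x in I_leb. dt T (dt T w) t x + mu p * dt T w t x + wderiv 4 (w t) x
          + (P_par p - S_par p * (LINT y|I_leb. (wderiv 1 (w t) y)\<^sup>2)) * wderiv 2 (w t) x
          + wderiv 1 (f_cab p (w t) (\<theta> t)) x
        = g x - bet p * Ups p * dt T \<theta> t x - eta p * \<theta> t x \<and>
        (ell p)\<^sup>2 / 3 * dt T (dt T \<theta>) t x + zeta p * dt T \<theta> t x
          + eps p * wderiv 4 (\<theta> t) x - kap p * wderiv 2 (\<theta> t) x
          + wderiv 1 (fbar_cab p (w t) (\<theta> t)) x = 0" if t: "t \<in> {0..T}" for t
  proof -
    note V = W(3,4)[OF t] and D = W(5,6)[OF t] and w4 = cf_wderiv_Dom[OF W(3)[OF t] lw[OF t]]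
      and \<theta>4 = cf_wderiv_Dom[OF W(4)[OF t] l\<theta>[OF t]] and F = cf_wderiv_f_cab[OF W(3,4)[OF t]]
      and D2 = rw(2,3)[OF t] r\<theta>(2,3)[OF t]
    have c2: "cf (wderiv 2 u) = - lap u" for u by (simp add: lap_def)
    have cJ: "cf (\<theta> t) = J (lap (\<theta> t))" by (rule cf_V[OF V(2)])
    let ?A = "LINT y|I_leb. (wderiv 1 (w t) y)\<^sup>2"
    have A: "?A = inner (lap (w t)) (J (lap (w t)))"
      unfolding norm1_V[OF V(1), symmetric] norm1_def inner1_def real_sqrt_pow2[OF inner0_nonneg]
      by (simp add: inner0_def power2_eq_square)
    note L = L2_add L2_diff L2_scale D D2 w4(1) \<theta>4(1) F(1,3) g V_hw(4)[OF V(1)] V_hw(4)[OF V(2)] V_hw(6)[OF V(1)] V_hw(6)[OF V(2)]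
    have "cf (\<lambda>x. dt T (dt T w) t x + mu p * dt T w t x + wderiv 4 (w t) x + (P_par p - S_par p * ?A) * wderiv 2 (w t) x
          + wderiv 1 (f_cab p (w t) (\<theta> t)) x)
        = snd (v1 t) + mu p *\<^sub>R cf (dt T w t) + yw t + (P_par p - S_par p * ?A) *\<^sub>R (- lap (w t))
          + - (Cab p (edge (ell p) (lap (w t)) (lap (\<theta> t))) + Cab p (edge (- ell p) (lap (w t)) (lap (\<theta> t))))"
      by (simp only: cf_add cf_scale L D2 w4(2) F(2) c2)
    also have "\<dots> = cf (\<lambda>x. g x - bet p * Ups p * dt T \<theta> t x - eta p * \<theta> t x)"
      unfolding yw_def n1_def A zs
      by (simp only: cf_diff cf_scale L cJ) (simp add: algebra_simps)
    finally have 1: "AE x in I_leb. dt T (dt T w) t x + mu p * dt T w t x + wderiv 4 (w t) x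
          + (P_par p - S_par p * ?A) * wderiv 2 (w t) x + wderiv 1 (f_cab p (w t) (\<theta> t)) x
        = g x - bet p * Ups p * dt T \<theta> t x - eta p * \<theta> t x"
      by (subst (asm) cf_eq_iff) (intro L)+
    have e: "eps p *\<^sub>R y\<theta> t = ((ell p)\<^sup>2 / 3) *\<^sub>R (n2 (Z t) - snd (v2 t))"
      unfolding y\<theta>_def cth_square using eps by simp
    have n: "((ell p)\<^sup>2 / 3) *\<^sub>R ((3 / (ell p)\<^sup>2) *\<^sub>R a) = a" for a :: ell2 using ell by simp
    have "cf (\<lambda>x. (ell p)\<^sup>2 / 3 * dt T (dt T \<theta>) t x + zeta p * dt T \<theta> t x + eps p * wderiv 4 (\<theta> t) x - kap p * wderiv 2 (\<theta> t) x
          + wderiv 1 (fbar_cab p (w t) (\<theta> t)) x)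
        = ((ell p)\<^sup>2 / 3) *\<^sub>R snd (v2 t) + zeta p *\<^sub>R cf (dt T \<theta> t) + eps p *\<^sub>R y\<theta> t - kap p *\<^sub>R (- lap (\<theta> t))
          + - ell p *\<^sub>R (Cab p (edge (ell p) (lap (w t)) (lap (\<theta> t))) - Cab p (edge (- ell p) (lap (w t)) (lap (\<theta> t))))"
      by (simp only: cf_add cf_diff cf_scale L D2 \<theta>4(2) F(4) c2)
    also have "\<dots> = 0"
      unfolding e scaleR_diff_right[of _ "n2 (Z t)"] unfolding n2_def n zs by (simp add: algebra_simps)
    finally have 2: "AE x in I_leb. (ell p)\<^sup>2 / 3 * dt T (dt T \<theta>) t x + zeta p * dt T \<theta> t x + eps p * wderiv 4 (\<theta> t) x
          - kap p * wderiv 2 (\<theta> t) x + wderiv 1 (fbar_cab p (w t) (\<theta> t)) x = 0"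
      by (rule cf_zero_imp_AE_zero[rotated]) (intro L)
    show ?thesis using 1 2 by eventually_elim simp
  qed
  have "solves_pointwise p g T w \<theta>"
    unfolding solves_pointwise_def
  proof (intro conjI ballI, rule AE_I2)
    fix t assume "t \<in> space (lebesgue_on {0<..<T})"
    then have "t \<in> {0..T}" by (intro sub) simp
    from eqs[OF this] show "AE x in I_leb. dt T (dt T w) t x + mu p * dt T w t x + wderiv 4 (w t) x
          + (P_par p - S_par p * (LINT y|I_leb. (wderiv 1 (w t) y)\<^sup>2)) * wderiv 2 (w t) x
          + wderiv 1 (f_cab p (w t) (\<theta> t)) x
        = g x - bet p * Ups p * dt T \<theta> t x - eta p * \<theta> t x \<and>
        (ell p)\<^sup>2 / 3 * dt T (dt T \<theta>) t x + zeta p * dt T \<theta> t x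
          + eps p * wderiv 4 (\<theta> t) x - kap p * wderiv 2 (\<theta> t) x
          + wderiv 1 (fbar_cab p (w t) (\<theta> t)) x = 0" .
  next
    fix t assume "t \<in> {0<..<T}"
    then have t: "t \<in> {0..T}" by (rule sub)
    show "zero_on_bd (w t)" "zero_on_bd (\<theta> t)" by (intro zero_on_bd_V W(3,4)[OF t])+
    show "zero_on_bd (wderiv 2 (w t))" "zero_on_bd (wderiv 2 (\<theta> t))"
      by (rule cf_wderiv_Dom(3)[OF W(3)[OF t] lw[OF t]], rule cf_wderiv_Dom(3)[OF W(4)[OF t] l\<theta>[OF t]])
  qed
  then show ?thesis using rw(1) r\<theta>(1) by blast
qed

end

theorem theorem2p2:
  fixes p :: fb_params and T :: real and g w0 w1 \<theta>0 \<theta>1 :: "real \<Rightarrow> real"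
  assumes "cab_a p > 0" and "cab_s0 p > 0" and "cab_b p \<ge> 0" and "cab_c p \<ge> 0"
    and "T > 0" and "g \<in> L2"
    and "mu p > 0" and "zeta p > 0" and "eps p > 0" and "ell p > 0" and "bet p > 0" and "S_par p > 0"
    and "P_par p \<ge> 0" and "kap p \<ge> 0" and "Ups p \<in> {- ell p..ell p}"
    and "w0 \<in> V" and "w1 \<in> L2" and "\<theta>0 \<in> V" and "\<theta>1 \<in> L2"
  shows "(\<exists>w \<theta>. weak_solution p g T w0 w1 \<theta>0 \<theta>1 w \<theta>)
    \<and> (\<forall>w \<theta> w' \<theta>'. weak_solution p g T w0 w1 \<theta>0 \<theta>1 w \<theta> \<longrightarrow>
          weak_solution p g T w0 w1 \<theta>0 \<theta>1 w' \<theta>' \<longrightarrow>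
          (\<forall>t\<in>{0..T}. (AE x in I_leb. w t x = w' t x) \<and> (AE x in I_leb. \<theta> t x = \<theta>' t x)))
    \<and> (\<forall>w \<theta>. weak_solution p g T w0 w1 \<theta>0 \<theta>1 w \<theta> \<longrightarrow>
          w0 \<in> Dom \<longrightarrow> \<theta>0 \<in> Dom \<longrightarrow> w1 \<in> V \<longrightarrow> \<theta>1 \<in> V \<longrightarrow>
          strong_regular T w \<and> strong_regular T \<theta> \<and> solves_pointwise p g T w \<theta>)
    \<and> (\<forall>w \<theta>. weak_solution p g T w0 w1 \<theta>0 \<theta>1 w \<theta> \<longrightarrow>
          (\<forall>s t. 0 \<le> s \<longrightarrow> s < t \<longrightarrow> t \<le> T \<longrightarrow>
             energy_at p g T w \<theta> t
               + mu p * integral {s..t} (\<lambda>\<tau>. (norm0 (dt T w \<tau>))\<^sup>2)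
               + zeta p * integral {s..t} (\<lambda>\<tau>. (norm0 (dt T \<theta> \<tau>))\<^sup>2)
             = energy_at p g T w \<theta> s
               - bet p * Ups p * integral {s..t} (\<lambda>\<tau>. inner0 (dt T \<theta> \<tau>) (dt T w \<tau>))
               - eta p * integral {s..t} (\<lambda>\<tau>. inner0 (\<theta> \<tau>) (dt T w \<tau>))))"
proof -
  interpret fishbone p g
    by unfold_locales (use assms in simp_all)
  note init = assms(16-19)
  show ?thesis
    using weak_solution_exists[OF assms(5) init] weak_solution_unique[OF assms(5) _ _ init]
      weak_solution_strong[OF assms(5)] weak_energy_identity[OF assms(5) _ init _ less_imp_le]
    by (intro conjI allI impI ballI) blast+
qed

end
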